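(* Let $\alpha p(p-1)\le1$. If $F$ is differentiable at some $\beta\in\mathbb{R}$, then almost surely $$\lim_{\epsilon\downarrow0}\limsup_{N\to\infty}\Bigl|\frac1N\log\mathcal{AN}_{N,\epsilon}\bigl(1+\alpha^{-1}F'(\beta)\bigr)-\bigl(\log2+F(\beta)-\beta F'(\beta)\bigr)\Bigr|=0 .$$ Additionally, if $\beta_1\le\beta_2$ are two points of differentiability of $F$, then 1. $F'(\beta_1)\le F'(\beta_2)$; 2. $F(\beta_1)-\beta_1F'(\beta_1)\ge F(\beta_2)-\beta_2F'(\beta_2)$ if $\beta_1>0$; and 3. $F(\beta_1)-\beta_1F'(\beta_1)\le F(\beta_2)-\beta_2F'(\beta_2)$ if $\beta_2<0$.
   Context: **Constraint satisfaction model.** Let $p\ge2$ be an integer, $\alpha>0$, $\theta:\{-1,1\}^p\to\{-1,0\}$ a random function, $(\theta_k)_{k\ge1}$ i.i.d. copies of $\theta$, $\pi(\alpha N)$ a Poisson random variable with mean $\alpha N$, and for each $k\ge1$ let $I(k,1),\dots,I(k,p)$ be distinct indices chosen uniformly from $[N]=\{1,\dots,N\}$; all independent. For $0<\epsilon<1$ and real $t$, $$\mathcal{AN}_{N,\epsilon}(t)=\#\Bigl\{\sigma\in\{-1,1\}^N:\frac1{\pi(\alpha N)}\sum_{k=1}^{\pi(\alpha N)}\bigl(1+\theta_k(\sigma_{I(k,1)},\dots,\sigma_{I(k,p)})\bigr)\in(t-\epsilon,t+\epsilon)\Bigr\}.$$ **The function $F$.** Let $\nu$ be the uniform probability measure on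 $\Sigma=\{-1,1\}$, $\mathcal{X}=C(\Sigma)$ with the sup norm, and $\Pr_1(\mathcal{X})$ the Borel probability measures $\lambda$ on $\mathcal{X}$ with $\int\|f\|_\infty\lambda(df)<\infty$. Let $\beta>0$. For $\lambda\in\Pr_1(\mathcal{X})$ let $X,X_1,X_2,\dots$ be i.i.d. with law $\lambda$, $\pi(\alpha p)$ Poisson with mean $\alpha p$, with $(X_k),\pi(\alpha p),(\theta_k),\theta$ independent; write $\langle f(\sigma)\rangle_{\beta,X}=\int f(\sigma)\prod_{k=1}^ne^{\beta X_k(\sigma_k)}\nu^{\otimes n}(d\sigma)$ for $f:\Sigma^n\to\mathbb{R}$ and, for $r\ge0$, $\mathcal{E}_{\beta,r}(\sigma,t)=\exp\bigl(\beta\sum_{k=1}^r\theta_k(\sigma_{(k-1)(p-1)+1},\dots,\sigma_{k(p-1)},t)\bigr)$. $\mathcal{T}_{\nu,\beta}(\lambda)$ is the law of $$t\mapsto\frac1\beta\log\frac{\langle\mathcal{E}_{\beta,\pi(\alpha p)}(\sigma,t)\rangle_{\beta,X}}{\langle\int\mathcal{E}_{\beta,\pi(\alpha p)}(\sigma,s)\nu(ds)\rangle_{\beta,X}},$$ $$\mathcal{P}_{\nu,\beta}(\lambda)=\mathbb{E}\log\Bigl\langle\int\mathcal{E}_{\beta,\pi(\alpha p)}(\sigma,\varepsilon)\nu(d\varepsilon)\Bigr\rangle_{\beta,X}-\alpha(p-1)\mathbb{E}\log\langle e^{\beta\theta(\sigma)}\rangle_{\beta,X}.$$ When $\alpha p(p-1)\le1$,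 $\mathcal{T}_{\nu,\beta}$ has a unique fixed point $\lambda_{\nu,\beta}\in\Pr_1(\mathcal{X})$, and $F(\beta):=\mathcal{P}_{\nu,\beta}(\lambda_{\nu,\beta})$. For $\beta<0$, $F(\beta)$ is defined as the value of this construction at $|\beta|$ with $\theta$ replaced by $-\theta$ (and $\theta_k$ by $-\theta_k$); $F(0)=0$.
   Formalization: The law of θ is additionally assumed invariant under permutations of its p arguments; without this the claim fails, e.g. for p=2, α≤1/2 and θ(s1,s2)=-1 if s1=1, else 0, at large β. *)

theory Defs
  imports "HOL-Probability.Probability" "HOL-Combinatorics.Permutations"
begin

section \<open>Spins and the space of continuous functions on them\<close>

typedef spin = "{-1, 1} :: int set"
  by auto

lemma UNIV_spin: "(UNIV :: spin set) = {Abs_spin (-1), Abs_spin 1}"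
  using type_definition.Abs_image[OF type_definition_spin] by auto

instance spin :: finite
  by standard (simp add: UNIV_spin)

instantiation spin :: discrete_topology
begin
definition open_spin :: "spin set \<Rightarrow> bool" where
  "open_spin A \<longleftrightarrow> True"
instance
  by standard (auto simp: open_spin_def)
end

text \<open>The space \<open>C(\<Sigma>)\<close>, \<open>\<Sigma> = {-1, 1}\<close>, with the sup norm is the library type
  \<open>spin \<Rightarrow>\<^sub>C real\<close> of bounded continuous functions; its \<open>norm\<close> is the sup norm.\<close>

definition \<nu> :: "spin measure" where
  "\<nu> = measure_pmf (pmf_of_set UNIV)"

definition Pr1 :: "(spin \<Rightarrow>\<^sub>C real) measure set" where
  "Pr1 = {\<mu>. prob_space \<mu> \<and> sets \<mu> = sets borel \<and> (\<integral>\<^sup>+ f. ennreal (norm f) \<partial>\<mu>) < \<infinity>}"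


section \<open>Random functions\<close>

text \<open>Elements of \<open>{-1, 1}\<^sup>p\<close> are lists of length \<open>p\<close>. A random function
  \<open>{-1, 1}\<^sup>p \<rightarrow> {-1, 0}\<close> takes finitely many values, so its law is a probability mass
  function \<open>\<Theta>\<close> on the functions below.\<close>

definition interactions :: "nat \<Rightarrow> (spin list \<Rightarrow> real) set" where
  "interactions p = {s. length s = p} \<rightarrow>\<^sub>E {-1, 0}"

text \<open>Invariance in law under permuting the arguments. The operator \<open>T\<close> below always puts the
  distinguished spin in the last argument, although a uniformly chosen tuple of sites puts a
  given site in each position equally often; the two agree only for exchangeable laws.
  Random \<open>p\<close>-SAT, NAE-SAT and XOR-SAT interactions are exchangeable.\<close>

definition exchangeable :: "nat \<Rightarrow> (spin list \<Rightarrow> real) pmf \<Rightarrow> bool" where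
  "exchangeable p \<Theta> \<longleftrightarrow>
     (\<forall>\<tau>. \<tau> permutes {..<p} \<longrightarrow> map_pmf (\<lambda>\<theta> s. \<theta> (permute_list \<tau> s)) \<Theta> = \<Theta>)"


section \<open>The constraint satisfaction model\<close>

text \<open>\<open>n\<close> is the number of constraints, and the \<open>k\<close>-th constraint applies \<open>\<theta> k\<close> to the spins
  at the sites listed in \<open>I k\<close>.\<close>

definition AN :: "nat \<Rightarrow> nat \<Rightarrow> (nat \<Rightarrow> spin list \<Rightarrow> real) \<Rightarrow> (nat \<Rightarrow> nat list) \<Rightarrow> real \<Rightarrow> real \<Rightarrow> nat"
  where
  "AN N n \<theta> I \<epsilon> t =
     card {\<sigma> \<in> {1..N} \<rightarrow>\<^sub>E UNIV.
       1 / real n * (\<Sum>k = 1..n. 1 + \<theta> k (map \<sigma> (I k))) \<in> {t - \<epsilon> <..< t + \<epsilon>}}"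

text \<open>\<open>AN\<close> may vanish, and then its logarithm is \<open>-\<infinity>\<close>, not the value \<open>0\<close> of the total
  function \<open>ln\<close>.\<close>

definition ln_nat :: "nat \<Rightarrow> ereal" where
  "ln_nat m = (if m = 0 then -\<infinity> else ereal (ln (real m)))"

datatype disorder = Number | Interaction nat | Sites nat

text \<open>\<open>n N\<close> is the Poisson number of constraints and \<open>I N k\<close> the random tuple of distinct sites
  of the \<open>k\<close>-th constraint in the system of size \<open>N\<close>, which exists only if \<open>p \<le> N\<close>. For each
  \<open>N\<close> all the variables entering the system of size \<open>N\<close> are independent; the joint law of
  the families for different \<open>N\<close> is left arbitrary.\<close>

locale csp_model = prob_space M for M :: "'a measure" +
  fixes p :: nat and \<alpha> :: real and \<Theta> :: "(spin list \<Rightarrow> real) pmf"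
    and \<theta> :: "nat \<Rightarrow> 'a \<Rightarrow> spin list \<Rightarrow> real"
    and n :: "nat \<Rightarrow> 'a \<Rightarrow> nat"
    and I :: "nat \<Rightarrow> nat \<Rightarrow> 'a \<Rightarrow> nat list"
  assumes p_ge_2: "p \<ge> 2"
    and \<alpha>_pos: "\<alpha> > 0"
    and law_interactions: "set_pmf \<Theta> \<subseteq> interactions p"
    and \<theta>_measurable: "\<And>k. k \<ge> 1 \<Longrightarrow> \<theta> k \<in> M \<rightarrow>\<^sub>M count_space UNIV"
    and \<theta>_law: "\<And>k. k \<ge> 1 \<Longrightarrow> distr M (count_space UNIV) (\<theta> k) = measure_pmf \<Theta>"
    and n_measurable: "\<And>N. N \<ge> p \<Longrightarrow> n N \<in> M \<rightarrow>\<^sub>M count_space UNIV"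
    and n_law: "\<And>N. N \<ge> p \<Longrightarrow>
       distr M (count_space UNIV) (n N) = measure_pmf (poisson_pmf (\<alpha> * real N))"
    and I_measurable: "\<And>N k. N \<ge> p \<Longrightarrow> k \<ge> 1 \<Longrightarrow> I N k \<in> M \<rightarrow>\<^sub>M count_space UNIV"
    and I_law: "\<And>N k. N \<ge> p \<Longrightarrow> k \<ge> 1 \<Longrightarrow> distr M (count_space UNIV) (I N k) =
       measure_pmf (pmf_of_set {is. length is = p \<and> distinct is \<and> set is \<subseteq> {1..N}})"
    and independent: "\<And>N. N \<ge> p \<Longrightarrow> indep_sets (\<lambda>d. case d of
         Number \<Rightarrow> {n N -` A \<inter> space M |A. True}
       | Interaction k \<Rightarrow> {\<theta> k -` A \<inter> space M |A. True}
       | Sites k \<Rightarrow> {I N k -` A \<inter> space M |A. True})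
       ({Number} \<union> Interaction ` {1..} \<union> Sites ` {1..})"


section \<open>The fixed point equation and the functional F\<close>

definition gibbs :: "nat \<Rightarrow> real \<Rightarrow> (nat \<Rightarrow> spin \<Rightarrow>\<^sub>C real) \<Rightarrow> ((nat \<Rightarrow> spin) \<Rightarrow> real) \<Rightarrow> real" where
  "gibbs n \<beta> X f =
     (\<integral>\<sigma>. f \<sigma> * (\<Prod>k = 1..n. exp (\<beta> * apply_bcontfun (X k) (\<sigma> k))) \<partial>(\<Pi>\<^sub>M k\<in>{1..n}. \<nu>))"

definition boltzmann ::
  "nat \<Rightarrow> real \<Rightarrow> nat \<Rightarrow> (nat \<Rightarrow> spin list \<Rightarrow> real) \<Rightarrow> (nat \<Rightarrow> spin) \<Rightarrow> spin \<Rightarrow> real" where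
  "boltzmann p \<beta> r \<theta> \<sigma> t =
     exp (\<beta> * (\<Sum>k = 1..r. \<theta> k (map \<sigma> [(k - 1) * (p - 1) + 1 ..< k * (p - 1) + 1] @ [t])))"

definition cavity_field ::
  "nat \<Rightarrow> real \<Rightarrow> nat \<Rightarrow> (nat \<Rightarrow> spin list \<Rightarrow> real) \<Rightarrow> (nat \<Rightarrow> spin \<Rightarrow>\<^sub>C real) \<Rightarrow> spin \<Rightarrow>\<^sub>C real" where
  "cavity_field p \<beta> r \<theta> X = Bcontfun (\<lambda>t. 1 / \<beta> *
     ln (gibbs (r * (p - 1)) \<beta> X (\<lambda>\<sigma>. boltzmann p \<beta> r \<theta> \<sigma> t) /
         gibbs (r * (p - 1)) \<beta> X (\<lambda>\<sigma>. \<integral>s. boltzmann p \<beta> r \<theta> \<sigma> s \<partial>\<nu>)))"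

text \<open>The joint law of \<open>(\<pi>(\<alpha>p), (\<theta>\<^sub>k), (X\<^sub>k))\<close>.\<close>

definition cavity_law ::
  "nat \<Rightarrow> real \<Rightarrow> (spin list \<Rightarrow> real) pmf \<Rightarrow> (spin \<Rightarrow>\<^sub>C real) measure \<Rightarrow>
    (nat \<times> (nat \<Rightarrow> spin list \<Rightarrow> real) \<times> (nat \<Rightarrow> spin \<Rightarrow>\<^sub>C real)) measure" where
  "cavity_law p \<alpha> \<Theta> \<mu> =
     measure_pmf (poisson_pmf (\<alpha> * real p)) \<Otimes>\<^sub>M
       ((\<Pi>\<^sub>M k\<in>{1..}. measure_pmf \<Theta>) \<Otimes>\<^sub>M (\<Pi>\<^sub>M k\<in>{1..}. \<mu>))"

definition T ::
  "nat \<Rightarrow> real \<Rightarrow> (spin list \<Rightarrow> real) pmf \<Rightarrow> real \<Rightarrow>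
    (spin \<Rightarrow>\<^sub>C real) measure \<Rightarrow> (spin \<Rightarrow>\<^sub>C real) measure" where
  "T p \<alpha> \<Theta> \<beta> \<mu> =
     distr (cavity_law p \<alpha> \<Theta> \<mu>) borel (\<lambda>(r, \<theta>, X). cavity_field p \<beta> r \<theta> X)"

definition P ::
  "nat \<Rightarrow> real \<Rightarrow> (spin list \<Rightarrow> real) pmf \<Rightarrow> real \<Rightarrow> (spin \<Rightarrow>\<^sub>C real) measure \<Rightarrow> real" where
  "P p \<alpha> \<Theta> \<beta> \<mu> =
     (\<integral>(r, \<theta>, X). ln (gibbs (r * (p - 1)) \<beta> X (\<lambda>\<sigma>. \<integral>e. boltzmann p \<beta> r \<theta> \<sigma> e \<partial>\<nu>))
        \<partial>cavity_law p \<alpha> \<Theta> \<mu>)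
     - \<alpha> * (real p - 1) *
       (\<integral>(\<theta>, X). ln (gibbs p \<beta> X (\<lambda>\<sigma>. exp (\<beta> * \<theta> (map \<sigma> [1..<p + 1]))))
          \<partial>(measure_pmf \<Theta> \<Otimes>\<^sub>M (\<Pi>\<^sub>M k\<in>{1..}. \<mu>)))"

definition fixed_point ::
  "nat \<Rightarrow> real \<Rightarrow> (spin list \<Rightarrow> real) pmf \<Rightarrow> real \<Rightarrow> (spin \<Rightarrow>\<^sub>C real) measure" where
  "fixed_point p \<alpha> \<Theta> \<beta> = (THE \<mu>. \<mu> \<in> Pr1 \<and> T p \<alpha> \<Theta> \<beta> \<mu> = \<mu>)"

definition F :: "nat \<Rightarrow> real \<Rightarrow> (spin list \<Rightarrow> real) pmf \<Rightarrow> real \<Rightarrow> real" where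
  "F p \<alpha> \<Theta> \<beta> =
     (if \<beta> > 0 then P p \<alpha> \<Theta> \<beta> (fixed_point p \<alpha> \<Theta> \<beta>)
      else if \<beta> < 0 then
        (let \<Theta>' = map_pmf (\<lambda>\<theta> s. - \<theta> s) \<Theta>
         in P p \<alpha> \<Theta>' \<bar>\<beta>\<bar> (fixed_point p \<alpha> \<Theta>' \<bar>\<beta>\<bar>))
      else 0)"

end

theory Submission
  imports Defs "HOL-Library.Function_Algebras"
begin

text \<open>The constraints form a random \<open>p\<close>-uniform hypergraph on the sites \<open>{1..N}\<close> with a Poisson
  number of edges. Around a site it looks like a Galton--Watson tree in which each site has
  Poisson \<open>\<alpha>p\<close> further edges with \<open>p - 1\<close> children each. The condition \<open>\<alpha>p(p - 1) \<le> 1\<close> says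
  that the mean number of children is at most one, so that this tree is almost surely finite.
  Everything rests on this.

  \<^bold>\<open>The fixed point.\<close> On a finite tree the effective field at the root is computed by passing
  messages from the leaves, with no boundary condition. Its law \<open>field_pmf\<close> is purely atomic and
  is fixed by the cavity operator. Conversely the atoms of an arbitrary fixed point dominate,
  by induction on the depth, the weights of the messages of trees extinct before that depth;
  by extinction these weights add up to one in the limit, which leaves no room for anything
  else. Hence the fixed point is unique (\<open>fixed_point_eq\<close>).

  \<^bold>\<open>The free energy.\<close> Under the Gibbs measure, finitely many given
  sites are with high probability independent, with effective fields that are themselves
  asymptotically independent samples of \<open>field_pmf\<close> (\<open>local_limit\<close>). This is proved by exposing
  the edges at a site, which removes the site, and inducting on the depth of the tree. Only lower bounds for
  the probabilities of the possible fields are proved, and no coupling with a tree is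
  constructed: as the bounds sum to one, they are sharp. The system with \<open>N + 1\<close> sites and the
  system with \<open>N\<close> sites both arise from a common smaller system, the former by attaching a site
  with Poisson \<open>\<alpha>p\<close> edges and the latter by adding Poisson \<open>\<alpha>(p - 1)\<close> edges. By the local limit
  the expected logarithms of the two ratios of partition functions converge to the two
  expectations in the functional \<open>P\<close>, whence the mean free energy per site converges to \<open>F \<beta>\<close>
  (\<open>free_energy_limit\<close>, \<open>mean_free_energy_tendsto_F\<close>). The case \<open>\<beta> < 0\<close> follows by changing
  the signs of \<open>\<beta>\<close> and of the interactions at once.

  \<^bold>\<open>Almost sure convergence.\<close> Inserting one constraint changes the log-partition function by at
  most \<open>\<bar>\<beta>\<bar>\<close>, so that it concentrates exponentially around its mean
  (\<open>poisson_list_concentration\<close>). By Borel--Cantelli the free energy converges almost surely,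
  for each of countably many \<open>\<beta>\<close>, however the systems of different sizes are coupled.

  \<^bold>\<open>The entropy.\<close> As a limit of convex functions \<open>F\<close> is convex, which gives the three
  monotonicity claims. At a point \<open>\<beta>\<close> of differentiability, the Gibbs measure puts at least
  half of its mass on the configurations with energy per constraint close to \<open>F' \<beta> / \<alpha>\<close>, because its
  exponential tilts by a small \<open>\<plusminus>\<delta>\<close> are governed by \<open>F (\<beta> \<plusminus> \<delta>)\<close>. On these configurations the
  Boltzmann weight is nearly constant, and dividing the partition function by it counts them
  (\<open>energy_window_limit\<close>).\<close>

section \<open>Poisson lists and compound Poisson laws\<close>

definition poisson_list :: "real \<Rightarrow> 'b pmf \<Rightarrow> 'b list pmf" where
  "poisson_list s Q = bind_pmf (poisson_pmf s) (\<lambda>n. replicate_pmf n Q)"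

definition compound_poisson :: "real \<Rightarrow> 'b::comm_monoid_add pmf \<Rightarrow> 'b pmf" where
  "compound_poisson s Q = map_pmf sum_list (poisson_list s Q)"

lemma replicate_pmf_Suc_pair:
  "replicate_pmf (Suc n) Q = map_pmf (\<lambda>(x, xs). x # xs) (pair_pmf Q (replicate_pmf n Q))"
  by (simp add: map_pmf_def pair_pmf_def bind_assoc_pmf bind_return_pmf)

lemma map_replicate_pmf: "map_pmf (map f) (replicate_pmf n Q) = replicate_pmf n (map_pmf f Q)"
proof (induction n)
  case (Suc n)
  have "map_pmf (map f) (replicate_pmf (Suc n) Q) =
      bind_pmf Q (\<lambda>x. map_pmf (\<lambda>xs. f x # xs) (map_pmf (map f) (replicate_pmf n Q)))"
    by (simp add: map_pmf_def bind_assoc_pmf bind_return_pmf)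
  also have "\<dots> = replicate_pmf (Suc n) (map_pmf f Q)"
    unfolding Suc by (simp add: map_pmf_def bind_assoc_pmf bind_return_pmf)
  finally show ?case .
qed simp

lemma map_poisson_list: "map_pmf (map f) (poisson_list s Q) = poisson_list s (map_pmf f Q)"
  by (simp add: poisson_list_def map_bind_pmf map_replicate_pmf)

lemma length_poisson_list: "map_pmf length (poisson_list s Q) = poisson_pmf s"
proof -
  have "map_pmf length (replicate_pmf n Q) = return_pmf n" for n
  proof -
    have "map_pmf length (replicate_pmf n Q) = map_pmf (\<lambda>_. n) (replicate_pmf n Q)"
      by (rule map_pmf_cong) (auto simp: set_replicate_pmf)
    then show ?thesis by simp
  qed
  then show ?thesis
    by (simp add: poisson_list_def map_bind_pmf bind_return_pmf')
qed

lemma set_poisson_list: "xs \<in> set_pmf (poisson_list s Q) \<Longrightarrow> set xs \<subseteq> set_pmf Q"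
  by (auto simp: poisson_list_def set_replicate_pmf)

lemma pmf_replicate_pmf:
  "pmf (replicate_pmf n Q) xs = (if length xs = n then prod_list (map (pmf Q) xs) else 0)"
proof (induction n arbitrary: xs)
  case 0
  then show ?case by (auto simp: indicator_def)
next
  case (Suc n)
  show ?case
  proof (cases xs)
    case Nil
    then have "xs \<notin> set_pmf (replicate_pmf (Suc n) Q)"
      unfolding set_replicate_pmf by auto
    then show ?thesis using Nil unfolding set_pmf_iff by simp
  next
    case (Cons y ys)
    have inj: "inj (\<lambda>(x :: 'a, xs). x # xs)" by (auto simp: inj_def)
    have "pmf (replicate_pmf (Suc n) Q) xs
        = pmf (map_pmf (\<lambda>(x, xs). x # xs) (pair_pmf Q (replicate_pmf n Q))) ((\<lambda>(x, xs). x # xs) (y, ys))"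
      by (simp only: replicate_pmf_Suc_pair Cons prod.case)
    also have "\<dots> = pmf (pair_pmf Q (replicate_pmf n Q)) (y, ys)"
      by (rule pmf_map_inj') (rule inj)
    finally show ?thesis by (simp add: pmf_pair Suc Cons)
  qed
qed

text \<open>Explicit weights turn identities and inequalities between laws of lists into statements about
  products.\<close>

lemma pmf_poisson_list:
  assumes "s > 0"
  shows "pmf (poisson_list s Q) xs = pmf (poisson_pmf s) (length xs) * prod_list (map (pmf Q) xs)"
proof -
  have "pmf (poisson_list s Q) xs =
      (\<integral>n. prod_list (map (pmf Q) xs) * indicator {length xs} n \<partial>measure_pmf (poisson_pmf s))"
    unfolding poisson_list_def pmf_bind
    by (intro Bochner_Integration.integral_cong) (auto simp: pmf_replicate_pmf indicator_def)
  also have "\<dots> = prod_list (map (pmf Q) xs) * measure (measure_pmf (poisson_pmf s)) {length xs}"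
    by simp
  finally show ?thesis by (simp add: measure_pmf_single)
qed

text \<open>Both sides give \<open>(k, m)\<close> the weight \<open>e\<^sup>-\<^sup>s (su)\<^sup>k (s(1 - u))\<^sup>m / (k! m!)\<close>: the binomial
  coefficient cancels the factorial in the Poisson weight of \<open>k + m\<close>.\<close>

lemma poisson_binomial_split:
  assumes s: "s > 0" and u: "0 < u" "u < (1::real)"
  shows "bind_pmf (poisson_pmf s) (\<lambda>n. map_pmf (\<lambda>k. (k, n - k)) (binomial_pmf n u))
       = pair_pmf (poisson_pmf (s * u)) (poisson_pmf (s * (1 - u)))"
proof (rule pmf_eqI, clarify)
  fix k l :: nat
  have *: "pmf (map_pmf (\<lambda>k. (k, n - k)) (binomial_pmf n u)) (k, l) =
      pmf (binomial_pmf (k + l) u) k * indicator {k + l} n" for n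
  proof (cases "n = k + l")
    case True
    have inj: "inj (\<lambda>k. (k, n - k))" by (auto simp: inj_def)
    have "pmf (map_pmf (\<lambda>k. (k, n - k)) (binomial_pmf n u)) ((\<lambda>k. (k, n - k)) k)
        = pmf (binomial_pmf n u) k"
      by (rule pmf_map_inj'[OF inj])
    then show ?thesis using True by simp
  next
    case False
    then have "(k, l) \<notin> set_pmf (map_pmf (\<lambda>k. (k, n - k)) (binomial_pmf n u))"
      using u by (auto simp: set_pmf_binomial_eq)
    then show ?thesis using False unfolding set_pmf_iff by simp
  qed
  have "pmf (bind_pmf (poisson_pmf s) (\<lambda>n. map_pmf (\<lambda>k. (k, n - k)) (binomial_pmf n u))) (k, l)
     = pmf (binomial_pmf (k + l) u) k * pmf (poisson_pmf s) (k + l)"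
    unfolding pmf_bind * by (simp add: measure_pmf_single)
  also have "\<dots> = (s * u) ^ k / fact k * exp (- (s * u)) * ((s * (1 - u)) ^ l / fact l * exp (- (s * (1 - u))))"
  proof -
    have e: "exp (- s) = exp (- (s * u)) * exp (- (s * (1 - u)))"
      by (simp add: exp_add[symmetric] algebra_simps)
    have b: "real (k + l choose k) = fact (k + l) / (fact k * fact l)"
      by (simp add: binomial_fact)
    show ?thesis using s u
      by (simp add: e b power_add power_mult_distrib divide_simps)
  qed
  finally show "pmf (bind_pmf (poisson_pmf s) (\<lambda>n. map_pmf (\<lambda>k. (k, n - k)) (binomial_pmf n u))) (k, l) =
      pmf (pair_pmf (poisson_pmf (s * u)) (poisson_pmf (s * (1 - u)))) (k, l)"
    using s u by (simp add: pmf_pair)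
qed

text \<open>Each of the \<open>n\<close> terms tosses a coin for its law; by commutativity only the number of heads
  matters.\<close>

lemma iid_sum_mixture:
  fixes Q1 Q2 :: "'b::comm_monoid_add pmf"
  assumes u: "0 < u" "u < (1::real)"
  shows "map_pmf sum_list (replicate_pmf n (bind_pmf (bernoulli_pmf u) (\<lambda>b. if b then Q1 else Q2))) =
    bind_pmf (binomial_pmf n u) (\<lambda>k. map_pmf (\<lambda>(x, y). x + y)
      (pair_pmf (map_pmf sum_list (replicate_pmf k Q1)) (map_pmf sum_list (replicate_pmf (n - k) Q2))))"
proof (induction n)
  case 0
  then show ?case using u by (simp add: binomial_pmf_0 bind_return_pmf pair_return_pmf1)
next
  case (Suc n)
  let ?M = "bind_pmf (bernoulli_pmf u) (\<lambda>b. if b then Q1 else Q2)"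
  let ?S = "\<lambda>n Q. map_pmf sum_list (replicate_pmf n Q)"
  let ?c = "\<lambda>k l. map_pmf (\<lambda>(x, y). x + y) (pair_pmf (?S k Q1) (?S l Q2))"
  have S: "?S (Suc n) Q = bind_pmf Q (\<lambda>x. map_pmf (\<lambda>y. x + y) (?S n Q))" for n and Q :: "'b pmf"
    by (simp add: map_pmf_def bind_assoc_pmf bind_return_pmf)
  have c1: "bind_pmf Q1 (\<lambda>x. map_pmf (\<lambda>y. x + y) (?c k l)) = ?c (Suc k) l" for k l
    unfolding S by (simp add: map_pmf_def pair_pmf_def bind_assoc_pmf bind_return_pmf add.assoc)
  have c2: "bind_pmf Q2 (\<lambda>x. map_pmf (\<lambda>y. x + y) (?c k l)) = ?c k (Suc l)" for k l
    unfolding S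
    apply (simp add: map_pmf_def pair_pmf_def bind_assoc_pmf bind_return_pmf)
    apply (subst bind_commute_pmf)
    apply (simp add: add.left_commute)
    done
  have "?S (Suc n) ?M = bind_pmf (bernoulli_pmf u) (\<lambda>b. bind_pmf (if b then Q1 else Q2)
      (\<lambda>x. map_pmf (\<lambda>y. x + y) (bind_pmf (binomial_pmf n u) (\<lambda>k. ?c k (n - k)))))"
    unfolding S Suc by (simp add: bind_assoc_pmf)
  also have "\<dots> = bind_pmf (bernoulli_pmf u) (\<lambda>b. bind_pmf (binomial_pmf n u)
      (\<lambda>k. bind_pmf (if b then Q1 else Q2) (\<lambda>x. map_pmf (\<lambda>y. x + y) (?c k (n - k)))))"
    unfolding map_bind_pmf by (intro bind_pmf_cong refl) (subst bind_commute_pmf, rule refl)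
  also have "\<dots> = bind_pmf (bernoulli_pmf u) (\<lambda>b. bind_pmf (binomial_pmf n u)
      (\<lambda>k. ?c ((if b then 1 else 0) + k) (Suc n - ((if b then 1 else 0) + k))))"
    using u by (intro bind_pmf_cong refl) (auto simp: c1 c2 Suc_diff_le simp del: replicate_pmf.simps)
  also have "\<dots> = bind_pmf (binomial_pmf (Suc n) u) (\<lambda>k. ?c k (Suc n - k))"
    using u by (subst binomial_pmf_Suc) (simp_all add: bind_assoc_pmf bind_return_pmf)
  finally show ?case .
qed

text \<open>Thinning: the edges of a Poisson hypergraph that contain a given site are independent of the
  remaining ones.\<close>

lemma compound_poisson_mixture:
  fixes Q1 Q2 :: "'b::comm_monoid_add pmf"
  assumes s: "s > 0" and u: "0 < u" "u < (1::real)"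
  shows "compound_poisson s (bind_pmf (bernoulli_pmf u) (\<lambda>b. if b then Q1 else Q2)) =
    map_pmf (\<lambda>(x, y). x + y)
      (pair_pmf (compound_poisson (s * u) Q1) (compound_poisson (s * (1 - u)) Q2))"
proof -
  let ?S = "\<lambda>n Q. map_pmf sum_list (replicate_pmf n Q)"
  let ?c = "\<lambda>k l. map_pmf (\<lambda>(x, y). x + y) (pair_pmf (?S k Q1) (?S l Q2))"
  have cp: "compound_poisson s Q = bind_pmf (poisson_pmf s) (\<lambda>n. ?S n Q)" for s and Q :: "'b pmf"
    by (simp add: compound_poisson_def poisson_list_def map_bind_pmf)
  have "compound_poisson s (bind_pmf (bernoulli_pmf u) (\<lambda>b. if b then Q1 else Q2)) =
     bind_pmf (bind_pmf (poisson_pmf s) (\<lambda>n. map_pmf (\<lambda>k. (k, n - k)) (binomial_pmf n u)))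
       (\<lambda>(k, l). ?c k l)"
    unfolding cp iid_sum_mixture[OF u] by (simp add: bind_assoc_pmf bind_map_pmf)
  also have "\<dots> = bind_pmf (pair_pmf (poisson_pmf (s * u)) (poisson_pmf (s * (1 - u)))) (\<lambda>(k, l). ?c k l)"
    by (simp only: poisson_binomial_split[OF s u])
  also have "\<dots> = map_pmf (\<lambda>(x, y). x + y)
      (pair_pmf (compound_poisson (s * u) Q1) (compound_poisson (s * (1 - u)) Q2))"
    unfolding cp pair_pmf_def
    apply (simp add: map_pmf_def bind_assoc_pmf bind_return_pmf)
    apply (intro bind_pmf_cong refl)
    apply (subst bind_commute_pmf)
    apply (simp add: bind_assoc_pmf bind_return_pmf)
    done
  finally show ?thesis .
qed

corollary compound_poisson_add:
  fixes Q :: "'b::comm_monoid_add pmf"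
  assumes "s > 0" "t > 0"
  shows "compound_poisson (s + t) Q =
    map_pmf (\<lambda>(x, y). x + y) (pair_pmf (compound_poisson s Q) (compound_poisson t Q))"
proof -
  define u where "u = s / (s + t)"
  have u: "0 < u" "u < 1" using assms by (simp_all add: u_def field_simps)
  have eq: "(s + t) * u = s" "(s + t) * (1 - u) = t" using assms by (simp_all add: u_def field_simps)
  have "bind_pmf (bernoulli_pmf u) (\<lambda>b. if b then Q else Q) = Q" by simp
  with compound_poisson_mixture[of "s + t" u Q Q] u assms show ?thesis by (simp add: eq)
qed

lemma map_compound_poisson:
  assumes "f 0 = 0" "\<And>x y. f (x + y) = f x + f y"
  shows "map_pmf f (compound_poisson s Q) = compound_poisson s (map_pmf f Q)"
proof -
  have "f (sum_list xs) = sum_list (map f xs)" for xs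
    by (induction xs) (simp_all add: assms)
  then show ?thesis
    by (simp add: compound_poisson_def pmf.map_comp o_def flip: map_poisson_list)
qed

lemma poisson_expectation:
  assumes s: "s > 0" and f: "\<And>n. f n \<ge> 0"
    and sums: "(\<lambda>n. pmf (poisson_pmf s) n * f n) sums S"
  shows "integrable (measure_pmf (poisson_pmf s)) f"
    and "measure_pmf.expectation (poisson_pmf s) f = S"
proof -
  have S: "S \<ge> 0" using sums f by (intro sums_le[OF _ sums_zero sums]) simp
  have "(\<integral>\<^sup>+n. ennreal (f n) \<partial>measure_pmf (poisson_pmf s)) =
      (\<integral>\<^sup>+n. ennreal (pmf (poisson_pmf s) n * f n) \<partial>count_space UNIV)"
    by (simp add: nn_integral_measure_pmf ennreal_mult f)
  also have "\<dots> = ennreal S"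
    unfolding nn_integral_count_space_nat using sums f by (intro suminf_ennreal_eq) auto
  finally have *: "(\<integral>\<^sup>+n. ennreal (f n) \<partial>measure_pmf (poisson_pmf s)) = ennreal S" .
  have "has_bochner_integral (measure_pmf (poisson_pmf s)) f S"
    using f S * by (intro has_bochner_integral_nn_integral) auto
  then show "integrable (measure_pmf (poisson_pmf s)) f"
    and "measure_pmf.expectation (poisson_pmf s) f = S"
    by (auto simp: has_bochner_integral_iff)
qed

lemma poisson_mean:
  assumes s: "s > 0"
  shows "integrable (measure_pmf (poisson_pmf s)) real"
    and "measure_pmf.expectation (poisson_pmf s) real = s"
proof -
  have "(\<lambda>n. s ^ n / fact n) sums exp s"
    using exp_converges[of s] by (simp add: scaleR_conv_of_real divide_inverse mult.commute)
  then have "(\<lambda>n. exp (-s) * s * (s ^ n / fact n)) sums (exp (-s) * s * exp s)"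
    by (rule sums_mult)
  moreover have "exp (-s) * s * exp s = s" by (simp add: exp_minus)
  moreover have "(\<lambda>n. exp (-s) * s * (s ^ n / fact n)) = (\<lambda>n. pmf (poisson_pmf s) (Suc n) * real (Suc n))"
    using s by (auto simp: fun_eq_iff divide_simps simp del: of_nat_Suc)
  ultimately have "(\<lambda>n. pmf (poisson_pmf s) (Suc n) * real (Suc n)) sums s" by simp
  then have "(\<lambda>n. pmf (poisson_pmf s) n * real n) sums s"
    by (subst (asm) sums_Suc_iff) simp
  from poisson_expectation[OF s _ this]
  show "integrable (measure_pmf (poisson_pmf s)) real"
    and "measure_pmf.expectation (poisson_pmf s) real = s" by auto
qed

lemma poisson_generating_function:
  assumes s: "s > 0" and x: "x \<ge> 0"
  shows "integrable (measure_pmf (poisson_pmf s)) (\<lambda>n. x ^ n)"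
    and "measure_pmf.expectation (poisson_pmf s) (\<lambda>n. x ^ n) = exp (s * (x - 1))"
proof -
  have "(\<lambda>n. (s * x) ^ n / fact n) sums exp (s * x)"
    using exp_converges[of "s * x"] by (simp add: scaleR_conv_of_real divide_inverse mult.commute)
  then have "(\<lambda>n. exp (-s) * ((s * x) ^ n / fact n)) sums (exp (-s) * exp (s * x))"
    by (rule sums_mult)
  also have "exp (-s) * exp (s * x) = exp (s * (x - 1))"
    by (simp add: exp_add[symmetric] algebra_simps)
  also have "(\<lambda>n. exp (-s) * ((s * x) ^ n / fact n)) = (\<lambda>n. pmf (poisson_pmf s) n * x ^ n)"
    using s by (auto simp: fun_eq_iff field_simps power_mult_distrib)
  finally have "(\<lambda>n. pmf (poisson_pmf s) n * x ^ n) sums exp (s * (x - 1))" .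
  from poisson_expectation[OF s _ this] x
  show "integrable (measure_pmf (poisson_pmf s)) (\<lambda>n. x ^ n)"
    and "measure_pmf.expectation (poisson_pmf s) (\<lambda>n. x ^ n) = exp (s * (x - 1))" by auto
qed

lemma integrable_length_poisson_list:
  assumes "s > 0"
  shows "integrable (measure_pmf (poisson_list s Q)) (\<lambda>xs. real (length xs))"
    and "measure_pmf.expectation (poisson_list s Q) (\<lambda>xs. real (length xs)) = s"
proof -
  have "integrable (measure_pmf (map_pmf length (poisson_list s Q))) real"
    unfolding length_poisson_list by (rule poisson_mean[OF assms])
  then show "integrable (measure_pmf (poisson_list s Q)) (\<lambda>xs. real (length xs))" by simp
  have "measure_pmf.expectation (map_pmf length (poisson_list s Q)) real = s"
    unfolding length_poisson_list by (rule poisson_mean[OF assms])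
  then show "measure_pmf.expectation (poisson_list s Q) (\<lambda>xs. real (length xs)) = s" by simp
qed

lemma integrable_poisson_list_le:
  assumes "s > 0" "\<And>xs. xs \<in> set_pmf (poisson_list s Q) \<Longrightarrow> \<bar>f xs\<bar> \<le> B * real (length xs)"
  shows "integrable (measure_pmf (poisson_list s Q)) f"
proof (rule Bochner_Integration.integrable_bound)
  show "integrable (measure_pmf (poisson_list s Q)) (\<lambda>xs. B * real (length xs))"
    by (intro integrable_mult_right integrable_length_poisson_list[OF assms(1)])
  show "AE xs in measure_pmf (poisson_list s Q). norm (f xs) \<le> norm (B * real (length xs))"
    using assms(2) unfolding AE_measure_pmf_iff real_norm_def by (meson abs_ge_self order_trans)
qed simp

lemma campbell_nn:
  assumes "s > 0"
  shows "(\<integral>\<^sup>+xs. (\<Sum>x\<leftarrow>xs. f x) \<partial>measure_pmf (poisson_list s Q)) = ennreal s * (\<integral>\<^sup>+x. f x \<partial>measure_pmf Q)"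
proof -
  have r: "(\<integral>\<^sup>+xs. (\<Sum>x\<leftarrow>xs. f x) \<partial>measure_pmf (replicate_pmf n Q)) = of_nat n * (\<integral>\<^sup>+x. f x \<partial>measure_pmf Q)" for n
  proof (induction n)
    case (Suc n)
    have "(\<integral>\<^sup>+xs. (\<Sum>x\<leftarrow>xs. f x) \<partial>measure_pmf (replicate_pmf (Suc n) Q)) =
      (\<integral>\<^sup>+x. (\<integral>\<^sup>+xs. f x + (\<Sum>x\<leftarrow>xs. f x) \<partial>measure_pmf (replicate_pmf n Q)) \<partial>measure_pmf Q)"
      by simp
    also have "\<dots> = (\<integral>\<^sup>+x. f x + of_nat n * (\<integral>\<^sup>+x. f x \<partial>measure_pmf Q) \<partial>measure_pmf Q)"
      by (subst nn_integral_add) (simp_all add: Suc)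
    also have "\<dots> = of_nat (Suc n) * (\<integral>\<^sup>+x. f x \<partial>measure_pmf Q)"
      by (subst nn_integral_add) (simp_all add: algebra_simps)
    finally show ?case .
  qed simp
  have "(\<integral>\<^sup>+xs. (\<Sum>x\<leftarrow>xs. f x) \<partial>measure_pmf (poisson_list s Q)) =
     (\<integral>\<^sup>+n. of_nat n * (\<integral>\<^sup>+x. f x \<partial>measure_pmf Q) \<partial>measure_pmf (poisson_pmf s))"
    by (simp add: poisson_list_def r)
  also have "\<dots> = (\<integral>\<^sup>+n. ennreal (real n) \<partial>measure_pmf (poisson_pmf s)) * (\<integral>\<^sup>+x. f x \<partial>measure_pmf Q)"
    by (simp add: nn_integral_multc ennreal_of_nat_eq_real_of_nat)
  also have "(\<integral>\<^sup>+n. ennreal (real n) \<partial>measure_pmf (poisson_pmf s)) = ennreal s"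
    using poisson_mean[OF assms] by (subst nn_integral_eq_integral) auto
  finally show ?thesis .
qed

text \<open>The hypothesis that \<open>f\<close> is bounded lets the formula for nonnegative functions be applied to
  \<open>f + B\<close> and to a constant.\<close>

lemma campbell:
  fixes f :: "'b \<Rightarrow> real"
  assumes s: "s > 0" and B: "\<And>x. x \<in> set_pmf Q \<Longrightarrow> \<bar>f x\<bar> \<le> B"
  shows "measure_pmf.expectation (poisson_list s Q) (\<lambda>xs. \<Sum>x\<leftarrow>xs. f x) = s * measure_pmf.expectation Q f"
proof -
  have B0: "B \<ge> 0"
  proof -
    obtain x where "x \<in> set_pmf Q" using set_pmf_not_empty by fast
    then show ?thesis using B by fastforce
  qed
  define g where "g x = max 0 (f x + B)" for x
  have gf: "g x = f x + B" if "x \<in> set_pmf Q" for x using B[OF that] by (auto simp: g_def max_def)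
  have ig: "integrable (measure_pmf Q) f"
    using B by (intro measure_pmf.integrable_const_bound[where B=B]) (auto simp: AE_measure_pmf_iff)
  have eg: "measure_pmf.expectation Q g = measure_pmf.expectation Q f + B"
  proof -
    have "measure_pmf.expectation Q g = measure_pmf.expectation Q (\<lambda>x. f x + B)"
      by (rule integral_cong_AE) (auto simp: AE_measure_pmf_iff gf)
    then show ?thesis using ig by simp
  qed
  have igg: "integrable (measure_pmf Q) g"
    using ig by (subst integrable_cong_AE[where g="\<lambda>x. f x + B"]) (auto simp: AE_measure_pmf_iff gf)
  have sg: "(\<Sum>x\<leftarrow>xs. g x) = (\<Sum>x\<leftarrow>xs. f x) + B * real (length xs)" if "set xs \<subseteq> set_pmf Q" for xs
    using that by (induction xs) (auto simp: gf algebra_simps)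
  have fb: "\<bar>\<Sum>x\<leftarrow>xs. f x\<bar> \<le> B * real (length xs)" if "set xs \<subseteq> set_pmf Q" for xs
    using that
  proof (induction xs)
    case (Cons a xs)
    then have "\<bar>f a\<bar> \<le> B" "\<bar>\<Sum>x\<leftarrow>xs. f x\<bar> \<le> B * real (length xs)" using B by auto
    then show ?case by (simp add: algebra_simps)
  qed simp
  have isf: "integrable (measure_pmf (poisson_list s Q)) (\<lambda>xs. \<Sum>x\<leftarrow>xs. f x)"
    by (rule integrable_poisson_list_le[OF s]) (use fb set_poisson_list in blast)
  have g0: "(\<Sum>x\<leftarrow>xs. g x) \<ge> 0" for xs by (intro sum_list_nonneg) (auto simp: g_def)
  have se: "(\<Sum>x\<leftarrow>xs. ennreal (g x)) = ennreal (\<Sum>x\<leftarrow>xs. g x)" for xs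
  proof (induction xs)
    case (Cons a xs)
    have "g a \<ge> 0" by (simp add: g_def)
    with Cons g0[of xs] show ?case by simp
  qed simp
  have ae: "AE xs in measure_pmf (poisson_list s Q). (\<Sum>x\<leftarrow>xs. g x) = (\<Sum>x\<leftarrow>xs. f x) + B * real (length xs)"
    by (auto simp: AE_measure_pmf_iff intro!: sg dest: set_poisson_list)
  have isg: "integrable (measure_pmf (poisson_list s Q)) (\<lambda>xs. \<Sum>x\<leftarrow>xs. g x)"
    by (subst integrable_cong_AE[OF _ _ ae])
       (auto intro!: Bochner_Integration.integrable_add integrable_mult_right isf
          integrable_length_poisson_list[OF s])
  have "ennreal (measure_pmf.expectation (poisson_list s Q) (\<lambda>xs. \<Sum>x\<leftarrow>xs. g x))
      = (\<integral>\<^sup>+xs. (\<Sum>x\<leftarrow>xs. ennreal (g x)) \<partial>measure_pmf (poisson_list s Q))"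
    unfolding se by (rule nn_integral_eq_integral[symmetric]) (use isg g0 in auto)
  also have "\<dots> = ennreal s * ennreal (measure_pmf.expectation Q g)"
    unfolding campbell_nn[OF s] using igg
    by (subst nn_integral_eq_integral) (auto simp: g_def)
  also have "\<dots> = ennreal (s * measure_pmf.expectation Q g)"
    using s by (simp add: ennreal_mult' )
  finally have "measure_pmf.expectation (poisson_list s Q) (\<lambda>xs. \<Sum>x\<leftarrow>xs. g x) = s * measure_pmf.expectation Q g"
  proof (subst (asm) ennreal_inj)
    show "0 \<le> measure_pmf.expectation (poisson_list s Q) (\<lambda>xs. \<Sum>x\<leftarrow>xs. g x)"
      by (rule Bochner_Integration.integral_nonneg) (rule g0)
    show "0 \<le> s * measure_pmf.expectation Q g"
      using s by (auto simp: g_def intro!: mult_nonneg_nonneg Bochner_Integration.integral_nonneg)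
  qed
  moreover have "measure_pmf.expectation (poisson_list s Q) (\<lambda>xs. \<Sum>x\<leftarrow>xs. g x)
     = measure_pmf.expectation (poisson_list s Q) (\<lambda>xs. \<Sum>x\<leftarrow>xs. f x) + B * s"
    using integral_cong_AE[OF _ _ ae] isf integrable_length_poisson_list[OF s, of Q] by simp
  ultimately show ?thesis using eg by (simp add: algebra_simps)
qed

section \<open>Spins in independent fields\<close>

text \<open>By finiteness of the spin space every function on it is such a field.\<close>

type_synonym field = "spin \<Rightarrow>\<^sub>C real"

definition spin_avg :: "(spin \<Rightarrow> real) \<Rightarrow> real" where
  "spin_avg f = (\<Sum>s\<in>UNIV. f s) / 2"

text \<open>The average of \<open>g\<close> over uniform independent spins \<open>s\<^sub>1, \<dots>, s\<^sub>n\<close>, weighted by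
  \<open>\<Prod>\<^sub>k exp(\<beta> x\<^sub>k(s\<^sub>k))\<close> but not normalized. Recursion along the list of fields avoids indices.\<close>

primrec field_avg :: "real \<Rightarrow> field list \<Rightarrow> (spin list \<Rightarrow> real) \<Rightarrow> real" where
  "field_avg \<beta> [] g = g []"
| "field_avg \<beta> (x # xs) g =
     spin_avg (\<lambda>s. exp (\<beta> * apply_bcontfun x s) * field_avg \<beta> xs (\<lambda>ss. g (s # ss)))"

definition conf_avg :: "nat \<Rightarrow> ((nat \<Rightarrow> spin) \<Rightarrow> real) \<Rightarrow> real" where
  "conf_avg N f = (\<Sum>\<sigma>\<in>{1..N} \<rightarrow>\<^sub>E UNIV. f \<sigma>) / 2 ^ N"

text \<open>Adding a constant to a field does not change the spin measure that it defines. This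
  normalization singles out one representative, and it makes the weights in \<open>field_avg\<close> a
  probability measure.\<close>

definition normalized :: "real \<Rightarrow> field \<Rightarrow> bool" where
  "normalized \<beta> x \<longleftrightarrow> spin_avg (\<lambda>s. exp (\<beta> * apply_bcontfun x s)) = 1"

text \<open>The edges at a site, each with its interaction and with the fields acting on its other sites.\<close>

type_synonym config = "((spin list \<Rightarrow> real) \<times> field list) list"

text \<open>The site at which the edges of a configuration meet always occupies the last argument, as in
  the cavity operator.\<close>

definition edge_weight :: "real \<Rightarrow> (spin list \<Rightarrow> real) \<times> field list \<Rightarrow> spin \<Rightarrow> real" where
  "edge_weight \<beta> e t = field_avg \<beta> (snd e) (\<lambda>ss. exp (\<beta> * fst e (ss @ [t])))"

definition star_weight :: "real \<Rightarrow> config \<Rightarrow> spin \<Rightarrow> real" where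
  "star_weight \<beta> c t = (\<Prod>e\<leftarrow>c. edge_weight \<beta> e t)"

definition message :: "real \<Rightarrow> config \<Rightarrow> field" where
  "message \<beta> c = Bcontfun (\<lambda>t. 1 / \<beta> * ln (star_weight \<beta> c t / spin_avg (star_weight \<beta> c)))"

lemma UNIV_spin_card: "(UNIV :: spin set) = {Abs_spin (-1), Abs_spin 1}" "Abs_spin (-1) \<noteq> Abs_spin 1"
  using UNIV_spin by (auto simp: Abs_spin_inject)

lemma card_spin: "card (UNIV :: spin set) = 2"
  using UNIV_spin_card(2) by (subst UNIV_spin_card(1)) simp

lemma spin_avg_alt: "spin_avg f = (f (Abs_spin (-1)) + f (Abs_spin 1)) / 2"
  using UNIV_spin_card(2) unfolding spin_avg_def by (subst UNIV_spin_card(1)) simp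

lemma spin_avg_const [simp]: "spin_avg (\<lambda>_. c) = c"
  by (simp add: spin_avg_alt)

lemma spin_avg_cmult: "spin_avg (\<lambda>s. c * f s) = c * spin_avg f"
  by (simp add: spin_avg_alt algebra_simps)

lemma spin_avg_mono: "(\<And>s. f s \<le> g s) \<Longrightarrow> spin_avg f \<le> spin_avg g"
  by (simp add: spin_avg_alt add_mono divide_right_mono)

lemma spin_avg_pos: "(\<And>s. f s > 0) \<Longrightarrow> spin_avg f > 0"
  by (simp add: spin_avg_alt add_pos_pos)

lemma bcontfun_spin: "(f :: spin \<Rightarrow> real) \<in> bcontfun"
  by (auto simp: bcontfun_def intro: finite_imp_bounded)

lemma apply_Bcontfun_spin [simp]: "apply_bcontfun (Bcontfun (f :: spin \<Rightarrow> real)) = f"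
  by (rule Bcontfun_inverse[OF bcontfun_spin])

lemma field_avg_cong:
  "(\<And>ss. length ss = length xs \<Longrightarrow> g ss = h ss) \<Longrightarrow> field_avg \<beta> xs g = field_avg \<beta> xs h"
proof (induction xs arbitrary: g h)
  case (Cons x xs)
  have "field_avg \<beta> xs (\<lambda>ss. g (s # ss)) = field_avg \<beta> xs (\<lambda>ss. h (s # ss))" for s
    by (rule Cons.IH) (simp add: Cons.prems)
  then show ?case by simp
qed simp

lemma field_avg_append:
  "field_avg \<beta> (xs @ ys) g = field_avg \<beta> xs (\<lambda>a. field_avg \<beta> ys (\<lambda>b. g (a @ b)))"
  by (induction xs arbitrary: g) simp_all

lemma field_avg_cmult: "field_avg \<beta> xs (\<lambda>ss. c * g ss) = c * field_avg \<beta> xs g"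
proof (induction xs arbitrary: g)
  case (Cons x xs)
  show ?case by (simp add: Cons mult.left_commute[of _ c] spin_avg_cmult)
qed simp

lemma field_avg_multc: "field_avg \<beta> xs (\<lambda>ss. g ss * c) = field_avg \<beta> xs g * c"
  using field_avg_cmult[of \<beta> xs c g] by (simp add: mult.commute)

lemma field_avg_pos: "(\<And>ss. g ss > 0) \<Longrightarrow> field_avg \<beta> xs g > 0"
  by (induction xs arbitrary: g) (auto intro!: spin_avg_pos mult_pos_pos)

lemma field_avg_mono:
  "(\<And>ss. length ss = length xs \<Longrightarrow> g ss \<le> h ss) \<Longrightarrow> field_avg \<beta> xs g \<le> field_avg \<beta> xs h"
proof (induction xs arbitrary: g h)
  case (Cons x xs)
  show ?case by (auto intro!: spin_avg_mono mult_left_mono Cons)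
qed simp

lemma field_avg_const:
  "(\<And>x. x \<in> set xs \<Longrightarrow> normalized \<beta> x) \<Longrightarrow> field_avg \<beta> xs (\<lambda>_. c) = c"
proof (induction xs)
  case (Cons x xs)
  then have "field_avg \<beta> xs (\<lambda>_. c) = c" by simp
  moreover have "spin_avg (\<lambda>s. exp (\<beta> * apply_bcontfun x s)) = 1"
    using Cons.prems by (simp add: normalized_def)
  ultimately show ?case
    using spin_avg_cmult[of c "\<lambda>s. exp (\<beta> * apply_bcontfun x s)"] by (simp add: mult.commute)
qed simp

lemma edge_weight_pos: "edge_weight \<beta> e t > 0"
  by (simp add: edge_weight_def field_avg_pos)

lemma star_weight_pos: "star_weight \<beta> c t > 0"
  unfolding star_weight_def by (induction c) (auto simp: edge_weight_pos)

lemma spin_avg_star_weight_pos: "spin_avg (star_weight \<beta> c) > 0"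
  by (intro spin_avg_pos star_weight_pos)

lemma exp_message:
  assumes "\<beta> \<noteq> 0"
  shows "exp (\<beta> * apply_bcontfun (message \<beta> c) t) = star_weight \<beta> c t / spin_avg (star_weight \<beta> c)"
  using assms star_weight_pos[of \<beta> c t] spin_avg_star_weight_pos[of \<beta> c] by (simp add: message_def)

lemma normalized_message:
  assumes "\<beta> \<noteq> 0"
  shows "normalized \<beta> (message \<beta> c)"
  using spin_avg_star_weight_pos[of \<beta> c] spin_avg_cmult[of "1 / spin_avg (star_weight \<beta> c)" "star_weight \<beta> c"]
  unfolding normalized_def exp_message[OF assms] by simp

text \<open>A product measure determines its factors, and a normalized field is determined by its spin
  measure.\<close>

lemma field_avg_inject:
  assumes \<beta>: "\<beta> \<noteq> 0"
    and "length xs = length ys" "\<forall>x\<in>set xs. normalized \<beta> x" "\<forall>y\<in>set ys. normalized \<beta> y"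
    and "\<And>g. field_avg \<beta> xs g = field_avg \<beta> ys g"
  shows "xs = ys"
  using assms(2-)
proof (induction xs ys rule: list_induct2)
  case (Cons x xs y ys)
  have nx: "normalized \<beta> x" "normalized \<beta> y" "\<forall>x\<in>set xs. normalized \<beta> x" "\<forall>y\<in>set ys. normalized \<beta> y"
    using Cons.prems by auto
  have "apply_bcontfun x s = apply_bcontfun y s" for s
  proof -
    have 1: "field_avg \<beta> xs (\<lambda>ss. c) = c" "field_avg \<beta> ys (\<lambda>ss. c) = c" for c
      using nx by (auto intro: field_avg_const)
    have ind: "(\<lambda>s'. exp (\<beta> * apply_bcontfun z s') * (if s' = s then 1 else 0)) =
      (\<lambda>s'. if s' = s then exp (\<beta> * apply_bcontfun z s') else 0)" for z :: field
      by auto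
    have "spin_avg (\<lambda>s'. exp (\<beta> * apply_bcontfun x s') * (if s' = s then 1 else 0)) =
       spin_avg (\<lambda>s'. exp (\<beta> * apply_bcontfun y s') * (if s' = s then 1 else 0))"
      using Cons.prems(3)[of "\<lambda>ss. if hd ss = s then 1 else 0"] by (simp add: 1)
    then show ?thesis using \<beta>
      unfolding ind by (simp add: spin_avg_def)
  qed
  then have "x = y" by (intro bcontfun_eqI) simp
  moreover have "xs = ys"
  proof (rule Cons.IH)
    fix g
    have "field_avg \<beta> (z # zs) (\<lambda>ss. g (tl ss)) = field_avg \<beta> zs g" if "normalized \<beta> z" for z zs
      using spin_avg_cmult[of "field_avg \<beta> zs g" "\<lambda>s. exp (\<beta> * apply_bcontfun z s)"] that
      by (simp add: normalized_def mult.commute)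
    then show "field_avg \<beta> xs g = field_avg \<beta> ys g"
      using Cons.prems(3)[of "\<lambda>ss. g (tl ss)"] nx by simp
  qed (use nx in auto)
  ultimately show ?case by simp
qed simp

lemma conf_avg_Suc:
  "conf_avg (Suc N) f = spin_avg (\<lambda>t. conf_avg N (\<lambda>\<sigma>. f (\<sigma>(Suc N := t))))"
proof -
  have ins: "{1..Suc N} = insert (Suc N) {1..N}" by auto
  have inj: "inj_on (\<lambda>(y, g). g(Suc N := y)) (UNIV \<times> ({1..N} \<rightarrow>\<^sub>E (UNIV :: spin set)))"
  proof (rule inj_onI, clarsimp)
    fix a g b h assume gh: "g \<in> {Suc 0..N} \<rightarrow>\<^sub>E (UNIV :: spin set)" "h \<in> {Suc 0..N} \<rightarrow>\<^sub>E (UNIV :: spin set)"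
      and eq: "g(Suc N := a) = h(Suc N := b)"
    have "a = b" using fun_cong[OF eq, of "Suc N"] by simp
    moreover have "g i = h i" for i
      using fun_cong[OF eq, of i] gh by (cases "i = Suc N") (auto simp: PiE_def extensional_def)
    ultimately show "a = b \<and> g = h" by auto
  qed
  have "(\<Sum>\<sigma>\<in>{1..Suc N} \<rightarrow>\<^sub>E UNIV. f \<sigma>) = (\<Sum>(t, \<sigma>)\<in>UNIV \<times> ({1..N} \<rightarrow>\<^sub>E UNIV). f (\<sigma>(Suc N := t)))"
    unfolding ins PiE_insert_eq by (subst sum.reindex[OF inj]) (simp add: case_prod_unfold)
  also have "\<dots> = (\<Sum>t\<in>UNIV. \<Sum>\<sigma>\<in>{1..N} \<rightarrow>\<^sub>E UNIV. f (\<sigma>(Suc N := t)))"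
    by (simp add: sum.cartesian_product)
  finally show ?thesis
    by (simp add: conf_avg_def spin_avg_def sum_divide_distrib[symmetric])
qed

lemma conf_avg_permute:
  assumes "\<pi> permutes {1..N}"
  shows "conf_avg N (\<lambda>\<sigma>. f (\<sigma> \<circ> \<pi>)) = conf_avg N f"
proof -
  have b: "bij_betw (\<lambda>\<sigma>. \<sigma> \<circ> \<pi>) ({1..N} \<rightarrow>\<^sub>E (UNIV :: spin set)) ({1..N} \<rightarrow>\<^sub>E UNIV)"
  proof (rule bij_betw_byWitness[where f' = "\<lambda>\<sigma>. \<sigma> \<circ> inv \<pi>"])
    show "\<forall>\<sigma>\<in>{1..N} \<rightarrow>\<^sub>E UNIV. \<sigma> \<circ> \<pi> \<circ> inv \<pi> = \<sigma>" "\<forall>\<sigma>\<in>{1..N} \<rightarrow>\<^sub>E UNIV. \<sigma> \<circ> inv \<pi> \<circ> \<pi> = \<sigma>"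
      using assms by (simp_all add: o_assoc[symmetric] permutes_inv_o)
    have "\<sigma> \<circ> \<rho> \<in> {1..N} \<rightarrow>\<^sub>E UNIV" if "\<sigma> \<in> {1..N} \<rightarrow>\<^sub>E (UNIV :: spin set)" "\<rho> permutes {1..N}" for \<sigma> \<rho>
      using that permutes_not_in[OF that(2)] by (auto simp: PiE_def extensional_def)
    then show "(\<lambda>\<sigma>. \<sigma> \<circ> \<pi>) ` ({1..N} \<rightarrow>\<^sub>E (UNIV :: spin set)) \<subseteq> {1..N} \<rightarrow>\<^sub>E UNIV"
      "(\<lambda>\<sigma>. \<sigma> \<circ> inv \<pi>) ` ({1..N} \<rightarrow>\<^sub>E (UNIV :: spin set)) \<subseteq> {1..N} \<rightarrow>\<^sub>E UNIV"
      using assms permutes_inv[OF assms] by blast+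
  qed
  show ?thesis
    unfolding conf_avg_def using sum.reindex_bij_betw[OF b, of f] by simp
qed

lemma conf_avg_cong:
  "(\<And>\<sigma>. \<sigma> \<in> {1..N} \<rightarrow>\<^sub>E UNIV \<Longrightarrow> f \<sigma> = g \<sigma>) \<Longrightarrow> conf_avg N f = conf_avg N g"
  by (simp add: conf_avg_def)

lemma card_conf: "card ({1..N} \<rightarrow>\<^sub>E (UNIV :: spin set)) = 2 ^ N"
  by (subst card_PiE) (simp_all add: card_spin)

lemma finite_conf [simp]: "finite ({1..N::nat} \<rightarrow>\<^sub>E (UNIV :: spin set))"
  by (rule finite_PiE) simp_all

lemma conf_avg_const [simp]: "conf_avg N (\<lambda>_. c) = c"
  by (simp add: conf_avg_def card_conf[simplified])

lemma conf_avg_cmult: "conf_avg N (\<lambda>\<sigma>. c * f \<sigma>) = c * conf_avg N f"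
  by (simp add: conf_avg_def sum_distrib_left)

lemma conf_avg_mono:
  "(\<And>\<sigma>. \<sigma> \<in> {1..N} \<rightarrow>\<^sub>E UNIV \<Longrightarrow> f \<sigma> \<le> g \<sigma>) \<Longrightarrow> conf_avg N f \<le> conf_avg N g"
  unfolding conf_avg_def by (intro divide_right_mono sum_mono) auto

lemma conf_avg_pos: "(\<And>\<sigma>. f \<sigma> > 0) \<Longrightarrow> conf_avg N f > 0"
proof -
  assume f: "\<And>\<sigma>. f \<sigma> > 0"
  have "({1..N} \<rightarrow>\<^sub>E (UNIV :: spin set)) \<noteq> {}" by (simp add: PiE_eq_empty_iff)
  then show ?thesis unfolding conf_avg_def using f
    by (intro divide_pos_pos sum_pos finite_conf) auto
qed

section \<open>Partition functions and factorizing Gibbs measures\<close>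

type_synonym energy = "(nat \<Rightarrow> spin) \<Rightarrow> real"

definition partition_fn :: "real \<Rightarrow> nat \<Rightarrow> energy \<Rightarrow> real" where
  "partition_fn \<beta> N H = conf_avg N (\<lambda>\<sigma>. exp (\<beta> * H \<sigma>))"

text \<open>Under the Gibbs measure of \<open>H\<close> the spins at the sites \<open>vs\<close> are independent, with effective
  fields \<open>xs\<close>.\<close>

definition factorizes :: "real \<Rightarrow> nat \<Rightarrow> energy \<Rightarrow> nat list \<Rightarrow> field list \<Rightarrow> bool" where
  "factorizes \<beta> N H vs xs \<longleftrightarrow> length vs = length xs \<and> (\<forall>x\<in>set xs. normalized \<beta> x) \<and>
     (\<forall>g. conf_avg N (\<lambda>\<sigma>. g (map \<sigma> vs) * exp (\<beta> * H \<sigma>)) = partition_fn \<beta> N H * field_avg \<beta> xs g)"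

definition supported :: "nat \<Rightarrow> energy \<Rightarrow> bool" where
  "supported N H \<longleftrightarrow> (\<forall>\<sigma> \<tau>. (\<forall>i\<in>{1..N}. \<sigma> i = \<tau> i) \<longrightarrow> H \<sigma> = H \<tau>)"

lemma partition_fn_pos: "partition_fn \<beta> N H > 0"
  by (simp add: partition_fn_def conf_avg_pos)

lemma factorizes_Nil: "factorizes \<beta> N H [] []"
  unfolding factorizes_def by (auto simp: partition_fn_def conf_avg_cmult mult.commute)

text \<open>This makes the events that the effective fields have given values disjoint.\<close>

lemma factorizes_unique:
  assumes "\<beta> \<noteq> 0" "factorizes \<beta> N H vs xs" "factorizes \<beta> N H vs ys"
  shows "xs = ys"
proof (rule field_avg_inject[OF assms(1)])
  fix g
  have "partition_fn \<beta> N H * field_avg \<beta> xs g = partition_fn \<beta> N H * field_avg \<beta> ys g"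
    using assms(2,3) unfolding factorizes_def by metis
  then show "field_avg \<beta> xs g = field_avg \<beta> ys g" using partition_fn_pos[of \<beta> N H] by simp
qed (use assms(2,3) in \<open>auto simp: factorizes_def\<close>)

text \<open>A new site \<open>v\<close> with the edges through it, which lists \<open>v\<close> last.\<close>

definition star_energy :: "nat \<Rightarrow> ((spin list \<Rightarrow> real) \<times> nat list) list \<Rightarrow> energy" where
  "star_energy v es \<sigma> = (\<Sum>(\<theta>, vs)\<leftarrow>es. \<theta> (map \<sigma> vs @ [\<sigma> v]))"

text \<open>With the spin \<open>t\<close> of the centre fixed, the edges of a star act on disjoint groups of
  independent spins, so that they can be integrated out one by one. The factor \<open>K\<close> in place of a
  Boltzmann weight lets the induction absorb the edges already treated.\<close>

lemma integrate_out_edges: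
  assumes "list_all2 (\<lambda>(\<theta>, vs) (\<theta>', c). \<theta> = \<theta>' \<and> length vs = length c) es cs"
    and "\<And>g. conf_avg N (\<lambda>\<sigma>. g (map \<sigma> (concat (map snd es) @ us)) * K \<sigma>) =
          z * field_avg \<beta> (concat (map snd cs) @ ys) g"
  shows "conf_avg N (\<lambda>\<sigma>. g (map \<sigma> us) * exp (\<beta> * (\<Sum>(\<theta>, vs)\<leftarrow>es. \<theta> (map \<sigma> vs @ [t]))) * K \<sigma>) =
          z * star_weight \<beta> cs t * field_avg \<beta> ys g"
  using assms
proof (induction es cs arbitrary: K z rule: list_all2_induct)
  case Nil
  then show ?case by (simp add: star_weight_def)
next
  case (Cons e es d cs)
  obtain \<theta> vs c where e: "e = (\<theta>, vs)" "d = (\<theta>, c)" and len: "length vs = length c"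
    using Cons.hyps by (cases e; cases d) auto
  define K' where "K' \<sigma> = exp (\<beta> * \<theta> (map \<sigma> vs @ [t])) * K \<sigma>" for \<sigma>
  have "conf_avg N (\<lambda>\<sigma>. g (map \<sigma> (concat (map snd es) @ us)) * K' \<sigma>) =
      z * edge_weight \<beta> d t * field_avg \<beta> (concat (map snd cs) @ ys) g" for g
  proof -
    let ?k = "length c"
    let ?g = "\<lambda>ss. exp (\<beta> * \<theta> (take ?k ss @ [t])) * g (drop ?k ss)"
    have "conf_avg N (\<lambda>\<sigma>. g (map \<sigma> (concat (map snd es) @ us)) * K' \<sigma>)
        = conf_avg N (\<lambda>\<sigma>. ?g (map \<sigma> (concat (map snd (e # es)) @ us)) * K \<sigma>)"
      by (rule conf_avg_cong) (simp add: K'_def e len take_map[symmetric] drop_map[symmetric])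
    also have "\<dots> = z * field_avg \<beta> (c @ (concat (map snd cs) @ ys)) ?g"
      by (subst Cons.prems) (simp add: e)
    also have "field_avg \<beta> (c @ (concat (map snd cs) @ ys)) ?g =
        field_avg \<beta> c (\<lambda>a. exp (\<beta> * \<theta> (a @ [t])) * field_avg \<beta> (concat (map snd cs) @ ys) g)"
      unfolding field_avg_append[of \<beta> c] by (rule field_avg_cong) (simp add: field_avg_cmult)
    also have "\<dots> = edge_weight \<beta> d t * field_avg \<beta> (concat (map snd cs) @ ys) g"
      by (simp add: field_avg_multc edge_weight_def e)
    finally show ?thesis by simp
  qed
  from Cons.IH[of K', OF this] show ?case
    by (simp add: K'_def e star_weight_def algebra_simps exp_add)
qed

text \<open>The step of message passing: joining a new site to independent spins gives it the message of
  its edges as effective field, and leaves it independent of the other sites \<open>us\<close>, whose fields do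
  not change. In the induction on trees \<open>us\<close> are the sites whose fields are still to be found.\<close>

lemma attach_star:
  assumes \<beta>: "\<beta> \<noteq> 0"
    and match: "list_all2 (\<lambda>(\<theta>, vs) (\<theta>', c). \<theta> = \<theta>' \<and> length vs = length c) es cs"
    and fac: "factorizes \<beta> N H (concat (map snd es) @ us) (concat (map snd cs) @ ys)"
    and len: "length us = length ys"
    and supp: "supported N H"
    and vs: "set (concat (map snd es)) \<subseteq> {1..N}" and us: "set us \<subseteq> {1..N}"
  shows "partition_fn \<beta> (Suc N) (star_energy (Suc N) es + H) = partition_fn \<beta> N H * spin_avg (star_weight \<beta> cs)"
    and "factorizes \<beta> (Suc N) (star_energy (Suc N) es + H) (Suc N # us) (message \<beta> cs # ys)"
proof -
  have norm: "\<forall>y\<in>set ys. normalized \<beta> y" using fac by (auto simp: factorizes_def)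
  have main: "conf_avg (Suc N) (\<lambda>\<sigma>. g (map \<sigma> (Suc N # us)) * exp (\<beta> * (star_energy (Suc N) es + H) \<sigma>))
     = partition_fn \<beta> N H * spin_avg (star_weight \<beta> cs) * field_avg \<beta> (message \<beta> cs # ys) g" for g
  proof -
    have mp: "map (\<sigma>(Suc N := t)) ws = map \<sigma> ws" if "set ws \<subseteq> {1..N}" for \<sigma> :: "nat \<Rightarrow> spin" and t ws
      using that by (intro map_cong) auto
    have en: "star_energy (Suc N) es (\<sigma>(Suc N := t)) = (\<Sum>(\<theta>, vs)\<leftarrow>es. \<theta> (map \<sigma> vs @ [t]))" for \<sigma> t
      unfolding star_energy_def
    proof (intro arg_cong[where f=sum_list] map_cong refl, clarify)
      fix \<theta> ws assume "(\<theta>, ws) \<in> set es"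
      then have "set ws \<subseteq> {1..N}" using vs by fastforce
      then show "\<theta> (map (\<sigma>(Suc N := t)) ws @ [(\<sigma>(Suc N := t)) (Suc N)]) = \<theta> (map \<sigma> ws @ [t])"
        by (simp only: mp) simp
    qed
    have H: "H (\<sigma>(Suc N := t)) = H \<sigma>" for \<sigma> t
    proof -
      have "\<forall>i\<in>{1..N}. (\<sigma>(Suc N := t)) i = \<sigma> i" by auto
      then show ?thesis using supp unfolding supported_def by blast
    qed
    have "conf_avg N (\<lambda>\<sigma>. g (map (\<sigma>(Suc N := t)) (Suc N # us)) * exp (\<beta> * (star_energy (Suc N) es + H) (\<sigma>(Suc N := t))))
       = partition_fn \<beta> N H * star_weight \<beta> cs t * field_avg \<beta> ys (\<lambda>b. g (t # b))" for t
    proof -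
      have "conf_avg N (\<lambda>\<sigma>. g (map (\<sigma>(Suc N := t)) (Suc N # us)) * exp (\<beta> * (star_energy (Suc N) es + H) (\<sigma>(Suc N := t))))
        = conf_avg N (\<lambda>\<sigma>. g (t # map \<sigma> us) * exp (\<beta> * (\<Sum>(\<theta>, vs)\<leftarrow>es. \<theta> (map \<sigma> vs @ [t]))) * exp (\<beta> * H \<sigma>))"
        by (rule conf_avg_cong) (simp add: mp[OF us] en H algebra_simps exp_add del: fun_upd_apply, simp)
      also have "\<dots> = partition_fn \<beta> N H * star_weight \<beta> cs t * field_avg \<beta> ys (\<lambda>b. g (t # b))"
        by (rule integrate_out_edges[OF match, where g="\<lambda>b. g (t # b)"])
           (use fac in \<open>simp add: factorizes_def\<close>)
      finally show ?thesis .
    qed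
    then have "conf_avg (Suc N) (\<lambda>\<sigma>. g (map \<sigma> (Suc N # us)) * exp (\<beta> * (star_energy (Suc N) es + H) \<sigma>)) =
      spin_avg (\<lambda>t. partition_fn \<beta> N H * star_weight \<beta> cs t * field_avg \<beta> ys (\<lambda>b. g (t # b)))"
      by (simp only: conf_avg_Suc)
    also have "\<dots> = spin_avg (\<lambda>t. partition_fn \<beta> N H * spin_avg (star_weight \<beta> cs) *
        (exp (\<beta> * apply_bcontfun (message \<beta> cs) t) * field_avg \<beta> ys (\<lambda>b. g (t # b))))"
      using spin_avg_star_weight_pos[of \<beta> cs] by (simp add: exp_message[OF \<beta>] mult.assoc)
    finally show ?thesis by (simp add: spin_avg_cmult)
  qed
  have one: "field_avg \<beta> (message \<beta> cs # ys) (\<lambda>_. 1) = 1"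
    by (rule field_avg_const) (use norm normalized_message[OF \<beta>] in auto)
  show Z: "partition_fn \<beta> (Suc N) (star_energy (Suc N) es + H) = partition_fn \<beta> N H * spin_avg (star_weight \<beta> cs)"
    using main[of "\<lambda>_. 1"] unfolding one by (simp add: partition_fn_def)
  show "factorizes \<beta> (Suc N) (star_energy (Suc N) es + H) (Suc N # us) (message \<beta> cs # ys)"
    unfolding factorizes_def Z using main norm normalized_message[OF \<beta>] len by auto
qed

definition edges_energy :: "((spin list \<Rightarrow> real) \<times> nat list) list \<Rightarrow> energy" where
  "edges_energy es \<sigma> = (\<Sum>(\<theta>, vs)\<leftarrow>es. \<theta> (map \<sigma> vs))"

text \<open>The weight of an edge all of whose sites carry fields; in \<open>edge_weight\<close> one of them is left out.\<close>

definition free_edge_weight :: "real \<Rightarrow> (spin list \<Rightarrow> real) \<times> field list \<Rightarrow> real" where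
  "free_edge_weight \<beta> e = field_avg \<beta> (snd e) (\<lambda>ss. exp (\<beta> * fst e ss))"

text \<open>Edges added to independent spins at distinct sites change the partition function by
  independent factors.\<close>

lemma attach_edges:
  assumes match: "list_all2 (\<lambda>(\<theta>, vs) (\<theta>', c). \<theta> = \<theta>' \<and> length vs = length c) es cs"
    and fac: "factorizes \<beta> N H (concat (map snd es)) (concat (map snd cs))"
  shows "partition_fn \<beta> N (edges_energy es + H) = partition_fn \<beta> N H * (\<Prod>e\<leftarrow>cs. free_edge_weight \<beta> e)"
proof -
  \<comment> \<open>A dummy last argument turns the edges into the edges of a star.\<close>
  define t where "t = (undefined :: spin)"
  define es' where "es' = map (\<lambda>(\<theta>, vs). (\<lambda>ss. \<theta> (butlast ss), vs :: nat list)) es"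
  define cs' where "cs' = map (\<lambda>(\<theta>, c). (\<lambda>ss. \<theta> (butlast ss), c :: field list)) cs"
  have m: "list_all2 (\<lambda>(\<theta>, vs) (\<theta>', c). \<theta> = \<theta>' \<and> length vs = length c) es' cs'"
    unfolding es'_def cs'_def list_all2_map1 list_all2_map2
    by (rule list_all2_mono[OF match]) auto
  have s: "map snd es' = map snd es" "map snd cs' = map snd cs"
    by (auto simp: es'_def cs'_def)
  have "conf_avg N (\<lambda>\<sigma>. 1 * exp (\<beta> * (\<Sum>(\<theta>, vs)\<leftarrow>es'. \<theta> (map \<sigma> vs @ [t]))) * exp (\<beta> * H \<sigma>)) =
          partition_fn \<beta> N H * star_weight \<beta> cs' t * field_avg \<beta> [] (\<lambda>_. 1)"
    by (rule integrate_out_edges[OF m, where us="[]"]) (use fac in \<open>simp add: factorizes_def s\<close>)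
  moreover have "(\<Sum>(\<theta>, vs)\<leftarrow>es'. \<theta> (map \<sigma> vs @ [t])) = edges_energy es \<sigma>" for \<sigma>
    unfolding es'_def edges_energy_def by (induction es) auto
  moreover have "star_weight \<beta> cs' t = (\<Prod>e\<leftarrow>cs. free_edge_weight \<beta> e)"
    unfolding cs'_def star_weight_def free_edge_weight_def edge_weight_def by (induction cs) auto
  ultimately show ?thesis by (simp add: partition_fn_def algebra_simps exp_add)
qed

lemma partition_fn_permute:
  assumes "\<pi> permutes {1..N}"
  shows "partition_fn \<beta> N (\<lambda>\<sigma>. H (\<sigma> \<circ> \<pi>)) = partition_fn \<beta> N H"
  unfolding partition_fn_def using conf_avg_permute[OF assms, of "\<lambda>\<sigma>. exp (\<beta> * H \<sigma>)"] by simp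

lemma factorizes_permute:
  assumes "\<pi> permutes {1..N}" "factorizes \<beta> N H vs xs"
  shows "factorizes \<beta> N (\<lambda>\<sigma>. H (\<sigma> \<circ> \<pi>)) (map \<pi> vs) xs"
  unfolding factorizes_def partition_fn_permute[OF assms(1)]
proof (intro conjI allI)
  fix g
  have "conf_avg N (\<lambda>\<sigma>. g (map \<sigma> (map \<pi> vs)) * exp (\<beta> * H (\<sigma> \<circ> \<pi>))) =
     conf_avg N (\<lambda>\<sigma>. g (map \<sigma> vs) * exp (\<beta> * H \<sigma>))"
    using conf_avg_permute[OF assms(1), of "\<lambda>\<sigma>. g (map \<sigma> vs) * exp (\<beta> * H \<sigma>)"] by (simp add: o_def)
  then show "conf_avg N (\<lambda>\<sigma>. g (map \<sigma> (map \<pi> vs)) * exp (\<beta> * H (\<sigma> \<circ> \<pi>))) = partition_fn \<beta> N H * field_avg \<beta> xs g"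
    using assms(2) by (simp add: factorizes_def)
qed (use assms(2) in \<open>auto simp: factorizes_def\<close>)

text \<open>The log-partition function is Lipschitz in the energy; this supplies the dominating functions
  and the bounded differences below.\<close>

lemma ln_partition_fn_diff:
  assumes "\<And>\<sigma>. \<sigma> \<in> {1..N} \<rightarrow>\<^sub>E UNIV \<Longrightarrow> \<bar>K \<sigma> - H \<sigma>\<bar> \<le> B" "\<beta> \<ge> 0"
  shows "\<bar>ln (partition_fn \<beta> N K) - ln (partition_fn \<beta> N H)\<bar> \<le> \<beta> * B"
proof -
  have *: "ln (partition_fn \<beta> N K) \<le> \<beta> * B + ln (partition_fn \<beta> N H)"
    if "\<And>\<sigma>. \<sigma> \<in> {1..N} \<rightarrow>\<^sub>E UNIV \<Longrightarrow> \<bar>K \<sigma> - H \<sigma>\<bar> \<le> B" for K H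
  proof -
    have "partition_fn \<beta> N K \<le> conf_avg N (\<lambda>\<sigma>. exp (\<beta> * B) * exp (\<beta> * H \<sigma>))"
      unfolding partition_fn_def
    proof (rule conf_avg_mono)
      fix \<sigma> assume "\<sigma> \<in> {1..N} \<rightarrow>\<^sub>E (UNIV :: spin set)"
      then have "K \<sigma> \<le> B + H \<sigma>" using that by fastforce
      then have "\<beta> * K \<sigma> \<le> \<beta> * (B + H \<sigma>)" using assms(2) by (rule mult_left_mono)
      then show "exp (\<beta> * K \<sigma>) \<le> exp (\<beta> * B) * exp (\<beta> * H \<sigma>)"
        by (simp add: exp_add[symmetric] algebra_simps)
    qed
    also have "\<dots> = exp (\<beta> * B) * partition_fn \<beta> N H"
      by (simp add: conf_avg_cmult partition_fn_def)
    finally have "ln (partition_fn \<beta> N K) \<le> ln (exp (\<beta> * B) * partition_fn \<beta> N H)"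
      using partition_fn_pos by (subst ln_le_cancel_iff) auto
    also have "\<dots> = \<beta> * B + ln (partition_fn \<beta> N H)"
      using partition_fn_pos[of \<beta> N H] by (simp add: ln_mult)
    finally show ?thesis .
  qed
  have "ln (partition_fn \<beta> N K) \<le> \<beta> * B + ln (partition_fn \<beta> N H)"
    by (rule *) (rule assms(1))
  moreover have "ln (partition_fn \<beta> N H) \<le> \<beta> * B + ln (partition_fn \<beta> N K)"
    by (rule *) (use assms(1) in \<open>simp add: abs_minus_commute\<close>)
  ultimately show ?thesis by linarith
qed

section \<open>The random hypergraph and its symmetries\<close>

definition tuples :: "nat \<Rightarrow> nat set \<Rightarrow> nat list set" where
  "tuples k V = {vs. length vs = k \<and> distinct vs \<and> set vs \<subseteq> V}"

definition edge_law :: "nat \<Rightarrow> (spin list \<Rightarrow> real) pmf \<Rightarrow> nat \<Rightarrow> energy pmf" where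
  "edge_law p \<Theta> N = map_pmf (\<lambda>(\<theta>, vs) \<sigma>. \<theta> (map \<sigma> vs)) (pair_pmf \<Theta> (pmf_of_set (tuples p {1..N})))"

definition star_edge_law :: "nat \<Rightarrow> (spin list \<Rightarrow> real) pmf \<Rightarrow> nat \<Rightarrow> energy pmf" where
  "star_edge_law p \<Theta> N = map_pmf (\<lambda>(\<theta>, vs) \<sigma>. \<theta> (map \<sigma> vs @ [\<sigma> (Suc N)]))
     (pair_pmf \<Theta> (pmf_of_set (tuples (p - 1) {1..N})))"

text \<open>Represented by its energy function, a hypergraph with Poisson many edges is a sum of
  independent elements of a commutative monoid, hence a compound Poisson variable.\<close>

definition graph_law :: "nat \<Rightarrow> (spin list \<Rightarrow> real) pmf \<Rightarrow> nat \<Rightarrow> real \<Rightarrow> energy pmf" where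
  "graph_law p \<Theta> N s = compound_poisson s (edge_law p \<Theta> N)"

lemma finite_tuples [simp]: "finite V \<Longrightarrow> finite (tuples k V)"
  using finite_lists_length_eq[of V k] by (rule finite_subset[rotated]) (auto simp: tuples_def)

lemma card_tuples:
  assumes "finite V"
  shows "real (card (tuples k V)) = (\<Prod>i<k. real (card V - i))"
proof (cases "k \<le> card V")
  case True
  have "card (tuples k V) = \<Prod>{card V - k + 1..card V}"
    unfolding tuples_def by (rule card_lists_distinct_length_eq[OF assms True])
  also have "\<dots> = (\<Prod>i<k. card V - i)"
    by (rule prod.reindex_bij_witness[where i="\<lambda>i. card V - i" and j="\<lambda>i. card V - i"])
       (use True in auto)
  finally show ?thesis by simp
next
  case False
  have "tuples k V = {}"
  proof (rule ccontr)
    assume "tuples k V \<noteq> {}"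
    then obtain vs where vs: "length vs = k" "distinct vs" "set vs \<subseteq> V" by (auto simp: tuples_def)
    then have "k = card (set vs)" by (simp add: distinct_card)
    then show False using card_mono[OF assms vs(3)] False by simp
  qed
  moreover have "(\<Prod>i<k. real (card V - i)) = 0"
    using False by (intro prod_zero) (auto intro!: bexI[of _ "card V"])
  ultimately show ?thesis by simp
qed

lemma tuples_nonempty: "finite V \<Longrightarrow> k \<le> card V \<Longrightarrow> tuples k V \<noteq> {}"
proof -
  assume a: "finite V" "k \<le> card V"
  have "(\<Prod>i<k. real (card V - i)) > 0" using a by (intro prod_pos) auto
  then have "real (card (tuples k V)) > 0" using card_tuples[OF a(1), of k] by simp
  then show "tuples k V \<noteq> {}" by auto
qed

lemma set_pmf_tuples: "k \<le> N \<Longrightarrow> set_pmf (pmf_of_set (tuples k {1..N})) = tuples k {1..N}"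
  using tuples_nonempty[of "{1..N}" k] by (simp add: set_pmf_of_set)

lemma sum_list_fun_apply: "sum_list fs x = (\<Sum>f\<leftarrow>fs. f x)"
  by (induction fs) (simp_all add: zero_fun_def plus_fun_def)

lemma edge_law_permute:
  assumes \<pi>: "\<pi> permutes {1..N}" and N: "p \<le> N"
  shows "map_pmf (\<lambda>H \<sigma>. H (\<sigma> \<circ> \<pi>)) (edge_law p \<Theta> N) = edge_law p \<Theta> N"
proof -
  let ?T = "tuples p {1..N}"
  have T: "?T \<noteq> {}" using N tuples_nonempty[of "{1..N}" p] by simp
  have inj: "inj_on (map \<pi>) ?T"
    using permutes_inj[OF \<pi>] by (auto intro: inj_on_subset[OF inj_mapI])
  have "map \<pi> ` ?T \<subseteq> ?T"
  proof (clarsimp simp: tuples_def distinct_map)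
    fix xs :: "nat list" assume xs: "set xs \<subseteq> {Suc 0..N}"
    have "inj_on \<pi> (set xs)" by (rule inj_on_subset[OF permutes_inj[OF \<pi>] subset_UNIV])
    moreover have "\<pi> ` set xs \<subseteq> {Suc 0..N}"
      using image_mono[OF xs, of \<pi>] permutes_image[OF \<pi>] unfolding One_nat_def by (rule ord_le_eq_trans)
    ultimately show "inj_on \<pi> (set xs) \<and> \<pi> ` set xs \<subseteq> {Suc 0..N}" ..
  qed
  then have im: "map \<pi> ` ?T = ?T" using inj by (intro card_subset_eq) (auto simp: card_image)
  have "map_pmf (map \<pi>) (pmf_of_set ?T) = pmf_of_set ?T"
    using map_pmf_of_set_inj[OF inj T] im by simp
  then have "edge_law p \<Theta> N = map_pmf (\<lambda>(\<theta>, vs) \<sigma>. \<theta> (map \<sigma> vs)) (pair_pmf \<Theta> (map_pmf (map \<pi>) (pmf_of_set ?T)))"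
    by (simp add: edge_law_def)
  also have "\<dots> = map_pmf (\<lambda>H \<sigma>. H (\<sigma> \<circ> \<pi>)) (edge_law p \<Theta> N)"
    unfolding edge_law_def pair_map_pmf2 pmf.map_comp by (intro map_pmf_cong refl) auto
  finally show ?thesis by simp
qed

lemma graph_law_permute:
  assumes \<pi>: "\<pi> permutes {1..N}" and N: "p \<le> N"
  shows "map_pmf (\<lambda>H \<sigma>. H (\<sigma> \<circ> \<pi>)) (graph_law p \<Theta> N s) = graph_law p \<Theta> N s"
  unfolding graph_law_def
  by (subst map_compound_poisson) (simp_all add: zero_fun_def plus_fun_def edge_law_permute[OF assms])

text \<open>Distinct sites are exchangeable: one tuple of them can be relabelled into any other.\<close>

lemma ex_permutes_map:
  assumes "finite A" "distinct vs" "distinct ws" "length vs = length ws" "set vs \<subseteq> A" "set ws \<subseteq> A"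
  shows "\<exists>\<pi>. \<pi> permutes A \<and> map \<pi> vs = ws"
proof -
  have "card (set vs) = card (set ws)" using assms by (simp add: distinct_card)
  then have "card (A - set vs) = card (A - set ws)"
    using assms by (simp add: card_Diff_subset)
  then obtain g where g: "bij_betw g (A - set vs) (A - set ws)"
    using assms(1) by (meson finite_Diff finite_same_card_bij)
  define f where "f v = the (map_of (zip vs ws) v)" for v
  have fm: "map f vs = ws"
    using assms(2,4) by (intro nth_equalityI) (auto simp: f_def map_of_zip_nth)
  have f: "bij_betw f (set vs) (set ws)"
  proof -
    have "f ` set vs = set ws" using fm by (metis set_map)
    moreover have "inj_on f (set vs)"
      using fm assms(3) by (metis distinct_map)
    ultimately show ?thesis by (simp add: bij_betw_def)
  qed
  define \<pi> where "\<pi> v = (if v \<in> set vs then f v else if v \<in> A then g v else v)" for v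
  have "bij_betw \<pi> (set vs) (set ws)" using f by (subst bij_betw_cong[of _ _ f]) (auto simp: \<pi>_def)
  moreover have "bij_betw \<pi> (A - set vs) (A - set ws)"
    using g by (subst bij_betw_cong[of _ _ g]) (auto simp: \<pi>_def)
  ultimately have "bij_betw \<pi> (set vs \<union> (A - set vs)) (set ws \<union> (A - set ws))"
    by (rule bij_betw_combine) auto
  then have "bij_betw \<pi> A A" using assms(5,6) by (simp add: Un_absorb1)
  then have "\<pi> permutes A" by (rule bij_imp_permutes) (use assms(5) in \<open>auto simp: \<pi>_def\<close>)
  moreover have "map \<pi> vs = ws" using fm by (auto simp: \<pi>_def cong: map_cong)
  ultimately show ?thesis by blast
qed

definition factor_prob :: "nat \<Rightarrow> (spin list \<Rightarrow> real) pmf \<Rightarrow> real \<Rightarrow> nat \<Rightarrow> real \<Rightarrow> nat list \<Rightarrow> field list \<Rightarrow> real" where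
  "factor_prob p \<Theta> \<beta> N s vs xs = measure_pmf.prob (graph_law p \<Theta> N s) {H. factorizes \<beta> N H vs xs}"

text \<open>The hypergraph law is invariant under relabelling, so that only the number of sites matters.\<close>

lemma factor_prob_permute:
  assumes "p \<le> N" "distinct vs" "distinct ws" "length vs = length ws" "set vs \<subseteq> {1..N}" "set ws \<subseteq> {1..N}"
  shows "factor_prob p \<Theta> \<beta> N s vs xs = factor_prob p \<Theta> \<beta> N s ws xs"
proof -
  have le: "factor_prob p \<Theta> \<beta> N s vs xs \<le> factor_prob p \<Theta> \<beta> N s ws xs"
    if a: "distinct vs" "distinct ws" "length vs = length ws" "set vs \<subseteq> {1..N}" "set ws \<subseteq> {1..N}" for vs ws
  proof -
    obtain \<pi> where \<pi>: "\<pi> permutes {1..N}" "map \<pi> vs = ws"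
      using ex_permutes_map[of "{1..N}" vs ws] a by auto
    have "factor_prob p \<Theta> \<beta> N s ws xs =
       measure_pmf.prob (map_pmf (\<lambda>H \<sigma>. H (\<sigma> \<circ> \<pi>)) (graph_law p \<Theta> N s)) {H. factorizes \<beta> N H ws xs}"
      using graph_law_permute[OF \<pi>(1) assms(1)] by (simp add: factor_prob_def)
    also have "\<dots> \<ge> factor_prob p \<Theta> \<beta> N s vs xs"
      unfolding factor_prob_def measure_map_pmf
      using factorizes_permute[OF \<pi>(1)] \<pi>(2) by (intro measure_pmf.finite_measure_mono) auto
    finally show ?thesis .
  qed
  show ?thesis using le[of vs ws] le[of ws vs] assms by fastforce
qed

lemma supported_sum_list: "(\<And>H. H \<in> set Hs \<Longrightarrow> supported N H) \<Longrightarrow> supported N (sum_list Hs)"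
proof (induction Hs)
  case Nil
  then show ?case by (simp add: supported_def zero_fun_def)
next
  case (Cons H Hs)
  then have "supported N H" "supported N (sum_list Hs)" by auto
  then show ?case unfolding supported_def by (metis plus_fun_apply sum_list.Cons)
qed

lemma supported_graph_law:
  assumes "p \<le> N" "H \<in> set_pmf (graph_law p \<Theta> N s)"
  shows "supported N H"
proof -
  obtain Hs where Hs: "Hs \<in> set_pmf (poisson_list s (edge_law p \<Theta> N))" "H = sum_list Hs"
    using assms(2) by (auto simp: graph_law_def compound_poisson_def)
  show ?thesis unfolding Hs(2)
  proof (rule supported_sum_list)
    fix h assume "h \<in> set Hs"
    then have "h \<in> set_pmf (edge_law p \<Theta> N)" using set_poisson_list[OF Hs(1)] by auto
    then obtain \<theta> vs where h: "h = (\<lambda>\<sigma>. \<theta> (map \<sigma> vs))" and vs: "set vs \<subseteq> {1..N}"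
      using set_pmf_tuples[OF assms(1)] by (auto simp: edge_law_def tuples_def)
    show "supported N h" unfolding supported_def h
    proof (intro allI impI)
      fix \<sigma> \<tau> :: "nat \<Rightarrow> spin" assume "\<forall>i\<in>{1..N}. \<sigma> i = \<tau> i"
      then have "map \<sigma> vs = map \<tau> vs" using vs by (intro map_cong) auto
      then show "\<theta> (map \<sigma> vs) = \<theta> (map \<tau> vs)" by (rule arg_cong)
    qed
  qed
qed

section \<open>Removing a site and adding edges\<close>

lemma pmf_of_set_disjoint_union:
  assumes "finite A" "finite B" "A \<noteq> {}" "B \<noteq> {}" "A \<inter> B = {}"
  shows "pmf_of_set (A \<union> B) = bind_pmf (bernoulli_pmf (real (card A) / real (card (A \<union> B))))
      (\<lambda>b. if b then pmf_of_set A else pmf_of_set B)"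
proof (rule pmf_eqI)
  fix x
  have c: "card (A \<union> B) = card A + card B" using assms by (simp add: card_Un_disjoint)
  have pos: "card A > 0" "card B > 0" using assms by auto
  let ?u = "real (card A) / real (card (A \<union> B))"
  have u: "0 \<le> ?u" "?u \<le> 1" using pos by (auto simp: c)
  have "pmf (bind_pmf (bernoulli_pmf ?u) (\<lambda>b. if b then pmf_of_set A else pmf_of_set B)) x =
      ?u * pmf (pmf_of_set A) x + (1 - ?u) * pmf (pmf_of_set B) x"
    unfolding pmf_bind using u by (subst integral_bernoulli_pmf) auto
  also have "1 - ?u = real (card B) / real (card (A \<union> B))"
    using pos by (simp add: c field_simps)
  also have "?u * pmf (pmf_of_set A) x + real (card B) / real (card (A \<union> B)) * pmf (pmf_of_set B) x
      = pmf (pmf_of_set (A \<union> B)) x"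
    using assms pos by (auto simp: indicator_def)
  finally show "pmf (pmf_of_set (A \<union> B)) x =
      pmf (bind_pmf (bernoulli_pmf ?u) (\<lambda>b. if b then pmf_of_set A else pmf_of_set B)) x" by simp
qed

lemma pmf_of_set_Times:
  assumes "finite A" "finite B" "A \<noteq> {}" "B \<noteq> {}"
  shows "pmf_of_set (A \<times> B) = pair_pmf (pmf_of_set A) (pmf_of_set B)"
proof (rule pmf_eqI, clarify)
  fix a b
  show "pmf (pmf_of_set (A \<times> B)) (a, b) = pmf (pair_pmf (pmf_of_set A) (pmf_of_set B)) (a, b)"
    using assms by (simp add: pmf_pair card_cartesian_product indicator_def)
qed

text \<open>The transposition puts the new vertex \<open>v\<close> at position \<open>j\<close>. Being an involution, it also
  undoes this.\<close>

definition insert_last :: "nat \<Rightarrow> nat \<Rightarrow> nat \<times> nat list \<Rightarrow> nat list" where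
  "insert_last p v = (\<lambda>(j, vs). permute_list (Transposition.transpose j (p - 1)) (vs @ [v]))"

text \<open>A tuple on \<open>{1..Suc N}\<close> either avoids \<open>Suc N\<close> or is determined by the position of \<open>Suc N\<close> and
  the remaining entries.\<close>

lemma tuples_Suc:
  assumes p: "p \<ge> 1"
  shows "tuples p {1..Suc N} = insert_last p (Suc N) ` ({..<p} \<times> tuples (p - 1) {1..N}) \<union> tuples p {1..N}"
    and "insert_last p (Suc N) ` ({..<p} \<times> tuples (p - 1) {1..N}) \<inter> tuples p {1..N} = {}"
    and "inj_on (insert_last p (Suc N)) ({..<p} \<times> tuples (p - 1) {1..N})"
proof -
  have perm: "Transposition.transpose j (p - 1) permutes {..<p}" if "j < p" for j
    using that p by (intro permutes_swap_id) auto
  have nth: "insert_last p (Suc N) (j, vs) ! i = Suc N \<longleftrightarrow> i = j"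
    if "j < p" "vs \<in> tuples (p - 1) {1..N}" "i < p" for i j vs
  proof -
    have len: "length (vs @ [Suc N]) = p" using that p by (auto simp: tuples_def)
    have "insert_last p (Suc N) (j, vs) ! i = (vs @ [Suc N]) ! (Transposition.transpose j (p - 1) i)"
      using perm[OF that(1)] that(3) len by (simp add: insert_last_def permute_list_nth)
    moreover have "(vs @ [Suc N]) ! l = Suc N \<longleftrightarrow> l = p - 1" if "l < p" for l
    proof (cases "l = p - 1")
      case True
      then show ?thesis using len by (auto simp: nth_append)
    next
      case False
      then have l: "l < length vs" using that len by auto
      have "set vs \<subseteq> {1..N}" using \<open>vs \<in> _\<close> by (simp add: tuples_def)
      then have "vs ! l \<in> {1..N}" using nth_mem[OF l] by blast
      then show ?thesis using l False by (auto simp: nth_append)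
    qed
    moreover have "Transposition.transpose j (p - 1) i < p" using that p by (auto simp: Transposition.transpose_def)
    moreover have "Transposition.transpose j (p - 1) i = p - 1 \<longleftrightarrow> i = j"
      by (metis Transposition.transpose_apply_second Transposition.transpose_involutory)
    ultimately show ?thesis by simp
  qed
  have inv: "permute_list (Transposition.transpose j (p - 1)) (permute_list (Transposition.transpose j (p - 1)) xs) = xs"
    if "j < p" "length xs = p" for j and xs :: "nat list"
    using permute_list_compose[of "Transposition.transpose j (p - 1)" xs "Transposition.transpose j (p - 1)"] perm[OF that(1)] that(2)
    by (simp)
  have in_t: "insert_last p (Suc N) (j, vs) \<in> tuples p {1..Suc N}"
    if "j < p" "vs \<in> tuples (p - 1) {1..N}" for j vs
  proof -
    have vs: "length vs = p - 1" "distinct vs" "set vs \<subseteq> {1..N}" using that by (simp_all add: tuples_def)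
    have len: "length (vs @ [Suc N]) = p" using vs p by simp
    have d: "distinct (vs @ [Suc N])" using vs by fastforce
    have s: "set (vs @ [Suc N]) \<subseteq> {1..Suc N}" using vs by fastforce
    have perm': "Transposition.transpose j (p - 1) permutes {..<length (vs @ [Suc N])}"
      unfolding len by (rule perm[OF that(1)])
    show ?thesis
      unfolding tuples_def insert_last_def prod.case mem_Collect_eq length_permute_list
        distinct_permute_list[OF perm'] set_permute_list[OF perm']
      by (intro conjI len d s)
  qed
  show inj: "inj_on (insert_last p (Suc N)) ({..<p} \<times> tuples (p - 1) {1..N})"
  proof (rule inj_onI, clarify)
    fix j vs j' vs'
    assume a: "j < p" "j' < p" "vs \<in> tuples (p - 1) {1..N}" "vs' \<in> tuples (p - 1) {1..N}"
      and eq: "insert_last p (Suc N) (j, vs) = insert_last p (Suc N) (j', vs')"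
    have j: "j = j'" using nth[of j vs j] nth[of j' vs' j] a eq by simp
    moreover have "vs @ [Suc N] = vs' @ [Suc N]"
    proof -
      have l: "length (vs @ [Suc N]) = p" "length (vs' @ [Suc N]) = p"
        using a p by (simp_all add: tuples_def)
      have "permute_list (Transposition.transpose j (p - 1)) (vs @ [Suc N]) =
          permute_list (Transposition.transpose j (p - 1)) (vs' @ [Suc N])"
        using eq unfolding insert_last_def prod.case j .
      then show ?thesis using inv[OF a(1) l(1)] inv[OF a(1) l(2)] by (metis (no_types))
    qed
    ultimately show "j = j' \<and> vs = vs'" by simp
  qed
  show "insert_last p (Suc N) ` ({..<p} \<times> tuples (p - 1) {1..N}) \<inter> tuples p {1..N} = {}"
  proof safe
    fix j vs assume a: "j < p" "vs \<in> tuples (p - 1) {1..N}" "insert_last p (Suc N) (j, vs) \<in> tuples p {1..N}"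
    then have "j < length (insert_last p (Suc N) (j, vs))" "set (insert_last p (Suc N) (j, vs)) \<subseteq> {1..N}"
      by (simp_all add: tuples_def)
    then have "insert_last p (Suc N) (j, vs) ! j \<in> {1..N}"
      using nth_mem by blast
    then show "insert_last p (Suc N) (j, vs) \<in> {}" using nth[of j vs j] a by simp
  qed
  show "tuples p {1..Suc N} = insert_last p (Suc N) ` ({..<p} \<times> tuples (p - 1) {1..N}) \<union> tuples p {1..N}"
  proof (intro equalityI subsetI)
    fix ws assume ws: "ws \<in> tuples p {1..Suc N}"
    show "ws \<in> insert_last p (Suc N) ` ({..<p} \<times> tuples (p - 1) {1..N}) \<union> tuples p {1..N}"
    proof (cases "Suc N \<in> set ws")
      case False
      then show ?thesis using ws by (fastforce simp: tuples_def le_Suc_eq)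
    next
      case True
      then obtain j where j: "j < p" "ws ! j = Suc N"
        using ws by (auto simp: in_set_conv_nth tuples_def)
      define us where "us = permute_list (Transposition.transpose j (p - 1)) ws"
      have perm': "Transposition.transpose j (p - 1) permutes {..<length ws}" using perm[OF j(1)] ws by (auto simp: tuples_def)
      have us: "length us = p" "distinct us" "set us \<subseteq> {1..Suc N}"
        using ws perm' unfolding us_def tuples_def by auto
      have ne: "us \<noteq> []" using us p by auto
      have "last us = us ! (p - 1)" using us ne by (simp add: last_conv_nth)
      also have "\<dots> = ws ! (Transposition.transpose j (p - 1) (p - 1))"
        unfolding us_def using perm' p ws by (subst permute_list_nth) (auto simp: tuples_def)
      finally have last: "last us = Suc N" using j by simp
      then have eq: "us = butlast us @ [Suc N]" using ne by (metis append_butlast_last_id)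
      then have "distinct (butlast us @ [Suc N])" using us by simp
      moreover have "set (butlast us) \<subseteq> {1..Suc N}" using us(3) by (meson in_set_butlastD subset_iff)
      ultimately have "butlast us \<in> tuples (p - 1) {1..N}"
        using us by (fastforce simp: tuples_def le_Suc_eq)
      moreover have "ws = insert_last p (Suc N) (j, butlast us)"
        unfolding insert_last_def prod.case eq[symmetric] unfolding us_def
        using inv[OF j(1), of ws] ws by (simp add: tuples_def)
      ultimately show ?thesis using j by blast
    qed
  next
    fix ws assume "ws \<in> insert_last p (Suc N) ` ({..<p} \<times> tuples (p - 1) {1..N}) \<union> tuples p {1..N}"
    then show "ws \<in> tuples p {1..Suc N}"
    proof
      assume "ws \<in> insert_last p (Suc N) ` ({..<p} \<times> tuples (p - 1) {1..N})"
      then show ?thesis using in_t by auto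
    next
      assume "ws \<in> tuples p {1..N}"
      then show ?thesis by (force simp: tuples_def)
    qed
  qed
qed

lemma card_tuples_ratio:
  assumes p: "p \<ge> 1" and N: "p \<le> N"
  shows "real (p * card (tuples (p - 1) {1..N})) / real (card (tuples p {1..Suc N})) = real p / real (Suc N)"
proof -
  obtain q where q: "p = Suc q" using p by (cases p) auto
  have "real (card (tuples p {1..Suc N})) = (\<Prod>i<Suc q. real (Suc N - i))"
    by (simp add: card_tuples q)
  also have "\<dots> = real (Suc N) * (\<Prod>i<q. real (N - i))"
    by (subst prod.lessThan_Suc_shift) simp
  also have "(\<Prod>i<q. real (N - i)) = real (card (tuples (p - 1) {1..N}))"
    by (simp add: card_tuples q)
  finally have "real (card (tuples p {1..Suc N})) = real (Suc N) * real (card (tuples (p - 1) {1..N}))" .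
  moreover have "real (card (tuples (p - 1) {1..N})) \<noteq> 0"
    using tuples_nonempty[of "{1..N}" "p - 1"] N by simp
  ultimately show ?thesis
    unfolding of_nat_mult by (simp only: mult_divide_mult_cancel_right) (rule mult_divide_mult_cancel_right)
qed

text \<open>A random edge contains the last site with probability \<open>p/(N + 1)\<close>, and then the site is equally
  likely to be at each position. For exchangeable interactions the position may be taken to be
  the last one.\<close>

lemma edge_law_Suc:
  assumes p: "p \<ge> 1" and N: "p \<le> N" and ex: "exchangeable p \<Theta>"
  shows "edge_law p \<Theta> (Suc N) = bind_pmf (bernoulli_pmf (real p / real (Suc N)))
     (\<lambda>b. if b then star_edge_law p \<Theta> N else edge_law p \<Theta> N)"
proof -
  let ?A = "insert_last p (Suc N) ` ({..<p} \<times> tuples (p - 1) {1..N})" and ?B = "tuples p {1..N}"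
  let ?E = "\<lambda>(\<theta>, vs) (\<sigma> :: nat \<Rightarrow> spin). (\<theta> (map \<sigma> vs) :: real)"
  have ne: "tuples (p - 1) {1..N} \<noteq> {}" "?B \<noteq> {}" "{..<p} \<noteq> {}"
    using p N tuples_nonempty[of "{1..N}"] by (auto simp: lessThan_empty_iff)
  have neA: "?A \<noteq> {}" using ne by auto
  have cA: "card ?A = p * card (tuples (p - 1) {1..N})"
    by (subst card_image[OF tuples_Suc(3)[OF p]]) (simp add: card_cartesian_product)
  have split: "pmf_of_set (tuples p {1..Suc N}) = bind_pmf (bernoulli_pmf (real p / real (Suc N)))
      (\<lambda>b. if b then pmf_of_set ?A else pmf_of_set ?B)"
    unfolding tuples_Suc(1)[OF p]
    using pmf_of_set_disjoint_union[OF _ _ neA ne(2) tuples_Suc(2)[OF p]]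
    unfolding cA tuples_Suc(1)[OF p, symmetric] card_tuples_ratio[OF p N] by simp
  have A: "map_pmf ?E (pair_pmf \<Theta> (pmf_of_set ?A)) = star_edge_law p \<Theta> N"
  proof -
    have "pmf_of_set ?A = map_pmf (insert_last p (Suc N)) (pair_pmf (pmf_of_set {..<p}) (pmf_of_set (tuples (p - 1) {1..N})))"
      using ne by (subst map_pmf_of_set_inj[OF tuples_Suc(3)[OF p], symmetric]) (auto simp: pmf_of_set_Times)
    then have "map_pmf ?E (pair_pmf \<Theta> (pmf_of_set ?A)) =
      bind_pmf (pmf_of_set {..<p}) (\<lambda>j. bind_pmf (pmf_of_set (tuples (p - 1) {1..N})) (\<lambda>vs.
        map_pmf (\<lambda>\<theta>. ?E (\<theta>, insert_last p (Suc N) (j, vs))) \<Theta>))"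
      unfolding pair_pmf_def map_pmf_def
      by (simp add: bind_assoc_pmf bind_return_pmf)
         (subst bind_commute_pmf, intro bind_pmf_cong refl, subst bind_commute_pmf, simp)
    also have "\<dots> = bind_pmf (pmf_of_set {..<p}) (\<lambda>j. bind_pmf (pmf_of_set (tuples (p - 1) {1..N})) (\<lambda>vs.
        map_pmf (\<lambda>\<theta>. ?E (\<theta>, vs @ [Suc N])) \<Theta>))"
    proof (intro bind_pmf_cong refl)
      fix j vs assume j: "j \<in> set_pmf (pmf_of_set {..<p})" and vs: "vs \<in> set_pmf (pmf_of_set (tuples (p - 1) {1..N}))"
      have j: "j < p" using j ne by (simp add: set_pmf_of_set)
      have "vs \<in> tuples (p - 1) {1..N}" using vs ne by (simp add: set_pmf_of_set)
      then have len: "length (vs @ [Suc N]) = p" using p by (auto simp: tuples_def)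
      have perm: "Transposition.transpose j (p - 1) permutes {..<p}" using j p by (intro permutes_swap_id) auto
      have E: "?E (\<theta>, insert_last p (Suc N) (j, vs)) =
          ?E (\<lambda>s. \<theta> (permute_list (Transposition.transpose j (p - 1)) s), vs @ [Suc N])" for \<theta>
        using perm len unfolding insert_last_def prod.case
        by (subst permute_list_map) auto
      \<comment> \<open>Exchangeability moves the new vertex from position \<open>j\<close> to the last one.\<close>
      have "map_pmf (\<lambda>\<theta> s. \<theta> (permute_list (Transposition.transpose j (p - 1)) s)) \<Theta> = \<Theta>"
        using ex perm by (auto simp: exchangeable_def)
      then have "map_pmf (\<lambda>\<theta>. ?E (\<theta>, vs @ [Suc N])) \<Theta> =
        map_pmf (\<lambda>\<theta>. ?E (\<theta>, vs @ [Suc N])) (map_pmf (\<lambda>\<theta> s. \<theta> (permute_list (Transposition.transpose j (p - 1)) s)) \<Theta>)"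
        by simp
      also have "\<dots> = map_pmf (\<lambda>\<theta>. ?E (\<theta>, insert_last p (Suc N) (j, vs))) \<Theta>"
        unfolding pmf.map_comp E by (simp add: o_def)
      finally show "map_pmf (\<lambda>\<theta>. ?E (\<theta>, insert_last p (Suc N) (j, vs))) \<Theta> =
        map_pmf (\<lambda>\<theta>. ?E (\<theta>, vs @ [Suc N])) \<Theta>" by simp
    qed
    also have "\<dots> = star_edge_law p \<Theta> N"
      unfolding star_edge_law_def pair_pmf_def map_pmf_def
      by (simp add: bind_assoc_pmf bind_return_pmf) (subst bind_commute_pmf, simp)
    finally show ?thesis .
  qed
  have "edge_law p \<Theta> (Suc N) = bind_pmf (bernoulli_pmf (real p / real (Suc N)))
      (\<lambda>b. map_pmf ?E (pair_pmf \<Theta> (if b then pmf_of_set ?A else pmf_of_set ?B)))"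
    unfolding edge_law_def split pair_pmf_def map_pmf_def
    by (simp add: bind_assoc_pmf bind_return_pmf) (subst bind_commute_pmf, simp)
  also have "\<dots> = bind_pmf (bernoulli_pmf (real p / real (Suc N)))
     (\<lambda>b. if b then star_edge_law p \<Theta> N else edge_law p \<Theta> N)"
  proof (intro bind_pmf_cong refl)
    fix b
    show "map_pmf ?E (pair_pmf \<Theta> (if b then pmf_of_set ?A else pmf_of_set ?B)) =
      (if b then star_edge_law p \<Theta> N else edge_law p \<Theta> N)"
      by (cases b) (simp_all only: if_True if_False A edge_law_def)
  qed
  finally show ?thesis .
qed

text \<open>For \<open>k = p\<close> these are complete edges, for \<open>k = p - 1\<close> edges that lack their last site.\<close>

abbreviation rooted_edges :: "nat \<Rightarrow> (spin list \<Rightarrow> real) pmf \<Rightarrow> nat \<Rightarrow> ((spin list \<Rightarrow> real) \<times> nat list) pmf" where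
  "rooted_edges k \<Theta> N \<equiv> pair_pmf \<Theta> (pmf_of_set (tuples k {1..N}))"

text \<open>By thinning, the edges through the last site and those that avoid it form independent Poisson
  families.\<close>

theorem graph_law_remove_vertex:
  assumes p: "p \<ge> 1" and N: "p \<le> N" and ex: "exchangeable p \<Theta>" and s: "s > 0"
  shows "graph_law p \<Theta> (Suc N) s = map_pmf (\<lambda>(es, H). star_energy (Suc N) es + H)
    (pair_pmf (poisson_list (s * (p / Suc N)) (rooted_edges (p - 1) \<Theta> N))
      (graph_law p \<Theta> N (s * (1 - p / Suc N))))"
proof -
  let ?u = "real p / real (Suc N)"
  have u: "0 < ?u" "?u < 1" using p N by auto
  have st: "compound_poisson t (star_edge_law p \<Theta> N) =
      map_pmf (star_energy (Suc N)) (poisson_list t (rooted_edges (p - 1) \<Theta> N))" for t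
    unfolding compound_poisson_def star_edge_law_def map_poisson_list[symmetric] pmf.map_comp
    by (intro map_pmf_cong refl)
       (auto simp: fun_eq_iff sum_list_fun_apply star_energy_def o_def case_prod_unfold)
  show ?thesis
    unfolding graph_law_def edge_law_Suc[OF p N ex] compound_poisson_mixture[OF s u] st pair_map_pmf1 pmf.map_comp
    by (intro map_pmf_cong refl) auto
qed

lemma graph_law_edges: "graph_law p \<Theta> N s = map_pmf edges_energy (poisson_list s (rooted_edges p \<Theta> N))"
  unfolding graph_law_def compound_poisson_def edge_law_def map_poisson_list[symmetric] pmf.map_comp
  by (intro map_pmf_cong refl)
     (auto simp: fun_eq_iff sum_list_fun_apply edges_energy_def o_def case_prod_unfold)

theorem graph_law_add_edges:
  assumes "s > 0" "t > 0"
  shows "graph_law p \<Theta> N (t + s) = map_pmf (\<lambda>(es, H). edges_energy es + H)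
    (pair_pmf (poisson_list t (rooted_edges p \<Theta> N)) (graph_law p \<Theta> N s))"
proof -
  have "graph_law p \<Theta> N (t + s) = map_pmf (\<lambda>(x, y). x + y) (pair_pmf (graph_law p \<Theta> N t) (graph_law p \<Theta> N s))"
    unfolding graph_law_def by (rule compound_poisson_add[OF assms(2,1)])
  then show ?thesis
    unfolding graph_law_edges[of p \<Theta> N t] pair_map_pmf1 pmf.map_comp
    by (simp add: o_def case_prod_unfold)
qed

section \<open>New edges meet distinct sites\<close>

text \<open>The probability that a uniform \<open>k\<close>-tuple of distinct elements of \<open>{1..N}\<close> avoids \<open>M\<close> given
  elements.\<close>

definition avoid_prob :: "nat \<Rightarrow> nat \<Rightarrow> nat \<Rightarrow> real" where
  "avoid_prob k N M = (\<Prod>i<k. real (N - M - i) / real (N - i))"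

lemma avoid_prob_tendsto: "(\<lambda>N. avoid_prob k N M) \<longlonglongrightarrow> 1"
proof -
  have "(\<lambda>N. \<Prod>i<k. real (N - M - i) / real (N - i)) \<longlonglongrightarrow> (\<Prod>i<k. 1)"
  proof (rule tendsto_prod)
    fix i
    have "(\<lambda>N. 1 - real M / real (N - i)) \<longlonglongrightarrow> 1 - 0"
    proof (intro tendsto_diff tendsto_const)
      have "filterlim (\<lambda>N. real (N - i)) at_top sequentially"
        by (rule filterlim_compose[OF filterlim_real_sequentially filterlim_minus_const_nat_at_top])
      then show "(\<lambda>N. real M / real (N - i)) \<longlonglongrightarrow> 0"
        by (rule real_tendsto_divide_at_top[OF tendsto_const])
    qed
    moreover have "\<forall>\<^sub>F N in sequentially. 1 - real M / real (N - i) = real (N - M - i) / real (N - i)"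
      using eventually_gt_at_top[of "M + i"]
      by eventually_elim (auto simp: field_simps of_nat_diff)
    ultimately show "(\<lambda>N. real (N - M - i) / real (N - i)) \<longlonglongrightarrow> 1"
      by (auto intro: Lim_transform_eventually)
  qed
  then show ?thesis by (simp add: avoid_prob_def)
qed

lemma avoid_prob_bounds: "0 \<le> avoid_prob k N M" "avoid_prob k N M \<le> 1"
  unfolding avoid_prob_def by (auto intro!: prod_nonneg prod_le_1 simp: divide_le_eq_1)

lemma prob_avoid:
  assumes "k \<le> N" "A \<subseteq> {1..N}" "card A \<le> M"
  shows "measure_pmf.prob (pmf_of_set (tuples k {1..N})) {vs. vs \<in> tuples k {1..N} \<and> set vs \<inter> A = {}} \<ge> avoid_prob k N M"
proof -
  have fA: "finite A" using assms(2) finite_subset by blast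
  have ne: "tuples k {1..N} \<noteq> {}" using assms tuples_nonempty[of "{1..N}" k] by simp
  have "tuples k {1..N} \<inter> {vs. vs \<in> tuples k {1..N} \<and> set vs \<inter> A = {}} = tuples k ({1..N} - A)"
    by (auto simp: tuples_def)
  then have "measure_pmf.prob (pmf_of_set (tuples k {1..N})) {vs. vs \<in> tuples k {1..N} \<and> set vs \<inter> A = {}}
     = real (card (tuples k ({1..N} - A))) / real (card (tuples k {1..N}))"
    using ne by (simp add: measure_pmf_of_set)
  also have "\<dots> = (\<Prod>i<k. real (N - card A - i)) / (\<Prod>i<k. real (N - i))"
    using assms(2) fA by (simp add: card_tuples card_Diff_subset)
  also have "\<dots> = (\<Prod>i<k. real (N - card A - i) / real (N - i))"
    by (simp add: prod_dividef)
  also have "\<dots> \<ge> avoid_prob k N M"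
    unfolding avoid_prob_def using assms(3) by (intro prod_mono) (auto intro!: divide_right_mono)
  finally show ?thesis .
qed

text \<open>Discarding all outcomes but one of the first draw is affordable here: only lower bounds are
  sought, and these are summed over the outcomes at the end.\<close>

lemma prob_bind_ge:
  "measure_pmf.prob (bind_pmf A f) S \<ge> pmf A a * measure_pmf.prob (f a) S"
proof -
  have "ennreal (pmf A a * measure_pmf.prob (f a) S) = emeasure (f a) S * emeasure A {a}"
    by (simp add: measure_pmf.emeasure_eq_measure pmf.rep_eq ennreal_mult' mult.commute)
  also have "\<dots> = (\<integral>\<^sup>+x. emeasure (f a) S * indicator {a} x \<partial>measure_pmf A)"
    by (simp add: nn_integral_cmult_indicator)
  also have "\<dots> \<le> (\<integral>\<^sup>+x. emeasure (f x) S \<partial>measure_pmf A)"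
    by (intro nn_integral_mono) (auto simp: indicator_def)
  also have "\<dots> = ennreal (measure_pmf.prob (bind_pmf A f) S)"
    by (simp add: emeasure_bind_pmf flip: measure_pmf.emeasure_eq_measure)
  finally show ?thesis by (simp add: ennreal_le_iff)
qed

lemma prob_bind_ge_const:
  assumes "\<And>a. a \<in> R \<Longrightarrow> measure_pmf.prob (f a) S \<ge> c" "c \<ge> 0"
  shows "measure_pmf.prob (bind_pmf A f) S \<ge> measure_pmf.prob A R * c"
proof -
  have "ennreal (measure_pmf.prob A R * c) = ennreal c * emeasure A R"
    using assms(2) by (simp add: measure_pmf.emeasure_eq_measure ennreal_mult' mult.commute)
  also have "\<dots> = (\<integral>\<^sup>+x. ennreal c * indicator R x \<partial>measure_pmf A)"
    by (simp add: nn_integral_cmult_indicator)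
  also have "\<dots> \<le> (\<integral>\<^sup>+x. emeasure (f x) S \<partial>measure_pmf A)"
    using assms(1) by (intro nn_integral_mono)
      (auto simp: indicator_def measure_pmf.emeasure_eq_measure intro: ennreal_leI)
  also have "\<dots> = ennreal (measure_pmf.prob (bind_pmf A f) S)"
    by (simp add: emeasure_bind_pmf flip: measure_pmf.emeasure_eq_measure)
  finally show ?thesis by (simp add: ennreal_le_iff)
qed

text \<open>The edges are exposed one at a time; each avoids the sites already used, of which there are at
  most \<open>M\<close>.\<close>

lemma prob_fresh_edges:
  assumes k: "k \<le> N"
  shows "set us \<subseteq> {1..N} \<Longrightarrow> distinct us \<Longrightarrow> length us + length \<theta>s * k \<le> M \<Longrightarrow>
    measure_pmf.prob (replicate_pmf (length \<theta>s) (rooted_edges k \<Theta> N))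
      {es. map fst es = \<theta>s \<and> (\<forall>e\<in>set es. snd e \<in> tuples k {1..N}) \<and> distinct (concat (map snd es) @ us)}
    \<ge> prod_list (map (pmf \<Theta>) \<theta>s) * avoid_prob k N M ^ length \<theta>s"
proof (induction \<theta>s arbitrary: us)
  case Nil
  then show ?case by simp
next
  case (Cons \<theta> \<theta>s)
  let ?U = "pmf_of_set (tuples k {1..N})" and ?R = "replicate_pmf (length \<theta>s) (rooted_edges k \<Theta> N)"
  let ?E = "\<lambda>\<theta>s us. {es. map fst es = \<theta>s \<and> (\<forall>e\<in>set es. snd e \<in> tuples k {1..N}) \<and> distinct (concat (map snd es) @ us)}"
  let ?b = "prod_list (map (pmf \<Theta>) \<theta>s) * avoid_prob k N M ^ length \<theta>s"
  have b0: "?b \<ge> 0"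
    by (intro mult_nonneg_nonneg zero_le_power avoid_prob_bounds prod_list_nonneg) auto
  have R: "replicate_pmf (length (\<theta> # \<theta>s)) (rooted_edges k \<Theta> N) =
     bind_pmf \<Theta> (\<lambda>\<theta>. bind_pmf ?U (\<lambda>vs. map_pmf (\<lambda>es. (\<theta>, vs) # es) ?R))"
    by (simp add: pair_pmf_def bind_assoc_pmf bind_return_pmf map_pmf_def)
  have inner: "measure_pmf.prob (map_pmf (\<lambda>es. (\<theta>, vs) # es) ?R) (?E (\<theta> # \<theta>s) us) \<ge> ?b"
    if vs: "vs \<in> {vs. vs \<in> tuples k {1..N} \<and> set vs \<inter> set us = {}}" for vs
  proof -
    have "?b \<le> measure_pmf.prob ?R (?E \<theta>s (vs @ us))"
      using vs Cons.prems by (intro Cons.IH) (auto simp: tuples_def)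
    also have "\<dots> \<le> measure_pmf.prob ?R ((\<lambda>es. (\<theta>, vs) # es) -` ?E (\<theta> # \<theta>s) us)"
      using vs by (intro measure_pmf.finite_measure_mono) (auto simp: tuples_def)
    finally show ?thesis by simp
  qed
  have cu: "card (set us) \<le> M" using Cons.prems by (simp add: distinct_card)
  have "avoid_prob k N M * ?b \<le> measure_pmf.prob ?U {vs. vs \<in> tuples k {1..N} \<and> set vs \<inter> set us = {}} * ?b"
    using prob_avoid[OF k _ cu] Cons.prems b0 by (intro mult_right_mono) auto
  also have "\<dots> \<le> measure_pmf.prob (bind_pmf ?U (\<lambda>vs. map_pmf (\<lambda>es. (\<theta>, vs) # es) ?R)) (?E (\<theta> # \<theta>s) us)"
    by (rule prob_bind_ge_const[OF inner b0])
  finally have "pmf \<Theta> \<theta> * (avoid_prob k N M * ?b) \<le> pmf \<Theta> \<theta> *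
     measure_pmf.prob (bind_pmf ?U (\<lambda>vs. map_pmf (\<lambda>es. (\<theta>, vs) # es) ?R)) (?E (\<theta> # \<theta>s) us)"
    by (intro mult_left_mono) auto
  also have "\<dots> \<le> measure_pmf.prob (replicate_pmf (length (\<theta> # \<theta>s)) (rooted_edges k \<Theta> N)) (?E (\<theta> # \<theta>s) us)"
    unfolding R by (rule prob_bind_ge)
  finally show ?case by (simp add: algebra_simps)
qed

text \<open>The new edges \<open>es\<close> carry the interactions listed in \<open>cs\<close>, and under the Gibbs measure of the
  remaining hypergraph the spins at their sites and at \<open>us\<close> are independent, with the fields
  listed in \<open>cs\<close> and \<open>ys\<close>.\<close>

definition attached :: "real \<Rightarrow> nat \<Rightarrow> nat \<Rightarrow> nat list \<Rightarrow> field list \<Rightarrow> config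
    \<Rightarrow> (((spin list \<Rightarrow> real) \<times> nat list) list \<times> energy) set" where
  "attached \<beta> k N us ys cs = {(es, H). map fst es = map fst cs \<and> (\<forall>e\<in>set es. snd e \<in> tuples k {1..N}) \<and>
     factorizes \<beta> N H (concat (map snd es) @ us) (concat (map snd cs) @ ys)}"

lemma concat_lengths: "(\<And>x. x \<in> set xs \<Longrightarrow> length x = k) \<Longrightarrow> length (concat xs) = length xs * k"
  by (induction xs) auto

text \<open>The edges are independent of the hypergraph \<open>H\<close>. Once they are exposed and found to meet
  distinct sites, the lower bound \<open>L\<close> for given sites applies to the sites that they meet.\<close>

lemma prob_attached:
  assumes k: "k \<le> N" and c: "c > 0"
    and us: "set us \<subseteq> {1..N}" "distinct us" "length us = length ys"
    and cs: "\<And>e. e \<in> set cs \<Longrightarrow> length (snd e) = k"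
    and L: "L \<ge> 0" "\<And>vs. distinct vs \<Longrightarrow> set vs \<subseteq> {1..N} \<Longrightarrow> length vs = length (concat (map snd cs) @ ys) \<Longrightarrow>
         factor_prob p \<Theta> \<beta> N s vs (concat (map snd cs) @ ys) \<ge> L"
  shows "measure_pmf.prob (pair_pmf (poisson_list c (rooted_edges k \<Theta> N)) (graph_law p \<Theta> N s)) (attached \<beta> k N us ys cs)
    \<ge> pmf (poisson_pmf c) (length cs) * (prod_list (map (pmf \<Theta> \<circ> fst) cs)
        * avoid_prob k N (length us + length cs * k) ^ length cs) * L"
proof -
  let ?R = "{es. map fst es = map fst cs \<and> (\<forall>e\<in>set es. snd e \<in> tuples k {1..N}) \<and> distinct (concat (map snd es) @ us)}"
  have P: "pair_pmf (poisson_list c (rooted_edges k \<Theta> N)) (graph_law p \<Theta> N s) =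
     bind_pmf (poisson_list c (rooted_edges k \<Theta> N)) (\<lambda>es. map_pmf (\<lambda>H. (es, H)) (graph_law p \<Theta> N s))"
    by (simp add: pair_pmf_def map_pmf_def)
  have "prod_list (map (pmf \<Theta>) (map fst cs)) * avoid_prob k N (length us + length cs * k) ^ length (map fst cs)
     \<le> measure_pmf.prob (replicate_pmf (length (map fst cs)) (rooted_edges k \<Theta> N)) ?R"
    by (rule prob_fresh_edges[OF k]) (use us in auto)
  then have "pmf (poisson_pmf c) (length cs) * (prod_list (map (pmf \<Theta> \<circ> fst) cs)
        * avoid_prob k N (length us + length cs * k) ^ length cs) \<le>
      pmf (poisson_pmf c) (length cs) * measure_pmf.prob (replicate_pmf (length cs) (rooted_edges k \<Theta> N)) ?R"
    by (intro mult_left_mono) (auto simp: o_def)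
  also have "\<dots> \<le> measure_pmf.prob (poisson_list c (rooted_edges k \<Theta> N)) ?R"
    unfolding poisson_list_def by (rule prob_bind_ge)
  finally have "pmf (poisson_pmf c) (length cs) * (prod_list (map (pmf \<Theta> \<circ> fst) cs)
        * avoid_prob k N (length us + length cs * k) ^ length cs) * L \<le>
      measure_pmf.prob (poisson_list c (rooted_edges k \<Theta> N)) ?R * L"
    using L(1) by (rule mult_right_mono)
  also have "\<dots> \<le> measure_pmf.prob (pair_pmf (poisson_list c (rooted_edges k \<Theta> N)) (graph_law p \<Theta> N s)) (attached \<beta> k N us ys cs)"
    unfolding P
  proof (rule prob_bind_ge_const)
    fix es assume es: "es \<in> ?R"
    have len: "length (concat (map snd es) @ us) = length (concat (map snd cs) @ ys)"
    proof -
      have "length es = length cs" using es by (auto dest: map_eq_imp_length_eq)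
      moreover have "length (concat (map snd es)) = length es * k"
        using es concat_lengths[of "map snd es" k] by (auto simp: tuples_def)
      moreover have "length (concat (map snd cs)) = length cs * k"
      proof -
        have "length x = k" if "x \<in> set (map snd cs)" for x using that cs by auto
        then show ?thesis using concat_lengths[of "map snd cs" k] by simp
      qed
      ultimately show ?thesis using us by simp
    qed
    have "set (concat (map snd es) @ us) \<subseteq> {1..N}" using es us by (auto simp: tuples_def)
    then have "L \<le> factor_prob p \<Theta> \<beta> N s (concat (map snd es) @ us) (concat (map snd cs) @ ys)"
      using es len by (intro L(2)) auto
    also have "\<dots> \<le> measure_pmf.prob (map_pmf (\<lambda>H. (es, H)) (graph_law p \<Theta> N s)) (attached \<beta> k N us ys cs)"
      unfolding factor_prob_def measure_map_pmf using es
      by (intro measure_pmf.finite_measure_mono) (auto simp: attached_def)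
    finally show "L \<le> measure_pmf.prob (map_pmf (\<lambda>H. (es, H)) (graph_law p \<Theta> N s)) (attached \<beta> k N us ys cs)" .
  qed (rule L(1))
  finally show ?thesis .
qed

lemma attached_disjoint:
  assumes \<beta>: "\<beta> \<noteq> 0" and "\<And>e. e \<in> set cs \<Longrightarrow> length (snd e) = k" "\<And>e. e \<in> set cs' \<Longrightarrow> length (snd e) = k"
    and "x \<in> attached \<beta> k N us ys cs" "x \<in> attached \<beta> k N us ys cs'"
  shows "cs = cs'"
proof -
  obtain es H where x: "x = (es, H)" by (cases x)
  have f: "map fst cs = map fst cs'" using assms(4,5) by (auto simp: attached_def x)
  have "concat (map snd cs) @ ys = concat (map snd cs') @ ys"
    using assms(4,5) factorizes_unique[OF \<beta>] unfolding attached_def x by blast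
  then have c: "concat (map snd cs) = concat (map snd cs')" by simp
  have len: "length (map snd cs) = length (map snd cs')" using f by (auto dest: map_eq_imp_length_eq)
  have "\<forall>(x, y)\<in>set (zip (map snd cs) (map snd cs')). length x = length y"
  proof clarify
    fix x y assume xy: "(x, y) \<in> set (zip (map snd cs) (map snd cs'))"
    then have "x \<in> set (map snd cs)" "y \<in> set (map snd cs')" by (auto dest: set_zip_leftD set_zip_rightD)
    then show "length x = length y" using assms(2,3) by auto
  qed
  then have "map snd cs = map snd cs'" using concat_injective[OF c len] by blast
  then show ?thesis using f by (metis zip_map_fst_snd)
qed

lemma attached_match:
  assumes "(es, H) \<in> attached \<beta> k N us ys cs" "\<And>e. e \<in> set cs \<Longrightarrow> length (snd e) = k"
  shows "list_all2 (\<lambda>(\<theta>, vs) (\<theta>', c). \<theta> = \<theta>' \<and> length vs = length c) es cs"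
proof -
  have f: "map fst es = map fst cs" and t: "\<And>e. e \<in> set es \<Longrightarrow> length (snd e) = k"
    using assms(1) by (auto simp: attached_def tuples_def)
  have len: "length es = length cs" using f by (auto dest: map_eq_imp_length_eq)
  have "fst (es ! i) = fst (cs ! i)" if "i < length es" for i
    using arg_cong[OF f, of "\<lambda>l. l ! i"] that len by simp
  then show ?thesis using len t assms(2)
    by (auto simp: list_all2_conv_all_nth case_prod_unfold)
qed

lemma prod_list_mono:
  fixes f g :: "'b \<Rightarrow> real"
  assumes "\<And>x. x \<in> set xs \<Longrightarrow> 0 \<le> f x \<and> f x \<le> g x"
  shows "0 \<le> prod_list (map f xs) \<and> prod_list (map f xs) \<le> prod_list (map g xs)"
  using assms
proof (induction xs)
  case (Cons x xs)
  then have "0 \<le> f x" "f x \<le> g x" "0 \<le> prod_list (map f xs)" "prod_list (map f xs) \<le> prod_list (map g xs)" by auto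
  then show ?case by (auto intro: mult_mono)
qed simp

text \<open>For the injection \<open>some_config\<close> this compares truncated with complete trees.\<close>

lemma prob_le_inj:
  assumes "inj_on f A" "\<And>x. x \<in> A \<Longrightarrow> pmf M (f x) \<le> pmf Q x"
  shows "measure_pmf.prob M (f ` A) \<le> measure_pmf.prob Q A"
proof -
  have "ennreal (measure_pmf.prob M (f ` A)) = (\<integral>\<^sup>+x. ennreal (pmf M x) \<partial>count_space (f ` A))"
    by (simp add: nn_integral_pmf measure_pmf.emeasure_eq_measure)
  also have "\<dots> = (\<integral>\<^sup>+x. ennreal (pmf M (f x)) \<partial>count_space A)"
    using assms(1) by (intro nn_integral_bij_count_space[symmetric]) (simp add: bij_betw_def)
  also have "\<dots> \<le> (\<integral>\<^sup>+x. ennreal (pmf Q x) \<partial>count_space A)"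
    using assms(2) by (intro nn_integral_mono) (auto intro: ennreal_leI)
  also have "\<dots> = ennreal (measure_pmf.prob Q A)"
    by (simp add: nn_integral_pmf measure_pmf.emeasure_eq_measure)
  finally show ?thesis by simp
qed

text \<open>Only finitely many events can be controlled uniformly in \<open>N\<close>; countable sums are therefore
  approximated from below by finite ones.\<close>

lemma prob_finite_approx:
  assumes "e > 0"
  shows "\<exists>C. finite C \<and> C \<subseteq> S \<and> C \<subseteq> set_pmf M \<and> measure_pmf.prob M C \<ge> measure_pmf.prob M S - e"
proof -
  have cnt: "countable (set_pmf M \<inter> S)" by auto
  show ?thesis
  proof (cases "set_pmf M \<inter> S = {}")
    case True
    then have "measure_pmf.prob M S = 0"
      by (subst measure_Int_set_pmf[symmetric]) (simp add: Int_commute)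
    then show ?thesis using assms by (intro exI[of _ "{}"]) auto
  next
    case False
    define A where "A n = from_nat_into (set_pmf M \<inter> S) ` {..n}" for n :: nat
    have "(\<lambda>n. measure_pmf.prob M (A n)) \<longlonglongrightarrow> measure_pmf.prob M (\<Union>n. A n)"
      by (rule measure_pmf.finite_Lim_measure_incseq) (auto simp: A_def incseq_def)
    moreover have "(\<Union>n. A n) = set_pmf M \<inter> S"
      using range_from_nat_into[OF False cnt] by (auto simp: A_def) blast
    ultimately have "(\<lambda>n. measure_pmf.prob M (A n)) \<longlonglongrightarrow> measure_pmf.prob M S"
      by (simp add: Int_commute measure_Int_set_pmf)
    then have "\<forall>\<^sub>F n in sequentially. measure_pmf.prob M (A n) > measure_pmf.prob M S - e"
      using assms by (intro order_tendstoD) auto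
    then obtain n where n: "measure_pmf.prob M (A n) > measure_pmf.prob M S - e"
      by (auto simp: eventually_sequentially)
    have "A n \<subseteq> set_pmf M \<inter> S" using from_nat_into[OF False] by (auto simp: A_def)
    then show ?thesis using n by (intro exI[of _ "A n"]) (auto simp: A_def less_imp_le)
  qed
qed

lemma field_avg_add: "field_avg \<beta> xs (\<lambda>ss. f ss + g ss) = field_avg \<beta> xs f + field_avg \<beta> xs g"
proof (induction xs arbitrary: f g)
  case (Cons x xs)
  show ?case by (simp add: Cons spin_avg_alt algebra_simps add_divide_distrib)
qed simp

lemma field_avg_commute:
  "field_avg \<beta> xs (\<lambda>a. field_avg \<beta> ys (\<lambda>b. h a b)) = field_avg \<beta> ys (\<lambda>b. field_avg \<beta> xs (\<lambda>a. h a b))"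
proof (induction xs arbitrary: h)
  case (Cons x xs)
  have sc: "field_avg \<beta> ys (\<lambda>b. spin_avg (\<lambda>s. f s b)) = spin_avg (\<lambda>s. field_avg \<beta> ys (f s))" for f
    using field_avg_cmult[of \<beta> ys "1/2" "\<lambda>b. f (Abs_spin (- 1)) b + f (Abs_spin 1) b"]
    by (simp add: spin_avg_alt field_avg_add)
  show ?case by (simp add: sc field_avg_cmult Cons)
qed simp

text \<open>Induction on trees proceeds from the head of a list of sites; exchanging blocks moves the sites
  met by new edges past those already treated.\<close>

lemma factorizes_swap:
  assumes "factorizes \<beta> N H (vs @ ws) (xs @ ys)" "length vs = length xs" "length ws = length ys"
  shows "factorizes \<beta> N H (ws @ vs) (ys @ xs)"
  unfolding factorizes_def
proof (intro conjI allI)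
  fix g :: "spin list \<Rightarrow> real"
  let ?n = "length xs"
  let ?g = "\<lambda>ss. g (drop ?n ss @ take ?n ss)"
  have "conf_avg N (\<lambda>\<sigma>. g (map \<sigma> (ws @ vs)) * exp (\<beta> * H \<sigma>)) = conf_avg N (\<lambda>\<sigma>. ?g (map \<sigma> (vs @ ws)) * exp (\<beta> * H \<sigma>))"
    using assms(2) by (intro conf_avg_cong) simp
  also have "\<dots> = partition_fn \<beta> N H * field_avg \<beta> (xs @ ys) ?g"
    by (rule assms(1)[unfolded factorizes_def, THEN conjunct2, THEN conjunct2, rule_format])
  also have "field_avg \<beta> (xs @ ys) ?g = field_avg \<beta> xs (\<lambda>a. field_avg \<beta> ys (\<lambda>b. g (b @ a)))"
    unfolding field_avg_append by (intro field_avg_cong) simp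
  also have "\<dots> = field_avg \<beta> (ys @ xs) g"
    by (simp add: field_avg_append field_avg_commute[of \<beta> xs])
  finally show "conf_avg N (\<lambda>\<sigma>. g (map \<sigma> (ws @ vs)) * exp (\<beta> * H \<sigma>)) = partition_fn \<beta> N H * field_avg \<beta> (ys @ xs) g" .
qed (use assms in \<open>auto simp: factorizes_def\<close>)

section \<open>Messages of truncated trees\<close>

text \<open>Interactions are only required to be bounded by \<open>1\<close>, because negative values of \<open>\<beta>\<close> lead to
  interactions with values in \<open>{0, 1}\<close>.\<close>

locale critical_csp =
  fixes p :: nat and \<alpha> \<beta> :: real and \<Theta> :: "(spin list \<Rightarrow> real) pmf"
  assumes p2: "p \<ge> 2" and \<alpha>: "\<alpha> > 0" and \<beta>: "\<beta> > 0"
    and finite_\<Theta>: "finite (set_pmf \<Theta>)"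
    and bound_\<Theta>: "\<And>\<theta> s. \<theta> \<in> set_pmf \<Theta> \<Longrightarrow> length s = p \<Longrightarrow> \<bar>\<theta> s\<bar> \<le> 1"
    and exch: "exchangeable p \<Theta>"
    and critical: "\<alpha> * real p * (real p - 1) \<le> 1"
begin

text \<open>The law of the edges at a site when the other sites carry independent samples of \<open>Q\<close>. Its type
  is polymorphic since the samples may be messages of truncated trees, of type \<open>field option\<close>.\<close>

definition config_law :: "real \<Rightarrow> nat \<Rightarrow> 'b pmf \<Rightarrow> ((spin list \<Rightarrow> real) \<times> 'b list) list pmf" where
  "config_law c k Q = poisson_list c (pair_pmf \<Theta> (replicate_pmf k Q))"

text \<open>The probability weight of a configuration when field \<open>x\<close> has weight \<open>m x\<close>. The weights need not
  add up to one: \<open>m\<close> will also be the family of atoms of a measure that may have a diffuse part,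
  and the family of messages of trees extinct by a given depth.\<close>

definition config_weight :: "real \<Rightarrow> nat \<Rightarrow> (field \<Rightarrow> real) \<Rightarrow> config \<Rightarrow> real" where
  "config_weight c k m cs = pmf (poisson_pmf c) (length cs) *
     (\<Prod>e\<leftarrow>cs. pmf \<Theta> (fst e) * (if length (snd e) = k then (\<Prod>x\<leftarrow>snd e. m x) else 0))"

definition finite_config :: "((spin list \<Rightarrow> real) \<times> field option list) list \<Rightarrow> bool" where
  "finite_config c \<longleftrightarrow> (\<forall>e\<in>set c. None \<notin> set (snd e))"

text \<open>The message at the root of the tree truncated at depth \<open>d\<close>. The value \<open>None\<close> means that the tree
  has not become extinct by that depth, in which case the message is not determined by what has
  been seen.\<close>

fun tree_message :: "nat \<Rightarrow> field option pmf" where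
  "tree_message 0 = return_pmf None"
| "tree_message (Suc d) = map_pmf (\<lambda>c. if finite_config c
      then Some (message \<beta> (map (\<lambda>(\<theta>, xs). (\<theta>, map the xs)) c)) else None)
    (config_law (\<alpha> * p) (p - 1) (tree_message d))"

definition some_config :: "config \<Rightarrow> ((spin list \<Rightarrow> real) \<times> field option list) list" where
  "some_config = map (\<lambda>(\<theta>, xs). (\<theta>, map Some xs))"

lemma \<alpha>p: "\<alpha> * real p > 0" using \<alpha> p2 by simp

lemma the_some_config: "map (\<lambda>(\<theta>, xs). (\<theta>, map the xs)) (some_config cs) = cs"
  by (simp add: some_config_def o_def case_prod_unfold)

lemma inj_some_config: "inj some_config"
  by (rule inj_on_inverseI) (rule the_some_config)

lemma pmf_config_law:
  assumes "c > 0"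
  shows "pmf (config_law c k Q) cs = config_weight c k (pmf Q) cs"
  unfolding config_law_def pmf_poisson_list[OF assms] config_weight_def
  by (intro arg_cong2[where f="(*)"] arg_cong[where f=prod_list] map_cong refl)
     (auto simp: pmf_pair pmf_replicate_pmf)

lemma pmf_config_law_some:
  assumes "c > 0"
  shows "pmf (config_law c k Q) (some_config cs) = config_weight c k (\<lambda>x. pmf Q (Some x)) cs"
  unfolding config_law_def pmf_poisson_list[OF assms] config_weight_def some_config_def
  by (auto simp: pmf_pair pmf_replicate_pmf o_def case_prod_unfold intro!: arg_cong[where f=prod_list])

lemma config_weight_mono:
  assumes "c > 0" "\<And>x. 0 \<le> m x \<and> m x \<le> m' x"
  shows "0 \<le> config_weight c k m cs \<and> config_weight c k m cs \<le> config_weight c k m' cs"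
proof -
  let ?f = "\<lambda>m e. pmf \<Theta> (fst e) * (if length (snd e) = k then (\<Prod>x\<leftarrow>snd e. m x) else 0)"
  have "0 \<le> prod_list (map (?f m) cs) \<and> prod_list (map (?f m) cs) \<le> prod_list (map (?f m') cs)"
    using prod_list_mono[of _ m m'] assms(2) by (intro prod_list_mono) (auto intro!: mult_left_mono)
  then show ?thesis using assms(1) unfolding config_weight_def
    by (auto intro!: mult_left_mono mult_nonneg_nonneg simp del: pmf_poisson)
qed

lemma finite_config_iff: "finite_config c \<longleftrightarrow> c \<in> range some_config"
proof
  assume "finite_config c"
  then have e: "map (Some \<circ> the) (snd e) = snd e" if "e \<in> set c" for e
    using that unfolding finite_config_def by (intro map_idI) (metis comp_apply option.collapse)
  have "some_config (map (\<lambda>(\<theta>, xs). (\<theta>, map the xs)) c) = map (\<lambda>e. (fst e, map (Some \<circ> the) (snd e))) c"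
    by (simp add: some_config_def case_prod_unfold)
  also have "\<dots> = c" by (rule map_idI) (simp add: e)
  finally show "c \<in> range some_config" by (metis rangeI)
qed (auto simp: finite_config_def some_config_def)

lemma pmf_tree_message_Suc:
  "pmf (tree_message (Suc d)) (Some y) =
    measure_pmf.prob (config_law (\<alpha> * p) (p - 1) (tree_message d)) (some_config ` {cs. message \<beta> cs = y})"
proof -
  have "(\<lambda>c. if finite_config c then Some (message \<beta> (map (\<lambda>(\<theta>, xs). (\<theta>, map the xs)) c)) else None) -` {Some y}
      = some_config ` {cs. message \<beta> cs = y}"
    by (auto simp: finite_config_iff the_some_config split: if_splits)
  then show ?thesis by (simp add: pmf_map)
qed

text \<open>A tree extinct by depth \<open>d\<close> is extinct by depth \<open>d + 1\<close>, with the same message.\<close>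

lemma tree_message_mono: "pmf (tree_message d) (Some y) \<le> pmf (tree_message (Suc d)) (Some y)"
proof (induction d arbitrary: y)
  case (Suc d)
  show ?case
    unfolding pmf_tree_message_Suc[of d] pmf_tree_message_Suc[of "Suc d"]
  proof (rule prob_le_inj[of "\<lambda>x. x", unfolded image_ident])
    fix c assume "c \<in> some_config ` {cs. message \<beta> cs = y}"
    then obtain cs where c: "c = some_config cs" by auto
    show "pmf (config_law (\<alpha> * p) (p - 1) (tree_message d)) c
      \<le> pmf (config_law (\<alpha> * p) (p - 1) (tree_message (Suc d))) c"
      unfolding c pmf_config_law_some[OF \<alpha>p]
      by (rule config_weight_mono[OF \<alpha>p, THEN conjunct2]) (simp add: Suc del: tree_message.simps)
  qed simp
qed simp

section \<open>Extinction of critical trees\<close>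

definition survival :: "nat \<Rightarrow> real" where
  "survival d = pmf (tree_message d) None"

lemma prob_pair_Times:
  "measure_pmf.prob (pair_pmf M N) (A \<times> B) = measure_pmf.prob M A * measure_pmf.prob N B"
proof -
  have "measure_pmf.prob (pair_pmf M N) (A \<times> B) = measure_pmf.prob (pair_pmf M N) ((A \<inter> set_pmf M) \<times> (B \<inter> set_pmf N))"
    by (subst measure_Int_set_pmf[symmetric]) (simp add: Times_Int_Times)
  also have "\<dots> = measure_pmf.prob M (A \<inter> set_pmf M) * measure_pmf.prob N (B \<inter> set_pmf N)"
    by (rule measure_pmf_prob_product) auto
  finally show ?thesis by (simp add: measure_Int_set_pmf)
qed

lemma prob_replicate_all:
  "measure_pmf.prob (replicate_pmf n Q) {xs. \<forall>x\<in>set xs. \<phi> x} = measure_pmf.prob Q {x. \<phi> x} ^ n"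
proof (induction n)
  case (Suc n)
  have "measure_pmf.prob (replicate_pmf (Suc n) Q) {xs. \<forall>x\<in>set xs. \<phi> x} =
    measure_pmf.prob (pair_pmf Q (replicate_pmf n Q)) ({x. \<phi> x} \<times> {xs. \<forall>x\<in>set xs. \<phi> x})"
    unfolding replicate_pmf_Suc_pair measure_map_pmf by (intro arg_cong2[where f=measure]) auto
  also have "\<dots> = measure_pmf.prob Q {x. \<phi> x} ^ Suc n"
    using Suc by (simp add: prob_pair_Times)
  finally show ?case .
qed simp

text \<open>The recursion of the Galton--Watson process: the tree dies out by depth \<open>d + 1\<close> if and only if
  all subtrees at the \<open>p - 1\<close> children of each of the Poisson \<open>\<alpha>p\<close> edges die out by depth \<open>d\<close>.\<close>

lemma survival_Suc: "1 - survival (Suc d) = exp (\<alpha> * p * ((1 - survival d) ^ (p - 1) - 1))"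
proof -
  let ?Q = "tree_message d"
  let ?R = "pair_pmf \<Theta> (replicate_pmf (p - 1) ?Q)"
  have c: "1 - pmf M None = measure_pmf.prob M {x. x \<noteq> None}" for M :: "field option pmf"
  proof -
    have "{x. x \<noteq> None} = space (measure_pmf M) - {None}" by auto
    then show ?thesis using measure_pmf.prob_compl[of "{None}" M] by (simp add: measure_pmf_single)
  qed
  have good: "measure_pmf.prob ?R {e. None \<notin> set (snd e)} = (1 - survival d) ^ (p - 1)"
  proof -
    have "measure_pmf.prob ?R {e. None \<notin> set (snd e)} =
       measure_pmf.prob (map_pmf snd ?R) {xs. \<forall>x\<in>set xs. x \<noteq> None}"
    proof -
      have "(\<forall>x\<in>set xs. x \<noteq> None) \<longleftrightarrow> None \<notin> set xs" for xs :: "field option list" by metis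
      then show ?thesis by (simp only: measure_map_pmf vimage_def mem_Collect_eq)
    qed
    also have "\<dots> = (1 - survival d) ^ (p - 1)"
      unfolding map_snd_pair_pmf prob_replicate_all survival_def c ..
    finally show ?thesis .
  qed
  have "1 - survival (Suc d) = measure_pmf.prob (config_law (\<alpha> * p) (p - 1) ?Q) {c. finite_config c}"
    unfolding survival_def c tree_message.simps measure_map_pmf
    by (intro arg_cong2[where f=measure]) auto
  also have "\<dots> = pmf (map_pmf finite_config (config_law (\<alpha> * p) (p - 1) ?Q)) True"
    by (simp add: pmf_map vimage_def)
  also have "\<dots> = measure_pmf.expectation (poisson_pmf (\<alpha> * p)) (\<lambda>n. ((1 - survival d) ^ (p - 1)) ^ n)"
  proof -
    have "pmf (map_pmf finite_config (replicate_pmf n ?R)) True = ((1 - survival d) ^ (p - 1)) ^ n" for n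
      using prob_replicate_all[of n ?R "\<lambda>e. None \<notin> set (snd e)"] good
      by (simp add: pmf_map vimage_def finite_config_def)
    then show ?thesis by (simp add: config_law_def poisson_list_def map_bind_pmf pmf_bind)
  qed
  also have "\<dots> = exp (\<alpha> * p * ((1 - survival d) ^ (p - 1) - 1))"
    by (rule poisson_generating_function[OF \<alpha>p]) (simp add: survival_def pmf_le_1)
  finally show ?thesis .
qed

lemma nn_integral_tree_message:
  "(\<integral>\<^sup>+y. ennreal (pmf (tree_message d) (Some y)) \<partial>count_space UNIV) = ennreal (1 - survival d)"
proof -
  have "(\<integral>\<^sup>+y. ennreal (pmf (tree_message d) (Some y)) \<partial>count_space UNIV) =
     (\<integral>\<^sup>+y. ennreal (pmf (tree_message d) y) \<partial>count_space (range Some))"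
    by (rule nn_integral_bij_count_space) (simp add: bij_betw_def)
  also have "\<dots> = ennreal (measure_pmf.prob (tree_message d) (- {None}))"
  proof -
    have "x \<in> range Some \<longleftrightarrow> x \<in> - {None}" for x :: "field option" by (cases x) auto
    then have "range Some = - {None :: field option}" by blast
    then show ?thesis by (simp only: nn_integral_pmf measure_pmf.emeasure_eq_measure)
  qed
  also have "measure_pmf.prob (tree_message d) (- {None}) = 1 - survival d"
    using measure_pmf.prob_compl[of "{None}" "tree_message d"]
    by (simp add: measure_pmf_single survival_def Compl_eq_Diff_UNIV)
  finally show ?thesis .
qed

lemma survival_antimono: "survival (Suc d) \<le> survival d"
proof -
  have "ennreal (1 - survival d) \<le> ennreal (1 - survival (Suc d))"
    unfolding nn_integral_tree_message[symmetric]
    by (intro nn_integral_mono ennreal_leI tree_message_mono)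
  then show ?thesis using pmf_le_1[of "tree_message (Suc d)" None]
    by (auto simp: survival_def ennreal_le_iff2 simp del: tree_message.simps)
qed

text \<open>The limit \<open>q\<close> satisfies \<open>1 - q = exp(\<alpha>p((1 - q)\<^sup>p\<^sup>-\<^sup>1 - 1))\<close>. By Bernoulli's inequality and
  \<open>\<alpha>p(p - 1) \<le> 1\<close> the right-hand side is at least \<open>exp(-q)\<close>, which exceeds \<open>1 - q\<close> unless \<open>q = 0\<close>.
  This is where criticality enters.\<close>

lemma survival_tendsto_0: "survival \<longlonglongrightarrow> 0"
proof -
  have b: "0 \<le> survival d" "survival d \<le> 1" for d by (simp_all add: survival_def pmf_le_1)
  have "decseq survival" using survival_antimono by (simp add: decseq_Suc_iff)
  then obtain q where q: "survival \<longlonglongrightarrow> q"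
    by (rule decseq_convergent[of survival 0]) (use b in auto)
  have q01: "0 \<le> q" "q \<le> 1"
    using LIMSEQ_le_const[OF q] LIMSEQ_le_const2[OF q] b by auto
  have "(\<lambda>d. 1 - survival (Suc d)) \<longlonglongrightarrow> exp (\<alpha> * p * ((1 - q) ^ (p - 1) - 1))"
    unfolding survival_Suc using q by (intro tendsto_intros)
  moreover have "(\<lambda>d. 1 - survival (Suc d)) \<longlonglongrightarrow> 1 - q"
    using LIMSEQ_Suc[OF q] by (intro tendsto_intros)
  ultimately have eq: "1 - q = exp (\<alpha> * p * ((1 - q) ^ (p - 1) - 1))"
    using LIMSEQ_unique by blast
  have "q = 0"
  proof (rule ccontr)
    assume "q \<noteq> 0"
    then have q0: "q > 0" using q01 by simp
    have "1 + real (p - 1) * (- q) \<le> (1 + (- q)) ^ (p - 1)"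
      using q01 by (intro Bernoulli_inequality) auto
    then have "(1 - q) ^ (p - 1) - 1 \<ge> - ((real p - 1) * q)"
      using p2 by (simp add: of_nat_diff)
    then have "\<alpha> * p * ((1 - q) ^ (p - 1) - 1) \<ge> \<alpha> * p * (- ((real p - 1) * q))"
      using \<alpha>p by (intro mult_left_mono) auto
    also have "\<alpha> * p * (- ((real p - 1) * q)) = - (\<alpha> * p * (real p - 1) * q)" by simp
    also have "\<dots> \<ge> - q" using mult_right_mono[OF critical, of q] q0 by simp
    finally have "\<alpha> * p * ((1 - q) ^ (p - 1) - 1) \<ge> - q" by simp
    then have "1 - q \<ge> exp (- q)" by (subst eq) (rule exp_le_cancel_iff[THEN iffD2])
    moreover have "exp (- q) > 1 + (- q)"
    proof -
      have "1 + (- q) < (1 + - q / 2) ^ 2" using q0 by (simp add: power2_eq_square algebra_simps)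
      also have "\<dots> \<le> exp (- q / 2) ^ 2"
        using q01 by (intro power_mono exp_ge_add_one_self) auto
      also have "\<dots> = exp (- q)" by (simp add: power2_eq_square flip: exp_add)
      finally show ?thesis .
    qed
    ultimately show False by simp
  qed
  then show ?thesis using q by simp
qed

section \<open>The law of the messages\<close>

lemma tree_message_incseq: "incseq (\<lambda>d. pmf (tree_message d) (Some y))"
  unfolding incseq_Suc_iff using tree_message_mono by blast

definition limit_weight :: "field \<Rightarrow> real" where
  "limit_weight y = lim (\<lambda>d. pmf (tree_message d) (Some y))"

lemma limit_weight_tendsto: "(\<lambda>d. pmf (tree_message d) (Some y)) \<longlonglongrightarrow> limit_weight y"
proof -
  obtain L where "(\<lambda>d. pmf (tree_message d) (Some y)) \<longlonglongrightarrow> L"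
    by (rule incseq_convergent[OF tree_message_incseq, of y 1]) (auto simp: pmf_le_1)
  then show ?thesis unfolding limit_weight_def by (simp add: limI)
qed

lemma limit_weight_ge: "pmf (tree_message d) (Some y) \<le> limit_weight y"
  by (rule incseq_le[OF tree_message_incseq limit_weight_tendsto])

lemma limit_weight_nonneg: "0 \<le> limit_weight y"
  using limit_weight_ge[of 0 y] pmf_nonneg[of "tree_message 0" "Some y"] by linarith

text \<open>No mass is lost in the limit, by extinction and monotone convergence.\<close>

lemma nn_integral_limit_weight: "(\<integral>\<^sup>+y. ennreal (limit_weight y) \<partial>count_space UNIV) = 1"
proof -
  have sup: "ennreal (limit_weight y) = (SUP d. ennreal (pmf (tree_message d) (Some y)))" for y
  proof (rule LIMSEQ_unique)
    show "(\<lambda>d. ennreal (pmf (tree_message d) (Some y))) \<longlonglongrightarrow> ennreal (limit_weight y)"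
      by (intro tendsto_ennrealI limit_weight_tendsto)
    show "(\<lambda>d. ennreal (pmf (tree_message d) (Some y))) \<longlonglongrightarrow> (SUP d. ennreal (pmf (tree_message d) (Some y)))"
      by (intro LIMSEQ_SUP) (auto simp: incseq_def intro!: ennreal_leI dest: incseqD[OF tree_message_incseq])
  qed
  have "(\<integral>\<^sup>+y. ennreal (limit_weight y) \<partial>count_space UNIV) =
      (SUP d. (\<integral>\<^sup>+y. ennreal (pmf (tree_message d) (Some y)) \<partial>count_space UNIV))"
    unfolding sup
    by (rule nn_integral_monotone_convergence_SUP)
       (auto simp: incseq_def le_fun_def intro!: ennreal_leI dest: incseqD[OF tree_message_incseq])
  also have "\<dots> = (SUP d. ennreal (1 - survival d))"
    by (simp only: nn_integral_tree_message)
  also have "\<dots> = 1"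
  proof (rule LIMSEQ_unique)
    show "(\<lambda>d. ennreal (1 - survival d)) \<longlonglongrightarrow> (SUP d. ennreal (1 - survival d))"
    proof (rule LIMSEQ_SUP)
      show "incseq (\<lambda>d. ennreal (1 - survival d))"
        unfolding incseq_Suc_iff using survival_antimono by (auto intro!: ennreal_leI)
    qed
    have "(\<lambda>d. ennreal (1 - survival d)) \<longlonglongrightarrow> ennreal (1 - 0)"
      by (intro tendsto_ennrealI tendsto_diff tendsto_const survival_tendsto_0)
    then show "(\<lambda>d. ennreal (1 - survival d)) \<longlonglongrightarrow> 1" by simp
  qed
  finally show ?thesis .
qed

text \<open>The law of the message at the root of the complete tree.\<close>

definition field_pmf :: "field pmf" where
  "field_pmf = embed_pmf limit_weight"

lemma pmf_field_pmf: "pmf field_pmf y = limit_weight y"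
  unfolding field_pmf_def by (rule pmf_embed_pmf) (auto simp: limit_weight_nonneg nn_integral_limit_weight)

lemma tree_message_le_field_pmf: "pmf (tree_message d) (Some y) \<le> pmf field_pmf y"
  by (simp add: pmf_field_pmf limit_weight_ge)

lemma tree_message_tendsto: "(\<lambda>d. pmf (tree_message d) (Some y)) \<longlonglongrightarrow> pmf field_pmf y"
  by (simp add: pmf_field_pmf limit_weight_tendsto)

text \<open>The principle by which lower bounds suffice throughout: both sides have total mass one.\<close>

lemma pmf_eq_of_le:
  assumes "\<And>y. pmf M y \<le> pmf N y"
  shows "M = N"
proof (rule pmf_eqI, rule antisym)
  fix y
  have "measure_pmf.prob M (- {y}) \<le> measure_pmf.prob N (- {y})"
    using prob_le_inj[of "\<lambda>x. x" "- {y}" M N] assms by simp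
  then show "pmf N y \<le> pmf M y"
    using measure_pmf.prob_compl[of "{y}" M] measure_pmf.prob_compl[of "{y}" N]
    by (simp add: measure_pmf_single Compl_eq_Diff_UNIV)
qed (rule assms)

text \<open>Letting \<open>d\<close> tend to infinity in the recursion for truncated trees gives an inequality between
  weights, hence equality.\<close>

theorem field_pmf_fixed_point:
  "map_pmf (message \<beta>) (config_law (\<alpha> * p) (p - 1) field_pmf) = field_pmf"
proof (rule pmf_eq_of_le[symmetric])
  fix y
  have "pmf (tree_message (Suc d)) (Some y) \<le> pmf (map_pmf (message \<beta>) (config_law (\<alpha> * p) (p - 1) field_pmf)) y" for d
  proof -
    have "measure_pmf.prob (config_law (\<alpha> * p) (p - 1) (tree_message d)) (some_config ` {cs. message \<beta> cs = y}) \<le>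
      measure_pmf.prob (config_law (\<alpha> * p) (p - 1) field_pmf) {cs. message \<beta> cs = y}"
    proof (rule prob_le_inj)
      fix cs
      show "pmf (config_law (\<alpha> * p) (p - 1) (tree_message d)) (some_config cs) \<le> pmf (config_law (\<alpha> * p) (p - 1) field_pmf) cs"
        unfolding pmf_config_law_some[OF \<alpha>p] pmf_config_law[OF \<alpha>p]
        by (rule config_weight_mono[OF \<alpha>p, THEN conjunct2]) (simp add: tree_message_le_field_pmf)
    qed (rule inj_on_subset[OF inj_some_config subset_UNIV])
    then show ?thesis unfolding pmf_tree_message_Suc by (simp add: pmf_map vimage_def)
  qed
  then show "pmf field_pmf y \<le> pmf (map_pmf (message \<beta>) (config_law (\<alpha> * p) (p - 1) field_pmf)) y"
    by (intro LIMSEQ_le_const2[OF LIMSEQ_Suc[OF tree_message_tendsto]]) auto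
qed

section \<open>Local limit of the Gibbs measure\<close>

text \<open>Removing a site changes the mean number of edges by a bounded amount. The local limit is
  therefore proved for all mean numbers \<open>s N\<close> of edges with the right density at once.\<close>

definition rate_seq :: "(nat \<Rightarrow> real) \<Rightarrow> bool" where
  "rate_seq s \<longleftrightarrow> (\<lambda>N. s N / real N) \<longlonglongrightarrow> \<alpha>"

lemma rate_seq_pos: "rate_seq s \<Longrightarrow> \<forall>\<^sub>F N in sequentially. s N > 0"
proof -
  assume "rate_seq s"
  then have "\<forall>\<^sub>F N in sequentially. s N / real N > 0"
    unfolding rate_seq_def using \<alpha> by (rule order_tendstoD)
  then show ?thesis
    by eventually_elim (auto simp: zero_less_divide_iff)
qed

text \<open>Uniformity in the sites holds by symmetry, and it is needed because the sites met by the
  edges of a removed site are random.\<close>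

definition factor_liminf_ge :: "field list \<Rightarrow> real \<Rightarrow> bool" where
  "factor_liminf_ge xs c \<longleftrightarrow> (\<forall>s. rate_seq s \<longrightarrow> (\<forall>e>0. \<forall>\<^sub>F N in sequentially.
     \<forall>vs. distinct vs \<and> set vs \<subseteq> {1..N} \<and> length vs = length xs \<longrightarrow> factor_prob p \<Theta> \<beta> N (s N) vs xs \<ge> c - e))"

lemma factor_liminf_ge_mono: "factor_liminf_ge xs c \<Longrightarrow> c' \<le> c \<Longrightarrow> factor_liminf_ge xs c'"
  unfolding factor_liminf_ge_def
proof (intro allI impI)
  fix s e assume a: "\<forall>s. rate_seq s \<longrightarrow> (\<forall>e>0. \<forall>\<^sub>F N in sequentially.
     \<forall>vs. distinct vs \<and> set vs \<subseteq> {1..N} \<and> length vs = length xs \<longrightarrow> c - e \<le> factor_prob p \<Theta> \<beta> N (s N) vs xs)"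
    "c' \<le> c" "rate_seq s" "0 < (e::real)"
  then have "\<forall>\<^sub>F N in sequentially.
     \<forall>vs. distinct vs \<and> set vs \<subseteq> {1..N} \<and> length vs = length xs \<longrightarrow> c - e \<le> factor_prob p \<Theta> \<beta> N (s N) vs xs" by blast
  then show "\<forall>\<^sub>F N in sequentially.
     \<forall>vs. distinct vs \<and> set vs \<subseteq> {1..N} \<and> length vs = length xs \<longrightarrow> c' - e \<le> factor_prob p \<Theta> \<beta> N (s N) vs xs"
    by eventually_elim (use a(2) in force)
qed

lemma factor_liminf_ge_slack:
  assumes "\<And>e. e > 0 \<Longrightarrow> factor_liminf_ge xs (c - e)"
  shows "factor_liminf_ge xs c"
  unfolding factor_liminf_ge_def
proof (intro allI impI)
  fix s e assume a: "rate_seq s" "0 < (e::real)"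
  then have "\<forall>\<^sub>F N in sequentially.
     \<forall>vs. distinct vs \<and> set vs \<subseteq> {1..N} \<and> length vs = length xs \<longrightarrow> (c - e / 2) - e / 2 \<le> factor_prob p \<Theta> \<beta> N (s N) vs xs"
    using assms[of "e / 2"] unfolding factor_liminf_ge_def by (meson half_gt_zero)
  then show "\<forall>\<^sub>F N in sequentially.
     \<forall>vs. distinct vs \<and> set vs \<subseteq> {1..N} \<and> length vs = length xs \<longrightarrow> c - e \<le> factor_prob p \<Theta> \<beta> N (s N) vs xs"
    by eventually_elim simp
qed

lemma factor_prob_nonneg: "factor_prob p \<Theta> \<beta> N s vs xs \<ge> 0"
  by (simp add: factor_prob_def)

lemma factor_liminf_ge_nonpos:
  assumes "c \<le> 0"
  shows "factor_liminf_ge xs c"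
  unfolding factor_liminf_ge_def
proof (intro allI impI always_eventually)
  fix s :: "nat \<Rightarrow> real" and e :: real and N vs assume "0 < e"
  then show "c - e \<le> factor_prob p \<Theta> \<beta> N (s N) vs xs"
    using assms factor_prob_nonneg[of N "s N" vs xs] by linarith
qed

lemma factor_liminf_ge_Nil: "factor_liminf_ge [] 1"
  unfolding factor_liminf_ge_def factor_prob_def by (auto simp: factorizes_Nil)

lemma factor_liminf_ge_swap:
  assumes "factor_liminf_ge (xs @ ys) c"
  shows "factor_liminf_ge (ys @ xs) c"
  unfolding factor_liminf_ge_def
proof (intro allI impI)
  fix s e assume a: "rate_seq s" "0 < (e::real)"
  then have "\<forall>\<^sub>F N in sequentially.
     \<forall>vs. distinct vs \<and> set vs \<subseteq> {1..N} \<and> length vs = length (xs @ ys) \<longrightarrow> c - e \<le> factor_prob p \<Theta> \<beta> N (s N) vs (xs @ ys)"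
    using assms unfolding factor_liminf_ge_def by blast
  then show "\<forall>\<^sub>F N in sequentially.
     \<forall>vs. distinct vs \<and> set vs \<subseteq> {1..N} \<and> length vs = length (ys @ xs) \<longrightarrow> c - e \<le> factor_prob p \<Theta> \<beta> N (s N) vs (ys @ xs)"
  proof eventually_elim
    case (elim N)
    show ?case
    proof (intro allI impI)
      fix vs assume vs: "distinct vs \<and> set vs \<subseteq> {1..N} \<and> length vs = length (ys @ xs)"
      define v1 v2 where "v1 = take (length ys) vs" and "v2 = drop (length ys) vs"
      have v: "vs = v1 @ v2" "length v1 = length ys" "length v2 = length xs"
        using vs by (auto simp: v1_def v2_def)
      have "c - e \<le> factor_prob p \<Theta> \<beta> N (s N) (v2 @ v1) (xs @ ys)"
        by (rule elim[rule_format]) (use vs v in auto)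
      also have "\<dots> \<le> factor_prob p \<Theta> \<beta> N (s N) vs (ys @ xs)"
        unfolding factor_prob_def v(1) using factorizes_swap[of \<beta> N _ v2 v1 xs ys] v
        by (intro measure_pmf.finite_measure_mono) auto
      finally show "c - e \<le> factor_prob p \<Theta> \<beta> N (s N) vs (ys @ xs)" .
    qed
  qed
qed

text \<open>Along a sequence \<open>s\<close> of rates the number of edges at a site is only asymptotically Poisson
  with mean \<open>\<alpha>p\<close>.\<close>

lemma tendsto_pmf_poisson:
  assumes "c \<longlonglongrightarrow> r" "r > 0"
  shows "(\<lambda>N. pmf (poisson_pmf (c N)) k) \<longlonglongrightarrow> pmf (poisson_pmf r) k"
proof -
  have "\<forall>\<^sub>F N in sequentially. c N > 0" by (rule order_tendstoD(1)[OF assms])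
  then have ev: "\<forall>\<^sub>F N in sequentially. c N ^ k / fact k * exp (- c N) = pmf (poisson_pmf (c N)) k"
    by eventually_elim simp
  have "(\<lambda>N. c N ^ k / fact k * exp (- c N)) \<longlonglongrightarrow> r ^ k / fact k * exp (- r)"
    using assms(1) by (intro tendsto_intros) auto
  then show ?thesis using ev assms(2) by (simp add: Lim_transform_eventually)
qed

lemma attached_liminf:
  assumes s: "rate_seq s" and c: "c \<longlonglongrightarrow> r" "r > 0"
    and cs: "\<And>e. e \<in> set cs \<Longrightarrow> length (snd e) = k"
    and L: "factor_liminf_ge (concat (map snd cs) @ ys) L" "L \<ge> 0"
    and e: "e > 0"
  shows "\<forall>\<^sub>F N in sequentially. \<forall>us. set us \<subseteq> {1..N} \<and> distinct us \<and> length us = length ys \<longrightarrow>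
    measure_pmf.prob (pair_pmf (poisson_list (c N) (rooted_edges k \<Theta> N)) (graph_law p \<Theta> N (s N))) (attached \<beta> k N us ys cs)
    \<ge> pmf (poisson_pmf r) (length cs) * prod_list (map (pmf \<Theta> \<circ> fst) cs) * L - e"
proof -
  define w where "w = prod_list (map (pmf \<Theta> \<circ> fst) cs)"
  have w0: "w \<ge> 0" unfolding w_def by (intro prod_list_nonneg) auto
  define M where "M = length ys + length cs * k"
  define e' where "e' = e / (2 * (1 + w))"
  have e': "e' > 0" using e w0 by (simp add: e'_def)
  have L': "\<forall>\<^sub>F N in sequentially. \<forall>vs. distinct vs \<and> set vs \<subseteq> {1..N} \<and> length vs = length (concat (map snd cs) @ ys) \<longrightarrow>
      factor_prob p \<Theta> \<beta> N (s N) vs (concat (map snd cs) @ ys) \<ge> L - e'"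
    using L(1) s e' unfolding factor_liminf_ge_def by blast
  let ?lo = "\<lambda>N. pmf (poisson_pmf (c N)) (length cs) * (w * avoid_prob k N M ^ length cs) * max 0 (L - e')"
  have "?lo \<longlonglongrightarrow> pmf (poisson_pmf r) (length cs) * (w * 1 ^ length cs) * max 0 (L - e')"
    by (intro tendsto_intros tendsto_pmf_poisson c avoid_prob_tendsto)
  moreover have "pmf (poisson_pmf r) (length cs) * (w * 1 ^ length cs) * max 0 (L - e')
      > pmf (poisson_pmf r) (length cs) * w * L - e"
  proof -
    have q: "pmf (poisson_pmf r) (length cs) \<le> 1" "0 \<le> pmf (poisson_pmf r) (length cs)"
      by (rule pmf_le_1, rule pmf_nonneg)
    have "pmf (poisson_pmf r) (length cs) * w * e' \<le> 1 * w * e'"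
      using q w0 e' by (intro mult_right_mono) auto
    also have "\<dots> < e"
    proof -
      have "w * e < (2 * (1 + w)) * e" using e w0 by (intro mult_strict_right_mono) auto
      then show ?thesis using w0 by (simp add: e'_def divide_less_eq mult.commute)
    qed
    finally have "pmf (poisson_pmf r) (length cs) * w * e' < e" .
    moreover have "pmf (poisson_pmf r) (length cs) * w * max 0 (L - e') \<ge> pmf (poisson_pmf r) (length cs) * w * (L - e')"
      using q w0 by (intro mult_left_mono) auto
    ultimately show ?thesis by (simp add: algebra_simps del: pmf_poisson)
  qed
  ultimately have "\<forall>\<^sub>F N in sequentially. ?lo N > pmf (poisson_pmf r) (length cs) * w * L - e"
    by (rule order_tendstoD)
  moreover have "\<forall>\<^sub>F N in sequentially. c N > 0" by (rule order_tendstoD(1)[OF c])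
  ultimately show ?thesis using L' eventually_ge_at_top[of k]
  proof eventually_elim
    case (elim N)
    show ?case
    proof (intro allI impI)
      fix us assume us: "set us \<subseteq> {1..N} \<and> distinct us \<and> length us = length ys"
      have "pmf (poisson_pmf (c N)) (length cs) * (prod_list (map (pmf \<Theta> \<circ> fst) cs)
        * avoid_prob k N (length us + length cs * k) ^ length cs) * max 0 (L - e') \<le>
        measure_pmf.prob (pair_pmf (poisson_list (c N) (rooted_edges k \<Theta> N)) (graph_law p \<Theta> N (s N))) (attached \<beta> k N us ys cs)"
      proof (rule prob_attached)
        show "k \<le> N" "0 < c N" by (rule elim(4), rule elim(2))
        show "set us \<subseteq> {1..N}" "distinct us" "length us = length ys" using us by simp_all
        show "length (snd d) = k" if "d \<in> set cs" for d by (rule cs[OF that])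
        show "max 0 (L - e') \<le> factor_prob p \<Theta> \<beta> N (s N) vs (concat (map snd cs) @ ys)"
          if "distinct vs" "set vs \<subseteq> {1..N}" "length vs = length (concat (map snd cs) @ ys)" for vs
          using elim(3)[rule_format, of vs] that factor_prob_nonneg[of N "s N" vs "concat (map snd cs) @ ys"]
          by (intro max.boundedI) blast+
      qed simp
      then show "pmf (poisson_pmf r) (length cs) * prod_list (map (pmf \<Theta> \<circ> fst) cs) * L - e
        \<le> measure_pmf.prob (pair_pmf (poisson_list (c N) (rooted_edges k \<Theta> N)) (graph_law p \<Theta> N (s N))) (attached \<beta> k N us ys cs)"
        using elim(1) us unfolding w_def M_def by simp
    qed
  qed
qed

lemma removed_rate:
  assumes "rate_seq s"
  shows "rate_seq (\<lambda>N. s (Suc N) * (1 - p / Suc N))" and "(\<lambda>N. s (Suc N) * (p / Suc N)) \<longlonglongrightarrow> \<alpha> * p"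
proof -
  have s: "(\<lambda>N. s (Suc N) / real (Suc N)) \<longlonglongrightarrow> \<alpha>"
    by (rule LIMSEQ_Suc[OF assms[unfolded rate_seq_def]])
  have "(\<lambda>N. s (Suc N) / real (Suc N) * p) \<longlonglongrightarrow> \<alpha> * p"
    by (rule tendsto_mult[OF s tendsto_const])
  then show c: "(\<lambda>N. s (Suc N) * (p / Suc N)) \<longlonglongrightarrow> \<alpha> * p"
    by (simp only: times_divide_eq_left times_divide_eq_right)
  have 1: "(\<lambda>N. s (Suc N) / real (Suc N) * (real (Suc N) / real N)) \<longlonglongrightarrow> \<alpha> * 1"
    by (rule tendsto_mult[OF s LIMSEQ_Suc_n_over_n])
  have 2: "(\<lambda>N. s (Suc N) * (p / Suc N) / real N) \<longlonglongrightarrow> 0"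
    by (rule real_tendsto_divide_at_top[OF c filterlim_real_sequentially])
  have "(\<lambda>N. s (Suc N) / real (Suc N) * (real (Suc N) / real N) - s (Suc N) * (p / Suc N) / real N) \<longlonglongrightarrow> \<alpha> * 1 - 0"
    by (rule tendsto_diff[OF 1 2])
  moreover have "s (Suc N) / real (Suc N) * (real (Suc N) / real N) - s (Suc N) * (p / Suc N) / real N
      = s (Suc N) * (1 - p / Suc N) / real N" for N
  proof -
    have "s (Suc N) / real (Suc N) * (real (Suc N) / real N) = s (Suc N) / real N" by (simp del: of_nat_Suc)
    then show ?thesis by (simp only: right_diff_distrib mult_1_right diff_divide_distrib)
  qed
  ultimately have "(\<lambda>N. s (Suc N) * (1 - p / Suc N) / real N) \<longlonglongrightarrow> \<alpha> * 1 - 0"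
    by (simp only:)
  then show "rate_seq (\<lambda>N. s (Suc N) * (1 - p / Suc N))"
    by (simp only: rate_seq_def mult_1_right diff_zero)
qed

lemma set_pmf_poisson_rooted:
  assumes "k \<le> N" "es \<in> set_pmf (poisson_list c (rooted_edges k \<Theta> N))" "e \<in> set es"
  shows "fst e \<in> set_pmf \<Theta>" "snd e \<in> tuples k {1..N}"
proof -
  have "e \<in> set_pmf (rooted_edges k \<Theta> N)" using set_poisson_list[OF assms(2)] assms(3) by blast
  then have "e \<in> set_pmf \<Theta> \<times> tuples k {1..N}"
    by (simp only: set_pair_pmf set_pmf_tuples[OF assms(1)])
  then show "fst e \<in> set_pmf \<Theta>" "snd e \<in> tuples k {1..N}"
    by (simp_all only: mem_Times_iff)
qed

text \<open>By symmetry the site that is to carry \<open>y\<close> may be taken to be the last one. It is removed and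
  reattached. Each configuration in \<open>C\<close> gives it the field \<open>y\<close>, and different configurations occur
  on disjoint events.\<close>

lemma factor_liminf_step:
  assumes C: "finite C" "\<And>cs. cs \<in> C \<Longrightarrow> message \<beta> cs = y"
    "\<And>cs e. cs \<in> C \<Longrightarrow> e \<in> set cs \<Longrightarrow> length (snd e) = p - 1"
    and L: "\<And>cs. cs \<in> C \<Longrightarrow> factor_liminf_ge (concat (map snd cs) @ ys) (L cs)" "\<And>cs. cs \<in> C \<Longrightarrow> L cs \<ge> 0"
  shows "factor_liminf_ge (y # ys)
    (\<Sum>cs\<in>C. pmf (poisson_pmf (\<alpha> * p)) (length cs) * prod_list (map (pmf \<Theta> \<circ> fst) cs) * L cs)"
  unfolding factor_liminf_ge_def
proof (intro allI impI)
  fix s e assume s: "rate_seq s" and e: "0 < (e::real)"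
  define w where "w cs = pmf (poisson_pmf (\<alpha> * p)) (length cs) * prod_list (map (pmf \<Theta> \<circ> fst) cs) * L cs" for cs
  define e' where "e' = e / (1 + real (card C))"
  have e': "e' > 0" "real (card C) * e' \<le> e" using e by (auto simp: e'_def field_simps)
  define s' where "s' N = s (Suc N) * (1 - p / Suc N)" for N
  define c where "c N = s (Suc N) * (p / Suc N)" for N
  define J where "J N = pair_pmf (poisson_list (c N) (rooted_edges (p - 1) \<Theta> N)) (graph_law p \<Theta> N (s' N))" for N
  have s': "rate_seq s'" and c: "c \<longlonglongrightarrow> \<alpha> * p"
    using removed_rate[OF s] unfolding s'_def c_def by simp_all
  have "\<forall>\<^sub>F N in sequentially. \<forall>cs\<in>C. \<forall>us. set us \<subseteq> {1..N} \<and> distinct us \<and> length us = length ys \<longrightarrow>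
      measure_pmf.prob (J N) (attached \<beta> (p - 1) N us ys cs) \<ge> w cs - e'"
    unfolding J_def w_def
    by (intro eventually_ball_finite[OF C(1)] ballI attached_liminf[OF s' c \<alpha>p] C(3) L e'(1))
  moreover have "\<forall>\<^sub>F N in sequentially. s (Suc N) > 0"
    using rate_seq_pos[OF s] by (simp add: eventually_sequentially_Suc[of "\<lambda>N. s N > 0"])
  moreover have "\<forall>\<^sub>F N in sequentially. N \<ge> p + length ys" by (rule eventually_ge_at_top)
  ultimately have "\<forall>\<^sub>F N in sequentially. \<forall>vs. distinct vs \<and> set vs \<subseteq> {1..Suc N} \<and> length vs = length (y # ys) \<longrightarrow>
      factor_prob p \<Theta> \<beta> (Suc N) (s (Suc N)) vs (y # ys) \<ge> (\<Sum>cs\<in>C. w cs) - e"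
  proof eventually_elim
    case (elim N)
    define us where "us = [1..<length ys + 1]"
    have us: "distinct us" "length us = length ys" by (simp_all add: us_def del: upt_Suc)
    have us1: "set us \<subseteq> {1..N}" using elim(3) unfolding us_def set_upt by auto
    note us = us1 us
    have pN: "p \<le> N" "p \<ge> 1" "p - 1 \<le> N" using elim(3) p2 by auto
    have law: "graph_law p \<Theta> (Suc N) (s (Suc N)) = map_pmf (\<lambda>(es, H). star_energy (Suc N) es + H) (J N)"
      unfolding J_def c_def s'_def by (rule graph_law_remove_vertex[OF pN(2,1) exch elim(2)])
    have disj: "disjoint_family_on (attached \<beta> (p - 1) N us ys) C"
      unfolding disjoint_family_on_def
    proof (intro ballI impI)
      fix cs cs' assume a: "cs \<in> C" "cs' \<in> C" "cs \<noteq> cs'"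
      have "x \<notin> attached \<beta> (p - 1) N us ys cs'" if "x \<in> attached \<beta> (p - 1) N us ys cs" for x
        using attached_disjoint[OF _ _ _ that, of cs'] C(3) a \<beta> by blast
      then show "attached \<beta> (p - 1) N us ys cs \<inter> attached \<beta> (p - 1) N us ys cs' = {}" by blast
    qed
    have "(\<Sum>cs\<in>C. w cs) - e \<le> (\<Sum>cs\<in>C. w cs) - real (card C) * e'" using e' by simp
    also have "\<dots> = (\<Sum>cs\<in>C. w cs - e')" by (simp add: sum_subtractf)
    also have "\<dots> \<le> (\<Sum>cs\<in>C. measure_pmf.prob (J N) (attached \<beta> (p - 1) N us ys cs))"
      using elim(1) us by (intro sum_mono) auto
    also have "\<dots> = measure_pmf.prob (J N) (\<Union>cs\<in>C. attached \<beta> (p - 1) N us ys cs)"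
      using C(1) disj by (intro measure_pmf.finite_measure_finite_Union[symmetric]) auto
    also have "\<dots> = measure_pmf.prob (J N) ((\<Union>cs\<in>C. attached \<beta> (p - 1) N us ys cs) \<inter> set_pmf (J N))"
      by (simp add: measure_Int_set_pmf)
    also have "\<dots> \<le> measure_pmf.prob (J N) ((\<lambda>(es, H). star_energy (Suc N) es + H) -`
        {H. factorizes \<beta> (Suc N) H (Suc N # us) (y # ys)})"
    proof (rule measure_pmf.finite_measure_mono)
      show "(\<Union>cs\<in>C. attached \<beta> (p - 1) N us ys cs) \<inter> set_pmf (J N) \<subseteq>
        (\<lambda>(es, H). star_energy (Suc N) es + H) -` {H. factorizes \<beta> (Suc N) H (Suc N # us) (y # ys)}"
      proof clarify
        fix es H cs assume cs: "cs \<in> C" and att: "(es, H) \<in> attached \<beta> (p - 1) N us ys cs"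
          and supp: "(es, H) \<in> set_pmf (J N)"
        have fac: "factorizes \<beta> N H (concat (map snd es) @ us) (concat (map snd cs) @ ys)"
          and tup: "\<And>e. e \<in> set es \<Longrightarrow> snd e \<in> tuples (p - 1) {1..N}"
          using att by (auto simp: attached_def)
        have "supported N H" using supp supported_graph_law[OF pN(1)] by (auto simp: J_def)
        moreover have "set (concat (map snd es)) \<subseteq> {1..N}" using tup by (fastforce simp: tuples_def)
        moreover have "list_all2 (\<lambda>(\<theta>, vs) (\<theta>', c). \<theta> = \<theta>' \<and> length vs = length c) es cs"
          by (rule attached_match[OF att]) (use C(3) cs in auto)
        ultimately have "factorizes \<beta> (Suc N) (star_energy (Suc N) es + H) (Suc N # us) (message \<beta> cs # ys)"
          using attach_star(2)[OF _ _ fac us(3)] \<beta> us by blast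
        then show "(es, H) \<in> (\<lambda>(es, H). star_energy (Suc N) es + H) -` {H. factorizes \<beta> (Suc N) H (Suc N # us) (y # ys)}"
          using C(2)[OF cs] by simp
      qed
    qed simp
    also have "\<dots> = factor_prob p \<Theta> \<beta> (Suc N) (s (Suc N)) (Suc N # us) (y # ys)"
      unfolding factor_prob_def law by simp
    finally have main: "(\<Sum>cs\<in>C. w cs) - e \<le> factor_prob p \<Theta> \<beta> (Suc N) (s (Suc N)) (Suc N # us) (y # ys)" .
    show ?case
    proof (intro allI impI)
      fix vs assume vs: "distinct vs \<and> set vs \<subseteq> {1..Suc N} \<and> length vs = length (y # ys)"
      have "factor_prob p \<Theta> \<beta> (Suc N) (s (Suc N)) vs (y # ys) = factor_prob p \<Theta> \<beta> (Suc N) (s (Suc N)) (Suc N # us) (y # ys)"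
        using vs us pN by (intro factor_prob_permute) auto
      then show "(\<Sum>cs\<in>C. w cs) - e \<le> factor_prob p \<Theta> \<beta> (Suc N) (s (Suc N)) vs (y # ys)" using main by simp
    qed
  qed
  then show "\<forall>\<^sub>F N in sequentially. \<forall>vs. distinct vs \<and> set vs \<subseteq> {1..N} \<and> length vs = length (y # ys) \<longrightarrow>
      (\<Sum>cs\<in>C. pmf (poisson_pmf (\<alpha> * p)) (length cs) * prod_list (map (pmf \<Theta> \<circ> fst) cs) * L cs) - e
      \<le> factor_prob p \<Theta> \<beta> N (s N) vs (y # ys)"
    unfolding w_def by (subst (asm) eventually_sequentially_Suc)
qed

lemma prod_list_mult: "prod_list (map (\<lambda>x. f x * g x) xs) = prod_list (map f xs) * (prod_list (map g xs) :: real)"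
  by (induction xs) auto

lemma prod_list_concat: "prod_list (concat xss) = (\<Prod>xs\<leftarrow>xss. prod_list xs :: real)"
  by (induction xss) auto

lemma config_weight_alt:
  assumes "\<And>e. e \<in> set cs \<Longrightarrow> length (snd e) = k"
  shows "config_weight c k m cs = pmf (poisson_pmf c) (length cs) * prod_list (map (pmf \<Theta> \<circ> fst) cs) *
     (\<Prod>x\<leftarrow>concat (map snd cs). m x)"
proof -
  have "(\<Prod>e\<leftarrow>cs. pmf \<Theta> (fst e) * (if length (snd e) = k then (\<Prod>x\<leftarrow>snd e. m x) else 0)) =
     (\<Prod>e\<leftarrow>cs. pmf \<Theta> (fst e) * (\<Prod>x\<leftarrow>snd e. m x))"
    using assms by (intro arg_cong[where f=prod_list] map_cong) auto
  also have "\<dots> = prod_list (map (pmf \<Theta> \<circ> fst) cs) * (\<Prod>e\<leftarrow>cs. \<Prod>x\<leftarrow>snd e. m x)"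
    by (simp add: prod_list_mult o_def)
  also have "(\<Prod>e\<leftarrow>cs. \<Prod>x\<leftarrow>snd e. m x) = (\<Prod>x\<leftarrow>concat (map snd cs). m x)"
    by (simp add: map_concat prod_list_concat o_def)
  finally show ?thesis by (simp only: config_weight_def mult.assoc)
qed

lemma config_weight_length:
  assumes "config_weight c k m cs \<noteq> 0" "e \<in> set cs"
  shows "length (snd e) = k"
  using assms by (auto simp: config_weight_def prod_list_zero_iff split: if_splits)

abbreviation tree_weight :: "nat \<Rightarrow> field list \<Rightarrow> real" where
  "tree_weight d xs \<equiv> (\<Prod>x\<leftarrow>xs. pmf (tree_message d) (Some x))"

lemma tree_weight_bounds: "0 \<le> tree_weight d xs" "tree_weight d xs \<le> 1"
proof -
  show "0 \<le> tree_weight d xs" by (intro prod_list_nonneg) auto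
  show "tree_weight d xs \<le> 1"
    using prod_list_mono[of xs "\<lambda>x. pmf (tree_message d) (Some x)" "\<lambda>_. 1"]
    by (simp add: pmf_le_1 map_replicate_const del: tree_message.simps)
qed

text \<open>The sites carrying \<open>xs\<close> are explored to depth \<open>d + 1\<close>, those carrying \<open>ys\<close> only to depth \<open>d\<close>. One
  site after the other is removed; the sites met by its edges need only the smaller depth, so
  that they join the second block.\<close>

lemma local_limit_step:
  assumes base: "\<And>ys. factor_liminf_ge ys (tree_weight d ys)"
  shows "factor_liminf_ge (xs @ ys) (tree_weight (Suc d) xs * tree_weight d ys)"
proof (induction xs arbitrary: ys)
  case Nil
  then show ?case using base by simp
next
  case (Cons y xs)
  define R where "R = tree_weight (Suc d) xs * tree_weight d ys"
  have R: "0 \<le> R" "R \<le> 1"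
    unfolding R_def using tree_weight_bounds mult_le_one by (blast intro: mult_nonneg_nonneg)+
  let ?Q = "config_law (\<alpha> * p) (p - 1) (tree_message d)" and ?m = "\<lambda>x. pmf (tree_message d) (Some x)"
  have "factor_liminf_ge (y # (xs @ ys)) (pmf (tree_message (Suc d)) (Some y) * R)"
  proof (rule factor_liminf_ge_slack)
    fix e :: real assume e: "e > 0"
    obtain D where D: "finite D" "D \<subseteq> some_config ` {cs. message \<beta> cs = y}" "D \<subseteq> set_pmf ?Q"
      "measure_pmf.prob ?Q D \<ge> pmf (tree_message (Suc d)) (Some y) - e"
      using prob_finite_approx[OF e] unfolding pmf_tree_message_Suc by metis
    define C where "C = some_config -` D"
    have CD: "D = some_config ` C" using D(2) unfolding C_def by auto
    have C: "finite C" unfolding C_def by (rule finite_vimageI[OF D(1) inj_some_config])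
    have Cy: "message \<beta> cs = y" if "cs \<in> C" for cs
      using that D(2) injD[OF inj_some_config] unfolding C_def by fastforce
    have Cw: "config_weight (\<alpha> * p) (p - 1) ?m cs \<noteq> 0" if "cs \<in> C" for cs
      using that D(3) unfolding C_def pmf_config_law_some[OF \<alpha>p, symmetric] by (auto simp: set_pmf_iff)
    have Cl: "length (snd e) = p - 1" if "cs \<in> C" "e \<in> set cs" for cs e
      by (rule config_weight_length[OF Cw[OF that(1)] that(2)])
    define L where "L cs = R * tree_weight d (concat (map snd cs))" for cs :: config
    have "factor_liminf_ge (y # (xs @ ys))
      (\<Sum>cs\<in>C. pmf (poisson_pmf (\<alpha> * p)) (length cs) * prod_list (map (pmf \<Theta> \<circ> fst) cs) * L cs)"
    proof (rule factor_liminf_step[OF C Cy Cl])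
      fix cs
      \<comment> \<open>The sites met by the edges at the removed site join \<open>ys\<close>, for which depth \<open>d\<close> is enough.\<close>
      have "factor_liminf_ge ((xs @ ys) @ concat (map snd cs)) (L cs)"
        using Cons.IH[of "ys @ concat (map snd cs)"] by (simp add: L_def R_def mult.assoc del: tree_message.simps)
      then show "factor_liminf_ge (concat (map snd cs) @ (xs @ ys)) (L cs)" by (rule factor_liminf_ge_swap)
      show "L cs \<ge> 0" unfolding L_def by (intro mult_nonneg_nonneg R tree_weight_bounds)
    qed
    moreover have "(\<Sum>cs\<in>C. pmf (poisson_pmf (\<alpha> * p)) (length cs) * prod_list (map (pmf \<Theta> \<circ> fst) cs) * L cs) =
      R * (\<Sum>cs\<in>C. config_weight (\<alpha> * p) (p - 1) ?m cs)"
      unfolding sum_distrib_left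
    proof (rule sum.cong[OF refl])
      fix cs assume "cs \<in> C"
      then show "pmf (poisson_pmf (\<alpha> * p)) (length cs) * prod_list (map (pmf \<Theta> \<circ> fst) cs) * L cs =
        R * config_weight (\<alpha> * p) (p - 1) ?m cs"
        by (subst config_weight_alt) (auto simp: Cl L_def simp del: tree_message.simps pmf_poisson)
    qed
    moreover have "(\<Sum>cs\<in>C. config_weight (\<alpha> * p) (p - 1) ?m cs) = measure_pmf.prob ?Q D"
      unfolding measure_measure_pmf_finite[OF D(1)] unfolding CD
      by (subst sum.reindex) (auto simp: pmf_config_law_some[OF \<alpha>p] intro: inj_on_subset[OF inj_some_config])
    ultimately have "factor_liminf_ge (y # (xs @ ys)) (R * measure_pmf.prob ?Q D)" by (simp only:)
    moreover have "pmf (tree_message (Suc d)) (Some y) * R - e \<le> R * measure_pmf.prob ?Q D"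
    proof -
      have "R * (pmf (tree_message (Suc d)) (Some y) - e) \<le> R * measure_pmf.prob ?Q D"
        using D(4) R by (intro mult_left_mono)
      moreover have "R * e \<le> e" using R e by simp
      ultimately show ?thesis by (simp add: algebra_simps del: tree_message.simps)
    qed
    ultimately show "factor_liminf_ge (y # (xs @ ys)) (pmf (tree_message (Suc d)) (Some y) * R - e)"
      by (rule factor_liminf_ge_mono)
  qed
  then show ?case by (simp add: R_def mult.assoc del: tree_message.simps)
qed

lemma local_limit_depth: "factor_liminf_ge xs (tree_weight d xs)"
proof (induction d arbitrary: xs)
  case 0
  show ?case
  proof (cases xs)
    case Nil
    then show ?thesis by (simp add: factor_liminf_ge_Nil)
  next
    case (Cons y zs)
    then show ?thesis by (intro factor_liminf_ge_nonpos) simp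
  qed
next
  case (Suc d)
  show ?case using local_limit_step[OF Suc, of xs "[]"] by (simp del: tree_message.simps)
qed

text \<open>The Gibbs measure at finitely many sites asymptotically factorizes, with independent effective
  fields of law \<open>field_pmf\<close>; the bounds are sharp because they sum to one over all \<open>xs\<close> of a given
  length.\<close>

theorem local_limit: "factor_liminf_ge xs (\<Prod>x\<leftarrow>xs. pmf field_pmf x)"
proof (rule factor_liminf_ge_slack)
  fix e :: real assume e: "e > 0"
  have "(\<lambda>d. tree_weight d xs) \<longlonglongrightarrow> (\<Prod>x\<leftarrow>xs. pmf field_pmf x)"
  proof (induction xs)
    case (Cons x xs)
    show ?case using tendsto_mult[OF tree_message_tendsto Cons] by simp
  qed simp
  then have "\<forall>\<^sub>F d in sequentially. tree_weight d xs > (\<Prod>x\<leftarrow>xs. pmf field_pmf x) - e"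
    using e by (intro order_tendstoD) auto
  then obtain d where "tree_weight d xs > (\<Prod>x\<leftarrow>xs. pmf field_pmf x) - e"
    by (auto simp: eventually_sequentially)
  then show "factor_liminf_ge xs ((\<Prod>x\<leftarrow>xs. pmf field_pmf x) - e)"
    using factor_liminf_ge_mono[OF local_limit_depth[of xs d]] by simp
qed

end

section \<open>Convergence of the mean free energy\<close>

lemma cesaro_increments:
  fixes f :: "nat \<Rightarrow> real"
  assumes "(\<lambda>N. f (Suc N) - f N) \<longlonglongrightarrow> L"
  shows "(\<lambda>N. f N / real N) \<longlonglongrightarrow> L"
proof (rule LIMSEQ_I)
  fix e :: real assume e: "e > 0"
  then obtain K where K: "\<And>N. N \<ge> K \<Longrightarrow> \<bar>f (Suc N) - f N - L\<bar> < e / 2"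
    using LIMSEQ_D[OF assms, of "e / 2"] by auto
  have ind: "\<bar>f N - f K - L * real (N - K)\<bar> \<le> e / 2 * real (N - K)" if "N \<ge> K" for N
    using that
  proof (induction N rule: dec_induct)
    case (step N)
    have n: "real (Suc N - K) = real (N - K) + 1" using step by (simp add: Suc_diff_le)
    have "f (Suc N) - f K - L * real (Suc N - K) = (f N - f K - L * real (N - K)) + (f (Suc N) - f N - L)"
      unfolding n by (simp add: algebra_simps)
    moreover have "e / 2 * real (Suc N - K) = e / 2 * real (N - K) + e / 2"
      unfolding n by (simp add: algebra_simps)
    ultimately show ?case using step.IH K[OF step(1)] by linarith
  qed simp
  define D where "D = \<bar>f K\<bar> + \<bar>L\<bar> * real K"
  obtain K2 :: nat where K2: "real K2 > 2 * D / e" using reals_Archimedean2 by blast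
  show "\<exists>no. \<forall>n\<ge>no. norm (f n / real n - L) < e"
  proof (intro exI allI impI)
    fix n assume n: "n \<ge> max (max K K2) 1"
    then have nK: "n \<ge> K" "n \<ge> K2" "n \<ge> 1" by auto
    have "\<bar>f n - L * real n\<bar> \<le> \<bar>f n - f K - L * real (n - K)\<bar> + \<bar>f K - L * real K\<bar>"
      using nK by (simp add: of_nat_diff algebra_simps)
    also have "\<dots> \<le> e / 2 * real (n - K) + D"
      using ind[OF nK(1)] abs_triangle_ineq4[of "f K" "L * real K"] by (simp add: D_def abs_mult)
    also have "\<dots> < e * real n"
    proof -
      have "2 * D / e < real n" using K2 nK by (simp add: less_le_trans)
      then have "D < e / 2 * real n" using e by (simp add: field_simps)
      moreover have "e / 2 * real (n - K) \<le> e / 2 * real n" using e by (intro mult_left_mono) auto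
      ultimately show ?thesis by (simp add: field_simps)
    qed
    finally have "\<bar>f n - L * real n\<bar> < e * real n" .
    moreover have "f n / real n - L = (f n - L * real n) / real n" using nK by (simp add: field_simps)
    ultimately show "norm (f n / real n - L) < e" using nK by (simp add: divide_less_eq)
  qed
qed

lemma expectation_finite_approx:
  fixes \<phi> :: "'b \<Rightarrow> real"
  assumes "integrable (measure_pmf w) \<phi>" "e > 0"
  shows "\<exists>C. finite C \<and> C \<subseteq> set_pmf w \<and> (\<Sum>y\<in>C. pmf w y * \<phi> y) \<ge> measure_pmf.expectation w \<phi> - e"
proof -
  have ne: "set_pmf w \<noteq> {}" by (rule set_pmf_not_empty)
  define A where "A n = from_nat_into (set_pmf w) ` {..n}" for n :: nat
  have un: "(\<Union>n. A n) = set_pmf w"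
    using range_from_nat_into[OF ne] by (auto simp: A_def) blast
  have "(\<lambda>n. measure_pmf.expectation w (\<lambda>y. indicator (A n) y * \<phi> y)) \<longlonglongrightarrow> measure_pmf.expectation w \<phi>"
  proof (rule integral_dominated_convergence[where w="\<lambda>y. \<bar>\<phi> y\<bar>"])
    show "AE y in measure_pmf w. (\<lambda>n. indicator (A n) y * \<phi> y) \<longlonglongrightarrow> \<phi> y"
    proof (rule AE_pmfI)
      fix y assume "y \<in> set_pmf w"
      then obtain n where n: "y \<in> A n" using un by blast
      have "\<forall>\<^sub>F m in sequentially. indicator (A m) y * \<phi> y = \<phi> y"
        using eventually_ge_at_top[of n]
        by eventually_elim (use n in \<open>auto simp: A_def indicator_def\<close>)
      then show "(\<lambda>n. indicator (A n) y * \<phi> y) \<longlonglongrightarrow> \<phi> y" by (rule tendsto_eventually)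
    qed
    show "integrable (measure_pmf w) (\<lambda>y. \<bar>\<phi> y\<bar>)" using assms(1) by simp
  qed (auto simp: indicator_def)
  then have "\<forall>\<^sub>F n in sequentially. measure_pmf.expectation w (\<lambda>y. indicator (A n) y * \<phi> y) > measure_pmf.expectation w \<phi> - e"
    using assms(2) by (intro order_tendstoD) auto
  then obtain n where n: "measure_pmf.expectation w (\<lambda>y. indicator (A n) y * \<phi> y) > measure_pmf.expectation w \<phi> - e"
    by (auto simp: eventually_sequentially)
  have fin: "finite (A n)" by (simp add: A_def)
  have sub: "A n \<subseteq> set_pmf w" using un by blast
  have "measure_pmf.expectation w (\<lambda>y. indicator (A n) y * \<phi> y) = (\<Sum>y\<in>A n. pmf w y *\<^sub>R (indicator (A n) y * \<phi> y))"
    by (rule integral_measure_pmf[OF fin]) (auto simp: indicator_def split: if_splits)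
  also have "\<dots> = (\<Sum>y\<in>A n. pmf w y * \<phi> y)" by (intro sum.cong) auto
  finally show ?thesis using n fin sub by (intro exI[of _ "A n"]) auto
qed

text \<open>Fatou's lemma for laws \<open>\<mu> N\<close> on varying spaces, in which the disjoint events \<open>A N y\<close> take the
  place of the points \<open>y\<close> of the limit.\<close>

lemma pmf_fatou:
  fixes \<mu> :: "nat \<Rightarrow> 'a pmf" and w :: "'b pmf" and \<phi> :: "'b \<Rightarrow> real"
  assumes disj: "\<And>N y y'. y \<in> set_pmf w \<Longrightarrow> y' \<in> set_pmf w \<Longrightarrow> y \<noteq> y' \<Longrightarrow> A N y \<inter> A N y' = {}"
    and lim: "\<And>y e. y \<in> set_pmf w \<Longrightarrow> e > 0 \<Longrightarrow> \<forall>\<^sub>F N in sequentially. measure_pmf.prob (\<mu> N) (A N y) \<ge> pmf w y - e"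
    and val: "\<forall>\<^sub>F N in sequentially. integrable (measure_pmf (\<mu> N)) (f N) \<and> (\<forall>x\<in>set_pmf (\<mu> N). f N x \<ge> 0) \<and>
       (\<forall>y\<in>set_pmf w. \<forall>x\<in>A N y \<inter> set_pmf (\<mu> N). f N x = \<phi> y)"
    and int: "integrable (measure_pmf w) \<phi>" and nn: "\<And>y. y \<in> set_pmf w \<Longrightarrow> \<phi> y \<ge> 0" and e: "e > 0"
  shows "\<forall>\<^sub>F N in sequentially. measure_pmf.expectation (\<mu> N) (f N) \<ge> measure_pmf.expectation w \<phi> - e"
proof -
  obtain C where C: "finite C" "C \<subseteq> set_pmf w" "(\<Sum>y\<in>C. pmf w y * \<phi> y) \<ge> measure_pmf.expectation w \<phi> - e / 2"
    using expectation_finite_approx[OF int, of "e / 2"] e by auto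
  define S where "S = (\<Sum>y\<in>C. \<phi> y)"
  have S0: "S \<ge> 0" unfolding S_def using C nn by (intro sum_nonneg) auto
  define e' where "e' = e / (2 * (1 + S))"
  have e': "e' > 0" "e' * S \<le> e / 2" using e S0 by (auto simp: e'_def field_simps)
  have "\<forall>\<^sub>F N in sequentially. \<forall>y\<in>C. measure_pmf.prob (\<mu> N) (A N y) \<ge> pmf w y - e'"
    using C lim e' by (intro eventually_ball_finite) auto
  then show ?thesis using val
  proof eventually_elim
    case (elim N)
    have iA: "integrable (measure_pmf (\<mu> N)) (\<lambda>x. \<phi> y * indicator (A N y) x)" for y
      by (intro measure_pmf.integrable_const_bound[where B="\<bar>\<phi> y\<bar>"]) (auto simp: indicator_def)
    have "measure_pmf.expectation w \<phi> - e \<le> (\<Sum>y\<in>C. pmf w y * \<phi> y) - e' * S" using C e' by linarith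
    also have "\<dots> = (\<Sum>y\<in>C. (pmf w y - e') * \<phi> y)"
      by (simp add: S_def sum_distrib_left left_diff_distrib sum_subtractf)
    also have "\<dots> \<le> (\<Sum>y\<in>C. measure_pmf.prob (\<mu> N) (A N y) * \<phi> y)"
      using elim(1) C nn by (intro sum_mono mult_right_mono) auto
    also have "\<dots> = measure_pmf.expectation (\<mu> N) (\<lambda>x. \<Sum>y\<in>C. \<phi> y * indicator (A N y) x)"
      by (subst Bochner_Integration.integral_sum[OF iA]) (simp add: mult.commute)
    also have "\<dots> \<le> measure_pmf.expectation (\<mu> N) (f N)"
    proof (rule integral_mono_AE)
      show "AE x in measure_pmf (\<mu> N). (\<Sum>y\<in>C. \<phi> y * indicator (A N y) x) \<le> f N x"
      proof (rule AE_pmfI)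
        fix x assume x: "x \<in> set_pmf (\<mu> N)"
        show "(\<Sum>y\<in>C. \<phi> y * indicator (A N y) x) \<le> f N x"
        proof (cases "\<exists>y\<in>C. x \<in> A N y")
          case True
          then obtain y where y: "y \<in> C" "x \<in> A N y" by auto
          have "(\<Sum>z\<in>C. \<phi> z * indicator (A N z) x) = (\<Sum>z\<in>C. if z = y then \<phi> y else 0)"
            using y disj[of y] C(2) by (intro sum.cong) (auto simp: indicator_def)
          also have "\<dots> = f N x" using elim(2) y x C by auto
          finally show ?thesis by simp
        next
          case False
          then have "(\<Sum>z\<in>C. \<phi> z * indicator (A N z) x) = 0" by (intro sum.neutral) auto
          then show ?thesis using elim(2) x by simp
        qed
      qed
    qed (use elim(2) iA in auto)
    finally show ?case .
  qed
qed

text \<open>The generalized dominated convergence theorem: Fatou's lemma is applied to \<open>g + R\<close> and to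
  \<open>g - R\<close>, and the dominating functions may vary with \<open>N\<close> as long as their expectations converge.\<close>

lemma pmf_dominated_limit:
  fixes \<mu> :: "nat \<Rightarrow> 'a pmf" and w :: "'b pmf" and a b :: "'b \<Rightarrow> real"
  assumes disj: "\<And>N y y'. y \<in> set_pmf w \<Longrightarrow> y' \<in> set_pmf w \<Longrightarrow> y \<noteq> y' \<Longrightarrow> A N y \<inter> A N y' = {}"
    and lim: "\<And>y e. y \<in> set_pmf w \<Longrightarrow> e > 0 \<Longrightarrow> \<forall>\<^sub>F N in sequentially. measure_pmf.prob (\<mu> N) (A N y) \<ge> pmf w y - e"
    and val: "\<forall>\<^sub>F N in sequentially. integrable (measure_pmf (\<mu> N)) (R N) \<and> integrable (measure_pmf (\<mu> N)) (g N) \<and>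
       (\<forall>x\<in>set_pmf (\<mu> N). \<bar>R N x\<bar> \<le> g N x) \<and>
       (\<forall>y\<in>set_pmf w. \<forall>x\<in>A N y \<inter> set_pmf (\<mu> N). R N x = a y \<and> g N x = b y)"
    and int: "integrable (measure_pmf w) a" "integrable (measure_pmf w) b"
    and ab: "\<And>y. y \<in> set_pmf w \<Longrightarrow> \<bar>a y\<bar> \<le> b y"
    and g: "(\<lambda>N. measure_pmf.expectation (\<mu> N) (g N)) \<longlonglongrightarrow> measure_pmf.expectation w b"
  shows "(\<lambda>N. measure_pmf.expectation (\<mu> N) (R N)) \<longlonglongrightarrow> measure_pmf.expectation w a"
proof (rule LIMSEQ_I)
  fix e :: real assume e: "e > 0"
  have e3: "e / 3 > 0" using e by simp
  have ba: "0 \<le> b y + a y" "0 \<le> b y - a y" if "y \<in> set_pmf w" for y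
    using ab[OF that] by arith+
  have 1: "\<forall>\<^sub>F N in sequentially. measure_pmf.expectation (\<mu> N) (\<lambda>x. g N x + R N x) \<ge> measure_pmf.expectation w (\<lambda>y. b y + a y) - e / 3"
  proof (rule pmf_fatou[OF disj lim _ _ _ e3])
    show "\<forall>\<^sub>F N in sequentially. integrable (measure_pmf (\<mu> N)) (\<lambda>x. g N x + R N x) \<and>
       (\<forall>x\<in>set_pmf (\<mu> N). 0 \<le> g N x + R N x) \<and> (\<forall>y\<in>set_pmf w. \<forall>x\<in>A N y \<inter> set_pmf (\<mu> N). g N x + R N x = b y + a y)"
      using val by eventually_elim (auto intro: Bochner_Integration.integrable_add simp: abs_le_iff)
  qed (use int ba in auto)
  have 2: "\<forall>\<^sub>F N in sequentially. measure_pmf.expectation (\<mu> N) (\<lambda>x. g N x - R N x) \<ge> measure_pmf.expectation w (\<lambda>y. b y - a y) - e / 3"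
  proof (rule pmf_fatou[OF disj lim _ _ _ e3])
    show "\<forall>\<^sub>F N in sequentially. integrable (measure_pmf (\<mu> N)) (\<lambda>x. g N x - R N x) \<and>
       (\<forall>x\<in>set_pmf (\<mu> N). 0 \<le> g N x - R N x) \<and> (\<forall>y\<in>set_pmf w. \<forall>x\<in>A N y \<inter> set_pmf (\<mu> N). g N x - R N x = b y - a y)"
      using val by eventually_elim (auto intro: Bochner_Integration.integrable_diff simp: abs_le_iff)
  qed (use int ba in auto)
  have 3: "\<forall>\<^sub>F N in sequentially. \<bar>measure_pmf.expectation (\<mu> N) (g N) - measure_pmf.expectation w b\<bar> < e / 3"
    using tendstoD[OF g e3] by (simp add: dist_real_def)
  have "\<forall>\<^sub>F N in sequentially. norm (measure_pmf.expectation (\<mu> N) (R N) - measure_pmf.expectation w a) < e"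
    using 1 2 3 val
  proof eventually_elim
    case (elim N)
    have i: "integrable (measure_pmf (\<mu> N)) (R N)" "integrable (measure_pmf (\<mu> N)) (g N)" using elim(4) by auto
    have "measure_pmf.expectation (\<mu> N) (\<lambda>x. g N x + R N x) = measure_pmf.expectation (\<mu> N) (g N) + measure_pmf.expectation (\<mu> N) (R N)"
      "measure_pmf.expectation (\<mu> N) (\<lambda>x. g N x - R N x) = measure_pmf.expectation (\<mu> N) (g N) - measure_pmf.expectation (\<mu> N) (R N)"
      "measure_pmf.expectation w (\<lambda>y. b y + a y) = measure_pmf.expectation w b + measure_pmf.expectation w a"
      "measure_pmf.expectation w (\<lambda>y. b y - a y) = measure_pmf.expectation w b - measure_pmf.expectation w a"
      using i int by simp_all
    then show ?case using elim(1-3) e unfolding real_norm_def by arith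
  qed
  then show "\<exists>no. \<forall>n\<ge>no. norm (measure_pmf.expectation (\<mu> n) (R n) - measure_pmf.expectation w a) < e"
    by (simp add: eventually_sequentially)
qed

lemma partition_fn_Suc_supported:
  assumes "supported N H"
  shows "partition_fn \<beta> (Suc N) H = partition_fn \<beta> N H"
proof -
  have "H (\<sigma>(Suc N := t)) = H \<sigma>" for \<sigma> t
  proof -
    have "\<forall>i\<in>{1..N}. (\<sigma>(Suc N := t)) i = \<sigma> i" by auto
    then show ?thesis using assms unfolding supported_def by blast
  qed
  then show ?thesis by (simp add: partition_fn_def conf_avg_Suc)
qed

context critical_csp begin

definition mean_log_partition :: "nat \<Rightarrow> real \<Rightarrow> real" where
  "mean_log_partition N s = measure_pmf.expectation (graph_law p \<Theta> N s) (\<lambda>H. ln (partition_fn \<beta> N H))"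

lemma abs_sum_list_le:
  fixes f :: "'b \<Rightarrow> real"
  assumes "\<And>x. x \<in> set xs \<Longrightarrow> \<bar>f x\<bar> \<le> B"
  shows "\<bar>\<Sum>x\<leftarrow>xs. f x\<bar> \<le> B * real (length xs)"
  using assms
proof (induction xs)
  case (Cons x xs)
  then have "\<bar>f x\<bar> \<le> B" "\<bar>\<Sum>x\<leftarrow>xs. f x\<bar> \<le> B * real (length xs)" by auto
  then show ?case by (simp add: algebra_simps)
qed simp

lemma integrable_log_partition:
  assumes N: "p \<le> N" and s: "s > 0"
  shows "integrable (measure_pmf (graph_law p \<Theta> N s)) (\<lambda>H. ln (partition_fn \<beta> N H))"
  unfolding graph_law_def compound_poisson_def integrable_map_pmf_eq
proof (rule integrable_poisson_list_le[OF s])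
  fix Hs assume Hs: "Hs \<in> set_pmf (poisson_list s (edge_law p \<Theta> N))"
  have "\<bar>h \<sigma>\<bar> \<le> 1" if "h \<in> set Hs" for h \<sigma>
  proof -
    have "h \<in> set_pmf (edge_law p \<Theta> N)" using that set_poisson_list[OF Hs] by auto
    then obtain \<theta> vs where "h = (\<lambda>\<sigma>. \<theta> (map \<sigma> vs))" "\<theta> \<in> set_pmf \<Theta>" "length vs = p"
      using set_pmf_tuples[OF N] by (auto simp: edge_law_def tuples_def)
    then show ?thesis using bound_\<Theta> by simp
  qed
  then have b: "\<bar>sum_list Hs \<sigma> - (\<lambda>_. 0) \<sigma>\<bar> \<le> 1 * real (length Hs)" for \<sigma>
    unfolding sum_list_fun_apply using abs_sum_list_le[of Hs "\<lambda>h. h \<sigma>" 1] by simp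
  have "partition_fn \<beta> N (\<lambda>_. 0) = 1" by (simp add: partition_fn_def)
  then show "\<bar>ln (partition_fn \<beta> N (sum_list Hs))\<bar> \<le> \<beta> * real (length Hs)"
    using ln_partition_fn_diff[of N "sum_list Hs" "\<lambda>_. 0" "1 * real (length Hs)" \<beta>] b \<beta> by simp
qed

lemma normalized_field_pmf: "x \<in> set_pmf field_pmf \<Longrightarrow> normalized \<beta> x"
  using \<beta> by (subst (asm) field_pmf_fixed_point[symmetric]) (auto intro: normalized_message)

lemma set_config_law:
  assumes "cs \<in> set_pmf (config_law c k field_pmf)" "e \<in> set cs"
  shows "fst e \<in> set_pmf \<Theta>" "length (snd e) = k" "\<And>x. x \<in> set (snd e) \<Longrightarrow> normalized \<beta> x"
proof -
  have "e \<in> set_pmf (pair_pmf \<Theta> (replicate_pmf k field_pmf))"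
    using set_poisson_list assms unfolding config_law_def by blast
  then show "fst e \<in> set_pmf \<Theta>" "length (snd e) = k" "\<And>x. x \<in> set (snd e) \<Longrightarrow> normalized \<beta> x"
    by (auto simp: set_replicate_pmf intro: normalized_field_pmf)
qed

lemma field_avg_exp_bounds:
  assumes "\<And>x. x \<in> set xs \<Longrightarrow> normalized \<beta> x" "\<And>ss. length ss = length xs \<Longrightarrow> \<bar>h ss\<bar> \<le> 1"
  shows "exp (- \<beta>) \<le> field_avg \<beta> xs (\<lambda>ss. exp (\<beta> * h ss))" "field_avg \<beta> xs (\<lambda>ss. exp (\<beta> * h ss)) \<le> exp \<beta>"
proof -
  have h: "- \<beta> \<le> \<beta> * h ss \<and> \<beta> * h ss \<le> \<beta>" if "length ss = length xs" for ss
    using mult_left_mono[of "h ss" 1 \<beta>] mult_left_mono[of "-1" "h ss" \<beta>] assms(2)[OF that] \<beta>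
    by (simp add: abs_le_iff)
  have "field_avg \<beta> xs (\<lambda>_. exp (- \<beta>)) \<le> field_avg \<beta> xs (\<lambda>ss. exp (\<beta> * h ss))"
    by (rule field_avg_mono) (use h in simp)
  then show "exp (- \<beta>) \<le> field_avg \<beta> xs (\<lambda>ss. exp (\<beta> * h ss))"
    using field_avg_const[OF assms(1)] by simp
  have "field_avg \<beta> xs (\<lambda>ss. exp (\<beta> * h ss)) \<le> field_avg \<beta> xs (\<lambda>_. exp \<beta>)"
    by (rule field_avg_mono) (use h in simp)
  then show "field_avg \<beta> xs (\<lambda>ss. exp (\<beta> * h ss)) \<le> exp \<beta>"
    using field_avg_const[OF assms(1)] by simp
qed

lemma ln_free_edge_weight_bound:
  assumes "fst e \<in> set_pmf \<Theta>" "length (snd e) = p" "\<And>x. x \<in> set (snd e) \<Longrightarrow> normalized \<beta> x"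
  shows "\<bar>ln (free_edge_weight \<beta> e)\<bar> \<le> \<beta>"
proof -
  have b: "exp (- \<beta>) \<le> free_edge_weight \<beta> e" "free_edge_weight \<beta> e \<le> exp \<beta>"
    unfolding free_edge_weight_def using assms bound_\<Theta> by (auto intro!: field_avg_exp_bounds)
  have pos: "free_edge_weight \<beta> e > 0" using b(1) exp_gt_zero less_le_trans by blast
  have "ln (exp (- \<beta>)) \<le> ln (free_edge_weight \<beta> e)" using b pos by (subst ln_le_cancel_iff) auto
  moreover have "ln (free_edge_weight \<beta> e) \<le> ln (exp \<beta>)" using b pos by (subst ln_le_cancel_iff) auto
  ultimately show ?thesis by (simp add: abs_le_iff)
qed

lemma star_weight_bounds:
  assumes "cs \<in> set_pmf (config_law c (p - 1) field_pmf)"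
  shows "exp (- \<beta>) ^ length cs \<le> star_weight \<beta> cs t \<and> star_weight \<beta> cs t \<le> exp \<beta> ^ length cs"
proof -
  have e: "exp (- \<beta>) \<le> edge_weight \<beta> e t \<and> edge_weight \<beta> e t \<le> exp \<beta>" if "e \<in> set cs" for e t
    unfolding edge_weight_def using set_config_law[OF assms that] bound_\<Theta> p2
    by (auto intro!: field_avg_exp_bounds)
  show ?thesis
    unfolding star_weight_def
    using prod_list_mono[of cs "\<lambda>_. exp (- \<beta>)" "\<lambda>e. edge_weight \<beta> e t"] prod_list_mono[of cs "\<lambda>e. edge_weight \<beta> e t" "\<lambda>_. exp \<beta>"] e
      edge_weight_pos[of \<beta> _ t]
    by (simp add: map_replicate_const less_imp_le)
qed

lemma ln_star_weight_bound:
  assumes "cs \<in> set_pmf (config_law c (p - 1) field_pmf)"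
  shows "\<bar>ln (spin_avg (star_weight \<beta> cs))\<bar> \<le> \<beta> * real (length cs)"
proof -
  note bd = star_weight_bounds[OF assms]
  have b: "exp (- \<beta>) ^ length cs \<le> spin_avg (star_weight \<beta> cs)" "spin_avg (star_weight \<beta> cs) \<le> exp \<beta> ^ length cs"
    using spin_avg_mono[of "\<lambda>_. exp (- \<beta>) ^ length cs" "star_weight \<beta> cs"] spin_avg_mono[of "star_weight \<beta> cs" "\<lambda>_. exp \<beta> ^ length cs"] bd
    by auto
  have pos: "spin_avg (star_weight \<beta> cs) > 0" by (rule spin_avg_star_weight_pos)
  have "ln (exp (- \<beta>) ^ length cs) \<le> ln (spin_avg (star_weight \<beta> cs))" using b pos by (subst ln_le_cancel_iff) auto
  moreover have "ln (spin_avg (star_weight \<beta> cs)) \<le> ln (exp \<beta> ^ length cs)" using b pos by (subst ln_le_cancel_iff) auto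
  ultimately show ?thesis by (simp add: abs_le_iff ln_realpow mult.commute)
qed

text \<open>The number of new edges, times \<open>\<beta>\<close>, dominates the increments, and its expectation \<open>\<beta> c N\<close>
  converges; the local limit supplies the convergence of the laws.\<close>

lemma increment_limit:
  assumes s: "rate_seq s" and c: "c \<longlonglongrightarrow> r" "r > 0"
    and R: "\<forall>\<^sub>F N in sequentially. \<forall>x\<in>set_pmf (pair_pmf (poisson_list (c N) (rooted_edges k \<Theta> N)) (graph_law p \<Theta> N (s N))).
        \<bar>R N x\<bar> \<le> \<beta> * real (length (fst x)) \<and>
        (\<forall>cs\<in>set_pmf (config_law r k field_pmf). x \<in> attached \<beta> k N [] [] cs \<longrightarrow> R N x = a cs)"
    and a: "\<And>cs. cs \<in> set_pmf (config_law r k field_pmf) \<Longrightarrow> \<bar>a cs\<bar> \<le> \<beta> * real (length cs)"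
  shows "(\<lambda>N. measure_pmf.expectation (pair_pmf (poisson_list (c N) (rooted_edges k \<Theta> N)) (graph_law p \<Theta> N (s N))) (R N))
    \<longlonglongrightarrow> measure_pmf.expectation (config_law r k field_pmf) a"
proof (rule pmf_dominated_limit[where A="\<lambda>N. attached \<beta> k N [] []" and g="\<lambda>N x. \<beta> * real (length (fst x))" and b="\<lambda>cs. \<beta> * real (length cs)"])
  let ?w = "config_law r k field_pmf"
  have cpos: "\<forall>\<^sub>F N in sequentially. c N > 0" using c by (rule order_tendstoD)
  show "attached \<beta> k N [] [] y \<inter> attached \<beta> k N [] [] y' = {}"
    if "y \<in> set_pmf ?w" "y' \<in> set_pmf ?w" "y \<noteq> y'" for N y y'
  proof -
    have "x \<notin> attached \<beta> k N [] [] y'" if "x \<in> attached \<beta> k N [] [] y" for x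
      using attached_disjoint[OF _ _ _ that, of y'] set_config_law(2) \<open>y \<in> _\<close> \<open>y' \<in> _\<close> \<open>y \<noteq> y'\<close> \<beta> by (metis less_irrefl)
    then show ?thesis by blast
  qed
  show "\<forall>\<^sub>F N in sequentially. measure_pmf.prob (pair_pmf (poisson_list (c N) (rooted_edges k \<Theta> N)) (graph_law p \<Theta> N (s N)))
      (attached \<beta> k N [] [] cs) \<ge> pmf ?w cs - e" if cs: "cs \<in> set_pmf ?w" and e: "e > 0" for cs e
  proof -
    have len: "\<And>e. e \<in> set cs \<Longrightarrow> length (snd e) = k" using set_config_law(2)[OF cs] by blast
    have w: "pmf ?w cs = pmf (poisson_pmf r) (length cs) * prod_list (map (pmf \<Theta> \<circ> fst) cs) * (\<Prod>x\<leftarrow>concat (map snd cs). pmf field_pmf x)"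
      unfolding pmf_config_law[OF c(2)] by (rule config_weight_alt[OF len])
    have "factor_liminf_ge (concat (map snd cs) @ []) (\<Prod>x\<leftarrow>concat (map snd cs). pmf field_pmf x)"
      using local_limit by simp
    moreover have "0 \<le> (\<Prod>x\<leftarrow>concat (map snd cs). pmf field_pmf x)" by (intro prod_list_nonneg) auto
    ultimately have "\<forall>\<^sub>F N in sequentially. \<forall>us. set us \<subseteq> {1..N} \<and> distinct us \<and> length us = length ([] :: field list) \<longrightarrow>
      measure_pmf.prob (pair_pmf (poisson_list (c N) (rooted_edges k \<Theta> N)) (graph_law p \<Theta> N (s N))) (attached \<beta> k N us [] cs)
      \<ge> pmf ?w cs - e"
      unfolding w using len by (intro attached_liminf[OF s c _ _ _ e]) auto
    then show ?thesis by eventually_elim simp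
  qed
  have iw: "integrable (measure_pmf ?w) (\<lambda>cs. \<beta> * real (length cs))"
    unfolding config_law_def by (intro integrable_mult_right integrable_length_poisson_list[OF c(2)])
  show "integrable (measure_pmf ?w) (\<lambda>cs. \<beta> * real (length cs))" by (rule iw)
  show "integrable (measure_pmf ?w) a"
    unfolding config_law_def by (rule integrable_poisson_list_le[OF c(2)]) (rule a[unfolded config_law_def])
  have ig: "integrable (measure_pmf (pair_pmf (poisson_list c (rooted_edges k \<Theta> N)) G)) (\<lambda>x. \<beta> * real (length (fst x)))"
    if "c > 0" for c N and G :: "energy pmf"
  proof -
    have "integrable (measure_pmf (map_pmf fst (pair_pmf (poisson_list c (rooted_edges k \<Theta> N)) G))) (\<lambda>es. \<beta> * real (length es))"
      unfolding map_fst_pair_pmf by (intro integrable_mult_right integrable_length_poisson_list[OF that])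
    then show ?thesis unfolding integrable_map_pmf_eq .
  qed
  show "\<forall>\<^sub>F N in sequentially.
       integrable (measure_pmf (pair_pmf (poisson_list (c N) (rooted_edges k \<Theta> N)) (graph_law p \<Theta> N (s N)))) (R N) \<and>
       integrable (measure_pmf (pair_pmf (poisson_list (c N) (rooted_edges k \<Theta> N)) (graph_law p \<Theta> N (s N)))) (\<lambda>x. \<beta> * real (length (fst x))) \<and>
       (\<forall>x\<in>set_pmf (pair_pmf (poisson_list (c N) (rooted_edges k \<Theta> N)) (graph_law p \<Theta> N (s N))). \<bar>R N x\<bar> \<le> \<beta> * real (length (fst x))) \<and>
       (\<forall>y\<in>set_pmf ?w. \<forall>x\<in>attached \<beta> k N [] [] y \<inter> set_pmf (pair_pmf (poisson_list (c N) (rooted_edges k \<Theta> N)) (graph_law p \<Theta> N (s N))).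
           R N x = a y \<and> \<beta> * real (length (fst x)) = \<beta> * real (length y))"
    using R cpos
  proof eventually_elim
    case (elim N)
    let ?J = "pair_pmf (poisson_list (c N) (rooted_edges k \<Theta> N)) (graph_law p \<Theta> N (s N))"
    have 1: "\<forall>x\<in>set_pmf ?J. \<bar>R N x\<bar> \<le> \<beta> * real (length (fst x))" using elim(1) by blast
    have 2: "integrable (measure_pmf ?J) (R N)"
    proof (rule Bochner_Integration.integrable_bound[OF ig[OF elim(2)]])
      show "AE x in measure_pmf ?J. norm (R N x) \<le> norm (\<beta> * real (length (fst x)))"
        unfolding AE_measure_pmf_iff real_norm_def using 1 by (meson abs_ge_self order_trans)
    qed simp
    have 3: "length (fst x) = length y" if "x \<in> attached \<beta> k N [] [] y" for x y
      using that unfolding attached_def by (auto dest: map_eq_imp_length_eq)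
    show ?case using 1 2 3 ig[OF elim(2)] elim(1) by auto
  qed
  have "\<forall>\<^sub>F N in sequentially. \<beta> * c N =
      measure_pmf.expectation (pair_pmf (poisson_list (c N) (rooted_edges k \<Theta> N)) (graph_law p \<Theta> N (s N))) (\<lambda>x. \<beta> * real (length (fst x)))"
    using cpos
  proof eventually_elim
    case (elim N)
    then show ?case
      using expectation_pair_pmf_fst[of "poisson_list (c N) (rooted_edges k \<Theta> N)" "graph_law p \<Theta> N (s N)" "\<lambda>es. \<beta> * real (length es)"] \<beta>
      by (auto simp: integrable_length_poisson_list)
  qed
  moreover have "(\<lambda>N. \<beta> * c N) \<longlonglongrightarrow> \<beta> * r" by (intro tendsto_intros c)
  moreover have "measure_pmf.expectation ?w (\<lambda>cs. \<beta> * real (length cs)) = \<beta> * r"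
    unfolding config_law_def by (simp add: integrable_length_poisson_list[OF c(2)])
  ultimately show "(\<lambda>N. measure_pmf.expectation (pair_pmf (poisson_list (c N) (rooted_edges k \<Theta> N)) (graph_law p \<Theta> N (s N))) (\<lambda>x. \<beta> * real (length (fst x))))
    \<longlonglongrightarrow> measure_pmf.expectation ?w (\<lambda>cs. \<beta> * real (length cs))"
    by (auto intro: Lim_transform_eventually)
qed (rule a)

lemma expectation_diff_pair:
  assumes G': "G' = map_pmf (\<lambda>(es, H). \<phi> es H) (pair_pmf E G)"
    and "integrable (measure_pmf G') f'" "integrable (measure_pmf G) f"
  shows "measure_pmf.expectation G' f' - measure_pmf.expectation G f =
    measure_pmf.expectation (pair_pmf E G) (\<lambda>(es, H). f' (\<phi> es H) - f H :: real)"
proof -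
  have i1: "integrable (measure_pmf (pair_pmf E G)) (\<lambda>x. f' (\<phi> (fst x) (snd x)))"
    using assms(2) unfolding G' integrable_map_pmf_eq by (simp add: case_prod_unfold)
  have "integrable (measure_pmf (map_pmf snd (pair_pmf E G))) f" using assms(3) by (simp add: map_snd_pair_pmf)
  then have i2: "integrable (measure_pmf (pair_pmf E G)) (\<lambda>x. f (snd x))"
    unfolding integrable_map_pmf_eq .
  have "measure_pmf.expectation G' f' = measure_pmf.expectation (pair_pmf E G) (\<lambda>x. f' (\<phi> (fst x) (snd x)))"
    unfolding G' by (simp add: case_prod_unfold)
  then show ?thesis using i1 i2 by (simp add: case_prod_unfold)
qed

text \<open>The expectations \<open>bethe_vertex\<close> and \<open>bethe_edge\<close> are the two terms of the functional \<open>P\<close> at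
  the law \<open>field_pmf\<close>.\<close>

definition bethe_vertex :: real where
  "bethe_vertex = measure_pmf.expectation (config_law (\<alpha> * p) (p - 1) field_pmf) (\<lambda>cs. ln (spin_avg (star_weight \<beta> cs)))"

definition bethe_edge :: real where
  "bethe_edge = measure_pmf.expectation (pair_pmf \<Theta> (replicate_pmf p field_pmf)) (\<lambda>e. ln (free_edge_weight \<beta> e))"

lemma vertex_increment:
  assumes s: "rate_seq s"
  shows "(\<lambda>N. mean_log_partition (Suc N) (s (Suc N)) - mean_log_partition N (s (Suc N) * (1 - p / Suc N))) \<longlonglongrightarrow> bethe_vertex"
proof -
  define s' where "s' N = s (Suc N) * (1 - p / Suc N)" for N
  define c where "c N = s (Suc N) * (p / Suc N)" for N
  have s': "rate_seq s'" and c: "c \<longlonglongrightarrow> \<alpha> * p"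
    using removed_rate[OF s] unfolding s'_def c_def by simp_all
  define R where "R N = (\<lambda>(es, H). ln (partition_fn \<beta> (Suc N) (star_energy (Suc N) es + H)) - ln (partition_fn \<beta> N H))" for N
  have "(\<lambda>N. measure_pmf.expectation (pair_pmf (poisson_list (c N) (rooted_edges (p - 1) \<Theta> N)) (graph_law p \<Theta> N (s' N))) (R N)) \<longlonglongrightarrow> bethe_vertex"
    unfolding bethe_vertex_def
  proof (rule increment_limit[OF s' c \<alpha>p _ ln_star_weight_bound])
    show "\<forall>\<^sub>F N in sequentially. \<forall>x\<in>set_pmf (pair_pmf (poisson_list (c N) (rooted_edges (p - 1) \<Theta> N)) (graph_law p \<Theta> N (s' N))).
        \<bar>R N x\<bar> \<le> \<beta> * real (length (fst x)) \<and>
        (\<forall>cs\<in>set_pmf (config_law (\<alpha> * p) (p - 1) field_pmf). x \<in> attached \<beta> (p - 1) N [] [] cs \<longrightarrow> R N x = ln (spin_avg (star_weight \<beta> cs)))"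
      using eventually_ge_at_top[of p]
    proof eventually_elim
      case (elim N)
      show ?case
      proof (intro ballI)
        fix x assume x: "x \<in> set_pmf (pair_pmf (poisson_list (c N) (rooted_edges (p - 1) \<Theta> N)) (graph_law p \<Theta> N (s' N)))"
        obtain es H where xe: "x = (es, H)" by (cases x)
        have es: "es \<in> set_pmf (poisson_list (c N) (rooted_edges (p - 1) \<Theta> N))" and H: "H \<in> set_pmf (graph_law p \<Theta> N (s' N))"
          using x unfolding xe set_pair_pmf by blast+
        have supp: "supported N H" by (rule supported_graph_law[OF elim H])
        have "\<bar>(star_energy (Suc N) es + H) \<sigma> - H \<sigma>\<bar> \<le> 1 * real (length es)" for \<sigma>
        proof -
          have "\<bar>\<theta> (map \<sigma> vs @ [\<sigma> (Suc N)])\<bar> \<le> 1" if "(\<theta>, vs) \<in> set es" for \<theta> vs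
            using set_pmf_poisson_rooted[OF _ es that] elim p2 bound_\<Theta> by (auto simp: tuples_def)
          then have "\<bar>star_energy (Suc N) es \<sigma>\<bar> \<le> 1 * real (length es)"
            unfolding star_energy_def by (intro abs_sum_list_le) auto
          then show ?thesis by simp
        qed
        then have bd: "\<bar>R N x\<bar> \<le> \<beta> * real (length (fst x))"
          using ln_partition_fn_diff[of "Suc N" "star_energy (Suc N) es + H" H "1 * real (length es)" \<beta>] \<beta>
          by (simp add: R_def partition_fn_Suc_supported[OF supp] xe)
        have "R N x = ln (spin_avg (star_weight \<beta> cs))"
          if cs: "cs \<in> set_pmf (config_law (\<alpha> * p) (p - 1) field_pmf)" and "x \<in> attached \<beta> (p - 1) N [] [] cs" for cs
        proof -
        have att: "(es, H) \<in> attached \<beta> (p - 1) N [] [] cs" using that(2) by (simp only: xe)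
        have fac: "factorizes \<beta> N H (concat (map snd es) @ []) (concat (map snd cs) @ [])"
          and tup: "\<And>e. e \<in> set es \<Longrightarrow> snd e \<in> tuples (p - 1) {1..N}"
          using att by (auto simp: attached_def)
        have "list_all2 (\<lambda>(\<theta>, vs) (\<theta>', c). \<theta> = \<theta>' \<and> length vs = length c) es cs"
          by (rule attached_match[OF att]) (rule set_config_law(2)[OF cs])
        then have "partition_fn \<beta> (Suc N) (star_energy (Suc N) es + H) = partition_fn \<beta> N H * spin_avg (star_weight \<beta> cs)"
          using tup \<beta> by (intro attach_star(1)[OF _ _ fac _ supp]) (fastforce simp: tuples_def)+
        then show ?thesis
          using partition_fn_pos[of \<beta> N H] spin_avg_star_weight_pos[of \<beta> cs] by (simp add: R_def ln_mult xe)
        qed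
        with bd show "\<bar>R N x\<bar> \<le> \<beta> * real (length (fst x)) \<and>
          (\<forall>cs\<in>set_pmf (config_law (\<alpha> * p) (p - 1) field_pmf). x \<in> attached \<beta> (p - 1) N [] [] cs \<longrightarrow> R N x = ln (spin_avg (star_weight \<beta> cs)))"
          by blast
      qed
    qed
  qed
  moreover have "\<forall>\<^sub>F N in sequentially. measure_pmf.expectation (pair_pmf (poisson_list (c N) (rooted_edges (p - 1) \<Theta> N)) (graph_law p \<Theta> N (s' N))) (R N)
      = mean_log_partition (Suc N) (s (Suc N)) - mean_log_partition N (s' N)"
  proof -
    have "\<forall>\<^sub>F N in sequentially. s (Suc N) > 0"
      using rate_seq_pos[OF s] by (simp add: eventually_sequentially_Suc[of "\<lambda>N. s N > 0"])
    then show ?thesis using eventually_ge_at_top[of p] rate_seq_pos[OF s']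
    proof eventually_elim
      case (elim N)
      have "graph_law p \<Theta> (Suc N) (s (Suc N)) = map_pmf (\<lambda>(es, H). star_energy (Suc N) es + H)
         (pair_pmf (poisson_list (c N) (rooted_edges (p - 1) \<Theta> N)) (graph_law p \<Theta> N (s' N)))"
        unfolding c_def s'_def using p2 elim by (intro graph_law_remove_vertex exch) auto
      from expectation_diff_pair[OF this, of "\<lambda>H. ln (partition_fn \<beta> (Suc N) H)" "\<lambda>H. ln (partition_fn \<beta> N H)"]
      show ?case unfolding mean_log_partition_def R_def
        using integrable_log_partition elim by simp
    qed
  qed
  ultimately have "(\<lambda>N. mean_log_partition (Suc N) (s (Suc N)) - mean_log_partition N (s' N)) \<longlonglongrightarrow> bethe_vertex"
    by (rule Lim_transform_eventually)
  then show ?thesis by (simp add: s'_def)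
qed

lemma free_edge_weight_pos: "free_edge_weight \<beta> e > 0"
  by (simp add: free_edge_weight_def field_avg_pos)

text \<open>The increments of the individual edges add up, and Campbell's formula gives the expectation of
  their sum.\<close>

lemma edge_increment:
  assumes s: "rate_seq s" and r: "r > 0"
  shows "(\<lambda>N. mean_log_partition N (r + s N) - mean_log_partition N (s N)) \<longlonglongrightarrow> r * bethe_edge"
proof -
  let ?J = "\<lambda>N. pair_pmf (poisson_list r (rooted_edges p \<Theta> N)) (graph_law p \<Theta> N (s N))"
  define R where "R N = (\<lambda>(es, H). ln (partition_fn \<beta> N (edges_energy es + H)) - ln (partition_fn \<beta> N H))" for N
  let ?a = "\<lambda>cs. \<Sum>e\<leftarrow>cs. ln (free_edge_weight \<beta> e)"
  have eb: "\<bar>ln (free_edge_weight \<beta> e)\<bar> \<le> \<beta>" if "e \<in> set_pmf (pair_pmf \<Theta> (replicate_pmf p field_pmf))" for e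
    using that by (intro ln_free_edge_weight_bound) (auto simp: set_replicate_pmf intro: normalized_field_pmf)
  have "(\<lambda>N. measure_pmf.expectation (?J N) (R N)) \<longlonglongrightarrow> measure_pmf.expectation (config_law r p field_pmf) ?a"
  proof (rule increment_limit[OF s tendsto_const r])
    show "\<bar>?a cs\<bar> \<le> \<beta> * real (length cs)" if "cs \<in> set_pmf (config_law r p field_pmf)" for cs
      using set_config_law[OF that] by (intro abs_sum_list_le ln_free_edge_weight_bound) auto
    show "\<forall>\<^sub>F N in sequentially. \<forall>x\<in>set_pmf (?J N). \<bar>R N x\<bar> \<le> \<beta> * real (length (fst x)) \<and>
        (\<forall>cs\<in>set_pmf (config_law r p field_pmf). x \<in> attached \<beta> p N [] [] cs \<longrightarrow> R N x = ?a cs)"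
      using eventually_ge_at_top[of p]
    proof eventually_elim
      case (elim N)
      show ?case
      proof (intro ballI)
        fix x assume x: "x \<in> set_pmf (?J N)"
        obtain es H where xe: "x = (es, H)" by (cases x)
        have es: "es \<in> set_pmf (poisson_list r (rooted_edges p \<Theta> N))" and H: "H \<in> set_pmf (graph_law p \<Theta> N (s N))"
          using x unfolding xe set_pair_pmf by blast+
        have "\<bar>(edges_energy es + H) \<sigma> - H \<sigma>\<bar> \<le> 1 * real (length es)" for \<sigma>
        proof -
          have "\<bar>\<theta> (map \<sigma> vs)\<bar> \<le> 1" if "(\<theta>, vs) \<in> set es" for \<theta> vs
            using set_pmf_poisson_rooted[OF elim es that] bound_\<Theta> by (auto simp: tuples_def)
          then have "\<bar>edges_energy es \<sigma>\<bar> \<le> 1 * real (length es)"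
            unfolding edges_energy_def by (intro abs_sum_list_le) auto
          then show ?thesis by simp
        qed
        then have bd: "\<bar>R N x\<bar> \<le> \<beta> * real (length (fst x))"
          using ln_partition_fn_diff[of N "edges_energy es + H" H "1 * real (length es)" \<beta>] \<beta>
          by (simp add: R_def xe)
        have "R N x = ?a cs" if cs: "cs \<in> set_pmf (config_law r p field_pmf)" and "x \<in> attached \<beta> p N [] [] cs" for cs
        proof -
        have att: "(es, H) \<in> attached \<beta> p N [] [] cs" using that(2) by (simp only: xe)
        have fac: "factorizes \<beta> N H (concat (map snd es)) (concat (map snd cs))"
          using att by (auto simp: attached_def)
        have "list_all2 (\<lambda>(\<theta>, vs) (\<theta>', c). \<theta> = \<theta>' \<and> length vs = length c) es cs"
          by (rule attached_match[OF att]) (rule set_config_law(2)[OF cs])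
        from attach_edges[OF this fac]
        have Z: "partition_fn \<beta> N (edges_energy es + H) = partition_fn \<beta> N H * (\<Prod>e\<leftarrow>cs. free_edge_weight \<beta> e)" .
        have "(\<Prod>e\<leftarrow>cs. free_edge_weight \<beta> e) > 0 \<and> ln (\<Prod>e\<leftarrow>cs. free_edge_weight \<beta> e) = ?a cs"
          by (induction cs) (auto simp: ln_mult free_edge_weight_pos less_imp_neq[THEN not_sym])
        then show ?thesis
          using partition_fn_pos[of \<beta> N H] by (simp add: R_def Z ln_mult xe)
        qed
        with bd show "\<bar>R N x\<bar> \<le> \<beta> * real (length (fst x)) \<and>
          (\<forall>cs\<in>set_pmf (config_law r p field_pmf). x \<in> attached \<beta> p N [] [] cs \<longrightarrow> R N x = ?a cs)"
          by blast
      qed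
    qed
  qed
  also have "measure_pmf.expectation (config_law r p field_pmf) ?a = r * bethe_edge"
    unfolding config_law_def bethe_edge_def by (rule campbell[OF r eb])
  finally have lim: "(\<lambda>N. measure_pmf.expectation (?J N) (R N)) \<longlonglongrightarrow> r * bethe_edge" .
  have "\<forall>\<^sub>F N in sequentially. measure_pmf.expectation (?J N) (R N) = mean_log_partition N (r + s N) - mean_log_partition N (s N)"
    using eventually_ge_at_top[of p] rate_seq_pos[OF s]
  proof eventually_elim
    case (elim N)
    have "graph_law p \<Theta> N (r + s N) = map_pmf (\<lambda>(es, H). edges_energy es + H) (?J N)"
      using elim r by (intro graph_law_add_edges) auto
    from expectation_diff_pair[OF this, of "\<lambda>H. ln (partition_fn \<beta> N H)" "\<lambda>H. ln (partition_fn \<beta> N H)"]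
    show ?case unfolding mean_log_partition_def R_def
      using integrable_log_partition elim r by simp
  qed
  then show ?thesis by (rule Lim_transform_eventually[OF lim])
qed

text \<open>The increment from \<open>N\<close> to \<open>N + 1\<close> sites passes through a common reference: what is left of
  the larger system when its last site is removed has \<open>N\<close> sites, but \<open>\<alpha>(p - 1)\<close> fewer edges in the
  mean than the system of \<open>N\<close> sites.\<close>

theorem free_energy_limit:
  "(\<lambda>N. mean_log_partition N (\<alpha> * N) / real N) \<longlonglongrightarrow> bethe_vertex - \<alpha> * (real p - 1) * bethe_edge"
proof (rule cesaro_increments)
  define s where "s N = \<alpha> * real N" for N
  define \<delta> where "\<delta> = \<alpha> * (real p - 1)"
  define s' where "s' N = s (Suc N) * (1 - p / Suc N)" for N
  have s: "rate_seq s"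
  proof -
    have "\<forall>\<^sub>F N in sequentially. \<alpha> = s N / real N"
      using eventually_gt_at_top[of 0] by eventually_elim (simp add: s_def)
    then show ?thesis unfolding rate_seq_def by (rule Lim_transform_eventually[OF tendsto_const])
  qed
  have \<delta>: "\<delta> > 0" using \<alpha> p2 by (simp add: \<delta>_def)
  have s': "rate_seq s'" unfolding s'_def by (rule removed_rate(1)[OF s])
  \<comment> \<open>Removing site \<open>N + 1\<close> takes away \<open>\<alpha>p\<close> edges in the mean, but a site brings only \<open>\<alpha>\<close>; the
    difference is made up for by \<open>\<delta>\<close> additional edges.\<close>
  have eq: "\<delta> + s' N = s N" for N
  proof -
    have "s (Suc N) * (1 - p / Suc N) = \<alpha> * (real (Suc N) - p)"
      unfolding s_def by (simp add: field_simps del: of_nat_Suc)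
    then show ?thesis by (simp add: s'_def \<delta>_def s_def algebra_simps)
  qed
  have "(\<lambda>N. (mean_log_partition (Suc N) (s (Suc N)) - mean_log_partition N (s' N)) -
     (mean_log_partition N (\<delta> + s' N) - mean_log_partition N (s' N))) \<longlonglongrightarrow> bethe_vertex - \<delta> * bethe_edge"
    unfolding s'_def by (intro tendsto_diff vertex_increment[OF s] edge_increment[OF s'[unfolded s'_def] \<delta>])
  then show "(\<lambda>N. mean_log_partition (Suc N) (\<alpha> * Suc N) - mean_log_partition N (\<alpha> * N)) \<longlonglongrightarrow> bethe_vertex - \<alpha> * (real p - 1) * bethe_edge"
    unfolding eq by (simp add: s_def \<delta>_def)
qed

end

section \<open>The cavity operator in terms of messages\<close>

lemma prob_space_\<nu>: "prob_space \<nu>"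
  by (simp add: \<nu>_def measure_pmf.prob_space_axioms)

lemma space_\<nu> [simp]: "space \<nu> = UNIV" and sets_\<nu> [simp]: "sets \<nu> = UNIV"
  by (simp_all add: \<nu>_def)

lemma emeasure_\<nu>_singleton: "emeasure \<nu> {s} = ennreal (1 / 2)"
  by (simp add: \<nu>_def emeasure_pmf_single card_spin)

lemma integral_\<nu>: "(\<integral>s. f s \<partial>\<nu>) = spin_avg f"
  unfolding \<nu>_def spin_avg_def by (subst integral_pmf_of_set) (auto simp: card_spin)

lemma sets_PiM_\<nu>: "A \<subseteq> {1..n} \<rightarrow>\<^sub>E UNIV \<Longrightarrow> A \<in> sets (\<Pi>\<^sub>M k\<in>{1..n::nat}. \<nu>)"
proof -
  assume A: "A \<subseteq> {1..n} \<rightarrow>\<^sub>E UNIV"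
  have "sets (\<Pi>\<^sub>M k\<in>{1..n}. \<nu>) = sets (\<Pi>\<^sub>M k\<in>{1..n}. count_space (UNIV :: spin set))"
    by (rule sets_PiM_cong) auto
  also have "\<dots> = sets (count_space ({1..n} \<rightarrow>\<^sub>E (UNIV :: spin set)))"
    using count_space_PiM_finite[of "{1..n}" "\<lambda>_. UNIV :: spin set"] by (simp only: finite_atLeastAtMost countable_finite[OF finite])
  finally show ?thesis using A by auto
qed

lemma space_PiM_\<nu>: "space (\<Pi>\<^sub>M k\<in>{1..n::nat}. \<nu>) = {1..n} \<rightarrow>\<^sub>E UNIV"
  by (simp add: space_PiM)

lemma integral_PiM_\<nu>: "(\<integral>\<sigma>. h \<sigma> \<partial>(\<Pi>\<^sub>M k\<in>{1..n}. \<nu>)) = conf_avg n h"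
proof -
  let ?M = "\<Pi>\<^sub>M k\<in>{1..n}. \<nu>" and ?S = "{1..n} \<rightarrow>\<^sub>E (UNIV :: spin set)"
  interpret product_prob_space "\<lambda>_::nat. \<nu>" by (rule product_prob_spaceI) (rule prob_space_\<nu>)
  have m: "emeasure ?M {\<sigma>} = ennreal ((1 / 2) ^ n)" if "\<sigma> \<in> ?S" for \<sigma>
  proof -
    have "emeasure ?M {\<sigma>} = emeasure ?M (\<Pi>\<^sub>E k\<in>{1..n}. {\<sigma> k})"
    proof -
      have "\<sigma> \<in> extensional {1..n}" using that unfolding PiE_def by blast
      then show ?thesis by (simp only: PiE_singleton)
    qed
    also have "\<dots> = (\<Prod>k\<in>{1..n}. emeasure \<nu> {\<sigma> k})" by (rule emeasure_PiM) auto
    also have "\<dots> = ennreal (1 / 2) ^ n"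
      by (simp only: emeasure_\<nu>_singleton prod_constant card_atLeastAtMost diff_Suc_1)
    also have "\<dots> = ennreal ((1 / 2) ^ n)" by (rule ennreal_power) simp
    finally show ?thesis .
  qed
  have "(\<integral>\<sigma>. h \<sigma> \<partial>?M) = (\<integral>\<sigma>. (\<Sum>\<tau>\<in>?S. h \<tau> * indicator {\<tau>} \<sigma>) \<partial>?M)"
  proof (rule Bochner_Integration.integral_cong[OF refl])
    fix \<sigma> assume "\<sigma> \<in> space ?M"
    then have \<sigma>: "\<sigma> \<in> ?S" by (simp only: space_PiM_\<nu>)
    have "(\<Sum>\<tau>\<in>?S. h \<tau> * indicator {\<tau>} \<sigma>) = (\<Sum>\<tau>\<in>?S. if \<tau> = \<sigma> then h \<tau> else 0)"
      by (rule sum.cong) (auto simp: indicator_def)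
    also have "\<dots> = h \<sigma>" by (simp only: sum.delta[OF finite_conf] \<sigma> if_True)
    finally show "h \<sigma> = (\<Sum>\<tau>\<in>?S. h \<tau> * indicator {\<tau>} \<sigma>)" by simp
  qed
  also have "\<dots> = (\<Sum>\<tau>\<in>?S. (\<integral>\<sigma>. h \<tau> * indicator {\<tau>} \<sigma> \<partial>?M))"
  proof (rule Bochner_Integration.integral_sum)
    fix \<tau> assume \<tau>: "\<tau> \<in> ?S"
    then have "{\<tau>} \<in> sets ?M" by (intro sets_PiM_\<nu>) blast
    moreover have "emeasure ?M {\<tau>} < \<infinity>" unfolding m[OF \<tau>] infinity_ennreal_def by (rule ennreal_less_top)
    ultimately show "integrable ?M (\<lambda>\<sigma>. h \<tau> * indicator {\<tau>} \<sigma>)"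
      by (intro integrable_mult_right integrable_real_indicator)
  qed
  also have "\<dots> = (\<Sum>\<tau>\<in>?S. h \<tau> * (1 / 2) ^ n)"
  proof (rule sum.cong[OF refl])
    fix \<tau> assume \<tau>: "\<tau> \<in> ?S"
    then have "{\<tau>} \<inter> space ?M = {\<tau>}" unfolding space_PiM_\<nu> by blast
    moreover have "measure ?M {\<tau>} = (1 / 2) ^ n" unfolding measure_def m[OF \<tau>] by (rule enn2real_ennreal) simp
    ultimately show "(\<integral>\<sigma>. h \<tau> * indicator {\<tau>} \<sigma> \<partial>?M) = h \<tau> * (1 / 2) ^ n"
      by (simp only: integral_mult_right_zero Bochner_Integration.integral_indicator)
  qed
  also have "\<dots> = conf_avg n h"
    by (simp only: conf_avg_def sum_divide_distrib power_one_over times_divide_eq_right mult_1_right)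
  finally show ?thesis .
qed

lemma gibbs_conf_avg:
  "gibbs n \<beta> X f = conf_avg n (\<lambda>\<sigma>. f \<sigma> * (\<Prod>k = 1..n. exp (\<beta> * apply_bcontfun (X k) (\<sigma> k))))"
  unfolding gibbs_def by (rule integral_PiM_\<nu>)

lemma tilted_conf_avg:
  "conf_avg n (\<lambda>\<sigma>. g (map \<sigma> [1..<n + 1]) * (\<Prod>k = 1..n. exp (\<beta> * apply_bcontfun (X k) (\<sigma> k)))) =
    field_avg \<beta> (map X [1..<n + 1]) g"
proof (induction n arbitrary: g)
  case 0
  show ?case by (simp add: conf_avg_def)
next
  case (Suc n)
  let ?w = "\<lambda>k s. exp (\<beta> * apply_bcontfun (X k) s)"
  have l: "[1..<Suc n + 1] = [1..<n + 1] @ [Suc n]" by simp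
  have "conf_avg (Suc n) (\<lambda>\<sigma>. g (map \<sigma> [1..<Suc n + 1]) * (\<Prod>k = 1..Suc n. ?w k (\<sigma> k))) =
    spin_avg (\<lambda>t. conf_avg n (\<lambda>\<sigma>. (g (map \<sigma> [1..<n + 1] @ [t]) * ?w (Suc n) t) * (\<Prod>k = 1..n. ?w k (\<sigma> k))))"
    unfolding conf_avg_Suc
  proof (intro arg_cong[where f=spin_avg] ext conf_avg_cong)
    fix t and \<sigma> :: "nat \<Rightarrow> spin"
    have "map (\<sigma>(Suc n := t)) [1..<Suc n + 1] = map \<sigma> [1..<n + 1] @ [t]"
      unfolding l by simp
    moreover have "(\<Prod>k = 1..Suc n. ?w k ((\<sigma>(Suc n := t)) k)) = (\<Prod>k = 1..n. ?w k (\<sigma> k)) * ?w (Suc n) t"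
    proof -
      have "(\<Prod>k = 1..n. ?w k ((\<sigma>(Suc n := t)) k)) = (\<Prod>k = 1..n. ?w k (\<sigma> k))"
        by (rule prod.cong) auto
      then show ?thesis by (simp add: prod.nat_ivl_Suc')
    qed
    ultimately show "g (map (\<sigma>(Suc n := t)) [1..<Suc n + 1]) * (\<Prod>k = 1..Suc n. ?w k ((\<sigma>(Suc n := t)) k)) =
       (g (map \<sigma> [1..<n + 1] @ [t]) * ?w (Suc n) t) * (\<Prod>k = 1..n. ?w k (\<sigma> k))"
      by (simp only: mult_ac)
  qed
  also have "\<dots> = spin_avg (\<lambda>t. field_avg \<beta> (map X [1..<n + 1]) (\<lambda>ss. g (ss @ [t]) * ?w (Suc n) t))"
    by (simp only: Suc[of "\<lambda>ss. g (ss @ [_]) * ?w (Suc n) _"])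
  also have "\<dots> = field_avg \<beta> (map X [1..<n + 1]) (\<lambda>ss. spin_avg (\<lambda>t. g (ss @ [t]) * ?w (Suc n) t))"
  proof -
    have sc: "field_avg \<beta> ys (\<lambda>b. spin_avg (\<lambda>s. f s b)) = spin_avg (\<lambda>s. field_avg \<beta> ys (f s))" for f ys
      using field_avg_cmult[of \<beta> ys "1/2" "\<lambda>b. f (Abs_spin (- 1)) b + f (Abs_spin 1) b"]
      by (simp add: spin_avg_alt field_avg_add)
    show ?thesis by (rule sc[symmetric])
  qed
  also have "\<dots> = field_avg \<beta> (map X [1..<Suc n + 1]) g"
    unfolding l map_append field_avg_append by (simp add: mult.commute)
  finally show ?case .
qed

text \<open>The cavity law provides infinite sequences of interactions and fields; only the first \<open>r\<close>
  interactions and the first \<open>r(p - 1)\<close> fields, in blocks of \<open>p - 1\<close>, enter the cavity field.\<close>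

definition read_config :: "nat \<Rightarrow> nat \<Rightarrow> (nat \<Rightarrow> spin list \<Rightarrow> real) \<Rightarrow> (nat \<Rightarrow> field) \<Rightarrow> config" where
  "read_config p r \<theta> X = map (\<lambda>k. (\<theta> k, map X [(k - 1) * (p - 1) + 1..<k * (p - 1) + 1])) [1..<r + 1]"

lemma concat_blocks: "concat (map (\<lambda>k. [(k - 1) * q + 1..<k * q + 1]) [1..<r + 1]) = [1..<r * q + 1]"
proof (induction r)
  case (Suc r)
  have "[1..<Suc r + 1] = [1..<r + 1] @ [Suc r]" by simp
  then have "concat (map (\<lambda>k. [(k - 1) * q + 1..<k * q + 1]) [1..<Suc r + 1]) = [1..<r * q + 1] @ [r * q + 1..<Suc r * q + 1]"
    using Suc by simp
  also have "\<dots> = [1..<Suc r * q + 1]"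
    using upt_add_eq_append[of 1 "r * q + 1" q] by (simp add: add.commute)
  finally show ?case .
qed simp

lemma gibbs_boltzmann:
  "gibbs (r * (p - 1)) \<beta> X (\<lambda>\<sigma>. boltzmann p \<beta> r \<theta> \<sigma> t) = star_weight \<beta> (read_config p r \<theta> X) t"
proof -
  let ?n = "r * (p - 1)" and ?b = "\<lambda>k. [(k - 1) * (p - 1) + 1..<k * (p - 1) + 1]"
  define es where "es = map (\<lambda>k. (\<theta> k, ?b k)) [1..<r + 1]"
  define K where "K \<sigma> = (\<Prod>k = 1..?n. exp (\<beta> * apply_bcontfun (X k) (\<sigma> k)))" for \<sigma>
  have es: "concat (map snd es) = [1..<?n + 1]"
    unfolding es_def map_map o_def snd_conv by (rule concat_blocks)
  have cs: "concat (map snd (read_config p r \<theta> X)) = map X [1..<?n + 1]"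
    unfolding read_config_def map_map o_def snd_conv concat_blocks[symmetric] map_concat by simp
  have "conf_avg ?n (\<lambda>\<sigma>. 1 * exp (\<beta> * (\<Sum>(\<theta>, vs)\<leftarrow>es. \<theta> (map \<sigma> vs @ [t]))) * K \<sigma>) =
     1 * star_weight \<beta> (read_config p r \<theta> X) t * field_avg \<beta> [] (\<lambda>_. 1)"
  proof (rule integrate_out_edges[where us="[]"])
    show "list_all2 (\<lambda>(\<theta>, vs) (\<theta>', c). \<theta> = \<theta>' \<and> length vs = length c) es (read_config p r \<theta> X)"
      unfolding es_def read_config_def list_all2_map1 list_all2_map2 by (rule list.rel_refl) simp
    show "conf_avg ?n (\<lambda>\<sigma>. g (map \<sigma> (concat (map snd es) @ [])) * K \<sigma>) =
        1 * field_avg \<beta> (concat (map snd (read_config p r \<theta> X)) @ []) g" for g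
      unfolding es cs K_def append_Nil2 tilted_conf_avg by simp
  qed
  moreover have "(\<Sum>(\<theta>, vs)\<leftarrow>es. \<theta> (map \<sigma> vs @ [t])) = (\<Sum>k = 1..r. \<theta> k (map \<sigma> (?b k) @ [t]))" for \<sigma>
  proof -
    have "(\<Sum>(\<theta>, vs)\<leftarrow>es. \<theta> (map \<sigma> vs @ [t])) = (\<Sum>k\<leftarrow>[1..<r + 1]. \<theta> k (map \<sigma> (?b k) @ [t]))"
      unfolding es_def by (simp add: o_def del: upt_Suc)
    also have "\<dots> = (\<Sum>k\<in>set [1..<r + 1]. \<theta> k (map \<sigma> (?b k) @ [t]))"
      by (rule sum_list_distinct_conv_sum_set) (rule distinct_upt)
    also have "set [1..<r + 1] = {1..r}" by (simp add: atLeastLessThanSuc_atLeastAtMost del: upt_Suc)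
    finally show ?thesis .
  qed
  ultimately show ?thesis
    unfolding gibbs_conf_avg boltzmann_def K_def by simp
qed

lemma gibbs_boltzmann_avg:
  "gibbs (r * (p - 1)) \<beta> X (\<lambda>\<sigma>. \<integral>s. boltzmann p \<beta> r \<theta> \<sigma> s \<partial>\<nu>) = spin_avg (star_weight \<beta> (read_config p r \<theta> X))"
proof -
  have sc: "conf_avg N (\<lambda>\<sigma>. spin_avg (\<lambda>s. f s \<sigma>) * w \<sigma>) = spin_avg (\<lambda>s. conf_avg N (\<lambda>\<sigma>. f s \<sigma> * w \<sigma>))" for N f w
    by (simp add: spin_avg_alt conf_avg_def sum.distrib sum_divide_distrib add_divide_distrib ring_distribs mult.commute)
  show ?thesis
    unfolding integral_\<nu> gibbs_boltzmann[symmetric, abs_def] gibbs_conf_avg sc ..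
qed

text \<open>This identifies the operator \<open>T\<close> with the map that sends a law of fields to the law of the
  message of a random configuration.\<close>

lemma cavity_field_eq_message: "cavity_field p \<beta> r \<theta> X = message \<beta> (read_config p r \<theta> X)"
  unfolding cavity_field_def message_def gibbs_boltzmann gibbs_boltzmann_avg ..

lemma gibbs_edge:
  "gibbs p \<beta> X (\<lambda>\<sigma>. exp (\<beta> * \<theta> (map \<sigma> [1..<p + 1]))) = free_edge_weight \<beta> (\<theta>, map X [1..<p + 1])"
  unfolding gibbs_conf_avg free_edge_weight_def fst_conv snd_conv
  by (rule tilted_conf_avg[where g="\<lambda>ss. exp (\<beta> * \<theta> ss)"])

lemma apply_bcontfun_measurable: "(\<lambda>f. apply_bcontfun f s) \<in> borel_measurable (borel :: (spin \<Rightarrow>\<^sub>C real) measure)"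
proof (rule borel_measurable_continuous_onI, rule continuous_onI)
  fix f :: field and e :: real assume "e > 0"
  then show "\<exists>d>0. \<forall>g\<in>UNIV. dist g f < d \<longrightarrow> dist (apply_bcontfun g s) (apply_bcontfun f s) \<le> e"
  proof (intro exI[of _ e] conjI ballI impI)
    fix g assume "dist g f < e"
    then show "dist (apply_bcontfun g s) (apply_bcontfun f s) \<le> e" using dist_bounded[of g s f] by linarith
  qed
qed

lemma Bcontfun_spin_measurable:
  assumes "\<And>t. (\<lambda>\<omega>. g \<omega> t) \<in> borel_measurable M"
  shows "(\<lambda>\<omega>. Bcontfun (g \<omega> :: spin \<Rightarrow> real)) \<in> borel_measurable M"
proof -
  define b :: "spin \<Rightarrow> field" where "b s = Bcontfun (\<lambda>t. if t = s then 1 else 0)" for s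
  define J where "J x = fst x *\<^sub>R b (Abs_spin (- 1)) + snd x *\<^sub>R b (Abs_spin 1)" for x :: "real \<times> real"
  have J: "J \<in> borel_measurable borel"
    unfolding J_def by (intro borel_measurable_continuous_onI continuous_intros)
  have "Bcontfun (g \<omega>) = J (g \<omega> (Abs_spin (- 1)), g \<omega> (Abs_spin 1))" for \<omega>
  proof (rule bcontfun_eqI)
    fix t :: spin
    have "t = Abs_spin (- 1) \<or> t = Abs_spin 1" using UNIV_spin_card(1) by auto
    then show "apply_bcontfun (Bcontfun (g \<omega>)) t = apply_bcontfun (J (g \<omega> (Abs_spin (- 1)), g \<omega> (Abs_spin 1))) t"
      using UNIV_spin_card(2) by (auto simp: J_def b_def)
  qed
  moreover have "(\<lambda>\<omega>. (g \<omega> (Abs_spin (- 1)), g \<omega> (Abs_spin 1))) \<in> M \<rightarrow>\<^sub>M borel"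
    unfolding borel_prod[symmetric] using assms by (intro measurable_Pair)
  ultimately show ?thesis using measurable_compose[OF _ J] by simp
qed

lemma field_avg_measurable:
  assumes "\<And>k s. k \<in> set ks \<Longrightarrow> (\<lambda>\<omega>. apply_bcontfun (X \<omega> k) s) \<in> borel_measurable M"
    and "\<And>ss. (\<lambda>\<omega>. G \<omega> ss) \<in> borel_measurable M"
  shows "(\<lambda>\<omega>. field_avg \<beta> (map (X \<omega>) ks) (G \<omega>)) \<in> borel_measurable M"
  using assms
proof (induction ks arbitrary: G)
  case (Cons k ks)
  have "(\<lambda>\<omega>. field_avg \<beta> (map (X \<omega>) ks) (\<lambda>ss. G \<omega> (s # ss))) \<in> borel_measurable M" for s
    using Cons.prems by (intro Cons.IH) auto
  moreover have "(\<lambda>\<omega>. apply_bcontfun (X \<omega> k) s) \<in> borel_measurable M" for s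
    using Cons.prems by auto
  ultimately show ?case unfolding list.map field_avg.simps spin_avg_alt by measurable
qed simp

lemma measurable_cavity_law:
  assumes \<mu>: "sets \<mu> = sets borel"
  shows "k \<ge> 1 \<Longrightarrow> (\<lambda>\<omega>. apply_bcontfun (snd (snd \<omega>) k) s) \<in> borel_measurable (cavity_law p \<alpha> \<Theta> \<mu>)"
    and "k \<ge> 1 \<Longrightarrow> (\<lambda>\<omega>. fst (snd \<omega>) k) \<in> cavity_law p \<alpha> \<Theta> \<mu> \<rightarrow>\<^sub>M count_space UNIV"
    and "fst \<in> cavity_law p \<alpha> \<Theta> \<mu> \<rightarrow>\<^sub>M count_space UNIV"
proof -
  show "(\<lambda>\<omega>. apply_bcontfun (snd (snd \<omega>) k) s) \<in> borel_measurable (cavity_law p \<alpha> \<Theta> \<mu>)" if "k \<ge> 1"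
  proof (rule measurable_compose[OF _ apply_bcontfun_measurable])
    have "(\<lambda>\<omega>. snd (snd \<omega>) k) \<in> cavity_law p \<alpha> \<Theta> \<mu> \<rightarrow>\<^sub>M \<mu>"
    proof -
      have k: "k \<in> {1..}" using that by simp
      show ?thesis unfolding cavity_law_def using k by measurable
    qed
    then show "(\<lambda>\<omega>. snd (snd \<omega>) k) \<in> cavity_law p \<alpha> \<Theta> \<mu> \<rightarrow>\<^sub>M borel"
      using measurable_cong_sets[OF refl \<mu>] by blast
  qed
  show "(\<lambda>\<omega>. fst (snd \<omega>) k) \<in> cavity_law p \<alpha> \<Theta> \<mu> \<rightarrow>\<^sub>M count_space UNIV" if "k \<ge> 1"
  proof -
    have "(\<lambda>\<omega>. fst (snd \<omega>) k) \<in> cavity_law p \<alpha> \<Theta> \<mu> \<rightarrow>\<^sub>M measure_pmf \<Theta>"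
    proof -
      have k: "k \<in> {1..}" using that by simp
      show ?thesis unfolding cavity_law_def using k by measurable
    qed
    then show ?thesis by simp
  qed
  show "fst \<in> cavity_law p \<alpha> \<Theta> \<mu> \<rightarrow>\<^sub>M count_space UNIV"
  proof -
    have "fst \<in> cavity_law p \<alpha> \<Theta> \<mu> \<rightarrow>\<^sub>M measure_pmf (poisson_pmf (\<alpha> * real p))"
      unfolding cavity_law_def by measurable
    then show ?thesis by simp
  qed
qed

text \<open>For each of the countably many numbers of edges, this is a finite product of averages into each of
  which finitely many fields enter.\<close>

lemma star_weight_measurable:
  assumes \<mu>: "sets \<mu> = sets borel"
  shows "(\<lambda>\<omega>. star_weight \<beta> (read_config p (fst \<omega>) (fst (snd \<omega>)) (snd (snd \<omega>))) t) \<in> borel_measurable (cavity_law p \<alpha> \<Theta> \<mu>)"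
proof (rule measurable_compose_countable[where f="\<lambda>r \<omega>. star_weight \<beta> (read_config p r (fst (snd \<omega>)) (snd (snd \<omega>))) t", OF _ measurable_cavity_law(3)[OF \<mu>]])
  fix r
  let ?M = "cavity_law p \<alpha> \<Theta> \<mu>" and ?b = "\<lambda>k. [(k - 1) * (p - 1) + 1..<k * (p - 1) + 1]"
  have e: "(\<lambda>\<omega>. edge_weight \<beta> (fst (snd \<omega>) k, map (snd (snd \<omega>)) (?b k)) t) \<in> borel_measurable ?M" if "k \<ge> 1" for k
    unfolding edge_weight_def fst_conv snd_conv
  proof (rule field_avg_measurable)
    show "(\<lambda>\<omega>. apply_bcontfun (snd (snd \<omega>) j) s) \<in> borel_measurable ?M" if "j \<in> set (?b k)" for j s
    proof (rule measurable_cavity_law(1)[OF \<mu>])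
      show "1 \<le> j" using that unfolding set_upt atLeastLessThan_iff by linarith
    qed
    show "(\<lambda>\<omega>. exp (\<beta> * fst (snd \<omega>) k (ss @ [t]))) \<in> borel_measurable ?M" for ss
      using measurable_compose[OF measurable_cavity_law(2)[OF \<mu> \<open>k \<ge> 1\<close>], of "\<lambda>\<theta>. exp (\<beta> * \<theta> (ss @ [t]))" borel] by simp
  qed
  have "(\<lambda>\<omega> :: nat \<times> (nat \<Rightarrow> spin list \<Rightarrow> real) \<times> (nat \<Rightarrow> field). star_weight \<beta> (read_config p r (fst (snd \<omega>)) (snd (snd \<omega>))) t) =
    (\<lambda>\<omega>. \<Prod>k\<in>{1..r}. edge_weight \<beta> (fst (snd \<omega>) k, map (snd (snd \<omega>)) (?b k)) t)"
  proof (rule ext)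
    fix \<omega> :: "nat \<times> (nat \<Rightarrow> spin list \<Rightarrow> real) \<times> (nat \<Rightarrow> field)"
    have "star_weight \<beta> (read_config p r (fst (snd \<omega>)) (snd (snd \<omega>))) t =
      (\<Prod>k\<leftarrow>[1..<r + 1]. edge_weight \<beta> (fst (snd \<omega>) k, map (snd (snd \<omega>)) (?b k)) t)"
      unfolding star_weight_def read_config_def map_map o_def ..
    also have "\<dots> = (\<Prod>k\<in>set [1..<r + 1]. edge_weight \<beta> (fst (snd \<omega>) k, map (snd (snd \<omega>)) (?b k)) t)"
      by (rule prod.distinct_set_conv_list[symmetric]) (rule distinct_upt)
    also have "set [1..<r + 1] = {1..r}" by (simp add: atLeastLessThanSuc_atLeastAtMost del: upt_Suc)
    finally show "star_weight \<beta> (read_config p r (fst (snd \<omega>)) (snd (snd \<omega>))) t =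
      (\<Prod>k\<in>{1..r}. edge_weight \<beta> (fst (snd \<omega>) k, map (snd (snd \<omega>)) (?b k)) t)" .
  qed
  then show "(\<lambda>\<omega>. star_weight \<beta> (read_config p r (fst (snd \<omega>)) (snd (snd \<omega>))) t) \<in> borel_measurable ?M"
    using e by (simp add: borel_measurable_prod)
qed

lemma cavity_field_measurable:
  assumes \<mu>: "sets \<mu> = sets borel"
  shows "(\<lambda>(r, \<theta>, X). cavity_field p \<beta> r \<theta> X) \<in> borel_measurable (cavity_law p \<alpha> \<Theta> \<mu>)"
  unfolding case_prod_unfold cavity_field_eq_message message_def spin_avg_alt
  by (intro Bcontfun_spin_measurable borel_measurable_times borel_measurable_ln borel_measurable_divide
      borel_measurable_add borel_measurable_const star_weight_measurable[OF \<mu>])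

lemma vertex_term_measurable:
  assumes \<mu>: "sets \<mu> = sets borel"
  shows "(\<lambda>\<omega>. ln (spin_avg (star_weight \<beta> (read_config p (fst \<omega>) (fst (snd \<omega>)) (snd (snd \<omega>)))))) \<in> borel_measurable (cavity_law p \<alpha> \<Theta> \<mu>)"
  unfolding spin_avg_alt
  by (intro borel_measurable_ln borel_measurable_divide borel_measurable_add borel_measurable_const
      star_weight_measurable[OF \<mu>])

lemma edge_term_measurable:
  assumes \<mu>: "sets \<mu> = sets borel"
  shows "(\<lambda>\<omega>. ln (free_edge_weight \<beta> (fst \<omega>, map (snd \<omega>) [1..<p + 1]))) \<in>
    borel_measurable (measure_pmf \<Theta> \<Otimes>\<^sub>M (\<Pi>\<^sub>M k\<in>{1..}. \<mu>))"
proof -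
  let ?M = "measure_pmf \<Theta> \<Otimes>\<^sub>M (\<Pi>\<^sub>M k\<in>{1::nat..}. \<mu>)"
  have "(\<lambda>\<omega>. free_edge_weight \<beta> (fst \<omega>, map (snd \<omega>) [1..<p + 1])) \<in> borel_measurable ?M"
    unfolding free_edge_weight_def fst_conv snd_conv
  proof (rule field_avg_measurable)
    fix j s assume "j \<in> set [1..<p + 1]"
    then have j: "j \<in> {1..}" by auto
    show "(\<lambda>\<omega>. apply_bcontfun (snd \<omega> j) s) \<in> borel_measurable ?M"
    proof (rule measurable_compose[OF _ apply_bcontfun_measurable])
      have "(\<lambda>\<omega>. snd \<omega> j) \<in> ?M \<rightarrow>\<^sub>M \<mu>" using j by measurable
      then show "(\<lambda>\<omega>. snd \<omega> j) \<in> ?M \<rightarrow>\<^sub>M borel" using measurable_cong_sets[OF refl \<mu>] by blast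
    qed
  next
    fix ss
    have "fst \<in> ?M \<rightarrow>\<^sub>M measure_pmf \<Theta>" by measurable
    then have "fst \<in> ?M \<rightarrow>\<^sub>M count_space UNIV" by simp
    from measurable_compose[OF this, of "\<lambda>\<theta>. exp (\<beta> * \<theta> ss)" borel]
    show "(\<lambda>\<omega>. exp (\<beta> * fst \<omega> ss)) \<in> borel_measurable ?M" by simp
  qed
  then show ?thesis by measurable
qed

section \<open>Uniqueness of the fixed point\<close>

text \<open>The variable \<open>Y\<close> need not be measurable for the discrete \<open>\<sigma>\<close>-algebra when its range is
  uncountable. If its atoms are measurable and carry the whole mass, then it is so after a change on a
  null set.\<close>

lemma pmf_version:
  fixes w :: "'b pmf" and Y :: "'a \<Rightarrow> 'b"
  assumes "prob_space M"
    and meas: "\<And>y. y \<in> set_pmf w \<Longrightarrow> {\<omega> \<in> space M. Y \<omega> = y} \<in> sets M"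
    and law: "\<And>y. y \<in> set_pmf w \<Longrightarrow> emeasure M {\<omega> \<in> space M. Y \<omega> = y} = ennreal (pmf w y)"
  obtains Y' where "Y' \<in> M \<rightarrow>\<^sub>M count_space UNIV" "distr M (count_space UNIV) Y' = measure_pmf w"
    "AE \<omega> in M. Y \<omega> = Y' \<omega>"
proof -
  interpret prob_space M by fact
  let ?S = "set_pmf w"
  obtain y0 where y0: "y0 \<in> ?S" using set_pmf_not_empty by fast
  define Y' where "Y' \<omega> = (if Y \<omega> \<in> ?S then Y \<omega> else y0)" for \<omega>
  define E where "E y = {\<omega> \<in> space M. Y \<omega> = y}" for y
  have E: "E y \<in> sets M" if "y \<in> ?S" for y using meas[OF that] by (simp add: E_def)
  have U: "(\<Union>y\<in>A. E y) \<in> sets M" if "A \<subseteq> ?S" for A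
    using that E by (intro sets.countable_UN'') (auto intro: countable_subset)
  have US: "(\<Union>y\<in>?S. E y) = {\<omega> \<in> space M. Y \<omega> \<in> ?S}" by (auto simp: E_def)
  have "emeasure M (\<Union>y\<in>?S. E y) = (\<integral>\<^sup>+y. emeasure M (E y) \<partial>count_space ?S)"
    by (rule emeasure_UN_countable) (auto simp: E disjoint_family_on_def, auto simp: E_def)
  also have "\<dots> = (\<integral>\<^sup>+y. ennreal (pmf w y) \<partial>count_space ?S)"
    by (intro nn_integral_cong) (simp add: E_def law)
  also have "\<dots> = emeasure (measure_pmf w) ?S" by (rule nn_integral_pmf)
  also have "\<dots> = 1" by (rule measure_pmf.emeasure_eq_1_AE) (simp_all add: AE_measure_pmf)
  finally have "emeasure M {\<omega> \<in> space M. Y \<omega> \<in> ?S} = 1" by (simp only: US)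
  then have "prob {\<omega> \<in> space M. Y \<omega> \<in> ?S} = 1" by (simp add: measure_def)
  moreover have ms: "{\<omega> \<in> space M. Y \<omega> \<in> ?S} \<in> sets M" using U[of ?S] by (simp only: US)
  ultimately have ae: "AE \<omega> in M. Y \<omega> \<in> ?S"
    using prob_Collect_eq_1[of "\<lambda>\<omega>. Y \<omega> \<in> ?S"] by (simp add: pred_def)
  have Y'm: "Y' \<in> M \<rightarrow>\<^sub>M count_space UNIV"
  proof (rule measurableI)
    fix A :: "'b set"
    have "Y' -` A \<inter> space M = (\<Union>y\<in>A \<inter> ?S. E y) \<union> (if y0 \<in> A then space M - {\<omega> \<in> space M. Y \<omega> \<in> ?S} else {})"
      using y0 by (auto simp: Y'_def E_def split: if_splits)
    also have "\<dots> \<in> sets M" using U[of "A \<inter> ?S"] ms by auto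
    finally show "Y' -` A \<inter> space M \<in> sets M" .
  qed simp
  have eq: "AE \<omega> in M. Y \<omega> = Y' \<omega>" using ae by eventually_elim (simp add: Y'_def)
  have "distr M (count_space UNIV) Y' = measure_pmf w"
  proof (rule measure_eqI_countable_AE[where \<Omega>="?S"])
    show "AE x in distr M (count_space UNIV) Y'. x \<in> ?S"
      by (subst AE_distr_iff[OF Y'm]) (auto simp: Y'_def y0)
    show "AE x in measure_pmf w. x \<in> ?S" by (simp add: AE_measure_pmf_iff)
    fix y assume y: "y \<in> ?S"
    have "emeasure (distr M (count_space UNIV) Y') {y} = emeasure M (Y' -` {y} \<inter> space M)"
      by (rule emeasure_distr[OF Y'm]) simp
    also have "\<dots> = emeasure M (E y)"
    proof (rule emeasure_eq_AE)
      show "AE \<omega> in M. (\<omega> \<in> Y' -` {y} \<inter> space M) = (\<omega> \<in> E y)"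
        using eq by eventually_elim (auto simp: E_def)
      show "Y' -` {y} \<inter> space M \<in> sets M" by (rule measurable_sets[OF Y'm]) simp
    qed (rule E[OF y])
    also have "\<dots> = emeasure (measure_pmf w) {y}" by (simp add: E_def law[OF y] emeasure_pmf_single)
    finally show "emeasure (distr M (count_space UNIV) Y') {y} = emeasure (measure_pmf w) {y}" .
  qed simp_all
  with Y'm eq that show ?thesis by blast
qed

lemma expectation_pmf_version:
  fixes w :: "'b pmf" and Y :: "'a \<Rightarrow> 'b" and f :: "'b \<Rightarrow> real"
  assumes "prob_space M"
    and meas: "\<And>y. y \<in> set_pmf w \<Longrightarrow> {\<omega> \<in> space M. Y \<omega> = y} \<in> sets M"
    and law: "\<And>y. y \<in> set_pmf w \<Longrightarrow> emeasure M {\<omega> \<in> space M. Y \<omega> = y} = ennreal (pmf w y)"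
    and f: "(\<lambda>\<omega>. f (Y \<omega>)) \<in> borel_measurable M"
  shows "(\<integral>\<omega>. f (Y \<omega>) \<partial>M) = measure_pmf.expectation w f"
proof -
  obtain Y' where Y': "Y' \<in> M \<rightarrow>\<^sub>M count_space UNIV" "distr M (count_space UNIV) Y' = measure_pmf w"
    "AE \<omega> in M. Y \<omega> = Y' \<omega>"
    using pmf_version[OF assms(1-3)] by blast
  have "(\<integral>\<omega>. f (Y \<omega>) \<partial>M) = (\<integral>\<omega>. f (Y' \<omega>) \<partial>M)"
  proof (rule integral_cong_AE[OF f])
    show "(\<lambda>\<omega>. f (Y' \<omega>)) \<in> borel_measurable M" by (rule measurable_compose[OF Y'(1)]) simp
    show "AE \<omega> in M. f (Y \<omega>) = f (Y' \<omega>)" using Y'(3) by eventually_elim simp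
  qed
  also have "\<dots> = (\<integral>y. f y \<partial>distr M (count_space UNIV) Y')"
    by (rule integral_distr[OF Y'(1), symmetric]) simp
  finally show ?thesis unfolding Y'(2) .
qed

text \<open>A probability measure whose atoms are at least those of a pmf has no mass left over.\<close>

lemma atomic_measure_eqI:
  assumes "prob_space \<mu>" "sets \<mu> = sets borel" and ge: "\<And>y. measure \<mu> {y} \<ge> pmf w y"
  shows "\<mu> = distr (measure_pmf w) (borel :: 'b::t1_space measure) (\<lambda>x. x)"
proof -
  interpret prob_space \<mu> by fact
  have sp: "space \<mu> = UNIV" using sets_eq_imp_space_eq[OF assms(2)] by simp
  have sing: "{y} \<in> sets \<mu>" for y using assms(2) by simp
  have le: "measure_pmf.prob w A \<le> prob A" if A: "A \<in> sets \<mu>" for A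
  proof (rule field_le_epsilon)
    fix e :: real assume "e > 0"
    then obtain C where C: "finite C" "C \<subseteq> A" "measure_pmf.prob w C \<ge> measure_pmf.prob w A - e"
      using prob_finite_approx[of e A w] by blast
    have "measure_pmf.prob w C = (\<Sum>y\<in>C. pmf w y)" by (rule measure_measure_pmf_finite[OF C(1)])
    also have "\<dots> \<le> (\<Sum>y\<in>C. prob {y})" by (intro sum_mono ge)
    also have "\<dots> = prob C"
      using finite_measure_eq_sum_singleton[OF C(1), of ] sing by simp
    also have "\<dots> \<le> prob A" by (rule finite_measure_mono[OF C(2) A])
    finally show "measure_pmf.prob w A \<le> prob A + e" using C(3) by linarith
  qed
  show ?thesis
  proof (rule measure_eqI)
    show "sets \<mu> = sets (distr (measure_pmf w) borel (\<lambda>x. x))" using assms(2) by simp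
    fix A assume A: "A \<in> sets \<mu>"
    then have AB: "A \<in> sets borel" using assms(2) by simp
    have "measure_pmf.prob w (space \<mu> - A) \<le> prob (space \<mu> - A)" using A by (intro le) auto
    then have "1 - measure_pmf.prob w A \<le> 1 - prob A"
      using prob_compl[OF A] measure_pmf.prob_compl[of A w] by (simp add: sp)
    with le[OF A] have "prob A = measure_pmf.prob w A" by linarith
    then show "emeasure \<mu> A = emeasure (distr (measure_pmf w) borel (\<lambda>x. x)) A"
      using AB by (simp add: emeasure_distr emeasure_eq_measure measure_pmf.emeasure_eq_measure)
  qed
qed

lemma prod_list_index: "(\<Prod>k\<in>{1..length xs}. f (xs ! (k - 1))) = (\<Prod>x\<leftarrow>xs. f x :: 'b::comm_monoid_mult)"
proof (induction xs rule: rev_induct)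
  case (snoc x xs)
  have "(\<Prod>k\<in>{1..length (xs @ [x])}. f ((xs @ [x]) ! (k - 1))) =
     (\<Prod>k\<in>{1..length xs}. f ((xs @ [x]) ! (k - 1))) * f x"
    by (simp add: prod.nat_ivl_Suc')
  also have "(\<Prod>k\<in>{1..length xs}. f ((xs @ [x]) ! (k - 1))) = (\<Prod>k\<in>{1..length xs}. f (xs ! (k - 1)))"
    by (rule prod.cong) (auto simp: nth_append)
  finally show ?case using snoc by simp
qed simp

lemma map_upt_eq_iff: "map X [1..<length xs + 1] = xs \<longleftrightarrow> (\<forall>k\<in>{1..length xs}. X k = xs ! (k - 1))"
proof
  assume a: "map X [1..<length xs + 1] = xs"
  show "\<forall>k\<in>{1..length xs}. X k = xs ! (k - 1)"
  proof
    fix k assume k: "k \<in> {1..length xs}"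
    have "xs ! (k - 1) = map X [1..<length xs + 1] ! (k - 1)" using a by simp
    also have "\<dots> = X k" using k by (subst nth_map) (auto simp del: upt_Suc)
    finally show "X k = xs ! (k - 1)" by simp
  qed
next
  assume "\<forall>k\<in>{1..length xs}. X k = xs ! (k - 1)"
  then show "map X [1..<length xs + 1] = xs"
    by (intro nth_equalityI) (auto simp del: upt_Suc)
qed

lemma emeasure_PiM_list:
  assumes "prob_space \<mu>" and sing: "\<And>x. x \<in> set xs \<Longrightarrow> {x} \<in> sets \<mu>"
  shows "{X \<in> space (\<Pi>\<^sub>M k\<in>{1::nat..}. \<mu>). map X [1..<length xs + 1] = xs} \<in> sets (\<Pi>\<^sub>M k\<in>{1::nat..}. \<mu>)"
    and "emeasure (\<Pi>\<^sub>M k\<in>{1::nat..}. \<mu>) {X \<in> space (\<Pi>\<^sub>M k\<in>{1::nat..}. \<mu>). map X [1..<length xs + 1] = xs} =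
      ennreal (\<Prod>x\<leftarrow>xs. measure \<mu> {x})"
proof -
  interpret \<mu>: prob_space \<mu> by fact
  interpret product_prob_space "\<lambda>_::nat. \<mu>" "{1..}"
    by (rule product_prob_spaceI) (rule assms(1))
  let ?M = "\<Pi>\<^sub>M k\<in>{1::nat..}. \<mu>" and ?n = "length xs"
  have set: "{X \<in> space ?M. map X [1..<?n + 1] = xs} = {X \<in> space ?M. \<forall>k\<in>{1..?n}. X k \<in> {xs ! (k - 1)}}"
    unfolding map_upt_eq_iff by simp
  have s: "{xs ! (k - 1)} \<in> sets \<mu>" if "k \<in> {1..?n}" for k
  proof -
    have "k - 1 < ?n" using that by auto
    then show ?thesis by (intro sing nth_mem)
  qed
  have "{X \<in> space ?M. \<forall>k\<in>{1..?n}. X k \<in> {xs ! (k - 1)}} \<in> sets ?M"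
  proof (rule sets.sets_Collect_finite_All)
    fix k assume k: "k \<in> {1..?n}"
    then have "(\<lambda>X. X k) -` {xs ! (k - 1)} \<inter> space ?M \<in> sets ?M"
      by (intro measurable_sets[OF measurable_component_singleton] s) auto
    moreover have "(\<lambda>X. X k) -` {xs ! (k - 1)} \<inter> space ?M = {X \<in> space ?M. X k \<in> {xs ! (k - 1)}}" by blast
    ultimately show "{X \<in> space ?M. X k \<in> {xs ! (k - 1)}} \<in> sets ?M" by (simp only:)
  qed simp
  then show "{X \<in> space ?M. map X [1..<?n + 1] = xs} \<in> sets ?M" by (simp only: set)
  have "emeasure ?M {X \<in> space ?M. \<forall>k\<in>{1..?n}. X k \<in> {xs ! (k - 1)}} = (\<Prod>k\<in>{1..?n}. emeasure \<mu> {xs ! (k - 1)})"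
    by (rule emeasure_PiM_Collect) (use s in auto)
  also have "\<dots> = (\<Prod>x\<leftarrow>xs. emeasure \<mu> {x})" by (rule prod_list_index)
  also have "\<dots> = ennreal (\<Prod>x\<leftarrow>xs. measure \<mu> {x})"
    by (induction xs) (auto simp: \<mu>.emeasure_eq_measure ennreal_mult' prod_list_nonneg)
  finally show "emeasure ?M {X \<in> space ?M. map X [1..<?n + 1] = xs} = ennreal (\<Prod>x\<leftarrow>xs. measure \<mu> {x})"
    by (simp only: set)
qed

lemma prob_space_PiM_const: "prob_space \<mu> \<Longrightarrow> prob_space (\<Pi>\<^sub>M k\<in>{1::nat..}. \<mu>)"
  by (rule prob_space_PiM)

lemma prob_space_pair: "prob_space A \<Longrightarrow> prob_space B \<Longrightarrow> prob_space (A \<Otimes>\<^sub>M B)"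
proof -
  assume "prob_space A" "prob_space B"
  then interpret pair_prob_space A B
    by (simp add: pair_prob_space_def pair_sigma_finite_def prob_space_imp_sigma_finite)
  show ?thesis by unfold_locales
qed

lemma prob_space_cavity_law: "prob_space \<mu> \<Longrightarrow> prob_space (cavity_law p \<alpha> \<Theta> \<mu>)"
  unfolding cavity_law_def
  by (intro prob_space_pair prob_space_PiM_const measure_pmf.prob_space_axioms)

lemma read_config_eq_iff:
  assumes "\<And>e. e \<in> set cs \<Longrightarrow> length (snd e) = p - 1"
  shows "read_config p r \<theta> X = cs \<longleftrightarrow> r = length cs \<and> map \<theta> [1..<length (map fst cs) + 1] = map fst cs \<and>
     map X [1..<length (concat (map snd cs)) + 1] = concat (map snd cs)"
proof -
  have len: "length (concat (map snd cs)) = length cs * (p - 1)"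
  proof -
    have "length x = p - 1" if "x \<in> set (map snd cs)" for x using that assms by auto
    then show ?thesis using concat_lengths[of "map snd cs" "p - 1"] by simp
  qed
  have 1: "map fst (read_config p r \<theta> X) = map \<theta> [1..<r + 1]"
    unfolding read_config_def map_map o_def fst_conv ..
  have 2: "concat (map snd (read_config p r \<theta> X)) = map X [1..<r * (p - 1) + 1]"
    unfolding read_config_def map_map o_def snd_conv concat_blocks[symmetric] map_concat by simp
  have 3: "length (read_config p r \<theta> X) = r" by (simp add: read_config_def del: upt_Suc)
  show ?thesis
  proof
    assume a: "read_config p r \<theta> X = cs"
    show "r = length cs \<and> map \<theta> [1..<length (map fst cs) + 1] = map fst cs \<and>
     map X [1..<length (concat (map snd cs)) + 1] = concat (map snd cs)"
      using 1 2 3 len unfolding a by simp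
  next
    assume b: "r = length cs \<and> map \<theta> [1..<length (map fst cs) + 1] = map fst cs \<and>
     map X [1..<length (concat (map snd cs)) + 1] = concat (map snd cs)"
    have f: "map fst (read_config p r \<theta> X) = map fst cs" using b 1 by simp
    have c: "concat (map snd (read_config p r \<theta> X)) = concat (map snd cs)" using b 2 len by simp
    have l: "length (map snd (read_config p r \<theta> X)) = length (map snd cs)" using 3 b by simp
    have "length (snd e) = p - 1" if "e \<in> set (read_config p r \<theta> X)" for e
    proof -
      obtain k where "k \<ge> 1" "e = (\<theta> k, map X [(k - 1) * (p - 1) + 1..<k * (p - 1) + 1])"
        using \<open>e \<in> _\<close> unfolding read_config_def set_map set_upt by fastforce
      then show ?thesis by (cases k) (simp_all del: upt_Suc)
    qed
    note lenR = this
    have "\<forall>(x, y)\<in>set (zip (map snd (read_config p r \<theta> X)) (map snd cs)). length x = length y"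
    proof (rule ballI, rule case_prodI2)
      fix z x y assume z: "z \<in> set (zip (map snd (read_config p r \<theta> X)) (map snd cs))" "z = (x, y)"
      then have xy: "(x, y) \<in> set (zip (map snd (read_config p r \<theta> X)) (map snd cs))" by simp
      have "x \<in> set (map snd (read_config p r \<theta> X))" "y \<in> set (map snd cs)"
        using set_zip_leftD[OF xy] set_zip_rightD[OF xy] .
      then show "length x = length y" using lenR assms by (metis (no_types, lifting) imageE set_map)
    qed
    then have "map snd (read_config p r \<theta> X) = map snd cs"
      using concat_injective[OF c l] by blast
    then show "read_config p r \<theta> X = cs" using f by (metis zip_map_fst_snd)
  qed
qed

context critical_csp begin

definition config_of :: "nat \<times> (nat \<Rightarrow> spin list \<Rightarrow> real) \<times> (nat \<Rightarrow> field) \<Rightarrow> config" where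
  "config_of \<omega> = read_config p (fst \<omega>) (fst (snd \<omega>)) (snd (snd \<omega>))"

text \<open>The atoms of the law of the configuration depend only on the atoms of \<open>\<mu>\<close>. This holds for an
  arbitrary \<open>\<mu>\<close>, and it is all that uniqueness requires.\<close>

lemma cavity_law_config:
  assumes \<mu>: "prob_space \<mu>" "sets \<mu> = sets borel" and cs: "\<And>e. e \<in> set cs \<Longrightarrow> length (snd e) = p - 1"
  shows "{\<omega> \<in> space (cavity_law p \<alpha> \<Theta> \<mu>). config_of \<omega> = cs} \<in> sets (cavity_law p \<alpha> \<Theta> \<mu>)" (is ?A)
    and "emeasure (cavity_law p \<alpha> \<Theta> \<mu>) {\<omega> \<in> space (cavity_law p \<alpha> \<Theta> \<mu>). config_of \<omega> = cs} =
      ennreal (config_weight (\<alpha> * p) (p - 1) (\<lambda>x. measure \<mu> {x}) cs)" (is ?B)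
proof -
  interpret \<mu>: prob_space \<mu> by fact
  let ?P = "measure_pmf (poisson_pmf (\<alpha> * p))" and ?T = "\<Pi>\<^sub>M k\<in>{1::nat..}. measure_pmf \<Theta>" and ?X = "\<Pi>\<^sub>M k\<in>{1::nat..}. \<mu>"
  let ?\<theta>s = "map fst cs" and ?xs = "concat (map snd cs)"
  define S1 where "S1 = {\<theta> \<in> space ?T. map \<theta> [1..<length ?\<theta>s + 1] = ?\<theta>s}"
  define S2 where "S2 = {X \<in> space ?X. map X [1..<length ?xs + 1] = ?xs}"
  have S1: "S1 \<in> sets ?T" "emeasure ?T S1 = ennreal (\<Prod>\<theta>\<leftarrow>?\<theta>s. measure (measure_pmf \<Theta>) {\<theta>})"
    unfolding S1_def by (rule emeasure_PiM_list; simp add: measure_pmf.prob_space_axioms)+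
  have sing: "{x} \<in> sets \<mu>" for x using \<mu>(2) by simp
  have S2: "S2 \<in> sets ?X" "emeasure ?X S2 = ennreal (\<Prod>x\<leftarrow>?xs. measure \<mu> {x})"
    unfolding S2_def by (rule emeasure_PiM_list[OF \<mu>(1) sing])+
  interpret X: prob_space ?X by (rule prob_space_PiM_const[OF \<mu>(1)])
  interpret T: prob_space ?T by (rule prob_space_PiM_const[OF measure_pmf.prob_space_axioms])
  interpret TX: prob_space "?T \<Otimes>\<^sub>M ?X" by (rule prob_space_pair[OF T.prob_space_axioms X.prob_space_axioms])
  have set: "{\<omega> \<in> space (cavity_law p \<alpha> \<Theta> \<mu>). config_of \<omega> = cs} = {length cs} \<times> (S1 \<times> S2)"
  proof (rule set_eqI)
    fix \<omega> :: "nat \<times> (nat \<Rightarrow> spin list \<Rightarrow> real) \<times> (nat \<Rightarrow> field)"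
    have eq: "config_of \<omega> = cs \<longleftrightarrow> fst \<omega> = length cs \<and> map (fst (snd \<omega>)) [1..<length ?\<theta>s + 1] = ?\<theta>s \<and>
        map (snd (snd \<omega>)) [1..<length ?xs + 1] = ?xs"
      unfolding config_of_def by (rule read_config_eq_iff[OF cs])
    show "\<omega> \<in> {\<omega> \<in> space (cavity_law p \<alpha> \<Theta> \<mu>). config_of \<omega> = cs} \<longleftrightarrow> \<omega> \<in> {length cs} \<times> (S1 \<times> S2)"
      unfolding mem_Collect_eq eq cavity_law_def space_pair_measure S1_def S2_def mem_Times_iff singleton_iff
        space_measure_pmf by blast
  qed
  have m: "S1 \<times> S2 \<in> sets (?T \<Otimes>\<^sub>M ?X)" using S1(1) S2(1) by (rule pair_measureI)
  show ?A unfolding set unfolding cavity_law_def by (rule pair_measureI) (simp, rule m)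
  have "emeasure (cavity_law p \<alpha> \<Theta> \<mu>) ({length cs} \<times> (S1 \<times> S2)) = emeasure ?P {length cs} * (emeasure ?T S1 * emeasure ?X S2)"
  proof -
    have "emeasure (?P \<Otimes>\<^sub>M (?T \<Otimes>\<^sub>M ?X)) ({length cs} \<times> (S1 \<times> S2)) = emeasure ?P {length cs} * emeasure (?T \<Otimes>\<^sub>M ?X) (S1 \<times> S2)"
      by (rule TX.emeasure_pair_measure_Times[OF _ m]) simp
    also have "emeasure (?T \<Otimes>\<^sub>M ?X) (S1 \<times> S2) = emeasure ?T S1 * emeasure ?X S2"
      by (rule X.emeasure_pair_measure_Times[OF S1(1) S2(1)])
    finally show ?thesis unfolding cavity_law_def .
  qed
  also have "\<dots> = ennreal (pmf (poisson_pmf (\<alpha> * p)) (length cs)) *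
     (ennreal (\<Prod>\<theta>\<leftarrow>?\<theta>s. pmf \<Theta> \<theta>) * ennreal (\<Prod>x\<leftarrow>?xs. measure \<mu> {x}))"
    unfolding S1 S2 measure_pmf_single emeasure_pmf_single ..
  also have "\<dots> = ennreal (pmf (poisson_pmf (\<alpha> * p)) (length cs) * prod_list (map (pmf \<Theta> \<circ> fst) cs) * (\<Prod>x\<leftarrow>?xs. measure \<mu> {x}))"
  proof -
    have "0 \<le> (\<Prod>\<theta>\<leftarrow>?\<theta>s. pmf \<Theta> \<theta>)" "0 \<le> (\<Prod>x\<leftarrow>?xs. measure \<mu> {x})"
      by (intro prod_list_nonneg, auto)+
    then show ?thesis by (simp only: ennreal_mult[symmetric] pmf_nonneg mult_nonneg_nonneg mult.assoc map_map o_def)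
  qed
  also have "\<dots> = ennreal (config_weight (\<alpha> * p) (p - 1) (\<lambda>x. measure \<mu> {x}) cs)"
    by (simp only: config_weight_alt[OF cs])
  finally show ?B unfolding set .
qed

lemma T_alt: "T p \<alpha> \<Theta> \<beta> \<mu> = distr (cavity_law p \<alpha> \<Theta> \<mu>) borel (\<lambda>\<omega>. message \<beta> (config_of \<omega>))"
  unfolding T_def config_of_def case_prod_unfold cavity_field_eq_message ..

lemma message_config_measurable:
  assumes "sets \<mu> = sets borel"
  shows "(\<lambda>\<omega>. message \<beta> (config_of \<omega>)) \<in> borel_measurable (cavity_law p \<alpha> \<Theta> \<mu>)"
  using cavity_field_measurable[OF assms, of p \<beta> \<alpha> \<Theta>]
  unfolding config_of_def case_prod_unfold cavity_field_eq_message .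

lemma prob_space_T:
  assumes "prob_space \<mu>" "sets \<mu> = sets borel"
  shows "prob_space (T p \<alpha> \<Theta> \<beta> \<mu>)"
  unfolding T_alt by (rule prob_space.prob_space_distr[OF prob_space_cavity_law[OF assms(1)] message_config_measurable[OF assms(2)]])

lemma T_atom_ge:
  assumes \<mu>: "prob_space \<mu>" "sets \<mu> = sets borel"
    and C: "finite C" "\<And>cs. cs \<in> C \<Longrightarrow> message \<beta> cs = y" "\<And>cs e. cs \<in> C \<Longrightarrow> e \<in> set cs \<Longrightarrow> length (snd e) = p - 1"
  shows "(\<Sum>cs\<in>C. config_weight (\<alpha> * p) (p - 1) (\<lambda>x. measure \<mu> {x}) cs) \<le> measure (T p \<alpha> \<Theta> \<beta> \<mu>) {y}"
proof -
  let ?M = "cavity_law p \<alpha> \<Theta> \<mu>"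
  interpret M: prob_space ?M by (rule prob_space_cavity_law[OF \<mu>(1)])
  define E where "E cs = {\<omega> \<in> space ?M. config_of \<omega> = cs}" for cs
  have E: "E cs \<in> sets ?M" "measure ?M (E cs) = config_weight (\<alpha> * p) (p - 1) (\<lambda>x. measure \<mu> {x}) cs" if "cs \<in> C" for cs
  proof -
    show "E cs \<in> sets ?M" unfolding E_def by (rule cavity_law_config(1)[OF \<mu> C(3)[OF that]])
    have "config_weight (\<alpha> * p) (p - 1) (\<lambda>x. measure \<mu> {x}) cs \<ge> 0"
      using config_weight_mono[OF \<alpha>p, of "\<lambda>x. measure \<mu> {x}" "\<lambda>x. measure \<mu> {x}"] by simp
    then show "measure ?M (E cs) = config_weight (\<alpha> * p) (p - 1) (\<lambda>x. measure \<mu> {x}) cs"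
      unfolding E_def using cavity_law_config(2)[OF \<mu> C(3)[OF that]] by (intro measure_eq_emeasure_eq_ennreal)
  qed
  have "(\<Sum>cs\<in>C. config_weight (\<alpha> * p) (p - 1) (\<lambda>x. measure \<mu> {x}) cs) = (\<Sum>cs\<in>C. measure ?M (E cs))"
    by (simp add: E)
  also have "\<dots> = measure ?M (\<Union>cs\<in>C. E cs)"
    using C(1) E by (intro M.finite_measure_finite_Union[symmetric]) (auto simp: disjoint_family_on_def E_def)
  also have "\<dots> \<le> measure ?M ((\<lambda>\<omega>. message \<beta> (config_of \<omega>)) -` {y} \<inter> space ?M)"
    using measurable_sets[OF message_config_measurable[OF \<mu>(2)], of "{y}"] C(2)
    by (intro M.finite_measure_mono) (auto simp: E_def)
  also have "\<dots> = measure (T p \<alpha> \<Theta> \<beta> \<mu>) {y}"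
    unfolding T_alt by (rule measure_distr[OF message_config_measurable[OF \<mu>(2)], symmetric]) simp
  finally show ?thesis .
qed

text \<open>A lower bound \<open>m\<close> for the atoms of \<open>\<mu>\<close> passes to \<open>T \<mu>\<close>. The injection \<open>f\<close> is the identity when
  \<open>m\<close> is a probability weight, and \<open>some_config\<close> when \<open>m\<close> belongs to truncated trees.\<close>

lemma T_atom_ge_message:
  assumes \<mu>: "prob_space \<mu>" "sets \<mu> = sets borel" and m: "\<And>x. 0 \<le> m x \<and> m x \<le> measure \<mu> {x}"
    and f: "inj f" "\<And>cs. pmf M (f cs) = config_weight (\<alpha> * p) (p - 1) m cs"
  shows "measure_pmf.prob M (f ` {cs. message \<beta> cs = y}) \<le> measure (T p \<alpha> \<Theta> \<beta> \<mu>) {y}"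
proof (rule field_le_epsilon)
  fix e :: real assume e: "e > 0"
  obtain D where D: "finite D" "D \<subseteq> f ` {cs. message \<beta> cs = y}" "D \<subseteq> set_pmf M"
    "measure_pmf.prob M D \<ge> measure_pmf.prob M (f ` {cs. message \<beta> cs = y}) - e"
    using prob_finite_approx[OF e] by metis
  define C where "C = f -` D"
  have CD: "D = f ` C" using D(2) unfolding C_def by auto
  have C: "finite C" unfolding C_def by (rule finite_vimageI[OF D(1) f(1)])
  have Cy: "message \<beta> cs = y" if "cs \<in> C" for cs
    using that D(2) injD[OF f(1)] unfolding C_def by fastforce
  have Cw: "config_weight (\<alpha> * p) (p - 1) m cs \<noteq> 0" if "cs \<in> C" for cs
    using that D(3) unfolding C_def f(2)[symmetric] by (auto simp: set_pmf_iff)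
  have Cl: "length (snd e) = p - 1" if "cs \<in> C" "e \<in> set cs" for cs e
    by (rule config_weight_length[OF Cw[OF that(1)] that(2)])
  have "measure_pmf.prob M D = (\<Sum>cs\<in>C. config_weight (\<alpha> * p) (p - 1) m cs)"
    unfolding measure_measure_pmf_finite[OF D(1)] unfolding CD
    by (subst sum.reindex) (auto simp: f(2) intro: inj_on_subset[OF f(1)])
  also have "\<dots> \<le> (\<Sum>cs\<in>C. config_weight (\<alpha> * p) (p - 1) (\<lambda>x. measure \<mu> {x}) cs)"
    using config_weight_mono[OF \<alpha>p, of m "\<lambda>x. measure \<mu> {x}", OF m] by (intro sum_mono) blast
  also have "\<dots> \<le> measure (T p \<alpha> \<Theta> \<beta> \<mu>) {y}"
    by (rule T_atom_ge[OF \<mu> C Cy Cl])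
  finally show "measure_pmf.prob M (f ` {cs. message \<beta> cs = y}) \<le> measure (T p \<alpha> \<Theta> \<beta> \<mu>) {y} + e"
    using D(4) by linarith
qed

definition field_measure :: "field measure" where
  "field_measure = distr (measure_pmf field_pmf) borel (\<lambda>x. x)"

lemma field_measure: "prob_space field_measure" "sets field_measure = sets borel" "measure field_measure {x} = pmf field_pmf x"
  unfolding field_measure_def
  by (auto intro!: measure_pmf.prob_space_distr simp: measure_distr measure_pmf_single)

lemma T_field_measure: "T p \<alpha> \<Theta> \<beta> field_measure = field_measure"
proof -
  have "pmf field_pmf y \<le> measure (T p \<alpha> \<Theta> \<beta> field_measure) {y}" for y
  proof -
    have "pmf field_pmf y = pmf (map_pmf (message \<beta>) (config_law (\<alpha> * p) (p - 1) field_pmf)) y"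
      by (simp only: field_pmf_fixed_point)
    also have "\<dots> = measure_pmf.prob (config_law (\<alpha> * p) (p - 1) field_pmf) ((\<lambda>x. x) ` {cs. message \<beta> cs = y})"
      by (simp add: pmf_map vimage_def)
    also have "\<dots> \<le> measure (T p \<alpha> \<Theta> \<beta> field_measure) {y}"
      by (rule T_atom_ge_message[where m="pmf field_pmf"]) (auto simp: field_measure pmf_config_law[OF \<alpha>p])
    finally show ?thesis .
  qed
  then have "T p \<alpha> \<Theta> \<beta> field_measure = distr (measure_pmf field_pmf) borel (\<lambda>x. x)"
    by (intro atomic_measure_eqI prob_space_T field_measure) (auto simp: T_def)
  then show ?thesis by (simp add: field_measure_def)
qed

text \<open>Starting from the trivial bound at depth \<open>0\<close>, each application of \<open>T\<close> improves the lower bound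
  for the atoms of the fixed point by one level of the tree.\<close>

lemma fixed_point_unique:
  assumes \<mu>: "prob_space \<mu>" "sets \<mu> = sets borel" and fp: "T p \<alpha> \<Theta> \<beta> \<mu> = \<mu>"
  shows "\<mu> = field_measure"
proof -
  have d: "pmf (tree_message d) (Some y) \<le> measure \<mu> {y}" for d y
  proof (induction d arbitrary: y)
    case (Suc d)
    have "pmf (tree_message (Suc d)) (Some y) \<le> measure (T p \<alpha> \<Theta> \<beta> \<mu>) {y}"
      unfolding pmf_tree_message_Suc
      by (rule T_atom_ge_message[OF \<mu> _ inj_some_config pmf_config_law_some[OF \<alpha>p]]) (simp add: Suc del: tree_message.simps)
    then show ?case by (simp only: fp)
  qed simp
  have "pmf field_pmf y \<le> measure \<mu> {y}" for y
    by (rule LIMSEQ_le_const2[OF tree_message_tendsto]) (use d in blast)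
  then show ?thesis unfolding field_measure_def by (intro atomic_measure_eqI \<mu>)
qed

text \<open>As the number of edges is Poisson, this bound gives the norm of a message finite mean.\<close>

lemma norm_message_le:
  assumes "cs \<in> set_pmf (config_law c (p - 1) field_pmf)"
  shows "norm (message \<beta> cs) \<le> 2 * real (length cs)"
proof (rule norm_bound)
  fix t
  let ?n = "real (length cs)" and ?a = "spin_avg (star_weight \<beta> cs)"
  note b = star_weight_bounds[OF assms, of t]
  have pos: "star_weight \<beta> cs t > 0" "?a > 0" by (rule star_weight_pos, rule spin_avg_star_weight_pos)
  have "ln (exp (- \<beta>) ^ length cs) \<le> ln (star_weight \<beta> cs t)" using b pos by (subst ln_le_cancel_iff) auto
  moreover have "ln (star_weight \<beta> cs t) \<le> ln (exp \<beta> ^ length cs)" using b pos by (subst ln_le_cancel_iff) auto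
  ultimately have "\<bar>ln (star_weight \<beta> cs t)\<bar> \<le> \<beta> * ?n" by (simp add: abs_le_iff ln_realpow mult.commute)
  moreover have "\<bar>ln ?a\<bar> \<le> \<beta> * ?n" by (rule ln_star_weight_bound[OF assms])
  ultimately have "\<bar>ln (star_weight \<beta> cs t / ?a)\<bar> \<le> \<beta> * (2 * ?n)"
    using pos by (simp add: ln_div abs_le_iff)
  then show "norm (apply_bcontfun (message \<beta> cs) t) \<le> 2 * ?n"
    using \<beta> by (simp add: message_def abs_mult divide_le_eq mult.commute)
qed

lemma field_measure_Pr1: "field_measure \<in> Pr1"
proof -
  have "(\<integral>\<^sup>+f. ennreal (norm f) \<partial>field_measure) = (\<integral>\<^sup>+f. ennreal (norm f) \<partial>measure_pmf field_pmf)"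
    unfolding field_measure_def by (subst nn_integral_distr) auto
  also have "\<dots> = (\<integral>\<^sup>+cs. ennreal (norm (message \<beta> cs)) \<partial>measure_pmf (config_law (\<alpha> * p) (p - 1) field_pmf))"
    by (subst field_pmf_fixed_point[symmetric]) simp
  also have "\<dots> \<le> (\<integral>\<^sup>+cs. ennreal (2 * real (length cs)) \<partial>measure_pmf (config_law (\<alpha> * p) (p - 1) field_pmf))"
    by (intro nn_integral_mono_AE AE_pmfI ennreal_leI norm_message_le)
  also have "\<dots> = ennreal (measure_pmf.expectation (config_law (\<alpha> * p) (p - 1) field_pmf) (\<lambda>cs. 2 * real (length cs)))"
    unfolding config_law_def using integrable_length_poisson_list[OF \<alpha>p]
    by (intro nn_integral_eq_integral) auto
  also have "\<dots> < \<infinity>" by simp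
  finally show ?thesis by (simp add: Pr1_def field_measure)
qed

theorem fixed_point_eq: "fixed_point p \<alpha> \<Theta> \<beta> = field_measure"
  unfolding fixed_point_def
proof (rule the_equality)
  show "field_measure \<in> Pr1 \<and> T p \<alpha> \<Theta> \<beta> field_measure = field_measure"
    using field_measure_Pr1 T_field_measure by blast
  show "\<mu> = field_measure" if "\<mu> \<in> Pr1 \<and> T p \<alpha> \<Theta> \<beta> \<mu> = \<mu>" for \<mu>
    using that fixed_point_unique unfolding Pr1_def by blast
qed

lemma vertex_term:
  "(\<integral>(r, \<theta>, X). ln (gibbs (r * (p - 1)) \<beta> X (\<lambda>\<sigma>. \<integral>e. boltzmann p \<beta> r \<theta> \<sigma> e \<partial>\<nu>)) \<partial>cavity_law p \<alpha> \<Theta> field_measure) = bethe_vertex"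
proof -
  let ?M = "cavity_law p \<alpha> \<Theta> field_measure" and ?w = "config_law (\<alpha> * p) (p - 1) field_pmf"
  have "(\<integral>(r, \<theta>, X). ln (gibbs (r * (p - 1)) \<beta> X (\<lambda>\<sigma>. \<integral>e. boltzmann p \<beta> r \<theta> \<sigma> e \<partial>\<nu>)) \<partial>?M) =
    (\<integral>\<omega>. ln (spin_avg (star_weight \<beta> (config_of \<omega>))) \<partial>?M)"
    unfolding gibbs_boltzmann_avg config_of_def case_prod_unfold ..
  also have "\<dots> = measure_pmf.expectation ?w (\<lambda>cs. ln (spin_avg (star_weight \<beta> cs)))"
  proof (rule expectation_pmf_version)
    show "prob_space ?M" by (rule prob_space_cavity_law[OF field_measure(1)])
    show "(\<lambda>\<omega>. ln (spin_avg (star_weight \<beta> (config_of \<omega>)))) \<in> borel_measurable ?M"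
      unfolding config_of_def by (rule vertex_term_measurable[OF field_measure(2)])
    fix cs assume cs: "cs \<in> set_pmf ?w"
    have len: "\<And>e. e \<in> set cs \<Longrightarrow> length (snd e) = p - 1" by (rule set_config_law(2)[OF cs])
    show "{\<omega> \<in> space ?M. config_of \<omega> = cs} \<in> sets ?M" by (rule cavity_law_config(1)[OF field_measure(1,2) len])
    show "emeasure ?M {\<omega> \<in> space ?M. config_of \<omega> = cs} = ennreal (pmf ?w cs)"
      using cavity_law_config(2)[OF field_measure(1,2) len] by (simp only: pmf_config_law[OF \<alpha>p] field_measure(3))
  qed
  finally show ?thesis by (simp add: bethe_vertex_def)
qed

lemma edge_term:
  "(\<integral>(\<theta>, X). ln (gibbs p \<beta> X (\<lambda>\<sigma>. exp (\<beta> * \<theta> (map \<sigma> [1..<p + 1])))) \<partial>(measure_pmf \<Theta> \<Otimes>\<^sub>M (\<Pi>\<^sub>M k\<in>{1..}. field_measure))) = bethe_edge"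
proof -
  let ?X = "\<Pi>\<^sub>M k\<in>{1::nat..}. field_measure"
  let ?M = "measure_pmf \<Theta> \<Otimes>\<^sub>M ?X" and ?w = "pair_pmf \<Theta> (replicate_pmf p field_pmf)"
  interpret X: prob_space ?X by (rule prob_space_PiM_const[OF field_measure(1)])
  have "(\<integral>(\<theta>, X). ln (gibbs p \<beta> X (\<lambda>\<sigma>. exp (\<beta> * \<theta> (map \<sigma> [1..<p + 1])))) \<partial>?M) =
    (\<integral>\<omega>. ln (free_edge_weight \<beta> (fst \<omega>, map (snd \<omega>) [1..<p + 1])) \<partial>?M)"
    unfolding gibbs_edge case_prod_unfold ..
  also have "\<dots> = measure_pmf.expectation ?w (\<lambda>e. ln (free_edge_weight \<beta> e))"
  proof (rule expectation_pmf_version)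
    show "prob_space ?M" by (rule prob_space_pair[OF measure_pmf.prob_space_axioms X.prob_space_axioms])
    show "(\<lambda>\<omega>. ln (free_edge_weight \<beta> (fst \<omega>, map (snd \<omega>) [1..<p + 1]))) \<in> borel_measurable ?M"
      by (rule edge_term_measurable[OF field_measure(2)])
    fix e assume e: "e \<in> set_pmf ?w"
    obtain \<theta> xs where e': "e = (\<theta>, xs)" by (cases e)
    have len: "length xs = p" using e by (simp add: e' set_replicate_pmf)
    have sing: "{x} \<in> sets field_measure" for x by (simp add: field_measure(2))
    note L = emeasure_PiM_list[OF field_measure(1) sing, of xs, unfolded len]
    have set: "{\<omega> \<in> space ?M. (fst \<omega>, map (snd \<omega>) [1..<p + 1]) = e} = {\<theta>} \<times> {X \<in> space ?X. map X [1..<p + 1] = xs}"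
      by (auto simp: e' space_pair_measure simp del: upt_Suc)
    show "{\<omega> \<in> space ?M. (fst \<omega>, map (snd \<omega>) [1..<p + 1]) = e} \<in> sets ?M"
      unfolding set by (rule pair_measureI) (simp, rule L(1))
    have "emeasure ?M ({\<theta>} \<times> {X \<in> space ?X. map X [1..<p + 1] = xs}) =
      emeasure (measure_pmf \<Theta>) {\<theta>} * emeasure ?X {X \<in> space ?X. map X [1..<p + 1] = xs}"
      by (rule X.emeasure_pair_measure_Times) (simp, rule L(1))
    also have "\<dots> = ennreal (pmf \<Theta> \<theta>) * ennreal (\<Prod>x\<leftarrow>xs. pmf field_pmf x)"
      unfolding L(2) by (simp only: emeasure_pmf_single field_measure(3))
    also have "\<dots> = ennreal (pmf ?w e)"
      by (simp add: e' pmf_pair pmf_replicate_pmf len ennreal_mult')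
    finally show "emeasure ?M {\<omega> \<in> space ?M. (fst \<omega>, map (snd \<omega>) [1..<p + 1]) = e} = ennreal (pmf ?w e)"
      unfolding set .
  qed
  finally show ?thesis by (simp add: bethe_edge_def)
qed

theorem P_fixed_point: "P p \<alpha> \<Theta> \<beta> (fixed_point p \<alpha> \<Theta> \<beta>) = bethe_vertex - \<alpha> * (real p - 1) * bethe_edge"
  unfolding fixed_point_eq P_def vertex_term edge_term ..

corollary free_energy_limit_P:
  "(\<lambda>N. mean_log_partition N (\<alpha> * N) / real N) \<longlonglongrightarrow> P p \<alpha> \<Theta> \<beta> (fixed_point p \<alpha> \<Theta> \<beta>)"
  unfolding P_fixed_point by (rule free_energy_limit)

end

section \<open>Concentration along Poisson lists\<close>

text \<open>The head is drawn after the tail, so that it can be integrated out with the tail fixed.\<close>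

lemma replicate_pmf_Suc_tail:
  "replicate_pmf (Suc n) Q = bind_pmf (replicate_pmf n Q) (\<lambda>xs. map_pmf (\<lambda>x. x # xs) Q)"
  unfolding replicate_pmf.simps by (subst bind_commute_pmf) (simp add: map_pmf_def)

lemma expectation_bind_finite:
  fixes h :: "'c \<Rightarrow> real"
  assumes "finite (set_pmf A)" "\<And>a. a \<in> set_pmf A \<Longrightarrow> finite (set_pmf (K a))"
  shows "measure_pmf.expectation (bind_pmf A K) h = measure_pmf.expectation A (\<lambda>a. measure_pmf.expectation (K a) h)"
proof -
  have "measure_pmf.expectation (bind_pmf A K) h = (\<Sum>a\<in>set_pmf A. pmf A a *\<^sub>R measure_pmf.expectation (K a) h)"
    by (rule pmf_expectation_bind[OF assms(1) assms(2)]) auto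
  also have "\<dots> = measure_pmf.expectation A (\<lambda>a. measure_pmf.expectation (K a) h)"
    by (rule integral_measure_pmf[OF assms(1), symmetric])
  finally show ?thesis .
qed

lemma finite_set_replicate_pmf: "finite (set_pmf Q) \<Longrightarrow> finite (set_pmf (replicate_pmf n Q))"
  unfolding set_replicate_pmf using finite_lists_length_eq[of "set_pmf Q" n] by (simp add: lists_eq_set)

lemma expectation_replicate_Suc:
  fixes f :: "'b list \<Rightarrow> real"
  assumes "finite (set_pmf Q)"
  shows "measure_pmf.expectation (replicate_pmf (Suc n) Q) f =
    measure_pmf.expectation (replicate_pmf n Q) (\<lambda>xs. measure_pmf.expectation Q (\<lambda>x. f (x # xs)))"
  unfolding replicate_pmf_Suc_tail
  by (subst expectation_bind_finite) (auto simp: assms finite_set_replicate_pmf)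

text \<open>The bounded difference property, formulated for insertion instead of replacement so that it
  also controls the dependence on the length of the list. The elements are restricted to a set
  \<open>S\<close>, in applications the support of their law.\<close>

definition insertion_bounded :: "real \<Rightarrow> 'b set \<Rightarrow> ('b list \<Rightarrow> real) \<Rightarrow> bool" where
  "insertion_bounded b S f \<longleftrightarrow> (\<forall>as x bs. set as \<subseteq> S \<and> x \<in> S \<and> set bs \<subseteq> S \<longrightarrow> \<bar>f (as @ x # bs) - f (as @ bs)\<bar> \<le> b)"

lemma insertion_boundedD:
  "insertion_bounded b S f \<Longrightarrow> set as \<subseteq> S \<Longrightarrow> x \<in> S \<Longrightarrow> set bs \<subseteq> S \<Longrightarrow> \<bar>f (as @ x # bs) - f (as @ bs)\<bar> \<le> b"
  by (simp add: insertion_bounded_def)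

lemma abs_expectation_le:
  fixes f :: "'b \<Rightarrow> real"
  assumes "finite (set_pmf Q)" "\<And>x. x \<in> set_pmf Q \<Longrightarrow> \<bar>f x\<bar> \<le> b"
  shows "\<bar>measure_pmf.expectation Q f\<bar> \<le> b"
proof -
  have i: "integrable (measure_pmf Q) f" by (rule integrable_measure_pmf_finite[OF assms(1)])
  have bd: "f x \<le> b \<and> - b \<le> f x" if "x \<in> set_pmf Q" for x using assms(2)[OF that] by arith
  have "measure_pmf.expectation Q f \<le> measure_pmf.expectation Q (\<lambda>_. b)"
    by (rule integral_mono_AE) (use i bd in \<open>auto simp: AE_measure_pmf_iff\<close>)
  moreover have "measure_pmf.expectation Q (\<lambda>_. - b) \<le> measure_pmf.expectation Q f"
    by (rule integral_mono_AE) (use i bd in \<open>auto simp: AE_measure_pmf_iff\<close>)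
  ultimately show ?thesis by (simp add: abs_le_iff)
qed

lemma insertion_bounded_expectation:
  assumes Q: "finite (set_pmf Q)" and f: "insertion_bounded b (set_pmf Q) f"
  shows "insertion_bounded b (set_pmf Q) (\<lambda>xs. measure_pmf.expectation Q (\<lambda>x. f (x # xs)))"
  unfolding insertion_bounded_def
proof (intro allI impI)
  fix as y bs assume a: "set as \<subseteq> set_pmf Q \<and> y \<in> set_pmf Q \<and> set bs \<subseteq> set_pmf Q"
  have i: "integrable (measure_pmf Q) h" for h :: "'a \<Rightarrow> real" by (rule integrable_measure_pmf_finite[OF Q])
  have "measure_pmf.expectation Q (\<lambda>x. f (x # as @ y # bs)) - measure_pmf.expectation Q (\<lambda>x. f (x # as @ bs)) =
    measure_pmf.expectation Q (\<lambda>x. f (x # as @ y # bs) - f (x # as @ bs))"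
    using i by simp
  also have "\<bar>\<dots>\<bar> \<le> b"
    using insertion_boundedD[OF f, of "_ # as" y bs] a by (intro abs_expectation_le[OF Q]) auto
  finally show "\<bar>measure_pmf.expectation Q (\<lambda>x. f (x # as @ y # bs)) - measure_pmf.expectation Q (\<lambda>x. f (x # as @ bs))\<bar> \<le> b" .
qed

text \<open>The bounded difference method: given the tail, the head moves \<open>f\<close> within an interval of length
  \<open>2b\<close>, to which Hoeffding's lemma applies, and averaging over the head preserves the bounded
  difference property.\<close>

lemma replicate_exponential_moment:
  assumes Q: "finite (set_pmf Q)" and t: "t > 0" and b: "b \<ge> 0"
  shows "insertion_bounded b (set_pmf Q) f \<Longrightarrow>
    (\<integral>\<^sup>+xs. exp (t * (f xs - measure_pmf.expectation (replicate_pmf n Q) f)) \<partial>replicate_pmf n Q)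
      \<le> ennreal (exp (real n * (t\<^sup>2 * b\<^sup>2 / 2)))"
proof (induction n arbitrary: f)
  case (Suc n)
  define g where "g xs = measure_pmf.expectation Q (\<lambda>x. f (x # xs))" for xs
  define a where "a = measure_pmf.expectation (replicate_pmf (Suc n) Q) f"
  have ag: "a = measure_pmf.expectation (replicate_pmf n Q) g"
    unfolding a_def g_def by (rule expectation_replicate_Suc[OF Q])
  have ib: "insertion_bounded b (set_pmf Q) g" unfolding g_def by (rule insertion_bounded_expectation[OF Q Suc.prems])
  have inner: "(\<integral>\<^sup>+x. exp (t * (f (x # xs) - a)) \<partial>measure_pmf Q) \<le> ennreal (exp (t * (g xs - a))) * ennreal (exp (t\<^sup>2 * b\<^sup>2 / 2))"
    if xs: "set xs \<subseteq> set_pmf Q" for xs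
  proof -
    have bd: "f (x # xs) \<in> {f xs - b..f xs + b}" if "x \<in> set_pmf Q" for x
    proof -
      have "\<bar>f (x # xs) - f xs\<bar> \<le> b"
        using insertion_boundedD[OF Suc.prems, of "[]" x xs] that xs by simp
      then show ?thesis unfolding atLeastAtMost_iff by arith
    qed
    interpret H: interval_bounded_random_variable "measure_pmf Q" "\<lambda>x. f (x # xs)" "f xs - b" "f xs + b"
    proof unfold_locales
      show "AE x in measure_pmf Q. f (x # xs) \<in> {f xs - b..f xs + b}"
        by (rule AE_pmfI) (rule bd)
    qed simp
    have "(\<integral>\<^sup>+x. exp (t * (f (x # xs) - a)) \<partial>measure_pmf Q) =
      (\<integral>\<^sup>+x. ennreal (exp (t * (g xs - a))) * ennreal (exp (t * (f (x # xs) - g xs))) \<partial>measure_pmf Q)"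
      by (intro nn_integral_cong) (simp add: ennreal_mult[symmetric] exp_add[symmetric] algebra_simps)
    also have "\<dots> = ennreal (exp (t * (g xs - a))) * (\<integral>\<^sup>+x. exp (t * (f (x # xs) - g xs)) \<partial>measure_pmf Q)"
      by (rule nn_integral_cmult) simp
    also have "\<dots> \<le> ennreal (exp (t * (g xs - a))) * ennreal (exp (t\<^sup>2 * (f xs + b - (f xs - b))\<^sup>2 / 8))"
      unfolding g_def by (intro mult_left_mono H.Hoeffdings_lemma_nn_integral[OF t]) simp
    also have "t\<^sup>2 * (f xs + b - (f xs - b))\<^sup>2 / 8 = t\<^sup>2 * b\<^sup>2 / 2"
      by (simp add: power2_eq_square)
    finally show ?thesis .
  qed
  have "(\<integral>\<^sup>+xs. exp (t * (f xs - a)) \<partial>replicate_pmf (Suc n) Q) =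
     (\<integral>\<^sup>+xs. (\<integral>\<^sup>+x. exp (t * (f (x # xs) - a)) \<partial>measure_pmf Q) \<partial>replicate_pmf n Q)"
    unfolding replicate_pmf_Suc_tail by simp
  also have "\<dots> \<le> (\<integral>\<^sup>+xs. ennreal (exp (t * (g xs - a))) * ennreal (exp (t\<^sup>2 * b\<^sup>2 / 2)) \<partial>replicate_pmf n Q)"
    by (intro nn_integral_mono_AE AE_pmfI inner) (auto simp: set_replicate_pmf)
  also have "\<dots> = (\<integral>\<^sup>+xs. exp (t * (g xs - a)) \<partial>replicate_pmf n Q) * ennreal (exp (t\<^sup>2 * b\<^sup>2 / 2))"
    by (rule nn_integral_multc) simp
  also have "\<dots> \<le> ennreal (exp (real n * (t\<^sup>2 * b\<^sup>2 / 2))) * ennreal (exp (t\<^sup>2 * b\<^sup>2 / 2))"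
    unfolding ag by (intro mult_right_mono Suc.IH ib) simp
  also have "\<dots> = ennreal (exp (real (Suc n) * (t\<^sup>2 * b\<^sup>2 / 2)))"
    by (simp add: ennreal_mult[symmetric] exp_add[symmetric] algebra_simps add_divide_distrib)
  finally show ?case unfolding a_def .
qed simp

lemma prob_ge_exp:
  assumes "(\<integral>\<^sup>+x. exp (t * h x) \<partial>measure_pmf M) \<le> ennreal B" "t > 0" "B \<ge> 0"
  shows "measure_pmf.prob M {x. h x \<ge> e} \<le> exp (- t * e) * B"
proof -
  have "emeasure M {x. h x \<ge> e} = (\<integral>\<^sup>+x. indicator {x. h x \<ge> e} x \<partial>measure_pmf M)" by simp
  also have "\<dots> \<le> (\<integral>\<^sup>+x. ennreal (exp (- t * e)) * ennreal (exp (t * h x)) \<partial>measure_pmf M)"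
  proof (rule nn_integral_mono)
    fix x
    show "indicator {x. h x \<ge> e} x \<le> ennreal (exp (- t * e)) * ennreal (exp (t * h x))"
    proof (cases "h x \<ge> e")
      case True
      then have "t * e \<le> t * h x" using assms(2) by (intro mult_left_mono) auto
      then have "1 \<le> exp (- t * e + t * h x)" by simp
      then have "ennreal 1 \<le> ennreal (exp (- t * e) * exp (t * h x))"
        unfolding exp_add by (rule ennreal_leI)
      then show ?thesis using True by (simp add: ennreal_mult)
    qed simp
  qed
  also have "\<dots> = ennreal (exp (- t * e)) * (\<integral>\<^sup>+x. exp (t * h x) \<partial>measure_pmf M)"
    by (rule nn_integral_cmult) simp
  also have "\<dots> \<le> ennreal (exp (- t * e)) * ennreal B"
    using assms(1) by (intro mult_left_mono) auto
  also have "\<dots> = ennreal (exp (- t * e) * B)" using assms(3) by (simp add: ennreal_mult)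
  finally show ?thesis using assms(3) by (simp add: measure_pmf.emeasure_eq_measure)
qed

text \<open>The length \<open>n\<close> is to be replaced by a Poisson variable of mean proportional to \<open>N\<close>; so the bound
  is phrased in terms of \<open>N\<close>.\<close>

lemma replicate_concentration:
  assumes Q: "finite (set_pmf Q)" and b: "b > 0" and f: "insertion_bounded b (set_pmf Q) f"
    and K: "K > 0" "real n \<le> K * real N" and d: "d > 0"
  shows "measure_pmf.prob (replicate_pmf n Q) {xs. \<bar>f xs - measure_pmf.expectation (replicate_pmf n Q) f\<bar> \<ge> d * real N}
    \<le> 2 * exp (- (d\<^sup>2 / (2 * K * b\<^sup>2)) * real N)"
proof -
  let ?a = "measure_pmf.expectation (replicate_pmf n Q) f" and ?R = "replicate_pmf n Q"
  \<comment> \<open>This choice minimizes the exponent \<open>- t d N + K N t\<^sup>2 b\<^sup>2 / 2\<close>.\<close>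
  define t where "t = d / (K * b\<^sup>2)"
  have t: "t > 0" using d b K by (simp add: t_def)
  have one: "measure_pmf.prob ?R {xs. h xs - measure_pmf.expectation ?R h \<ge> d * real N} \<le> exp (- (d\<^sup>2 / (2 * K * b\<^sup>2)) * real N)"
    if h: "insertion_bounded b (set_pmf Q) h" for h
  proof -
    have "measure_pmf.prob ?R {xs. h xs - measure_pmf.expectation ?R h \<ge> d * real N} \<le>
       exp (- t * (d * real N)) * exp (real n * (t\<^sup>2 * b\<^sup>2 / 2))"
      by (rule prob_ge_exp[OF replicate_exponential_moment[OF Q t _ h]]) (use b t in auto)
    also have "\<dots> = exp (- t * (d * real N) + real n * (t\<^sup>2 * b\<^sup>2 / 2))" by (rule exp_add[symmetric])
    also have "\<dots> \<le> exp (- t * (d * real N) + K * real N * (t\<^sup>2 * b\<^sup>2 / 2))"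
      using K(2) by (intro exp_le_cancel_iff[THEN iffD2] add_left_mono mult_right_mono) auto
    also have "- t * (d * real N) + K * real N * (t\<^sup>2 * b\<^sup>2 / 2) = - (d\<^sup>2 / (2 * K * b\<^sup>2)) * real N"
      using K b by (simp add: t_def power2_eq_square field_simps)
    finally show ?thesis .
  qed
  have neg: "insertion_bounded b (set_pmf Q) (\<lambda>xs. - f xs)"
    using f by (simp add: insertion_bounded_def abs_minus_commute)
  have "{xs. \<bar>f xs - ?a\<bar> \<ge> d * real N} \<subseteq> {xs. f xs - ?a \<ge> d * real N} \<union> {xs. - f xs - measure_pmf.expectation ?R (\<lambda>xs. - f xs) \<ge> d * real N}"
    by (auto simp: abs_real_def split: if_splits)
  then have "measure_pmf.prob ?R {xs. \<bar>f xs - ?a\<bar> \<ge> d * real N} \<le>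
     measure_pmf.prob ?R ({xs. f xs - ?a \<ge> d * real N} \<union> {xs. - f xs - measure_pmf.expectation ?R (\<lambda>xs. - f xs) \<ge> d * real N})"
    by (intro measure_pmf.finite_measure_mono) auto
  also have "\<dots> \<le> measure_pmf.prob ?R {xs. f xs - ?a \<ge> d * real N} + measure_pmf.prob ?R {xs. - f xs - measure_pmf.expectation ?R (\<lambda>xs. - f xs) \<ge> d * real N}"
    by (rule measure_Un_le) auto
  also have "\<dots> \<le> 2 * exp (- (d\<^sup>2 / (2 * K * b\<^sup>2)) * real N)" using one[OF f] one[OF neg] by simp
  finally show ?thesis .
qed

lemma exp_minus_bound: "0 \<le> t \<Longrightarrow> exp (- t) \<le> 1 - t + t\<^sup>2" for t :: real
proof -
  assume t: "0 \<le> t"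
  have "1 \<le> (1 - t + t\<^sup>2) * (1 + t)" using t by (simp add: power2_eq_square algebra_simps)
  also have "\<dots> \<le> (1 - t + t\<^sup>2) * exp t"
  proof (rule mult_left_mono)
    have "1 - t + t\<^sup>2 = (1 - t / 2)\<^sup>2 + 3 / 4 * t\<^sup>2" by (simp add: power2_eq_square algebra_simps)
    then show "0 \<le> 1 - t + t\<^sup>2" by simp
  qed simp
  finally show ?thesis by (simp add: exp_minus field_simps)
qed

lemma poisson_exponential_moment:
  assumes s: "s > 0" and t: "0 \<le> t" "t \<le> 1"
  shows "(\<integral>\<^sup>+n. exp (t * (real n - s)) \<partial>poisson_pmf s) \<le> ennreal (exp (s * t\<^sup>2))"
    and "(\<integral>\<^sup>+n. exp (t * (s - real n)) \<partial>poisson_pmf s) \<le> ennreal (exp (s * t\<^sup>2))"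
proof -
  have gen: "(\<integral>\<^sup>+n. exp (u * (real n - s)) \<partial>poisson_pmf s) = ennreal (exp (s * (exp u - 1 - u)))" for u
  proof -
    have "(\<integral>\<^sup>+n. exp (u * (real n - s)) \<partial>poisson_pmf s) = (\<integral>\<^sup>+n. ennreal (exp (- (u * s))) * ennreal (exp u ^ n) \<partial>poisson_pmf s)"
      by (intro nn_integral_cong) (simp add: ennreal_mult[symmetric] exp_of_nat_mult[symmetric] exp_add[symmetric] algebra_simps)
    also have "\<dots> = ennreal (exp (- (u * s))) * (\<integral>\<^sup>+n. ennreal (exp u ^ n) \<partial>poisson_pmf s)"
      by (rule nn_integral_cmult) simp
    also have "(\<integral>\<^sup>+n. ennreal (exp u ^ n) \<partial>poisson_pmf s) = ennreal (exp (s * (exp u - 1)))"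
      using poisson_generating_function[OF s, of "exp u"] by (subst nn_integral_eq_integral) auto
    also have "ennreal (exp (- (u * s))) * ennreal (exp (s * (exp u - 1))) = ennreal (exp (s * (exp u - 1 - u)))"
      by (simp add: ennreal_mult[symmetric] exp_add[symmetric] algebra_simps)
    finally show ?thesis .
  qed
  have "s * (exp t - 1 - t) \<le> s * t\<^sup>2"
    using s exp_bound[OF t] by (intro mult_left_mono) auto
  then show "(\<integral>\<^sup>+n. exp (t * (real n - s)) \<partial>poisson_pmf s) \<le> ennreal (exp (s * t\<^sup>2))"
    unfolding gen by (intro ennreal_leI) simp
  have "s * (exp (- t) - 1 - (- t)) \<le> s * t\<^sup>2"
    using s exp_minus_bound[OF t(1)] by (intro mult_left_mono) auto
  moreover have "t * (s - real n) = - t * (real n - s)" for n by (simp add: algebra_simps)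
  ultimately show "(\<integral>\<^sup>+n. exp (t * (s - real n)) \<partial>poisson_pmf s) \<le> ennreal (exp (s * t\<^sup>2))"
    using gen[of "- t"] by (auto intro!: ennreal_leI)
qed

lemma poisson_concentration:
  assumes a: "a > 0" and d: "d > 0" and N: "N > 0"
  shows "measure_pmf.prob (poisson_pmf (a * real N)) {n. \<bar>real n - a * real N\<bar> \<ge> d * real N}
    \<le> 2 * exp (- (min 1 (d / (2 * a)) * d / 2) * real N)"
proof -
  let ?s = "a * real N" and ?M = "poisson_pmf (a * real N)"
  define t where "t = min 1 (d / (2 * a))"
  have t: "0 < t" "t \<le> 1" "t \<le> d / (2 * a)" using a d by (auto simp: t_def)
  have s: "?s > 0" using a N by simp
  have e: "exp (- t * (d * real N)) * exp (?s * t\<^sup>2) \<le> exp (- (t * d / 2) * real N)"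
  proof -
    have "a * t \<le> d / 2" using t(3) a by (simp add: field_simps)
    then have "a * t * (t * real N) \<le> d / 2 * (t * real N)" using t by (intro mult_right_mono) auto
    then have "- t * (d * real N) + ?s * t\<^sup>2 \<le> - (t * d / 2) * real N" by (simp add: power2_eq_square algebra_simps)
    then show ?thesis by (simp add: exp_add[symmetric])
  qed
  have "{n. \<bar>real n - ?s\<bar> \<ge> d * real N} \<subseteq> {n. real n - ?s \<ge> d * real N} \<union> {n. ?s - real n \<ge> d * real N}"
    by (auto simp: abs_real_def split: if_splits)
  then have "measure_pmf.prob ?M {n. \<bar>real n - ?s\<bar> \<ge> d * real N} \<le>
     measure_pmf.prob ?M ({n. real n - ?s \<ge> d * real N} \<union> {n. ?s - real n \<ge> d * real N})"
    by (intro measure_pmf.finite_measure_mono) auto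
  also have "\<dots> \<le> measure_pmf.prob ?M {n. real n - ?s \<ge> d * real N} + measure_pmf.prob ?M {n. ?s - real n \<ge> d * real N}"
    by (rule measure_Un_le) auto
  also have "\<dots> \<le> 2 * exp (- (t * d / 2) * real N)"
  proof -
    have "measure_pmf.prob ?M {n. real n - ?s \<ge> d * real N} \<le> exp (- t * (d * real N)) * exp (?s * t\<^sup>2)"
      by (rule prob_ge_exp[OF poisson_exponential_moment(1)[OF s]]) (use t in auto)
    moreover have "measure_pmf.prob ?M {n. ?s - real n \<ge> d * real N} \<le> exp (- t * (d * real N)) * exp (?s * t\<^sup>2)"
      by (rule prob_ge_exp[OF poisson_exponential_moment(2)[OF s]]) (use t in auto)
    ultimately show ?thesis using e by simp
  qed
  finally show ?thesis by (simp add: t_def)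
qed

text \<open>The constant is not sharp; only the order \<open>\<surd>s\<close> matters. It follows from the exponential moments
  at \<open>t = 1/\<surd>s\<close>, since \<open>t\<bar>y\<bar> \<le> e\<^sup>t\<^sup>y + e\<^sup>-\<^sup>t\<^sup>y\<close>.\<close>

lemma poisson_mean_deviation:
  assumes s: "s \<ge> 1"
  shows "measure_pmf.expectation (poisson_pmf s) (\<lambda>n. \<bar>real n - s\<bar>) \<le> 2 * exp 1 * sqrt s"
proof -
  define t where "t = 1 / sqrt s"
  have t: "0 < t" "t \<le> 1" "s * t\<^sup>2 = 1" using s by (auto simp: t_def power_divide)
  have s0: "s > 0" using s by simp
  have pw: "t * \<bar>y\<bar> \<le> exp (t * y) + exp (- (t * y))" for y :: real
  proof -
    have "t * y \<le> exp (t * y)" "- (t * y) \<le> exp (- (t * y))" using exp_gt_self less_imp_le by blast+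
    moreover have "exp (t * y) > 0" "exp (- (t * y)) > 0" by simp_all
    moreover have "t * \<bar>y\<bar> = \<bar>t * y\<bar>" using t by (simp add: abs_mult)
    ultimately show ?thesis by linarith
  qed
  have i: "integrable (measure_pmf (poisson_pmf s)) (\<lambda>n. \<bar>real n - s\<bar>)"
    using poisson_mean(1)[OF s0] by auto
  have "ennreal (t * measure_pmf.expectation (poisson_pmf s) (\<lambda>n. \<bar>real n - s\<bar>)) =
     (\<integral>\<^sup>+n. ennreal (t * \<bar>real n - s\<bar>) \<partial>poisson_pmf s)"
    using i t by (subst nn_integral_eq_integral) auto
  also have "\<dots> \<le> (\<integral>\<^sup>+n. ennreal (exp (t * (real n - s))) + ennreal (exp (t * (s - real n))) \<partial>poisson_pmf s)"
  proof (rule nn_integral_mono)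
    fix n
    have "t * \<bar>real n - s\<bar> \<le> exp (t * (real n - s)) + exp (t * (s - real n))"
      using pw[of "real n - s"] by (simp add: algebra_simps)
    then show "ennreal (t * \<bar>real n - s\<bar>) \<le> ennreal (exp (t * (real n - s))) + ennreal (exp (t * (s - real n)))"
      by (simp only: ennreal_plus[symmetric] exp_ge_zero ennreal_leI)
  qed
  also have "\<dots> = (\<integral>\<^sup>+n. exp (t * (real n - s)) \<partial>poisson_pmf s) + (\<integral>\<^sup>+n. exp (t * (s - real n)) \<partial>poisson_pmf s)"
    by (rule nn_integral_add) auto
  also have "\<dots> \<le> ennreal (exp (s * t\<^sup>2)) + ennreal (exp (s * t\<^sup>2))"
    using t by (intro add_mono poisson_exponential_moment s0) auto
  also have "\<dots> = ennreal (2 * exp 1)" by (simp add: t(3) flip: ennreal_plus)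
  finally have "t * measure_pmf.expectation (poisson_pmf s) (\<lambda>n. \<bar>real n - s\<bar>) \<le> 2 * exp 1"
    by (subst (asm) ennreal_le_iff) auto
  then show ?thesis using s by (simp add: t_def divide_le_eq mult.commute)
qed

lemma expectation_replicate_lipschitz:
  assumes Q: "finite (set_pmf Q)" and b: "b \<ge> 0" and f: "insertion_bounded b (set_pmf Q) f"
  shows "\<bar>measure_pmf.expectation (replicate_pmf n Q) f - measure_pmf.expectation (replicate_pmf m Q) f\<bar> \<le> b * \<bar>real n - real m\<bar>"
proof -
  let ?a = "\<lambda>n. measure_pmf.expectation (replicate_pmf n Q) f"
  have step: "\<bar>?a (Suc n) - ?a n\<bar> \<le> b" for n
  proof -
    have fin: "finite (set_pmf (replicate_pmf n Q))" by (rule finite_set_replicate_pmf[OF Q])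
    have i: "integrable (measure_pmf (replicate_pmf n Q)) h" for h :: "'a list \<Rightarrow> real"
      by (rule integrable_measure_pmf_finite[OF fin])
    have iQ: "integrable (measure_pmf Q) h" for h :: "'a \<Rightarrow> real" by (rule integrable_measure_pmf_finite[OF Q])
    have "?a (Suc n) - ?a n = measure_pmf.expectation (replicate_pmf n Q) (\<lambda>xs. measure_pmf.expectation Q (\<lambda>x. f (x # xs)) - f xs)"
      unfolding expectation_replicate_Suc[OF Q] using i by simp
    also have "\<bar>\<dots>\<bar> \<le> b"
    proof (rule abs_expectation_le[OF fin])
      fix xs assume xs: "xs \<in> set_pmf (replicate_pmf n Q)"
      then have xs': "set xs \<subseteq> set_pmf Q" by (auto simp: set_replicate_pmf)
      have "measure_pmf.expectation Q (\<lambda>x. f (x # xs)) - f xs = measure_pmf.expectation Q (\<lambda>x. f (x # xs) - f xs)"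
        using iQ by simp
      also have "\<bar>\<dots>\<bar> \<le> b"
        using insertion_boundedD[OF f, of "[]" _ xs] xs' by (intro abs_expectation_le[OF Q]) auto
      finally show "\<bar>measure_pmf.expectation Q (\<lambda>x. f (x # xs)) - f xs\<bar> \<le> b" .
    qed
    finally show ?thesis .
  qed
  have up: "\<bar>?a (m + k) - ?a m\<bar> \<le> b * real k" for m k
  proof (induction k)
    case (Suc k)
    have "\<bar>?a (m + Suc k) - ?a m\<bar> \<le> \<bar>?a (Suc (m + k)) - ?a (m + k)\<bar> + \<bar>?a (m + k) - ?a m\<bar>" by simp
    also have "\<dots> \<le> b + b * real k" by (intro add_mono step Suc)
    finally show ?case by (simp add: algebra_simps)
  qed simp
  show ?thesis
  proof (cases "m \<le> n")
    case True
    then show ?thesis using up[of m "n - m"] by (simp add: of_nat_diff)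
  next
    case False
    then show ?thesis using up[of n "m - n"] by (simp add: of_nat_diff abs_minus_commute)
  qed
qed

lemma insertion_bounded_length:
  assumes "insertion_bounded b S f" "set xs \<subseteq> S"
  shows "\<bar>f xs\<bar> \<le> b * real (length xs) + \<bar>f []\<bar>"
  using assms(2)
proof (induction xs)
  case (Cons x xs)
  have "\<bar>f (x # xs) - f xs\<bar> \<le> b" using insertion_boundedD[OF assms(1), of "[]" x xs] Cons.prems by simp
  then show ?case using Cons by (simp add: algebra_simps)
qed simp

lemma expectation_poisson_list:
  assumes Q: "finite (set_pmf Q)" and b: "b \<ge> 0" and f: "insertion_bounded b (set_pmf Q) f" and s: "s > 0" and f0: "f [] = 0"
  shows "measure_pmf.expectation (poisson_list s Q) f = measure_pmf.expectation (poisson_pmf s) (\<lambda>n. measure_pmf.expectation (replicate_pmf n Q) f)"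
proof -
  have nn: "measure_pmf.expectation (poisson_list s Q) h = measure_pmf.expectation (poisson_pmf s) (\<lambda>n. measure_pmf.expectation (replicate_pmf n Q) h)"
    if h: "\<And>xs. h xs \<ge> 0" and i: "integrable (measure_pmf (poisson_list s Q)) h" for h :: "'a list \<Rightarrow> real"
  proof -
    have "ennreal (measure_pmf.expectation (poisson_list s Q) h) = (\<integral>\<^sup>+xs. h xs \<partial>poisson_list s Q)"
      using h i by (intro nn_integral_eq_integral[symmetric]) auto
    also have "\<dots> = (\<integral>\<^sup>+n. (\<integral>\<^sup>+xs. h xs \<partial>replicate_pmf n Q) \<partial>poisson_pmf s)"
      by (simp add: poisson_list_def)
    also have "\<dots> = (\<integral>\<^sup>+n. ennreal (measure_pmf.expectation (replicate_pmf n Q) h) \<partial>poisson_pmf s)"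
      by (intro nn_integral_cong nn_integral_eq_integral integrable_measure_pmf_finite finite_set_replicate_pmf[OF Q]) (auto simp: h)
    finally have eq: "(\<integral>\<^sup>+n. ennreal (measure_pmf.expectation (replicate_pmf n Q) h) \<partial>poisson_pmf s) = ennreal (measure_pmf.expectation (poisson_list s Q) h)"
      by simp
    have h0: "measure_pmf.expectation (replicate_pmf n Q) h \<ge> 0" for n
      by (rule Bochner_Integration.integral_nonneg) (rule h)
    have h1: "measure_pmf.expectation (poisson_list s Q) h \<ge> 0"
      by (rule Bochner_Integration.integral_nonneg) (rule h)
    have "has_bochner_integral (measure_pmf (poisson_pmf s)) (\<lambda>n. measure_pmf.expectation (replicate_pmf n Q) h) (measure_pmf.expectation (poisson_list s Q) h)"
      by (rule has_bochner_integral_nn_integral) (use h0 h1 eq in auto)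
    then show ?thesis by (simp add: has_bochner_integral_iff)
  qed
  have bd: "\<bar>f xs\<bar> \<le> b * real (length xs)" if "set xs \<subseteq> set_pmf Q" for xs
    using insertion_bounded_length[OF f that] by (simp add: f0)
  have if1: "integrable (measure_pmf (poisson_list s Q)) f"
    by (rule integrable_poisson_list_le[OF s]) (use bd set_poisson_list in blast)
  let ?g = "\<lambda>xs. max 0 (f xs)" and ?h = "\<lambda>xs. max 0 (- f xs)"
  have ig: "integrable (measure_pmf (poisson_list s Q)) ?g" and ih: "integrable (measure_pmf (poisson_list s Q)) ?h"
    using if1 by (auto intro: integrable_max)
  have fin: "integrable (measure_pmf (replicate_pmf n Q)) h" for n and h :: "'a list \<Rightarrow> real"
    by (rule integrable_measure_pmf_finite[OF finite_set_replicate_pmf[OF Q]])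
  have f_eq: "f = (\<lambda>xs. ?g xs - ?h xs)" by (auto simp: max_def)
  have ab: "\<bar>measure_pmf.expectation (replicate_pmf n Q) k\<bar> \<le> b * real n"
    if "\<And>xs. \<bar>k xs\<bar> \<le> \<bar>f xs\<bar>" for k n
  proof (rule abs_expectation_le[OF finite_set_replicate_pmf[OF Q]])
    fix xs assume "xs \<in> set_pmf (replicate_pmf n Q)"
    then have "set xs \<subseteq> set_pmf Q" "length xs = n" by (auto simp: set_replicate_pmf)
    then show "\<bar>k xs\<bar> \<le> b * real n" using bd[of xs] that[of xs] by simp
  qed
  have ip: "integrable (measure_pmf (poisson_pmf s)) (\<lambda>n. measure_pmf.expectation (replicate_pmf n Q) k)"
    if "\<And>xs. \<bar>k xs\<bar> \<le> \<bar>f xs\<bar>" for k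
  proof (rule Bochner_Integration.integrable_bound)
    show "integrable (measure_pmf (poisson_pmf s)) (\<lambda>n. b * real n)"
      by (intro integrable_mult_right poisson_mean s)
    show "AE n in measure_pmf (poisson_pmf s). norm (measure_pmf.expectation (replicate_pmf n Q) k) \<le> norm (b * real n)"
      unfolding AE_measure_pmf_iff real_norm_def using ab[OF that] by (meson abs_ge_self order_trans)
  qed simp
  have "measure_pmf.expectation (poisson_list s Q) f = measure_pmf.expectation (poisson_list s Q) ?g - measure_pmf.expectation (poisson_list s Q) ?h"
    by (subst f_eq) (rule Bochner_Integration.integral_diff[OF ig ih])
  also have "\<dots> = measure_pmf.expectation (poisson_pmf s) (\<lambda>n. measure_pmf.expectation (replicate_pmf n Q) ?g) -
     measure_pmf.expectation (poisson_pmf s) (\<lambda>n. measure_pmf.expectation (replicate_pmf n Q) ?h)"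
    using nn[OF _ ig] nn[OF _ ih] by simp
  also have "\<dots> = measure_pmf.expectation (poisson_pmf s) (\<lambda>n. measure_pmf.expectation (replicate_pmf n Q) ?g - measure_pmf.expectation (replicate_pmf n Q) ?h)"
    by (rule Bochner_Integration.integral_diff[symmetric]) (rule ip; auto)+
  also have "\<dots> = measure_pmf.expectation (poisson_pmf s) (\<lambda>n. measure_pmf.expectation (replicate_pmf n Q) f)"
    by (intro Bochner_Integration.integral_cong refl) (subst (3) f_eq, rule Bochner_Integration.integral_diff[symmetric, OF fin fin])
  finally show ?thesis .
qed

text \<open>The mean for lists of length \<open>n\<close> is Lipschitz in \<open>n\<close>, and the Poisson number fluctuates by
  \<open>O(\<surd>s)\<close>.\<close>

lemma expectation_poisson_list_deviation:
  assumes Q: "finite (set_pmf Q)" and b: "b \<ge> 0" and f: "insertion_bounded b (set_pmf Q) f" and s: "s \<ge> 1" and f0: "f [] = 0"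
  shows "\<bar>measure_pmf.expectation (replicate_pmf n Q) f - measure_pmf.expectation (poisson_list s Q) f\<bar> \<le> b * (\<bar>real n - s\<bar> + 2 * exp 1 * sqrt s)"
proof -
  let ?a = "\<lambda>n. measure_pmf.expectation (replicate_pmf n Q) f"
  have s0: "s > 0" using s by simp
  have lip: "\<bar>?a n - ?a m\<bar> \<le> b * (\<bar>real n - s\<bar> + \<bar>real m - s\<bar>)" for m
  proof -
    have "\<bar>?a n - ?a m\<bar> \<le> b * \<bar>real n - real m\<bar>" by (rule expectation_replicate_lipschitz[OF Q b f])
    also have "\<dots> \<le> b * (\<bar>real n - s\<bar> + \<bar>real m - s\<bar>)" using b by (intro mult_left_mono) auto
    finally show ?thesis .
  qed
  have idev: "integrable (measure_pmf (poisson_pmf s)) (\<lambda>m. \<bar>real m - s\<bar>)"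
    using poisson_mean(1)[OF s0] by auto
  have ibd: "integrable (measure_pmf (poisson_pmf s)) (\<lambda>m. b * (\<bar>real n - s\<bar> + \<bar>real m - s\<bar>))"
    using idev by (intro integrable_mult_right Bochner_Integration.integrable_add) auto
  have idiff: "integrable (measure_pmf (poisson_pmf s)) (\<lambda>m. ?a n - ?a m)"
  proof (rule Bochner_Integration.integrable_bound[OF ibd])
    show "AE m in measure_pmf (poisson_pmf s). norm (?a n - ?a m) \<le> norm (b * (\<bar>real n - s\<bar> + \<bar>real m - s\<bar>))"
      unfolding AE_measure_pmf_iff real_norm_def using lip by (meson abs_ge_self order_trans)
  qed simp
  have ia: "integrable (measure_pmf (poisson_pmf s)) ?a"
    using Bochner_Integration.integrable_diff[OF _ idiff, of "\<lambda>_. ?a n"] by simp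
  have "?a n - measure_pmf.expectation (poisson_list s Q) f = measure_pmf.expectation (poisson_pmf s) (\<lambda>m. ?a n - ?a m)"
    unfolding expectation_poisson_list[OF Q b f s0 f0] using ia by simp
  also have "\<bar>\<dots>\<bar> \<le> measure_pmf.expectation (poisson_pmf s) (\<lambda>m. \<bar>?a n - ?a m\<bar>)"
    by (rule integral_abs_bound)
  also have "\<dots> \<le> measure_pmf.expectation (poisson_pmf s) (\<lambda>m. b * (\<bar>real n - s\<bar> + \<bar>real m - s\<bar>))"
    using idiff ibd lip by (intro integral_mono) auto
  also have "\<dots> = b * (\<bar>real n - s\<bar> + measure_pmf.expectation (poisson_pmf s) (\<lambda>m. \<bar>real m - s\<bar>))"
    using idev by simp
  also have "\<dots> \<le> b * (\<bar>real n - s\<bar> + 2 * exp 1 * sqrt s)"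
    using b poisson_mean_deviation[OF s] by (intro mult_left_mono add_left_mono)
  finally show ?thesis .
qed

text \<open>The two sources of randomness are separated: the number of elements concentrates by the
  Poisson tail bound, and for a fixed number close to its mean the bounded difference method
  applies. The rate \<open>c\<close> does not depend on the law \<open>Q\<close> or on \<open>f\<close>, as both vary with \<open>N\<close> in the
  application.\<close>

lemma poisson_list_concentration:
  assumes a: "a > 0" and b: "b > 0" and d: "d > 0"
  shows "\<exists>c>0. \<forall>\<^sub>F N in sequentially. \<forall>(Q :: 'b pmf) f. finite (set_pmf Q) \<and> insertion_bounded b (set_pmf Q) f \<and> f [] = 0 \<longrightarrow>
    measure_pmf.prob (poisson_list (a * real N) Q)
      {xs. \<bar>real (length xs) - a * real N\<bar> \<ge> d * real N \<or> \<bar>f xs - measure_pmf.expectation (poisson_list (a * real N) Q) f\<bar> \<ge> d * real N}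
    \<le> 4 * exp (- c * real N)"
proof -
  \<comment> \<open>If the length is within \<open>d' N\<close> of its mean, then the mean of \<open>f\<close> over lists of that length
    differs from the mean over Poisson lists by at most \<open>d N / 4 + O(\<surd>N)\<close>.\<close>
  define d' where "d' = min d (d / (4 * b))"
  have d': "d' > 0" "d' \<le> d" "b * d' \<le> d / 4" using d b by (auto simp: d'_def min_def field_simps)
  define K where "K = a + d'"
  have K: "K > 0" using a d' by (simp add: K_def)
  define c1 where "c1 = min 1 (d' / (2 * a)) * d' / 2"
  define c2 where "c2 = (d / 4)\<^sup>2 / (2 * K * b\<^sup>2)"
  define c where "c = min c1 c2"
  have c: "c > 0" using a b d d' K by (auto simp: c_def c1_def c2_def)
  have "(\<lambda>N. b * (2 * exp 1 * sqrt (a * real N)) / real N) \<longlonglongrightarrow> 0"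
  proof -
    have "(\<lambda>N. b * (2 * exp 1 * sqrt a) * (1 / sqrt (real N))) \<longlonglongrightarrow> b * (2 * exp 1 * sqrt a) * 0"
    proof (intro tendsto_mult_left)
      show "(\<lambda>N. 1 / sqrt (real N)) \<longlonglongrightarrow> 0"
        by (rule real_tendsto_divide_at_top[OF tendsto_const filterlim_compose[OF sqrt_at_top filterlim_real_sequentially]])
    qed
    moreover have "\<forall>\<^sub>F N in sequentially. b * (2 * exp 1 * sqrt a) * (1 / sqrt (real N)) = b * (2 * exp 1 * sqrt (a * real N)) / real N"
      using eventually_gt_at_top[of 0]
    proof eventually_elim
      case (elim N)
      have "sqrt (real N) / real N = 1 / sqrt (real N)"
        using real_divide_square_eq[of "sqrt (real N)" 1] by simp
      then have "b * (2 * exp 1 * sqrt a) * (1 / sqrt (real N)) = b * (2 * exp 1 * sqrt a) * (sqrt (real N) / real N)"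
        by (simp only:)
      also have "\<dots> = b * (2 * exp 1 * sqrt (a * real N)) / real N"
        by (simp only: real_sqrt_mult times_divide_eq_right mult.assoc)
      finally show ?case .
    qed
    ultimately show ?thesis by (auto intro: Lim_transform_eventually)
  qed
  then have "\<forall>\<^sub>F N in sequentially. b * (2 * exp 1 * sqrt (a * real N)) / real N < d / 4"
    using d by (intro order_tendstoD) auto
  moreover have "\<forall>\<^sub>F N in sequentially. real N \<ge> 1 / a"
    using filterlim_real_sequentially unfolding filterlim_at_top by blast
  ultimately have "\<forall>\<^sub>F N in sequentially. \<forall>(Q :: 'b pmf) f. finite (set_pmf Q) \<and> insertion_bounded b (set_pmf Q) f \<and> f [] = 0 \<longrightarrow>
    measure_pmf.prob (poisson_list (a * real N) Q)
      {xs. \<bar>real (length xs) - a * real N\<bar> \<ge> d * real N \<or> \<bar>f xs - measure_pmf.expectation (poisson_list (a * real N) Q) f\<bar> \<ge> d * real N}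
    \<le> 4 * exp (- c * real N)"
    using eventually_gt_at_top[of 0]
  proof eventually_elim
    case (elim N)
    show ?case
    proof (intro allI impI)
      fix Q :: "'b pmf" and f assume Qf: "finite (set_pmf Q) \<and> insertion_bounded b (set_pmf Q) f \<and> f [] = 0"
      let ?s = "a * real N"
      let ?m = "measure_pmf.expectation (poisson_list ?s Q) f"
      let ?B = "{xs. \<bar>real (length xs) - ?s\<bar> \<ge> d * real N \<or> \<bar>f xs - ?m\<bar> \<ge> d * real N}"
      have s: "?s \<ge> 1" "?s > 0" using elim a by (auto simp: field_simps)
      have sq: "b * (2 * exp 1 * sqrt ?s) \<le> d / 4 * real N" using elim by (simp add: divide_less_eq)
      have small: "measure_pmf.prob (replicate_pmf n Q) ?B \<le> 2 * exp (- c2 * real N)" if n: "\<bar>real n - ?s\<bar> < d' * real N" for n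
      proof -
        let ?a = "measure_pmf.expectation (replicate_pmf n Q) f"
        have "\<bar>?a - ?m\<bar> \<le> b * (\<bar>real n - ?s\<bar> + 2 * exp 1 * sqrt ?s)"
          using Qf b s by (intro expectation_poisson_list_deviation) auto
        also have "\<dots> \<le> b * (d' * real N) + d / 4 * real N"
          using n b sq by (simp add: distrib_left add_mono)
        also have "\<dots> \<le> d / 4 * real N + d / 4 * real N"
          using mult_right_mono[OF d'(3), of "real N"] by (simp add: mult.assoc)
        finally have am: "\<bar>?a - ?m\<bar> \<le> d / 2 * real N" by simp
        have nd: "d' * real N \<le> d * real N" using d' by (intro mult_right_mono) auto
        have pos: "d * real N > 0" using d elim by simp
        have "measure_pmf.prob (replicate_pmf n Q) ?B = measure_pmf.prob (replicate_pmf n Q) (?B \<inter> set_pmf (replicate_pmf n Q))"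
          by (simp add: measure_Int_set_pmf)
        also have "\<dots> \<le> measure_pmf.prob (replicate_pmf n Q) {xs. \<bar>f xs - ?a\<bar> \<ge> d / 4 * real N}"
        proof (rule measure_pmf.finite_measure_mono)
          show "?B \<inter> set_pmf (replicate_pmf n Q) \<subseteq> {xs. \<bar>f xs - ?a\<bar> \<ge> d / 4 * real N}"
          proof
            fix xs assume xs: "xs \<in> ?B \<inter> set_pmf (replicate_pmf n Q)"
            then have "length xs = n" by (auto simp: set_replicate_pmf)
            then have "\<bar>f xs - ?m\<bar> \<ge> d * real N" using xs n nd by auto
            then have "\<bar>f xs - ?a\<bar> \<ge> d / 2 * real N" using am by linarith
            moreover have "d / 2 * real N \<ge> d / 4 * real N" using pos by simp
            ultimately show "xs \<in> {xs. \<bar>f xs - ?a\<bar> \<ge> d / 4 * real N}" by simp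
          qed
        qed simp
        also have "\<dots> \<le> 2 * exp (- c2 * real N)"
        proof -
          have "real n \<le> K * real N" using n unfolding K_def distrib_right by linarith
          then show ?thesis unfolding c2_def using Qf b K d by (intro replicate_concentration) auto
        qed
        finally show ?thesis .
      qed
      have "ennreal (measure_pmf.prob (poisson_list ?s Q) ?B) = (\<integral>\<^sup>+n. emeasure (replicate_pmf n Q) ?B \<partial>poisson_pmf ?s)"
        by (simp add: poisson_list_def emeasure_bind_pmf flip: measure_pmf.emeasure_eq_measure)
      also have "\<dots> \<le> (\<integral>\<^sup>+n. ennreal (2 * exp (- c2 * real N)) + indicator {n. \<bar>real n - ?s\<bar> \<ge> d' * real N} n \<partial>poisson_pmf ?s)"
      proof (rule nn_integral_mono)
        fix n
        show "emeasure (replicate_pmf n Q) ?B \<le> ennreal (2 * exp (- c2 * real N)) + indicator {n. \<bar>real n - ?s\<bar> \<ge> d' * real N} n"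
        proof (cases "\<bar>real n - ?s\<bar> < d' * real N")
          case True
          then show ?thesis using small[OF True] by (simp add: measure_pmf.emeasure_eq_measure ennreal_leI)
        next
          case False
          then have "emeasure (replicate_pmf n Q) ?B \<le> indicator {n. \<bar>real n - ?s\<bar> \<ge> d' * real N} n"
            by (simp add: measure_pmf.emeasure_le_1 not_less)
          then show ?thesis by (rule order_trans) simp
        qed
      qed
      also have "\<dots> = ennreal (2 * exp (- c2 * real N)) + emeasure (poisson_pmf ?s) {n. \<bar>real n - ?s\<bar> \<ge> d' * real N}"
        by (subst nn_integral_add) auto
      also have "\<dots> = ennreal (2 * exp (- c2 * real N) + measure_pmf.prob (poisson_pmf ?s) {n. \<bar>real n - ?s\<bar> \<ge> d' * real N})"
        by (simp add: measure_pmf.emeasure_eq_measure)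
      finally have "measure_pmf.prob (poisson_list ?s Q) ?B \<le>
         2 * exp (- c2 * real N) + measure_pmf.prob (poisson_pmf ?s) {n. \<bar>real n - ?s\<bar> \<ge> d' * real N}"
        by (subst (asm) ennreal_le_iff) auto
      also have "\<dots> \<le> 2 * exp (- c2 * real N) + 2 * exp (- c1 * real N)"
        unfolding c1_def using poisson_concentration[OF a d'(1), of N] elim by simp
      also have "\<dots> \<le> 2 * exp (- c * real N) + 2 * exp (- c * real N)"
      proof -
        have "c * real N \<le> c1 * real N" "c * real N \<le> c2 * real N"
          by (intro mult_right_mono; simp add: c_def)+
        then show ?thesis by (intro add_mono mult_left_mono) auto
      qed
      finally show "measure_pmf.prob (poisson_list ?s Q) ?B \<le> 4 * exp (- c * real N)" by simp
    qed
  qed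
  then show ?thesis using c by blast
qed

section \<open>The function F as a limit, and its convexity\<close>

definition log_partition :: "real \<Rightarrow> nat \<Rightarrow> ((spin list \<Rightarrow> real) \<times> nat list) list \<Rightarrow> real" where
  "log_partition \<beta> N es = ln (partition_fn \<beta> N (edges_energy es))"

definition mean_free_energy :: "nat \<Rightarrow> real \<Rightarrow> (spin list \<Rightarrow> real) pmf \<Rightarrow> nat \<Rightarrow> real \<Rightarrow> real" where
  "mean_free_energy p \<alpha> \<Theta> N \<beta> = measure_pmf.expectation (poisson_list (\<alpha> * N) (rooted_edges p \<Theta> N)) (log_partition \<beta> N)"

lemma (in critical_csp) mean_free_energy_eq: "mean_free_energy p \<alpha> \<Theta> N \<beta> = mean_log_partition N (\<alpha> * N)"
  unfolding mean_free_energy_def mean_log_partition_def graph_law_edges log_partition_def by simp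

text \<open>The energy only enters through its product with \<open>\<beta>\<close>. This reduces negative \<open>\<beta>\<close> to positive
  \<open>\<beta>\<close>.\<close>

lemma mean_free_energy_uminus:
  "mean_free_energy p \<alpha> (map_pmf (\<lambda>\<theta> s. - \<theta> s) \<Theta>) N (- \<beta>) = mean_free_energy p \<alpha> \<Theta> N \<beta>"
proof -
  let ?f = "\<lambda>(\<theta>, vs). (\<lambda>s. - \<theta> s, vs) :: (spin list \<Rightarrow> real) \<times> nat list"
  have r: "rooted_edges p (map_pmf (\<lambda>\<theta> s. - \<theta> s) \<Theta>) N = map_pmf ?f (rooted_edges p \<Theta> N)"
    unfolding pair_map_pmf1 by (intro map_pmf_cong refl) auto
  have e: "edges_energy (map ?f es) \<sigma> = - edges_energy es \<sigma>" for es \<sigma>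
    unfolding edges_energy_def by (induction es) auto
  have "log_partition (- \<beta>) N (map ?f es) = log_partition \<beta> N es" for es
    unfolding log_partition_def partition_fn_def e by simp
  then show ?thesis unfolding mean_free_energy_def r map_poisson_list[symmetric] by simp
qed

definition csp_parameters :: "nat \<Rightarrow> real \<Rightarrow> (spin list \<Rightarrow> real) pmf \<Rightarrow> bool" where
  "csp_parameters p \<alpha> \<Theta> \<longleftrightarrow> p \<ge> 2 \<and> \<alpha> > 0 \<and> set_pmf \<Theta> \<subseteq> interactions p \<and> exchangeable p \<Theta> \<and> \<alpha> * real p * (real p - 1) \<le> 1"

lemma finite_interactions: "finite (interactions p)"
proof -
  have "finite {s :: spin list. length s = p}"
    using finite_lists_length_eq[of "UNIV :: spin set" p] by simp
  then show ?thesis unfolding interactions_def by (intro finite_PiE) auto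
qed

lemma interactions_bound: "\<theta> \<in> interactions p \<Longrightarrow> length s = p \<Longrightarrow> \<bar>\<theta> s\<bar> \<le> 1"
proof -
  assume "\<theta> \<in> interactions p" "length s = p"
  then have "\<theta> s \<in> {-1, 0}"
    using PiE_mem[of \<theta> "{s. length s = p}" "\<lambda>_. {-1, 0}" s] unfolding interactions_def by blast
  then show ?thesis by auto
qed

lemma exchangeable_uminus:
  assumes "exchangeable p \<Theta>"
  shows "exchangeable p (map_pmf (\<lambda>\<theta> s. - \<theta> s) \<Theta>)"
  unfolding exchangeable_def
proof (intro allI impI)
  fix \<tau> assume "\<tau> permutes {..<p}"
  then have "map_pmf (\<lambda>\<theta> s. \<theta> (permute_list \<tau> s)) \<Theta> = \<Theta>" using assms by (auto simp: exchangeable_def)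
  then have "map_pmf (\<lambda>\<theta> s. - \<theta> s) (map_pmf (\<lambda>\<theta> s. \<theta> (permute_list \<tau> s)) \<Theta>) = map_pmf (\<lambda>\<theta> s. - \<theta> s) \<Theta>" by simp
  then show "map_pmf (\<lambda>\<theta> s. \<theta> (permute_list \<tau> s)) (map_pmf (\<lambda>\<theta> s. - \<theta> s) \<Theta>) = map_pmf (\<lambda>\<theta> s. - \<theta> s) \<Theta>"
    by (simp add: pmf.map_comp o_def)
qed

theorem mean_free_energy_tendsto_F:
  assumes "csp_parameters p \<alpha> \<Theta>"
  shows "(\<lambda>N. mean_free_energy p \<alpha> \<Theta> N \<beta> / real N) \<longlonglongrightarrow> F p \<alpha> \<Theta> \<beta>"
proof -
  have par: "p \<ge> 2" "\<alpha> > 0" "set_pmf \<Theta> \<subseteq> interactions p" "exchangeable p \<Theta>" "\<alpha> * real p * (real p - 1) \<le> 1"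
    using assms by (simp_all add: csp_parameters_def)
  have fin: "finite (set_pmf \<Theta>)" using par(3) finite_interactions finite_subset by blast
  consider "\<beta> > 0" | "\<beta> < 0" | "\<beta> = 0" by linarith
  then show ?thesis
  proof cases
    case 1
    interpret critical_csp p \<alpha> \<beta> \<Theta>
      by unfold_locales (use par fin 1 interactions_bound in auto)
    show ?thesis using free_energy_limit_P 1 by (simp add: mean_free_energy_eq F_def)
  next
    case 2
    let ?\<Theta> = "map_pmf (\<lambda>\<theta> s. - \<theta> s) \<Theta>"
    interpret critical_csp p \<alpha> "- \<beta>" ?\<Theta>
    proof unfold_locales
      show "exchangeable p ?\<Theta>" by (rule exchangeable_uminus[OF par(4)])
      show "\<bar>\<theta> s\<bar> \<le> 1" if "\<theta> \<in> set_pmf ?\<Theta>" "length s = p" for \<theta> s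
        using that par(3) interactions_bound[of _ p s] by fastforce
    qed (use par fin 2 in auto)
    have "(\<lambda>N. mean_free_energy p \<alpha> ?\<Theta> N (- \<beta>) / real N) \<longlonglongrightarrow> P p \<alpha> ?\<Theta> (- \<beta>) (fixed_point p \<alpha> ?\<Theta> (- \<beta>))"
      unfolding mean_free_energy_eq by (rule free_energy_limit_P)
    then show ?thesis using 2 by (simp add: mean_free_energy_uminus F_def Let_def)
  next
    case 3
    have "log_partition 0 N = (\<lambda>_. 0)" for N by (rule ext) (simp add: log_partition_def partition_fn_def)
    then have "mean_free_energy p \<alpha> \<Theta> N 0 = 0" for N by (simp add: mean_free_energy_def)
    then show ?thesis using 3 by (simp add: F_def)
  qed
qed

text \<open>Hoelder's inequality, obtained from convexity of the exponential function applied pointwise to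
  the normalized Boltzmann weights.\<close>

lemma log_partition_convex:
  assumes "0 \<le> l" "l \<le> 1"
  shows "log_partition ((1 - l) * x + l * y) N es \<le> (1 - l) * log_partition x N es + l * log_partition y N es"
proof -
  let ?H = "edges_energy es" and ?Z = "\<lambda>b. partition_fn b N (edges_energy es)"
  have Z: "?Z b > 0" for b by (rule partition_fn_pos)
  define A where "A = (1 - l) * ln (?Z x) + l * ln (?Z y)"
  have pw: "exp (((1 - l) * x + l * y) * ?H \<sigma>) \<le> exp A * ((1 - l) / ?Z x * exp (x * ?H \<sigma>) + l / ?Z y * exp (y * ?H \<sigma>))" for \<sigma>
  proof -
    let ?a = "x * ?H \<sigma> - ln (?Z x)" and ?b = "y * ?H \<sigma> - ln (?Z y)"
    have "exp ((1 - l) * ?a + l * ?b) \<le> (1 - l) * exp ?a + l * exp ?b"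
      using convex_onD[OF convex_on_exp[of 1], of l ?a ?b] assms by simp
    also have "\<dots> = (1 - l) / ?Z x * exp (x * ?H \<sigma>) + l / ?Z y * exp (y * ?H \<sigma>)"
      using Z by (simp add: exp_diff)
    finally have "exp A * exp ((1 - l) * ?a + l * ?b) \<le> exp A * ((1 - l) / ?Z x * exp (x * ?H \<sigma>) + l / ?Z y * exp (y * ?H \<sigma>))"
      by (rule mult_left_mono) simp
    moreover have "exp A * exp ((1 - l) * ?a + l * ?b) = exp (((1 - l) * x + l * y) * ?H \<sigma>)"
      unfolding exp_add[symmetric] A_def by (rule arg_cong[where f=exp]) (simp add: algebra_simps)
    ultimately show ?thesis by simp
  qed
  have "?Z ((1 - l) * x + l * y) \<le> conf_avg N (\<lambda>\<sigma>. exp A * ((1 - l) / ?Z x * exp (x * ?H \<sigma>) + l / ?Z y * exp (y * ?H \<sigma>)))"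
    unfolding partition_fn_def[of "(1 - l) * x + l * y"] by (rule conf_avg_mono) (rule pw)
  also have "\<dots> = exp A * ((1 - l) / ?Z x * ?Z x + l / ?Z y * ?Z y)"
    unfolding conf_avg_cmult partition_fn_def
    by (simp add: conf_avg_def sum.distrib sum_distrib_left add_divide_distrib times_divide_eq_right)
  also have "\<dots> = exp A" using Z[of x] Z[of y] by simp
  finally have "ln (?Z ((1 - l) * x + l * y)) \<le> ln (exp A)" using Z by (subst ln_le_cancel_iff) auto
  then show ?thesis by (simp add: log_partition_def A_def)
qed

text \<open>The constant \<open>\<bar>\<beta>\<bar>\<close> would do; adding \<open>1\<close> keeps it positive at \<open>\<beta> = 0\<close>, as the concentration
  bound requires.\<close>

lemma insertion_bounded_log_partition:
  assumes p: "p \<le> N" and \<Theta>: "set_pmf \<Theta> \<subseteq> interactions p"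
  shows "insertion_bounded (\<bar>\<beta>\<bar> + 1) (set_pmf (rooted_edges p \<Theta> N)) (log_partition \<beta> N)"
  unfolding insertion_bounded_def
proof (intro allI impI)
  fix as e bs assume a: "set as \<subseteq> set_pmf (rooted_edges p \<Theta> N) \<and> e \<in> set_pmf (rooted_edges p \<Theta> N) \<and> set bs \<subseteq> set_pmf (rooted_edges p \<Theta> N)"
  have "e \<in> set_pmf \<Theta> \<times> tuples p {1..N}" using a by (simp only: set_pair_pmf set_pmf_tuples[OF p])
  then have e: "fst e \<in> interactions p" "length (snd e) = p" using \<Theta> by (auto simp: tuples_def)
  have d: "\<bar>edges_energy (as @ e # bs) \<sigma> - edges_energy (as @ bs) \<sigma>\<bar> \<le> 1" for \<sigma>
    using interactions_bound[OF e(1), of "map \<sigma> (snd e)"] e(2) by (simp add: edges_energy_def case_prod_unfold)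
  have "\<bar>log_partition \<beta> N (as @ e # bs) - log_partition \<beta> N (as @ bs)\<bar> \<le> \<bar>\<beta>\<bar> * 1"
  proof (cases "\<beta> \<ge> 0")
    case True
    then show ?thesis unfolding log_partition_def using ln_partition_fn_diff[OF d True, of N] by simp
  next
    case False
    have neg: "partition_fn \<beta> N H = partition_fn (- \<beta>) N (\<lambda>\<sigma>. - H \<sigma>)" for H
      by (simp add: partition_fn_def)
    have "\<bar>- edges_energy (as @ e # bs) \<sigma> - - edges_energy (as @ bs) \<sigma>\<bar> \<le> 1" for \<sigma>
      using d[of \<sigma>] by linarith
    then show ?thesis unfolding log_partition_def neg
      using ln_partition_fn_diff[of N "\<lambda>\<sigma>. - edges_energy (as @ e # bs) \<sigma>" "\<lambda>\<sigma>. - edges_energy (as @ bs) \<sigma>" 1 "- \<beta>"] False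
      by simp
  qed
  then show "\<bar>log_partition \<beta> N (as @ e # bs) - log_partition \<beta> N (as @ bs)\<bar> \<le> \<bar>\<beta>\<bar> + 1" by linarith
qed

lemma log_partition_Nil: "log_partition \<beta> N [] = 0"
  by (simp add: log_partition_def partition_fn_def edges_energy_def)

lemma integrable_log_partition_edges:
  assumes "p \<le> N" "set_pmf \<Theta> \<subseteq> interactions p" "s > 0"
  shows "integrable (measure_pmf (poisson_list s (rooted_edges p \<Theta> N))) (log_partition \<beta> N)"
proof (rule integrable_poisson_list_le[OF assms(3)])
  fix es assume es: "es \<in> set_pmf (poisson_list s (rooted_edges p \<Theta> N))"
  show "\<bar>log_partition \<beta> N es\<bar> \<le> (\<bar>\<beta>\<bar> + 1) * real (length es)"
    using insertion_bounded_length[OF insertion_bounded_log_partition[OF assms(1,2)] set_poisson_list[OF es], of \<beta>]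
    by (simp add: log_partition_Nil)
qed

theorem convex_F:
  assumes par: "csp_parameters p \<alpha> \<Theta>"
  shows "convex_on UNIV (F p \<alpha> \<Theta>)"
proof (rule convex_onI)
  fix l x y :: real assume l: "0 < l" "l < 1"
  let ?z = "(1 - l) *\<^sub>R x + l *\<^sub>R y"
  have pos: "\<alpha> > 0" "set_pmf \<Theta> \<subseteq> interactions p" using par by (simp_all add: csp_parameters_def)
  have "(\<lambda>N. (1 - l) * (mean_free_energy p \<alpha> \<Theta> N x / real N) + l * (mean_free_energy p \<alpha> \<Theta> N y / real N)) \<longlonglongrightarrow>
      (1 - l) * F p \<alpha> \<Theta> x + l * F p \<alpha> \<Theta> y"
    by (intro tendsto_intros mean_free_energy_tendsto_F[OF par])
  moreover have "(\<lambda>N. mean_free_energy p \<alpha> \<Theta> N ?z / real N) \<longlonglongrightarrow> F p \<alpha> \<Theta> ?z"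
    by (rule mean_free_energy_tendsto_F[OF par])
  moreover have "\<forall>\<^sub>F N in sequentially. mean_free_energy p \<alpha> \<Theta> N ?z / real N \<le>
     (1 - l) * (mean_free_energy p \<alpha> \<Theta> N x / real N) + l * (mean_free_energy p \<alpha> \<Theta> N y / real N)"
    using eventually_ge_at_top[of p] eventually_gt_at_top[of 0]
  proof eventually_elim
    case (elim N)
    let ?M = "measure_pmf (poisson_list (\<alpha> * N) (rooted_edges p \<Theta> N))"
    have i: "integrable ?M (log_partition b N)" for b
      using elim pos by (intro integrable_log_partition_edges) auto
    have "mean_free_energy p \<alpha> \<Theta> N ?z \<le> (\<integral>es. (1 - l) * log_partition x N es + l * log_partition y N es \<partial>?M)"
      unfolding mean_free_energy_def using i l log_partition_convex[of l x y N]
      by (intro integral_mono) auto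
    also have "\<dots> = (1 - l) * mean_free_energy p \<alpha> \<Theta> N x + l * mean_free_energy p \<alpha> \<Theta> N y"
      unfolding mean_free_energy_def using i by simp
    finally have "mean_free_energy p \<alpha> \<Theta> N ?z / real N \<le> ((1 - l) * mean_free_energy p \<alpha> \<Theta> N x + l * mean_free_energy p \<alpha> \<Theta> N y) / real N"
      by (rule divide_right_mono) simp
    then show ?case by (simp only: add_divide_distrib times_divide_eq_right)
  qed
  ultimately show "F p \<alpha> \<Theta> ?z \<le> (1 - l) * F p \<alpha> \<Theta> x + l * F p \<alpha> \<Theta> y"
    by (intro tendsto_le[OF sequentially_bot])
qed simp

text \<open>Where \<open>f\<close> is differentiable, \<open>f z - z f'(z)\<close> is the intercept of the tangent at \<open>z\<close>. For \<open>x > 0\<close> the tangent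
  at \<open>y\<close>, being steeper and lying below \<open>f\<close> at \<open>x\<close>, meets the vertical axis lower; for \<open>y < 0\<close> it is
  the other way round.\<close>

lemma convex_legendre_monotone:
  fixes f :: "real \<Rightarrow> real"
  assumes cv: "convex_on UNIV f" and d: "f differentiable (at x)" "f differentiable (at y)" and xy: "x \<le> y"
  shows "deriv f x \<le> deriv f y"
    and "x > 0 \<Longrightarrow> f y - y * deriv f y \<le> f x - x * deriv f x"
    and "y < 0 \<Longrightarrow> f x - x * deriv f x \<le> f y - y * deriv f y"
proof -
  have tan: "f w - f z \<ge> deriv f z * (w - z)" if "f differentiable (at z)" for z w
  proof (rule convex_on_imp_above_tangent[OF cv])
    show "(f has_real_derivative deriv f z) (at z within UNIV)"
      using that by (simp add: DERIV_deriv_iff_real_differentiable)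
  qed auto
  have 1: "f x - f y \<ge> deriv f y * (x - y)" and 2: "f y - f x \<ge> deriv f x * (y - x)"
    using tan[OF d(2), of x] tan[OF d(1), of y] by auto
  show m: "deriv f x \<le> deriv f y"
  proof (cases "x = y")
    case False
    have "0 \<le> (deriv f y - deriv f x) * (y - x)" using 1 2 by (simp add: algebra_simps)
    then show ?thesis using False xy by (simp add: zero_le_mult_iff)
  qed simp
  show "f y - y * deriv f y \<le> f x - x * deriv f x" if "x > 0"
  proof -
    have "x * deriv f x \<le> x * deriv f y" using m that by (intro mult_left_mono) auto
    then show ?thesis using 1 by (simp add: algebra_simps)
  qed
  show "f x - x * deriv f x \<le> f y - y * deriv f y" if "y < 0"
  proof -
    have "y * deriv f y \<le> y * deriv f x" using m that by (intro mult_left_mono_neg) auto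
    then show ?thesis using 2 by (simp add: algebra_simps)
  qed
qed

section \<open>Counting configurations of given energy\<close>

lemma partition_fn_sum: "2 ^ N * partition_fn \<beta> N H = (\<Sum>\<sigma>\<in>{1..N} \<rightarrow>\<^sub>E UNIV. exp (\<beta> * H \<sigma>))"
  by (simp add: partition_fn_def conf_avg_def)

definition energy_window :: "nat \<Rightarrow> energy \<Rightarrow> nat \<Rightarrow> real \<Rightarrow> real \<Rightarrow> (nat \<Rightarrow> spin) set" where
  "energy_window N H n \<mu> \<epsilon> = {\<sigma> \<in> {1..N} \<rightarrow>\<^sub>E UNIV. \<bar>H \<sigma> - real n * \<mu>\<bar> < real n * \<epsilon>}"

text \<open>Markov's inequality with the weight \<open>exp(\<beta> H)\<close>.\<close>

lemma energy_window_upper: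
  assumes "card (energy_window N H n \<mu> \<epsilon>) > 0"
  shows "ln (card (energy_window N H n \<mu> \<epsilon>)) \<le> N * ln 2 + ln (partition_fn \<beta> N H) - \<beta> * (n * \<mu>) + \<bar>\<beta>\<bar> * (n * \<epsilon>)"
proof -
  let ?W = "energy_window N H n \<mu> \<epsilon>"
  have sub: "?W \<subseteq> {1..N} \<rightarrow>\<^sub>E UNIV" by (auto simp: energy_window_def)
  have e: "\<beta> * (n * \<mu>) - \<bar>\<beta>\<bar> * (n * \<epsilon>) \<le> \<beta> * H \<sigma>" if "\<sigma> \<in> ?W" for \<sigma>
  proof -
    have "\<bar>\<beta> * (H \<sigma> - n * \<mu>)\<bar> \<le> \<bar>\<beta>\<bar> * (n * \<epsilon>)"
      unfolding abs_mult using that by (intro mult_left_mono) (auto simp: energy_window_def)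
    then show ?thesis by (simp add: right_diff_distrib abs_le_iff)
  qed
  have "card ?W * exp (\<beta> * (n * \<mu>) - \<bar>\<beta>\<bar> * (n * \<epsilon>)) = (\<Sum>\<sigma>\<in>?W. exp (\<beta> * (n * \<mu>) - \<bar>\<beta>\<bar> * (n * \<epsilon>)))" by simp
  also have "\<dots> \<le> (\<Sum>\<sigma>\<in>?W. exp (\<beta> * H \<sigma>))" using e by (intro sum_mono) simp
  also have "\<dots> \<le> 2 ^ N * partition_fn \<beta> N H"
    unfolding partition_fn_sum by (rule sum_mono2[OF finite_conf sub]) simp
  finally have "ln (card ?W * exp (\<beta> * (n * \<mu>) - \<bar>\<beta>\<bar> * (n * \<epsilon>))) \<le> ln (2 ^ N * partition_fn \<beta> N H)"
    using assms partition_fn_pos[of \<beta> N H] by (subst ln_le_cancel_iff) auto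
  then show ?thesis using assms partition_fn_pos[of \<beta> N H] by (simp add: ln_mult ln_realpow algebra_simps)
qed

text \<open>Chernoff bounds for the Gibbs measure, whose exponential moments are ratios of partition
  functions.\<close>

lemma energy_tail:
  assumes "\<delta> \<ge> 0"
  shows "(\<Sum>\<sigma>\<in>{\<sigma> \<in> {1..N} \<rightarrow>\<^sub>E UNIV. H \<sigma> \<ge> a}. exp (\<beta> * H \<sigma>)) \<le> exp (- \<delta> * a) * (2 ^ N * partition_fn (\<beta> + \<delta>) N H)"
    and "(\<Sum>\<sigma>\<in>{\<sigma> \<in> {1..N} \<rightarrow>\<^sub>E UNIV. H \<sigma> \<le> a}. exp (\<beta> * H \<sigma>)) \<le> exp (\<delta> * a) * (2 ^ N * partition_fn (\<beta> - \<delta>) N H)"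
proof -
  let ?S = "{1..N} \<rightarrow>\<^sub>E (UNIV :: spin set)"
  have "(\<Sum>\<sigma>\<in>{\<sigma> \<in> ?S. H \<sigma> \<ge> a}. exp (\<beta> * H \<sigma>)) \<le> (\<Sum>\<sigma>\<in>{\<sigma> \<in> ?S. H \<sigma> \<ge> a}. exp (- \<delta> * a) * exp ((\<beta> + \<delta>) * H \<sigma>))"
  proof (rule sum_mono)
    fix \<sigma> assume "\<sigma> \<in> {\<sigma> \<in> ?S. H \<sigma> \<ge> a}"
    then have "\<delta> * a \<le> \<delta> * H \<sigma>" using assms by (intro mult_left_mono) auto
    then show "exp (\<beta> * H \<sigma>) \<le> exp (- \<delta> * a) * exp ((\<beta> + \<delta>) * H \<sigma>)"
      unfolding exp_add[symmetric] by (simp add: algebra_simps)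
  qed
  also have "\<dots> \<le> (\<Sum>\<sigma>\<in>?S. exp (- \<delta> * a) * exp ((\<beta> + \<delta>) * H \<sigma>))"
    by (rule sum_mono2[OF finite_conf]) auto
  finally show "(\<Sum>\<sigma>\<in>{\<sigma> \<in> ?S. H \<sigma> \<ge> a}. exp (\<beta> * H \<sigma>)) \<le> exp (- \<delta> * a) * (2 ^ N * partition_fn (\<beta> + \<delta>) N H)"
    by (simp only: partition_fn_sum sum_distrib_left)
  have "(\<Sum>\<sigma>\<in>{\<sigma> \<in> ?S. H \<sigma> \<le> a}. exp (\<beta> * H \<sigma>)) \<le> (\<Sum>\<sigma>\<in>{\<sigma> \<in> ?S. H \<sigma> \<le> a}. exp (\<delta> * a) * exp ((\<beta> - \<delta>) * H \<sigma>))"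
  proof (rule sum_mono)
    fix \<sigma> assume "\<sigma> \<in> {\<sigma> \<in> ?S. H \<sigma> \<le> a}"
    then have "\<delta> * H \<sigma> \<le> \<delta> * a" using assms by (intro mult_left_mono) auto
    then show "exp (\<beta> * H \<sigma>) \<le> exp (\<delta> * a) * exp ((\<beta> - \<delta>) * H \<sigma>)"
      unfolding exp_add[symmetric] by (simp add: algebra_simps)
  qed
  also have "\<dots> \<le> (\<Sum>\<sigma>\<in>?S. exp (\<delta> * a) * exp ((\<beta> - \<delta>) * H \<sigma>))"
    by (rule sum_mono2[OF finite_conf]) auto
  finally show "(\<Sum>\<sigma>\<in>{\<sigma> \<in> ?S. H \<sigma> \<le> a}. exp (\<beta> * H \<sigma>)) \<le> exp (\<delta> * a) * (2 ^ N * partition_fn (\<beta> - \<delta>) N H)"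
    by (simp only: partition_fn_sum sum_distrib_left)
qed

text \<open>If each of the two tails has at most a quarter of the Gibbs mass, then the window has at least half
  of it, and each configuration in the window has Boltzmann weight at most
  \<open>exp(\<beta>n\<mu> + \<bar>\<beta>\<bar>n\<epsilon>)\<close>.\<close>

lemma energy_window_lower:
  assumes \<delta>: "\<delta> \<ge> 0"
    and up: "ln (partition_fn (\<beta> + \<delta>) N H) - ln (partition_fn \<beta> N H) - \<delta> * (n * \<mu> + n * \<epsilon>) \<le> - ln 4"
    and lo: "ln (partition_fn (\<beta> - \<delta>) N H) - ln (partition_fn \<beta> N H) + \<delta> * (n * \<mu> - n * \<epsilon>) \<le> - ln 4"
  shows "card (energy_window N H n \<mu> \<epsilon>) > 0"
    and "ln (card (energy_window N H n \<mu> \<epsilon>)) \<ge> N * ln 2 + ln (partition_fn \<beta> N H) - ln 2 - \<beta> * (n * \<mu>) - \<bar>\<beta>\<bar> * (n * \<epsilon>)"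
proof -
  let ?W = "energy_window N H n \<mu> \<epsilon>" and ?S = "{1..N} \<rightarrow>\<^sub>E (UNIV :: spin set)"
  let ?Z = "\<lambda>b. partition_fn b N H"
  let ?U = "{\<sigma> \<in> ?S. H \<sigma> \<ge> n * \<mu> + n * \<epsilon>}" and ?L = "{\<sigma> \<in> ?S. H \<sigma> \<le> n * \<mu> - n * \<epsilon>}"
  have Z: "?Z b > 0" for b by (rule partition_fn_pos)
  have quarter: "exp c * ?Z b \<le> ?Z \<beta> / 4" if "ln (?Z b) - ln (?Z \<beta>) + c \<le> - ln 4" for b c
  proof -
    have "c + ln (?Z b) \<le> ln (?Z \<beta>) - ln 4" using that by linarith
    then have "exp (c + ln (?Z b)) \<le> exp (ln (?Z \<beta>) - ln 4)" by (rule exp_le_cancel_iff[THEN iffD2])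
    then show ?thesis unfolding exp_add exp_diff using Z by simp
  qed
  have qu: "exp (- \<delta> * (n * \<mu> + n * \<epsilon>)) * ?Z (\<beta> + \<delta>) \<le> ?Z \<beta> / 4" by (rule quarter) (use up in simp)
  have ql: "exp (\<delta> * (n * \<mu> - n * \<epsilon>)) * ?Z (\<beta> - \<delta>) \<le> ?Z \<beta> / 4" by (rule quarter) (use lo in simp)
  have "(\<Sum>\<sigma>\<in>?U. exp (\<beta> * H \<sigma>)) \<le> exp (- \<delta> * (n * \<mu> + n * \<epsilon>)) * (2 ^ N * ?Z (\<beta> + \<delta>))"
    by (rule energy_tail(1)[OF \<delta>])
  also have "\<dots> = 2 ^ N * (exp (- \<delta> * (n * \<mu> + n * \<epsilon>)) * ?Z (\<beta> + \<delta>))" by (simp only: mult.left_commute)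
  also have "\<dots> \<le> 2 ^ N * (?Z \<beta> / 4)" by (rule mult_left_mono[OF qu]) simp
  finally have U: "(\<Sum>\<sigma>\<in>?U. exp (\<beta> * H \<sigma>)) \<le> 2 ^ N * (?Z \<beta> / 4)" .
  have "(\<Sum>\<sigma>\<in>?L. exp (\<beta> * H \<sigma>)) \<le> exp (\<delta> * (n * \<mu> - n * \<epsilon>)) * (2 ^ N * ?Z (\<beta> - \<delta>))"
    by (rule energy_tail(2)[OF \<delta>])
  also have "\<dots> = 2 ^ N * (exp (\<delta> * (n * \<mu> - n * \<epsilon>)) * ?Z (\<beta> - \<delta>))" by (simp only: mult.left_commute)
  also have "\<dots> \<le> 2 ^ N * (?Z \<beta> / 4)" by (rule mult_left_mono[OF ql]) simp
  finally have L: "(\<Sum>\<sigma>\<in>?L. exp (\<beta> * H \<sigma>)) \<le> 2 ^ N * (?Z \<beta> / 4)" .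
  have fin: "finite ?S" by (rule finite_conf)
  have finW: "finite ?W" "finite ?U" "finite ?L" unfolding energy_window_def using fin by simp_all
  have cover: "?S \<subseteq> ?W \<union> (?U \<union> ?L)" unfolding energy_window_def by (auto simp: abs_less_iff)
  have "2 ^ N * ?Z \<beta> \<le> (\<Sum>\<sigma>\<in>?W \<union> (?U \<union> ?L). exp (\<beta> * H \<sigma>))"
    unfolding partition_fn_sum using cover finW by (intro sum_mono2) auto
  also have "\<dots> \<le> (\<Sum>\<sigma>\<in>?W. exp (\<beta> * H \<sigma>)) + ((\<Sum>\<sigma>\<in>?U. exp (\<beta> * H \<sigma>)) + (\<Sum>\<sigma>\<in>?L. exp (\<beta> * H \<sigma>)))"
  proof -
    have "(\<Sum>\<sigma>\<in>A \<union> B. exp (\<beta> * H \<sigma>)) \<le> (\<Sum>\<sigma>\<in>A. exp (\<beta> * H \<sigma>)) + (\<Sum>\<sigma>\<in>B. exp (\<beta> * H \<sigma>))"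
      if "finite A" "finite B" for A B
      using sum.union_inter[OF that, of "\<lambda>\<sigma>. exp (\<beta> * H \<sigma>)"] sum_nonneg[of "A \<inter> B" "\<lambda>\<sigma>. exp (\<beta> * H \<sigma>)"] by simp
    then show ?thesis using finW by (meson add_left_mono finite_UnI order_trans)
  qed
  finally have half: "2 ^ N * ?Z \<beta> / 2 \<le> (\<Sum>\<sigma>\<in>?W. exp (\<beta> * H \<sigma>))" using U L by simp
  have hpos: "2 ^ N * ?Z \<beta> / 2 > 0" using Z[of \<beta>] by simp
  show cpos: "card ?W > 0"
  proof (rule ccontr)
    assume "\<not> card ?W > 0"
    then have "?W = {}" using finW by simp
    then have "(\<Sum>\<sigma>\<in>?W. exp (\<beta> * H \<sigma>)) = 0" by simp
    then show False using half hpos by linarith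
  qed
  have e: "\<beta> * H \<sigma> \<le> \<beta> * (n * \<mu>) + \<bar>\<beta>\<bar> * (n * \<epsilon>)" if "\<sigma> \<in> ?W" for \<sigma>
  proof -
    have "\<bar>\<beta> * (H \<sigma> - n * \<mu>)\<bar> \<le> \<bar>\<beta>\<bar> * (n * \<epsilon>)"
      unfolding abs_mult using that by (intro mult_left_mono) (auto simp: energy_window_def)
    then show ?thesis by (simp add: right_diff_distrib abs_le_iff)
  qed
  have "(\<Sum>\<sigma>\<in>?W. exp (\<beta> * H \<sigma>)) \<le> (\<Sum>\<sigma>\<in>?W. exp (\<beta> * (n * \<mu>) + \<bar>\<beta>\<bar> * (n * \<epsilon>)))"
    using e by (intro sum_mono) simp
  also have "\<dots> = card ?W * exp (\<beta> * (n * \<mu>) + \<bar>\<beta>\<bar> * (n * \<epsilon>))" by simp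
  finally have "2 ^ N * ?Z \<beta> / 2 \<le> card ?W * exp (\<beta> * (n * \<mu>) + \<bar>\<beta>\<bar> * (n * \<epsilon>))" using half by linarith
  then have "ln (2 ^ N * ?Z \<beta> / 2) \<le> ln (card ?W * exp (\<beta> * (n * \<mu>) + \<bar>\<beta>\<bar> * (n * \<epsilon>)))"
    using hpos cpos by (subst ln_le_cancel_iff) auto
  then show "ln (card ?W) \<ge> N * ln 2 + ln (?Z \<beta>) - ln 2 - \<beta> * (n * \<mu>) - \<bar>\<beta>\<bar> * (n * \<epsilon>)"
    using cpos Z[of \<beta>] by (simp add: ln_mult ln_div ln_realpow algebra_simps)
qed

text \<open>At a point of differentiability the Chernoff exponents are negative for a small tilt. Tilts of the form
  \<open>1/(j + 1)\<close> keep the number of required inverse temperatures countable, so that one null set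
  suffices.\<close>

lemma tilted_exponent_negative:
  fixes f :: "real \<Rightarrow> real"
  assumes "(f has_real_derivative D) (at x)" "e > 0"
  shows "\<exists>j. f (x + 1 / Suc j) - f x - (1 / Suc j) * (D + e) < 0 \<and> f (x - 1 / Suc j) - f x + (1 / Suc j) * (D - e) < 0"
proof -
  have lim: "(\<lambda>h. (f (x + h) - f x) / h) \<midarrow>0\<rightarrow> D" using assms(1) by (simp add: DERIV_def)
  then obtain r where r: "r > 0" "\<And>h. h \<noteq> 0 \<Longrightarrow> norm h < r \<Longrightarrow> norm ((f (x + h) - f x) / h - D) < e"
    using assms(2) LIM_D[OF lim assms(2)] by auto
  obtain j where j: "1 / real (Suc j) < r" using r(1) nat_approx_posE by blast
  let ?d = "1 / real (Suc j)"
  have d: "?d > 0" by simp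
  have "\<bar>(f (x + ?d) - f x) / ?d - D\<bar> < e" using r(2)[of ?d] j by simp
  then have "(f (x + ?d) - f x) / ?d < D + e" by linarith
  then have 1: "f (x + ?d) - f x < (D + e) * ?d" using d by (simp only: pos_divide_less_eq)
  have "\<bar>(f (x + - ?d) - f x) / (- ?d) - D\<bar> < e" using r(2)[of "- ?d"] j by simp
  then have "(f (x + - ?d) - f x) / (- ?d) > D - e" by linarith
  then have "- ((f (x - ?d) - f x) / ?d) > D - e" by simp
  then have "(f (x - ?d) - f x) / ?d < - (D - e)" by linarith
  then have 2: "f (x - ?d) - f x < - (D - e) * ?d" using d by (simp only: pos_divide_less_eq)
  have 3: "(D + e) * ?d = ?d * (D + e)" "- (D - e) * ?d = - (?d * (D - e))"
    by (simp_all only: mult_minus_left mult.commute)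
  from 1 2 show ?thesis unfolding 3 by (intro exI[of _ j] conjI) linarith+
qed

text \<open>The deterministic part of the entropy formula: a version of the Gaertner--Ellis theorem for
  counting, with the window centred at the derivative of the limiting free energy.\<close>

theorem energy_window_limit:
  fixes H :: "nat \<Rightarrow> energy" and n :: "nat \<Rightarrow> nat" and f :: "real \<Rightarrow> real"
  assumes a: "a > 0" and n: "(\<lambda>N. real (n N) / real N) \<longlonglongrightarrow> a"
    and f: "(f has_real_derivative D) (at \<beta>)"
    and Z: "(\<lambda>N. ln (partition_fn \<beta> N (H N)) / real N) \<longlonglongrightarrow> f \<beta>"
    and Z1: "\<And>j. (\<lambda>N. ln (partition_fn (\<beta> + 1 / Suc j) N (H N)) / real N) \<longlonglongrightarrow> f (\<beta> + 1 / Suc j)"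
    and Z2: "\<And>j. (\<lambda>N. ln (partition_fn (\<beta> - 1 / Suc j) N (H N)) / real N) \<longlonglongrightarrow> f (\<beta> - 1 / Suc j)"
    and \<epsilon>: "\<epsilon> > 0"
  shows "\<forall>\<^sub>F N in sequentially. card (energy_window N (H N) (n N) (D / a) \<epsilon>) > 0 \<and>
    \<bar>ln (card (energy_window N (H N) (n N) (D / a) \<epsilon>)) / real N - (ln 2 + f \<beta> - \<beta> * D)\<bar> \<le> (\<bar>\<beta>\<bar> * a + 1) * \<epsilon>"
proof -
  let ?W = "\<lambda>N. energy_window N (H N) (n N) (D / a) \<epsilon>" and ?z = "\<lambda>b N. ln (partition_fn b N (H N))"
  let ?x = "\<lambda>N. real (n N) / real N"
  obtain j where j: "f (\<beta> + 1 / Suc j) - f \<beta> - (1 / Suc j) * (D + a * \<epsilon>) < 0"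
      "f (\<beta> - 1 / Suc j) - f \<beta> + (1 / Suc j) * (D - a * \<epsilon>) < 0"
    using tilted_exponent_negative[OF f, of "a * \<epsilon>"] a \<epsilon> by auto
  define \<delta> where "\<delta> = 1 / real (Suc j)"
  have \<delta>: "\<delta> > 0" by (simp add: \<delta>_def)
  have inv: "(\<lambda>N. ln 4 / real N) \<longlonglongrightarrow> 0" "(\<lambda>N. ln 2 / real N) \<longlonglongrightarrow> 0" by (rule lim_const_over_n)+
  have aD: "a * (D / a) = D" using a by simp
  have "(\<lambda>N. ?z (\<beta> + \<delta>) N / real N - ?z \<beta> N / real N - \<delta> * (?x N * (D / a) + ?x N * \<epsilon>) + ln 4 / real N)
      \<longlonglongrightarrow> f (\<beta> + \<delta>) - f \<beta> - \<delta> * (a * (D / a) + a * \<epsilon>) + 0"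
    unfolding \<delta>_def by (intro tendsto_intros Z Z1 n inv)
  moreover have "f (\<beta> + \<delta>) - f \<beta> - \<delta> * (a * (D / a) + a * \<epsilon>) + 0 < 0" using j(1) by (simp only: \<delta>_def aD add_0_right)
  ultimately have up: "\<forall>\<^sub>F N in sequentially. ?z (\<beta> + \<delta>) N / real N - ?z \<beta> N / real N - \<delta> * (?x N * (D / a) + ?x N * \<epsilon>) + ln 4 / real N < 0"
    by (rule order_tendstoD)
  have "(\<lambda>N. ?z (\<beta> - \<delta>) N / real N - ?z \<beta> N / real N + \<delta> * (?x N * (D / a) - ?x N * \<epsilon>) + ln 4 / real N)
      \<longlonglongrightarrow> f (\<beta> - \<delta>) - f \<beta> + \<delta> * (a * (D / a) - a * \<epsilon>) + 0"
    unfolding \<delta>_def by (intro tendsto_intros Z Z2 n inv)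
  moreover have "f (\<beta> - \<delta>) - f \<beta> + \<delta> * (a * (D / a) - a * \<epsilon>) + 0 < 0" using j(2) by (simp only: \<delta>_def aD add_0_right)
  ultimately have lo: "\<forall>\<^sub>F N in sequentially. ?z (\<beta> - \<delta>) N / real N - ?z \<beta> N / real N + \<delta> * (?x N * (D / a) - ?x N * \<epsilon>) + ln 4 / real N < 0"
    by (rule order_tendstoD)
  have "(\<lambda>N. ln 2 + ?z \<beta> N / real N - \<beta> * (?x N * (D / a)) + \<bar>\<beta>\<bar> * (?x N * \<epsilon>)) \<longlonglongrightarrow> ln 2 + f \<beta> - \<beta> * (a * (D / a)) + \<bar>\<beta>\<bar> * (a * \<epsilon>)"
    by (intro tendsto_intros Z n)
  moreover have "ln 2 + f \<beta> - \<beta> * (a * (D / a)) + \<bar>\<beta>\<bar> * (a * \<epsilon>) < ln 2 + f \<beta> - \<beta> * D + (\<bar>\<beta>\<bar> * a + 1) * \<epsilon>"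
    unfolding aD using \<epsilon> by (simp add: algebra_simps)
  ultimately have ub: "\<forall>\<^sub>F N in sequentially. ln 2 + ?z \<beta> N / real N - \<beta> * (?x N * (D / a)) + \<bar>\<beta>\<bar> * (?x N * \<epsilon>)
      < ln 2 + f \<beta> - \<beta> * D + (\<bar>\<beta>\<bar> * a + 1) * \<epsilon>"
    by (rule order_tendstoD)
  have "(\<lambda>N. ln 2 + ?z \<beta> N / real N - ln 2 / real N - \<beta> * (?x N * (D / a)) - \<bar>\<beta>\<bar> * (?x N * \<epsilon>)) \<longlonglongrightarrow> ln 2 + f \<beta> - 0 - \<beta> * (a * (D / a)) - \<bar>\<beta>\<bar> * (a * \<epsilon>)"
    by (intro tendsto_intros Z n inv)
  moreover have "ln 2 + f \<beta> - 0 - \<beta> * (a * (D / a)) - \<bar>\<beta>\<bar> * (a * \<epsilon>) > ln 2 + f \<beta> - \<beta> * D - (\<bar>\<beta>\<bar> * a + 1) * \<epsilon>"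
    unfolding aD using \<epsilon> by (simp add: algebra_simps)
  ultimately have lb: "\<forall>\<^sub>F N in sequentially. ln 2 + ?z \<beta> N / real N - ln 2 / real N - \<beta> * (?x N * (D / a)) - \<bar>\<beta>\<bar> * (?x N * \<epsilon>)
      > ln 2 + f \<beta> - \<beta> * D - (\<bar>\<beta>\<bar> * a + 1) * \<epsilon>"
    by (rule order_tendstoD)
  show ?thesis using up lo ub lb eventually_gt_at_top[of 0]
  proof eventually_elim
    case (elim N)
    have N: "real N > 0" using elim(5) by simp
    have "?z (\<beta> + \<delta>) N / real N - ?z \<beta> N / real N - \<delta> * (?x N * (D / a) + ?x N * \<epsilon>) + ln 4 / real N =
      (?z (\<beta> + \<delta>) N - ?z \<beta> N - \<delta> * (n N * (D / a) + n N * \<epsilon>) + ln 4) / real N"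
      using N by (simp add: field_simps)
    then have 1: "?z (\<beta> + \<delta>) N - ?z \<beta> N - \<delta> * (n N * (D / a) + n N * \<epsilon>) \<le> - ln 4"
      using elim(1) N by (simp only: divide_less_0_iff) linarith
    have "?z (\<beta> - \<delta>) N / real N - ?z \<beta> N / real N + \<delta> * (?x N * (D / a) - ?x N * \<epsilon>) + ln 4 / real N =
      (?z (\<beta> - \<delta>) N - ?z \<beta> N + \<delta> * (n N * (D / a) - n N * \<epsilon>) + ln 4) / real N"
      using N by (simp add: field_simps)
    then have 2: "?z (\<beta> - \<delta>) N - ?z \<beta> N + \<delta> * (n N * (D / a) - n N * \<epsilon>) \<le> - ln 4"
      using elim(2) N by (simp only: divide_less_0_iff) linarith
    have c: "card (?W N) > 0" by (rule energy_window_lower(1)[OF less_imp_le[OF \<delta>] 1 2])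
    have l: "ln (card (?W N)) \<ge> N * ln 2 + ?z \<beta> N - ln 2 - \<beta> * (n N * (D / a)) - \<bar>\<beta>\<bar> * (n N * \<epsilon>)"
      by (rule energy_window_lower(2)[OF less_imp_le[OF \<delta>] 1 2])
    have u: "ln (card (?W N)) \<le> N * ln 2 + ?z \<beta> N - \<beta> * (n N * (D / a)) + \<bar>\<beta>\<bar> * (n N * \<epsilon>)"
      by (rule energy_window_upper[OF c])
    have "ln (card (?W N)) / N \<le> (N * ln 2 + ?z \<beta> N - \<beta> * (n N * (D / a)) + \<bar>\<beta>\<bar> * (n N * \<epsilon>)) / N"
      using u by (rule divide_right_mono) simp
    also have "\<dots> = ln 2 + ?z \<beta> N / real N - \<beta> * (?x N * (D / a)) + \<bar>\<beta>\<bar> * (?x N * \<epsilon>)"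
      using N by (simp add: field_simps)
    finally have U: "ln (card (?W N)) / N \<le> ln 2 + f \<beta> - \<beta> * D + (\<bar>\<beta>\<bar> * a + 1) * \<epsilon>" using elim(3) by linarith
    have "ln 2 + ?z \<beta> N / real N - ln 2 / real N - \<beta> * (?x N * (D / a)) - \<bar>\<beta>\<bar> * (?x N * \<epsilon>) =
       (N * ln 2 + ?z \<beta> N - ln 2 - \<beta> * (n N * (D / a)) - \<bar>\<beta>\<bar> * (n N * \<epsilon>)) / N"
      using N by (simp add: field_simps)
    also have "\<dots> \<le> ln (card (?W N)) / N"
      using l by (rule divide_right_mono) simp
    finally have L: "ln (card (?W N)) / N \<ge> ln 2 + f \<beta> - \<beta> * D - (\<bar>\<beta>\<bar> * a + 1) * \<epsilon>" using elim(4) by linarith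
    show ?case using c U L by (simp add: abs_le_iff)
  qed
qed

section \<open>The random constraint satisfaction problem\<close>

context csp_model begin

definition constraints :: "nat \<Rightarrow> 'a \<Rightarrow> ((spin list \<Rightarrow> real) \<times> nat list) list" where
  "constraints N \<omega> = map (\<lambda>k. (\<theta> k \<omega>, I N k \<omega>)) [1..<n N \<omega> + 1]"

lemma prob_preimage:
  assumes "X \<in> M \<rightarrow>\<^sub>M count_space UNIV" "distr M (count_space UNIV) X = measure_pmf w"
  shows "prob (X -` {x} \<inter> space M) = pmf w x"
  using measure_distr[OF assms(1), of "{x}"] unfolding assms(2) by (simp add: measure_pmf_single)

text \<open>The number of constraints, the interactions and the tuples of sites are independent, so that the
  weight of a list of constraints is the product of their weights.\<close>

lemma constraints_law:
  assumes N: "N \<ge> p"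
  shows "{\<omega> \<in> space M. constraints N \<omega> = es} \<in> sets M"
    and "emeasure M {\<omega> \<in> space M. constraints N \<omega> = es} = ennreal (pmf (poisson_list (\<alpha> * N) (rooted_edges p \<Theta> N)) es)"
proof -
  let ?r = "length es"
  let ?idx = "insert Number (Interaction ` {1..?r} \<union> Sites ` {1..?r})"
  define A where "A d = (case d of Number \<Rightarrow> n N -` {?r} \<inter> space M
     | Interaction k \<Rightarrow> \<theta> k -` {fst (es ! (k - 1))} \<inter> space M
     | Sites k \<Rightarrow> I N k -` {snd (es ! (k - 1))} \<inter> space M)" for d
  have U: "{is. length is = p \<and> distinct is \<and> set is \<subseteq> {1..N}} = tuples p {1..N}" by (simp add: tuples_def)
  have s: "\<alpha> * real N > 0" using \<alpha>_pos N p_ge_2 by simp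
  have set: "{\<omega> \<in> space M. constraints N \<omega> = es} = (\<Inter>d\<in>?idx. A d)"
  proof -
    have "constraints N \<omega> = es \<longleftrightarrow> n N \<omega> = ?r \<and> (\<forall>k\<in>{1..?r}. \<theta> k \<omega> = fst (es ! (k - 1)) \<and> I N k \<omega> = snd (es ! (k - 1)))" for \<omega>
    proof -
      have "constraints N \<omega> = es \<longleftrightarrow> n N \<omega> = ?r \<and> map (\<lambda>k. (\<theta> k \<omega>, I N k \<omega>)) [1..<?r + 1] = es"
        unfolding constraints_def by (auto simp del: upt_Suc dest: arg_cong[where f=length])
      then show ?thesis unfolding map_upt_eq_iff by (auto simp: prod_eq_iff)
    qed
    then have "{\<omega> \<in> space M. constraints N \<omega> = es} = {\<omega> \<in> space M. n N \<omega> = ?r \<and> (\<forall>k\<in>{1..?r}. \<theta> k \<omega> = fst (es ! (k - 1)) \<and> I N k \<omega> = snd (es ! (k - 1)))}"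
      by (simp only:)
    also have "\<dots> = A Number \<inter> ((\<Inter>k\<in>{1..?r}. A (Interaction k)) \<inter> (\<Inter>k\<in>{1..?r}. A (Sites k)))"
      unfolding A_def disorder.case by auto
    also have "\<dots> = (\<Inter>d\<in>?idx. A d)" by blast
    finally show ?thesis .
  qed
  let ?G = "\<lambda>d. case d of Number \<Rightarrow> {n N -` A \<inter> space M |A. True}
       | Interaction k \<Rightarrow> {\<theta> k -` A \<inter> space M |A. True}
       | Sites k \<Rightarrow> {I N k -` A \<inter> space M |A. True}"
  have ind: "indep_sets ?G ({Number} \<union> Interaction ` {1..} \<union> Sites ` {1..})" by (rule independent[OF N])
  have AG: "A d \<in> ?G d" for d by (cases d) (auto simp: A_def)
  have sub: "?idx \<subseteq> {Number} \<union> Interaction ` {1..} \<union> Sites ` {1..}" by auto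
  have Aev: "A d \<in> events" if "d \<in> ?idx" for d
    using ind AG[of d] that sub unfolding indep_sets_def by blast
  have "(\<Inter>d\<in>?idx. A d) \<in> sets M" by (intro sets.finite_INT) (use Aev in auto)
  then show "{\<omega> \<in> space M. constraints N \<omega> = es} \<in> sets M" by (simp only: set)
  have "prob (\<Inter>d\<in>?idx. A d) = (\<Prod>d\<in>?idx. prob (A d))"
  proof -
    have "\<forall>J\<subseteq>{Number} \<union> Interaction ` {1..} \<union> Sites ` {1..}. J \<noteq> {} \<longrightarrow> finite J \<longrightarrow> (\<forall>A\<in>Pi J ?G. prob (\<Inter>j\<in>J. A j) = (\<Prod>j\<in>J. prob (A j)))"
      using ind unfolding indep_sets_def by (rule conjunct2)
    from this[THEN spec, THEN mp, OF sub]
    have *: "?idx \<noteq> {} \<longrightarrow> finite ?idx \<longrightarrow> (\<forall>A\<in>Pi ?idx ?G. prob (\<Inter>j\<in>?idx. A j) = (\<Prod>j\<in>?idx. prob (A j)))" .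
    have AP: "A \<in> Pi ?idx ?G" by (rule Pi_I) (rule AG)
    have ne: "?idx \<noteq> {}" and fi: "finite ?idx" by simp_all
    show ?thesis by (rule bspec[OF mp[OF mp[OF * ne] fi] AP])
  qed
  also have "\<dots> = prob (A Number) * ((\<Prod>d\<in>Interaction ` {1..?r}. prob (A d)) * (\<Prod>d\<in>Sites ` {1..?r}. prob (A d)))"
    by (subst prod.insert) (auto intro!: prod.union_disjoint)
  also have "(\<Prod>d\<in>Interaction ` {1..?r}. prob (A d)) = (\<Prod>k\<in>{1..?r}. prob (A (Interaction k)))"
    by (subst prod.reindex) (auto simp: inj_on_def)
  also have "(\<Prod>d\<in>Sites ` {1..?r}. prob (A d)) = (\<Prod>k\<in>{1..?r}. prob (A (Sites k)))"
    by (subst prod.reindex) (auto simp: inj_on_def)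
  also have "prob (A Number) = pmf (poisson_pmf (\<alpha> * N)) ?r"
    unfolding A_def disorder.case by (rule prob_preimage[OF n_measurable[OF N] n_law[OF N]])
  also have "(\<Prod>k\<in>{1..?r}. prob (A (Interaction k))) = (\<Prod>k\<in>{1..?r}. pmf \<Theta> (fst (es ! (k - 1))))"
    unfolding A_def disorder.case
    by (rule prod.cong[OF refl], rule prob_preimage[OF \<theta>_measurable \<theta>_law]) auto
  also have "(\<Prod>k\<in>{1..?r}. prob (A (Sites k))) = (\<Prod>k\<in>{1..?r}. pmf (pmf_of_set (tuples p {1..N})) (snd (es ! (k - 1))))"
    unfolding A_def disorder.case
    by (rule prod.cong[OF refl], rule prob_preimage[OF I_measurable[OF N] I_law[OF N, unfolded U]]) auto
  also have "(\<Prod>k\<in>{1..?r}. pmf \<Theta> (fst (es ! (k - 1)))) * (\<Prod>k\<in>{1..?r}. pmf (pmf_of_set (tuples p {1..N})) (snd (es ! (k - 1))))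
     = (\<Prod>k\<in>{1..?r}. pmf (rooted_edges p \<Theta> N) (es ! (k - 1)))"
  proof -
    have "pmf (rooted_edges p \<Theta> N) e = pmf \<Theta> (fst e) * pmf (pmf_of_set (tuples p {1..N})) (snd e)" for e
      using pmf_pair[of \<Theta> "pmf_of_set (tuples p {1..N})" "fst e" "snd e"] by simp
    then show ?thesis by (simp only: prod.distrib)
  qed
  also have "\<dots> = prod_list (map (pmf (rooted_edges p \<Theta> N)) es)" by (rule prod_list_index)
  also have "pmf (poisson_pmf (\<alpha> * N)) ?r * \<dots> = pmf (poisson_list (\<alpha> * N) (rooted_edges p \<Theta> N)) es"
    by (rule pmf_poisson_list[OF s, symmetric])
  finally show "emeasure M {\<omega> \<in> space M. constraints N \<omega> = es} = ennreal (pmf (poisson_list (\<alpha> * N) (rooted_edges p \<Theta> N)) es)"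
    unfolding set by (simp only: emeasure_eq_measure)
qed

lemma ex_constraint_version:
  "\<exists>Y. \<forall>N\<ge>p. Y N \<in> M \<rightarrow>\<^sub>M count_space UNIV \<and>
     distr M (count_space UNIV) (Y N) = measure_pmf (poisson_list (\<alpha> * N) (rooted_edges p \<Theta> N)) \<and>
     (AE \<omega> in M. constraints N \<omega> = Y N \<omega>)"
proof -
  have "\<exists>Y. Y \<in> M \<rightarrow>\<^sub>M count_space UNIV \<and>
     distr M (count_space UNIV) Y = measure_pmf (poisson_list (\<alpha> * N) (rooted_edges p \<Theta> N)) \<and>
     (AE \<omega> in M. constraints N \<omega> = Y \<omega>)" if N: "N \<ge> p" for N
  proof -
    obtain Y where "Y \<in> M \<rightarrow>\<^sub>M count_space UNIV"
      "distr M (count_space UNIV) Y = measure_pmf (poisson_list (\<alpha> * N) (rooted_edges p \<Theta> N))"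
      "AE \<omega> in M. constraints N \<omega> = Y \<omega>"
      by (rule pmf_version[OF prob_space_axioms constraints_law[OF N]])
    then show ?thesis by blast
  qed
  then have "\<forall>N. \<exists>Y. N \<ge> p \<longrightarrow> Y \<in> M \<rightarrow>\<^sub>M count_space UNIV \<and>
     distr M (count_space UNIV) Y = measure_pmf (poisson_list (\<alpha> * N) (rooted_edges p \<Theta> N)) \<and>
     (AE \<omega> in M. constraints N \<omega> = Y \<omega>)" by blast
  then have "\<exists>Y. \<forall>N. N \<ge> p \<longrightarrow> Y N \<in> M \<rightarrow>\<^sub>M count_space UNIV \<and>
     distr M (count_space UNIV) (Y N) = measure_pmf (poisson_list (\<alpha> * N) (rooted_edges p \<Theta> N)) \<and>
     (AE \<omega> in M. constraints N \<omega> = Y N \<omega>)" by (rule choice)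
  then show ?thesis .
qed

text \<open>The failure probabilities are summable, so that the first Borel--Cantelli lemma applies. It does
  not involve the joint law of the systems of different sizes.\<close>

lemma AE_eventually_concentrated:
  assumes d: "d > 0"
  shows "AE \<omega> in M. \<forall>\<^sub>F N in sequentially. \<bar>real (n N \<omega>) - \<alpha> * real N\<bar> < d * real N \<and>
    \<bar>log_partition \<beta> N (constraints N \<omega>) - mean_free_energy p \<alpha> \<Theta> N \<beta>\<bar> < d * real N"
proof -
  obtain Y where Y: "\<And>N. N \<ge> p \<Longrightarrow> Y N \<in> M \<rightarrow>\<^sub>M count_space UNIV"
    "\<And>N. N \<ge> p \<Longrightarrow> distr M (count_space UNIV) (Y N) = measure_pmf (poisson_list (\<alpha> * N) (rooted_edges p \<Theta> N))"
    "\<And>N. N \<ge> p \<Longrightarrow> AE \<omega> in M. constraints N \<omega> = Y N \<omega>"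
    using ex_constraint_version by blast
  define B where "B N = {es. \<bar>real (length es) - \<alpha> * real N\<bar> \<ge> d * real N \<or>
      \<bar>log_partition \<beta> N es - mean_free_energy p \<alpha> \<Theta> N \<beta>\<bar> \<ge> d * real N}" for N
  define E where "E N = (if N \<ge> p then Y N -` B N \<inter> space M else {})" for N
  have E: "E N \<in> sets M" for N
    unfolding E_def using measurable_sets[OF Y(1), of N "B N"] by auto
  have b: "\<bar>\<beta>\<bar> + 1 > 0" by linarith
  have fin: "finite (set_pmf (rooted_edges p \<Theta> N))" if "N \<ge> p" for N
    unfolding set_pair_pmf set_pmf_tuples[OF that]
    using finite_subset[OF law_interactions finite_interactions] by simp
  obtain c where c: "c > 0" "\<forall>\<^sub>F N in sequentially. \<forall>(Q :: ((spin list \<Rightarrow> real) \<times> nat list) pmf) f. finite (set_pmf Q) \<and> insertion_bounded (\<bar>\<beta>\<bar> + 1) (set_pmf Q) f \<and> f [] = 0 \<longrightarrow>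
    measure_pmf.prob (poisson_list (\<alpha> * real N) Q)
      {xs. \<bar>real (length xs) - \<alpha> * real N\<bar> \<ge> d * real N \<or> \<bar>f xs - measure_pmf.expectation (poisson_list (\<alpha> * real N) Q) f\<bar> \<ge> d * real N}
    \<le> 4 * exp (- c * real N)"
    using poisson_list_concentration[OF \<alpha>_pos b d] by blast
  have bound: "\<forall>\<^sub>F N in sequentially. norm (measure M (E N)) \<le> 4 * exp (- c) ^ N"
    using c(2) eventually_ge_at_top[of p]
  proof eventually_elim
    case (elim N)
    have "measure M (E N) = measure (distr M (count_space UNIV) (Y N)) (B N)"
      using measure_distr[OF Y(1)[OF elim(2)], of "B N"] elim(2) by (simp add: E_def)
    also have "\<dots> = measure_pmf.prob (poisson_list (\<alpha> * N) (rooted_edges p \<Theta> N)) (B N)"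
      by (simp only: Y(2)[OF elim(2)])
    also have "\<dots> \<le> 4 * exp (- c * real N)"
    proof -
      have "finite (set_pmf (rooted_edges p \<Theta> N)) \<and>
        insertion_bounded (\<bar>\<beta>\<bar> + 1) (set_pmf (rooted_edges p \<Theta> N)) (log_partition \<beta> N) \<and> log_partition \<beta> N [] = 0"
        by (intro conjI fin[OF elim(2)] insertion_bounded_log_partition[OF elim(2) law_interactions] log_partition_Nil)
      from elim(1)[THEN spec, THEN spec, THEN mp, OF this] show ?thesis
        unfolding B_def mean_free_energy_def .
    qed
    also have "exp (- c * real N) = exp (- c) ^ N" by (simp add: exp_of_nat_mult[symmetric] mult.commute)
    finally show ?case by simp
  qed
  have "summable (\<lambda>N. 4 * exp (- c) ^ N)"
    using c(1) by (intro summable_mult summable_geometric) simp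
  then have "summable (\<lambda>N. measure M (E N))"
    using bound by (rule summable_comparison_test_ev[rotated])
  then have "AE \<omega> in M. eventually (\<lambda>N. \<omega> \<in> space M - E N) sequentially"
    using E by (intro borel_cantelli_AE1) (auto simp: emeasure_eq_measure)
  moreover have "AE \<omega> in M. \<forall>N. N \<ge> p \<longrightarrow> constraints N \<omega> = Y N \<omega>"
    unfolding AE_all_countable
  proof
    fix N
    show "AE \<omega> in M. N \<ge> p \<longrightarrow> constraints N \<omega> = Y N \<omega>"
    proof (cases "N \<ge> p")
      case True
      from Y(3)[OF True] show ?thesis by eventually_elim simp
    qed simp
  qed
  ultimately show ?thesis
  proof eventually_elim
    case (elim \<omega>)
    show ?case using elim(1) eventually_ge_at_top[of p]
    proof eventually_elim
      case N: (elim N)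
      have "constraints N \<omega> = Y N \<omega>" using elim(2) N(2) by blast
      moreover have "length (constraints N \<omega>) = n N \<omega>" by (simp add: constraints_def del: upt_Suc)
      moreover have "Y N \<omega> \<notin> B N" using N unfolding E_def by (auto split: if_splits)
      ultimately show ?case by (simp add: B_def not_le)
    qed
  qed
qed

lemma AE_free_energy:
  assumes par: "csp_parameters p \<alpha> \<Theta>"
  shows "AE \<omega> in M. (\<lambda>N. real (n N \<omega>) / real N) \<longlonglongrightarrow> \<alpha> \<and>
    (\<lambda>N. log_partition \<beta> N (constraints N \<omega>) / real N) \<longlonglongrightarrow> F p \<alpha> \<Theta> \<beta>"
proof -
  have "AE \<omega> in M. \<forall>j. \<forall>\<^sub>F N in sequentially. \<bar>real (n N \<omega>) - \<alpha> * real N\<bar> < 1 / Suc j * real N \<and>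
    \<bar>log_partition \<beta> N (constraints N \<omega>) - mean_free_energy p \<alpha> \<Theta> N \<beta>\<bar> < 1 / Suc j * real N"
    unfolding AE_all_countable by (intro allI AE_eventually_concentrated) simp
  then show ?thesis
  proof eventually_elim
    case (elim \<omega>)
    have small: "(\<lambda>N. u N / real N) \<longlonglongrightarrow> 0" if "\<And>j. \<forall>\<^sub>F N in sequentially. \<bar>u N\<bar> < 1 / Suc j * real N" for u :: "nat \<Rightarrow> real"
    proof (rule tendstoI)
      fix e :: real assume "e > 0"
      then obtain j where j: "1 / real (Suc j) < e" using nat_approx_posE by blast
      show "\<forall>\<^sub>F N in sequentially. dist (u N / real N) 0 < e"
        using that[of j] eventually_gt_at_top[of 0]
      proof eventually_elim
        case (elim N)
        have "\<bar>u N / real N\<bar> = \<bar>u N\<bar> / real N" by simp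
        also have "\<dots> < 1 / Suc j" using elim by (simp only: pos_divide_less_eq of_nat_0_less_iff)
        also have "\<dots> < e" by (rule j)
        finally show ?case by simp
      qed
    qed
    have 1: "(\<lambda>N. (real (n N \<omega>) - \<alpha> * real N) / real N) \<longlonglongrightarrow> 0"
    proof (rule small)
      fix j show "\<forall>\<^sub>F N in sequentially. \<bar>real (n N \<omega>) - \<alpha> * real N\<bar> < 1 / Suc j * real N"
        using elim[rule_format, of j] by eventually_elim blast
    qed
    have 2: "(\<lambda>N. (log_partition \<beta> N (constraints N \<omega>) - mean_free_energy p \<alpha> \<Theta> N \<beta>) / real N) \<longlonglongrightarrow> 0"
    proof (rule small)
      fix j show "\<forall>\<^sub>F N in sequentially. \<bar>log_partition \<beta> N (constraints N \<omega>) - mean_free_energy p \<alpha> \<Theta> N \<beta>\<bar> < 1 / Suc j * real N"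
        using elim[rule_format, of j] by eventually_elim blast
    qed
    have "(\<lambda>N. (real (n N \<omega>) - \<alpha> * real N) / real N + \<alpha>) \<longlonglongrightarrow> 0 + \<alpha>"
      by (intro tendsto_add 1 tendsto_const)
    moreover have "\<forall>\<^sub>F N in sequentially. (real (n N \<omega>) - \<alpha> * real N) / real N + \<alpha> = real (n N \<omega>) / real N"
      using eventually_gt_at_top[of 0] by eventually_elim (simp add: diff_divide_distrib)
    ultimately have "(\<lambda>N. real (n N \<omega>) / real N) \<longlonglongrightarrow> \<alpha>" by (auto intro: Lim_transform_eventually)
    moreover have "(\<lambda>N. (log_partition \<beta> N (constraints N \<omega>) - mean_free_energy p \<alpha> \<Theta> N \<beta>) / real N + mean_free_energy p \<alpha> \<Theta> N \<beta> / real N) \<longlonglongrightarrow> 0 + F p \<alpha> \<Theta> \<beta>"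
      by (intro tendsto_add 2 mean_free_energy_tendsto_F[OF par])
    then have "(\<lambda>N. log_partition \<beta> N (constraints N \<omega>) / real N) \<longlonglongrightarrow> F p \<alpha> \<Theta> \<beta>"
      by (simp add: add_divide_distrib[symmetric])
    ultimately show ?case by blast
  qed
qed

lemma AN_energy_window:
  assumes n0: "n N \<omega> > 0"
  shows "AN N (n N \<omega>) (\<lambda>k. \<theta> k \<omega>) (\<lambda>k. I N k \<omega>) \<epsilon> (1 + \<mu>) =
    card (energy_window N (edges_energy (constraints N \<omega>)) (n N \<omega>) \<mu> \<epsilon>)"
proof -
  let ?n = "n N \<omega>" and ?H = "edges_energy (constraints N \<omega>)"
  have H: "?H \<sigma> = (\<Sum>k = 1..?n. \<theta> k \<omega> (map \<sigma> (I N k \<omega>)))" for \<sigma>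
  proof -
    have "?H \<sigma> = (\<Sum>k\<leftarrow>[1..<?n + 1]. \<theta> k \<omega> (map \<sigma> (I N k \<omega>)))"
      unfolding edges_energy_def constraints_def by (simp add: o_def del: upt_Suc)
    also have "\<dots> = (\<Sum>k\<in>set [1..<?n + 1]. \<theta> k \<omega> (map \<sigma> (I N k \<omega>)))"
      by (rule sum_list_distinct_conv_sum_set) (rule distinct_upt)
    also have "set [1..<?n + 1] = {1..?n}" by (simp add: atLeastLessThanSuc_atLeastAtMost del: upt_Suc)
    finally show ?thesis .
  qed
  have "1 / real ?n * (\<Sum>k = 1..?n. 1 + \<theta> k \<omega> (map \<sigma> (I N k \<omega>))) \<in> {1 + \<mu> - \<epsilon><..<1 + \<mu> + \<epsilon>} \<longleftrightarrow>
     \<bar>?H \<sigma> - real ?n * \<mu>\<bar> < real ?n * \<epsilon>" for \<sigma>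
  proof -
    have r: "real ?n > 0" using n0 by simp
    have "1 / real ?n * (\<Sum>k = 1..?n. 1 + \<theta> k \<omega> (map \<sigma> (I N k \<omega>))) = 1 + ?H \<sigma> / real ?n"
      unfolding H sum.distrib using r by (simp add: distrib_left)
    moreover have "1 + ?H \<sigma> / real ?n \<in> {1 + \<mu> - \<epsilon><..<1 + \<mu> + \<epsilon>} \<longleftrightarrow> \<bar>?H \<sigma> / real ?n - \<mu>\<bar> < \<epsilon>"
      by (auto simp: abs_less_iff)
    moreover have "?H \<sigma> / real ?n - \<mu> = (?H \<sigma> - real ?n * \<mu>) / real ?n" using r by (simp add: diff_divide_distrib)
    moreover have "\<bar>(?H \<sigma> - real ?n * \<mu>) / real ?n\<bar> < \<epsilon> \<longleftrightarrow> \<bar>?H \<sigma> - real ?n * \<mu>\<bar> < real ?n * \<epsilon>"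
      using r by (simp add: pos_divide_less_eq mult.commute)
    ultimately show ?thesis by (simp only:)
  qed
  then show ?thesis unfolding AN_def energy_window_def by (simp only:)
qed

lemma limsup_abs_tendsto_0:
  fixes Y :: "real \<Rightarrow> nat \<Rightarrow> nat" and L C :: real
  assumes ev: "\<And>\<epsilon>. \<epsilon> > 0 \<Longrightarrow> \<forall>\<^sub>F N in sequentially. Y \<epsilon> N > 0 \<and> \<bar>ln (real (Y \<epsilon> N)) / real N - L\<bar> \<le> C * \<epsilon>"
  shows "((\<lambda>\<epsilon>. limsup (\<lambda>N. \<bar>ereal (1 / real N) * ln_nat (Y \<epsilon> N) - ereal L\<bar>)) \<longlongrightarrow> 0) (at_right 0)"
proof (rule tendsto_sandwich)
  let ?f = "\<lambda>\<epsilon>. limsup (\<lambda>N. \<bar>ereal (1 / real N) * ln_nat (Y \<epsilon> N) - ereal L\<bar>)"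
  show "\<forall>\<^sub>F \<epsilon> in at_right 0. 0 \<le> ?f \<epsilon>"
    by (intro always_eventually allI le_Limsup) auto
  have pos: "\<forall>\<^sub>F \<epsilon> in at_right (0::real). 0 < \<epsilon>" by (simp add: eventually_at_right_less)
  then show "\<forall>\<^sub>F \<epsilon> in at_right 0. ?f \<epsilon> \<le> ereal (C * \<epsilon>)"
  proof eventually_elim
    case (elim \<epsilon>)
    show ?case
    proof (rule Limsup_bounded)
      show "\<forall>\<^sub>F N in sequentially. \<bar>ereal (1 / real N) * ln_nat (Y \<epsilon> N) - ereal L\<bar> \<le> ereal (C * \<epsilon>)"
        using ev[OF elim]
      proof eventually_elim
        case (elim N)
        then have "\<bar>ereal (1 / real N) * ln_nat (Y \<epsilon> N) - ereal L\<bar> = ereal \<bar>ln (real (Y \<epsilon> N)) / real N - L\<bar>"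
          by (simp add: ln_nat_def)
        then show ?case using elim by simp
      qed
    qed
  qed
  have "((\<lambda>\<epsilon>. C * \<epsilon>) \<longlongrightarrow> C * 0) (at_right 0)" by (intro tendsto_intros)
  then show "((\<lambda>\<epsilon>. ereal (C * \<epsilon>)) \<longlongrightarrow> 0) (at_right 0)" by (simp add: zero_ereal_def)
qed simp

theorem AE_entropy:
  assumes par: "csp_parameters p \<alpha> \<Theta>" and diff: "F p \<alpha> \<Theta> differentiable (at \<beta>)"
  shows "AE \<omega> in M. ((\<lambda>\<epsilon>. limsup (\<lambda>N. \<bar>ereal (1 / real N) *
      ln_nat (AN N (n N \<omega>) (\<lambda>k. \<theta> k \<omega>) (\<lambda>k. I N k \<omega>) \<epsilon> (1 + inverse \<alpha> * deriv (F p \<alpha> \<Theta>) \<beta>))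
      - ereal (ln 2 + F p \<alpha> \<Theta> \<beta> - \<beta> * deriv (F p \<alpha> \<Theta>) \<beta>)\<bar>)) \<longlongrightarrow> 0) (at_right 0)"
proof -
  let ?D = "deriv (F p \<alpha> \<Theta>) \<beta>"
  have der: "(F p \<alpha> \<Theta> has_real_derivative ?D) (at \<beta>)"
    using diff by (simp add: DERIV_deriv_iff_real_differentiable)
  have "AE \<omega> in M. \<forall>j. (\<lambda>N. real (n N \<omega>) / real N) \<longlonglongrightarrow> \<alpha> \<and>
    (\<lambda>N. log_partition (\<beta> + 1 / Suc j) N (constraints N \<omega>) / real N) \<longlonglongrightarrow> F p \<alpha> \<Theta> (\<beta> + 1 / Suc j)"
    unfolding AE_all_countable by (intro allI AE_free_energy par)
  moreover have "AE \<omega> in M. \<forall>j. (\<lambda>N. real (n N \<omega>) / real N) \<longlonglongrightarrow> \<alpha> \<and>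
    (\<lambda>N. log_partition (\<beta> - 1 / Suc j) N (constraints N \<omega>) / real N) \<longlonglongrightarrow> F p \<alpha> \<Theta> (\<beta> - 1 / Suc j)"
    unfolding AE_all_countable by (intro allI AE_free_energy par)
  moreover have "AE \<omega> in M. (\<lambda>N. real (n N \<omega>) / real N) \<longlonglongrightarrow> \<alpha> \<and>
    (\<lambda>N. log_partition \<beta> N (constraints N \<omega>) / real N) \<longlonglongrightarrow> F p \<alpha> \<Theta> \<beta>"
    by (rule AE_free_energy[OF par])
  ultimately show ?thesis
  proof eventually_elim
    case (elim \<omega>)
    have lim: "(\<lambda>N. real (n N \<omega>) / real N) \<longlonglongrightarrow> \<alpha>" using elim(3) by blast
    have npos: "\<forall>\<^sub>F N in sequentially. n N \<omega> > 0"
    proof -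
      have "\<forall>\<^sub>F N in sequentially. real (n N \<omega>) / real N > 0" by (rule order_tendstoD(1)[OF lim \<alpha>_pos])
      then show ?thesis by eventually_elim (auto simp: zero_less_divide_iff)
    qed
    show ?case
    proof (rule limsup_abs_tendsto_0[where C="\<bar>\<beta>\<bar> * \<alpha> + 1"])
      fix \<epsilon> :: real assume \<epsilon>: "\<epsilon> > 0"
      have "\<forall>\<^sub>F N in sequentially. card (energy_window N (edges_energy (constraints N \<omega>)) (n N \<omega>) (?D / \<alpha>) \<epsilon>) > 0 \<and>
        \<bar>ln (card (energy_window N (edges_energy (constraints N \<omega>)) (n N \<omega>) (?D / \<alpha>) \<epsilon>)) / real N - (ln 2 + F p \<alpha> \<Theta> \<beta> - \<beta> * ?D)\<bar>
          \<le> (\<bar>\<beta>\<bar> * \<alpha> + 1) * \<epsilon>"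
        using elim unfolding log_partition_def
        by (intro energy_window_limit[OF \<alpha>_pos lim der _ _ _ \<epsilon>]) blast+
      then show "\<forall>\<^sub>F N in sequentially. AN N (n N \<omega>) (\<lambda>k. \<theta> k \<omega>) (\<lambda>k. I N k \<omega>) \<epsilon> (1 + inverse \<alpha> * ?D) > 0 \<and>
        \<bar>ln (real (AN N (n N \<omega>) (\<lambda>k. \<theta> k \<omega>) (\<lambda>k. I N k \<omega>) \<epsilon> (1 + inverse \<alpha> * ?D))) / real N - (ln 2 + F p \<alpha> \<Theta> \<beta> - \<beta> * ?D)\<bar>
          \<le> (\<bar>\<beta>\<bar> * \<alpha> + 1) * \<epsilon>"
        using npos
      proof eventually_elim
        case (elim N)
        have "inverse \<alpha> * ?D = ?D / \<alpha>" by (simp add: divide_inverse mult.commute)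
        then show ?case using elim(1) by (simp only: AN_energy_window[OF elim(2)])
      qed
    qed
  qed
qed

end

theorem theorem2p1:
  fixes M :: "'a measure" and p :: nat and \<alpha> :: real
    and \<Theta> :: "(spin list \<Rightarrow> real) pmf"
    and \<theta> :: "nat \<Rightarrow> 'a \<Rightarrow> spin list \<Rightarrow> real"
    and n :: "nat \<Rightarrow> 'a \<Rightarrow> nat"
    and I :: "nat \<Rightarrow> nat \<Rightarrow> 'a \<Rightarrow> nat list"
  assumes "csp_model M p \<alpha> \<Theta> \<theta> n I"
    and "exchangeable p \<Theta>"
    and "\<alpha> * real p * (real p - 1) \<le> 1"
  shows
    "(\<forall>\<beta>. F p \<alpha> \<Theta> differentiable (at \<beta>) \<longrightarrow>
       (AE \<omega> in M.
         ((\<lambda>\<epsilon>. limsup (\<lambda>N.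
             \<bar>ereal (1 / real N) *
                ln_nat (AN N (n N \<omega>) (\<lambda>k. \<theta> k \<omega>) (\<lambda>k. I N k \<omega>) \<epsilon>
                  (1 + inverse \<alpha> * deriv (F p \<alpha> \<Theta>) \<beta>))
              - ereal (ln 2 + F p \<alpha> \<Theta> \<beta> - \<beta> * deriv (F p \<alpha> \<Theta>) \<beta>)\<bar>))
          \<longlongrightarrow> 0) (at_right 0))) \<and>
     (\<forall>\<beta>1 \<beta>2. \<beta>1 \<le> \<beta>2 \<longrightarrow>
        F p \<alpha> \<Theta> differentiable (at \<beta>1) \<longrightarrow> F p \<alpha> \<Theta> differentiable (at \<beta>2) \<longrightarrow>
        deriv (F p \<alpha> \<Theta>) \<beta>1 \<le> deriv (F p \<alpha> \<Theta>) \<beta>2 \<and>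
        (\<beta>1 > 0 \<longrightarrow>
           F p \<alpha> \<Theta> \<beta>1 - \<beta>1 * deriv (F p \<alpha> \<Theta>) \<beta>1
             \<ge> F p \<alpha> \<Theta> \<beta>2 - \<beta>2 * deriv (F p \<alpha> \<Theta>) \<beta>2) \<and>
        (\<beta>2 < 0 \<longrightarrow>
           F p \<alpha> \<Theta> \<beta>1 - \<beta>1 * deriv (F p \<alpha> \<Theta>) \<beta>1
             \<le> F p \<alpha> \<Theta> \<beta>2 - \<beta>2 * deriv (F p \<alpha> \<Theta>) \<beta>2))"
proof -
  interpret csp_model M p \<alpha> \<Theta> \<theta> n I by (rule assms(1))
  have par: "csp_parameters p \<alpha> \<Theta>"
    using p_ge_2 \<alpha>_pos law_interactions assms(2,3) by (simp add: csp_parameters_def)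
  show ?thesis
    using AE_entropy[OF par] convex_legendre_monotone[OF convex_F[OF par]] by blast
qed

end
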